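(* Let $u\in K$ be the primal solution, i.e. the unique minimizer of $I$ on $W^{1,\infty}(\Omega)$. Then the following statements apply. (i) A (Fenchel) dual problem to the minimization of $I$ is given via the maximization of $D$; that is, for every $\nu\in(\mathrm{ba}(\Omega))^d$, $$-G^*(\nu)-F^*(-\nabla^*\nu)=D(\nu).$$ (ii) There exists a maximizer $\mu=z\otimes\mathrm{d}x+\mu^s\in(\mathrm{ba}(\Omega))^d$ of $D$, where $z\in(L^1(\Omega))^d$ and $\mu^s\in(\mathrm{ba}(\Omega))^d$ are the absolutely continuous density and the singular part of $\mu$, satisfying $$\langle\mu,\nabla v\rangle_{(L^\infty(\Omega))^d}=(f,v)_\Omega+\langle g,v\rangle_{\Gamma_N}\quad\text{for all }v\in W^{1,\infty}_D(\Omega).$$ In addition, strong duality holds: $I(u)=D(\mu)$. (iii) For $u$ and $\mu=z\otimes\mathrm{d}x+\mu^s$, there hold the convex optimality relations $$\nabla u=D_t\phi^*(\cdot,z)=\begin{cases} z&\text{if }|z|\le\zeta,\\ \zeta\,\frac{z}{|z|}&\text{if }|z|>\zeta\end{cases}\quad\text{a.e. in }\Omega,$$ $$|\zeta\mu^s|(\Omega)=\langle\mu^s,\nabla u\rangle_{(L^\infty(\Omega))^d}.$$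
   Context: Let $\Omega\subseteq\mathbb{R}^d$, $d\in\mathbb{N}$, be a bounded simplicial Lipschitz domain (polyhedral, i.e. exactly decomposable into simplices) whose boundary is divided into two disjoint relatively open parts $\Gamma_D$ with $|\Gamma_D|>0$ (surface measure) and $\Gamma_N$, $\partial\Omega=\overline\Gamma_D\cup\overline\Gamma_N$. Write $(v,w)_\omega=\int_\omega v\cdot w$, $\|\cdot\|_{p,\omega}$ for the $L^p(\omega)$-norm (Euclidean norm for vectors). Traces are not denoted explicitly. $W^{1,\infty}_D(\Omega)=\{v\in W^{1,\infty}(\Omega): v=0\text{ a.e. on }\Gamma_D\}$. $W^{-1,1}(\Gamma_N)$ denotes the dual of $W^{1,\infty}(\Gamma_N)$ and $\langle\cdot,\cdot\rangle_{\Gamma_N}$ the duality pairing. Data: $f\in L^1(\Omega)$, $g\in W^{-1,1}(\Gamma_N)$, $\zeta\in L^\infty(\Omega)$ with $\operatorname{ess\,inf}_\Omega\zeta>0$, $u_D\in W^{1,\infty}(\Gamma_D)$ such that there is a (fixed) $\widehat u_D\in W^{1,\infty}(\Omega)$ with $\widehat u_D=u_D$ on $\Gamma_D$ and $\|\nabla\widehat u_D/\zeta\|_{\infty,\Omega}<1$. For a.e. $x\in\Omega$ and $t,s\in\mathbb{R}^d$: $\phi(x,t)=\frac12|t|^2$ if $|t|\le\zeta(x)$ and $+\infty$ otherwise; its Fenchel conjugate in the second argument is $\phi^*(x,s)=\frac12|s|^2$ if $|s|\le\zeta(x)$ and $\phi^*(x,s)=\zeta(x)|s|-\frac12\zeta(x)^2$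 if $|s|>\zeta(x)$. $D_t\phi^*$ is the gradient in the second argument. Primal problem: $K=\{v\in W^{1,\infty}(\Omega): |\nabla v|\le\zeta\text{ a.e. in }\Omega,\ v=u_D\text{ a.e. on }\Gamma_D\}$, and $I:W^{1,\infty}(\Omega)\to\mathbb{R}\cup\{+\infty\}$, $I(v)=\frac12\|\nabla v\|_{2,\Omega}^2-(f,v)_\Omega-\langle g,v\rangle_{\Gamma_N}$ if $v\in K$, $I(v)=+\infty$ otherwise. $I$ has a unique minimizer $u\in K$ (standing fact), called the primal solution. Finitely additive measures: $(\mathrm{ba}(\Omega))^d$ is the space of finitely additive $\mathbb{R}^d$-valued set functions $\nu$ on the Lebesgue measurable subsets of $\Omega$ that vanish on Lebesgue null sets and have finite total variation $|\nu|(\Omega)=\sup\sum_i|\nu(A_i)|$ (supremum over countable measurable partitions $(A_i)$ of $\Omega$). It is isometrically isomorphic to $((L^\infty(\Omega))^d)^*$ via $\langle\nu,y\rangle_{(L^\infty(\Omega))^d}=\int_\Omega y\cdot\mathrm{d}\nu$. For $y\in(L^1(\Omega))^d$, $y\otimes\mathrm{d}x$ is the element $\widehat y\mapsto\int_\Omega y\cdot\widehat y\,\mathrm{d}x$. Every $\nu\in(\mathrm{ba}(\Omega))^d$ decomposes uniquely as $\nu=y\otimes\mathrm{d}x+\nu^s$ with $y\in(L^1(\Omega))^d$ and $\nu^s\in(\mathrm{ba}(\Omega))^d$ singular (Lebesgue/Yosida–Hewitt decomposition: there are decreasing measurable sets $E_n$ with $|E_n|\to0$ and $|\nu^s|(\Omega\setminus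 E_n)=0$ for all $n$). $\zeta\nu^s\in(\mathrm{ba}(\Omega))^d$ is $(\zeta\nu^s)(A)=\int_A\zeta\,\mathrm{d}\nu^s$. Dual functional: $K^*=\{\nu\in(\mathrm{ba}(\Omega))^d:\langle\nu,\nabla v\rangle_{(L^\infty(\Omega))^d}=(f,v)_\Omega+\langle g,v\rangle_{\Gamma_N}\ \forall v\in W^{1,\infty}_D(\Omega)\}$, and for $\nu=y\otimes\mathrm{d}x+\nu^s$, $D(\nu)=-\int_\Omega\phi^*(\cdot,y)\,\mathrm{d}x-|\zeta\nu^s|(\Omega)+\langle\nu,\nabla\widehat u_D\rangle_{(L^\infty(\Omega))^d}-(f,\widehat u_D)_\Omega-\langle g,\widehat u_D\rangle_{\Gamma_N}$ if $\nu\in K^*$, and $D(\nu)=-\infty$ otherwise. Fenchel dual (Ekeland–Témam): with $G:(L^\infty(\Omega))^d\to\mathbb{R}\cup\{+\infty\}$, $G(y)=\int_\Omega\phi(\cdot,y)\,\mathrm{d}x$, and $F:W^{1,\infty}(\Omega)\to\mathbb{R}\cup\{+\infty\}$, $F(v)=-(f,v)_\Omega-\langle g,v\rangle_{\Gamma_N}$ if $v=u_D$ a.e. on $\Gamma_D$ and $+\infty$ otherwise, one has $I(v)=G(\nabla v)+F(v)$; the Fenchel dual problem is the maximization of $\nu\mapsto-G^*(\nu)-F^*(-\nabla^*\nu)$ over $(\mathrm{ba}(\Omega))^d$, where $G^*,F^*$ are Fenchel conjugates and $\nabla^*:(\mathrm{ba}(\Omega))^d\to(W^{1,\infty}(\Omega))^*$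 is the adjoint of $\nabla:W^{1,\infty}(\Omega)\to(L^\infty(\Omega))^d$. *)

theory Defs
  imports "HOL-Analysis.Analysis" "HOL-Probability.Essential_Supremum"
begin

text \<open>Near each boundary point the set is, in suitable orthogonal coordinates, the strict epigraph
  of a Lipschitz function on a hyperplane \<open>{y. e \<bullet> y = 0}\<close>.\<close>

definition lipschitz_boundary :: "'a::euclidean_space set \<Rightarrow> bool" where
  "lipschitz_boundary \<Omega> \<longleftrightarrow>
     (\<forall>p\<in>frontier \<Omega>. \<exists>e r L \<psi>. norm e = 1 \<and> 0 < r \<and> L-lipschitz_on {y. e \<bullet> y = 0} \<psi> \<and>
        \<Omega> \<inter> ball p r = {y \<in> ball p r. \<psi> (y - (e \<bullet> y) *\<^sub>R e) < e \<bullet> y})"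

definition simplicial_lipschitz_domain :: "'a::euclidean_space set \<Rightarrow> bool" where
  "simplicial_lipschitz_domain \<Omega> \<longleftrightarrow>
     open \<Omega> \<and> connected \<Omega> \<and> \<Omega> \<noteq> {} \<and> bounded \<Omega> \<and> lipschitz_boundary \<Omega> \<and>
     (\<exists>\<T>. triangulation \<T> \<and> (\<forall>T\<in>\<T>. int DIM('a) simplex T) \<and> closure \<Omega> = \<Union>\<T>)"

text \<open>Hausdorff outer measure of integer dimension \<open>s\<close>. The empty set is treated separately because
  \<open>0 ^ 0 = 1\<close>, so that \<open>s = 0\<close> gives the counting measure.\<close>

definition hausdorff_pre :: "nat \<Rightarrow> real \<Rightarrow> 'a::metric_space set \<Rightarrow> ennreal" where
  "hausdorff_pre s \<delta> A =
     (INF U \<in> {U :: nat \<Rightarrow> 'a set. A \<subseteq> (\<Union>i. U i) \<and> (\<forall>i. bounded (U i) \<and> diameter (U i) \<le> \<delta>)}.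
        \<Sum>i. if U i = {} then 0 else ennreal (unit_ball_vol (real s) / 2 ^ s * diameter (U i) ^ s))"

definition hausdorff_measure :: "nat \<Rightarrow> 'a::metric_space set \<Rightarrow> ennreal" where
  "hausdorff_measure s A = (SUP \<delta>\<in>{0<..}. hausdorff_pre s \<delta> A)"

definition surface_measure :: "'a::euclidean_space set \<Rightarrow> ennreal" where
  "surface_measure A = hausdorff_measure (DIM('a) - 1) A"

definition surface_ae :: "'a::euclidean_space set \<Rightarrow> ('a \<Rightarrow> bool) \<Rightarrow> bool" where
  "surface_ae \<Gamma> P \<longleftrightarrow> surface_measure {x\<in>\<Gamma>. \<not> P x} = 0"

text \<open>Elements of function spaces are represented by everywhere defined functions; values outside
  \<open>\<Omega>\<close> (respectively \<open>\<Gamma>\<close>) and on null sets are irrelevant.\<close>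

definition Linf_norm :: "'a::euclidean_space set \<Rightarrow> ('a \<Rightarrow> 'b::euclidean_space) \<Rightarrow> ereal" where
  "Linf_norm \<Omega> y = esssup (lebesgue_on \<Omega>) (\<lambda>x. ereal (norm (y x)))"

definition Linf :: "'a::euclidean_space set \<Rightarrow> ('a \<Rightarrow> 'b::euclidean_space) set" where
  "Linf \<Omega> = {y \<in> borel_measurable (lebesgue_on \<Omega>). Linf_norm \<Omega> y < \<infinity>}"

text \<open>Test functions of class \<open>C\<^sup>1\<close> with compact support in \<open>\<Omega>\<close>; the second argument is the gradient.\<close>

definition test_function :: "'a::euclidean_space set \<Rightarrow> ('a \<Rightarrow> real) \<Rightarrow> ('a \<Rightarrow> 'a) \<Rightarrow> bool" where
  "test_function \<Omega> \<phi> d\<phi> \<longleftrightarrow>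
     (\<forall>x. GDERIV \<phi> x :> d\<phi> x) \<and> continuous_on UNIV d\<phi> \<and>
     compact (closure {x. \<phi> x \<noteq> 0}) \<and> closure {x. \<phi> x \<noteq> 0} \<subseteq> \<Omega>"

definition weak_gradient :: "'a::euclidean_space set \<Rightarrow> ('a \<Rightarrow> real) \<Rightarrow> ('a \<Rightarrow> 'a) \<Rightarrow> bool" where
  "weak_gradient \<Omega> v V \<longleftrightarrow>
     (\<forall>\<phi> d\<phi>. test_function \<Omega> \<phi> d\<phi> \<longrightarrow>
        (LINT x|lebesgue_on \<Omega>. v x *\<^sub>R d\<phi> x) = - (LINT x|lebesgue_on \<Omega>. \<phi> x *\<^sub>R V x))"

definition W1inf :: "'a::euclidean_space set \<Rightarrow> ('a \<Rightarrow> real) set" where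
  "W1inf \<Omega> = {v \<in> Linf \<Omega>. \<exists>V\<in>Linf \<Omega>. weak_gradient \<Omega> v V}"

definition grad :: "'a::euclidean_space set \<Rightarrow> ('a \<Rightarrow> real) \<Rightarrow> 'a \<Rightarrow> 'a" where
  "grad \<Omega> v = (SOME V. V \<in> Linf \<Omega> \<and> weak_gradient \<Omega> v V)"

text \<open>On a bounded Lipschitz domain every element of \<open>W\<^sup>1\<^sup>,\<^sup>\<infinity>(\<Omega>)\<close> has exactly one representative
  that is continuous up to the boundary, and its boundary values are the trace.\<close>

definition bd_trace :: "'a::euclidean_space set \<Rightarrow> ('a \<Rightarrow> real) \<Rightarrow> 'a \<Rightarrow> real" where
  "bd_trace \<Omega> v = (SOME w. continuous_on (closure \<Omega>) w \<and> (AE x in lebesgue_on \<Omega>. w x = v x))"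

definition W1inf_D :: "'a::euclidean_space set \<Rightarrow> 'a set \<Rightarrow> ('a \<Rightarrow> real) set" where
  "W1inf_D \<Omega> \<Gamma>D = {v \<in> W1inf \<Omega>. surface_ae \<Gamma>D (\<lambda>x. bd_trace \<Omega> v x = 0)}"

text \<open>\<open>W\<^sup>1\<^sup>,\<^sup>\<infinity>(\<Gamma>)\<close> for a relatively open part \<open>\<Gamma>\<close> of a Lipschitz boundary. Only Lipschitz charts are
  available there, and in such charts the class consists of the bounded functions that are locally
  Lipschitz with a uniform constant. The constant is required only locally, so functions may jump
  between parts of \<open>\<Gamma>\<close> that are close in space but separated within \<open>\<Gamma>\<close>.\<close>

definition W1inf_surface_bound ::
    "'a::euclidean_space set \<Rightarrow> ('a \<Rightarrow> real) \<Rightarrow> real \<Rightarrow> real \<Rightarrow> bool" where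
  "W1inf_surface_bound \<Gamma> w C L \<longleftrightarrow>
     0 \<le> C \<and> 0 \<le> L \<and>
     (\<exists>w'. surface_ae \<Gamma> (\<lambda>x. w' x = w x) \<and> (\<forall>x\<in>\<Gamma>. \<bar>w' x\<bar> \<le> C) \<and>
        (\<forall>x\<in>\<Gamma>. \<exists>r>0. L-lipschitz_on (\<Gamma> \<inter> ball x r) w'))"

definition W1inf_surface :: "'a::euclidean_space set \<Rightarrow> ('a \<Rightarrow> real) set" where
  "W1inf_surface \<Gamma> = {w. \<exists>C L. W1inf_surface_bound \<Gamma> w C L}"

definition W1inf_surface_norm :: "'a::euclidean_space set \<Rightarrow> ('a \<Rightarrow> real) \<Rightarrow> real" where
  "W1inf_surface_norm \<Gamma> w = Inf {C + L | C L. W1inf_surface_bound \<Gamma> w C L}"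

text \<open>The norm bound forces a functional to take equal values on functions that agree almost
  everywhere on \<open>\<Gamma>\<close>.\<close>

definition W1inf_surface_dual :: "'a::euclidean_space set \<Rightarrow> (('a \<Rightarrow> real) \<Rightarrow> real) set" where
  "W1inf_surface_dual \<Gamma> = {g.
     (\<forall>v\<in>W1inf_surface \<Gamma>. \<forall>w\<in>W1inf_surface \<Gamma>. g (\<lambda>x. v x + w x) = g v + g w) \<and>
     (\<forall>c. \<forall>w\<in>W1inf_surface \<Gamma>. g (\<lambda>x. c * w x) = c * g w) \<and>
     (\<exists>M. \<forall>w\<in>W1inf_surface \<Gamma>. \<bar>g w\<bar> \<le> M * W1inf_surface_norm \<Gamma> w)}"

text \<open>The functional \<open>v \<mapsto> (f, v)\<^sub>\<Omega> + \<langle>g, v\<rangle>\<close>, where the functional \<open>g\<close> on boundary functions acts on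
  the trace of \<open>v\<close>.\<close>

definition load :: "'a::euclidean_space set \<Rightarrow> ('a \<Rightarrow> real) \<Rightarrow> (('a \<Rightarrow> real) \<Rightarrow> real) \<Rightarrow>
    ('a \<Rightarrow> real) \<Rightarrow> real" where
  "load \<Omega> f g v = (LINT x|lebesgue_on \<Omega>. f x * v x) + g (bd_trace \<Omega> v)"

text \<open>Only the values of a set function on the measurable subsets of \<open>\<Omega>\<close> matter. Finite partitions are
  covered by padding with empty sets.\<close>

definition total_variation ::
    "'a::euclidean_space set \<Rightarrow> ('a set \<Rightarrow> 'a) \<Rightarrow> 'a set \<Rightarrow> ennreal" where
  "total_variation \<Omega> \<nu> A =
     (SUP P \<in> {P :: nat \<Rightarrow> 'a set. range P \<subseteq> sets (lebesgue_on \<Omega>) \<and> disjoint_family P \<and> (\<Union>i. P i) = A}.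
        \<Sum>i. ennreal (norm (\<nu> (P i))))"

definition ba :: "'a::euclidean_space set \<Rightarrow> ('a set \<Rightarrow> 'a) set" where
  "ba \<Omega> = {\<nu>.
     (\<forall>A\<in>sets (lebesgue_on \<Omega>). \<forall>B\<in>sets (lebesgue_on \<Omega>). A \<inter> B = {} \<longrightarrow> \<nu> (A \<union> B) = \<nu> A + \<nu> B) \<and>
     (\<forall>A\<in>null_sets (lebesgue_on \<Omega>). \<nu> A = 0) \<and>
     total_variation \<Omega> \<nu> \<Omega> < \<infinity>}"

definition ba_simple_integral ::
    "'a::euclidean_space set \<Rightarrow> ('a set \<Rightarrow> 'a) \<Rightarrow> ('a \<Rightarrow> 'a) \<Rightarrow> real" where
  "ba_simple_integral \<Omega> \<nu> s = (\<Sum>c\<in>s ` \<Omega>. c \<bullet> \<nu> {x\<in>\<Omega>. s x = c})"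

text \<open>\<open>\<integral>\<^sub>\<Omega> y \<cdot> d\<nu>\<close> for essentially bounded \<open>y\<close>: the limit of the integrals of simple functions
  converging to \<open>y\<close> essentially uniformly. This is the duality pairing of \<open>\<nu>\<close> with \<open>y\<close>.\<close>

definition has_ba_integral ::
    "'a::euclidean_space set \<Rightarrow> ('a set \<Rightarrow> 'a) \<Rightarrow> ('a \<Rightarrow> 'a) \<Rightarrow> real \<Rightarrow> bool" where
  "has_ba_integral \<Omega> \<nu> y I \<longleftrightarrow>
     (\<exists>s. (\<forall>n::nat. simple_function (lebesgue_on \<Omega>) (s n)) \<and>
        (\<lambda>n. Linf_norm \<Omega> (\<lambda>x. s n x - y x)) \<longlonglongrightarrow> 0 \<and>
        (\<lambda>n. ba_simple_integral \<Omega> \<nu> (s n)) \<longlonglongrightarrow> I)"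

definition ba_integral ::
    "'a::euclidean_space set \<Rightarrow> ('a set \<Rightarrow> 'a) \<Rightarrow> ('a \<Rightarrow> 'a) \<Rightarrow> real" where
  "ba_integral \<Omega> \<nu> y = (THE I. has_ba_integral \<Omega> \<nu> y I)"

text \<open>\<open>(\<zeta>\<nu>)(A) = \<integral>\<^sub>A \<zeta> d\<nu>\<close>, assembled from its components.\<close>

definition ba_scale ::
    "'a::euclidean_space set \<Rightarrow> ('a \<Rightarrow> real) \<Rightarrow> ('a set \<Rightarrow> 'a) \<Rightarrow> 'a set \<Rightarrow> 'a" where
  "ba_scale \<Omega> \<zeta> \<nu> A = (\<Sum>b\<in>Basis. ba_integral \<Omega> \<nu> (\<lambda>x. (indicator A x * \<zeta> x) *\<^sub>R b) *\<^sub>R b)"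

definition ba_singular :: "'a::euclidean_space set \<Rightarrow> ('a set \<Rightarrow> 'a) \<Rightarrow> bool" where
  "ba_singular \<Omega> \<nu> \<longleftrightarrow>
     (\<exists>E :: nat \<Rightarrow> 'a set. decseq E \<and> range E \<subseteq> sets (lebesgue_on \<Omega>) \<and>
        (\<lambda>n. emeasure (lebesgue_on \<Omega>) (E n)) \<longlonglongrightarrow> 0 \<and>
        (\<forall>n. total_variation \<Omega> \<nu> (\<Omega> - E n) = 0))"

definition ba_decomposition ::
    "'a::euclidean_space set \<Rightarrow> ('a set \<Rightarrow> 'a) \<Rightarrow> ('a \<Rightarrow> 'a) \<Rightarrow> ('a set \<Rightarrow> 'a) \<Rightarrow> bool" where
  "ba_decomposition \<Omega> \<nu> y \<nu>s \<longleftrightarrow>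
     integrable (lebesgue_on \<Omega>) y \<and> \<nu>s \<in> ba \<Omega> \<and> ba_singular \<Omega> \<nu>s \<and>
     (\<forall>A\<in>sets (lebesgue_on \<Omega>). \<nu> A = (LINT x:A|lebesgue_on \<Omega>. y x) + \<nu>s A)"

definition fenchel_conjugate :: "'b set \<Rightarrow> ('b \<Rightarrow> ereal) \<Rightarrow> ('b \<Rightarrow> real) \<Rightarrow> ereal" where
  "fenchel_conjugate X H l = (SUP y\<in>X. ereal (l y) - H y)"

definition phi :: "('a::euclidean_space \<Rightarrow> real) \<Rightarrow> 'a \<Rightarrow> 'a \<Rightarrow> ereal" where
  "phi \<zeta> x t = (if norm t \<le> \<zeta> x then ereal ((norm t)\<^sup>2 / 2) else \<infinity>)"

definition phi_star :: "('a::euclidean_space \<Rightarrow> real) \<Rightarrow> 'a \<Rightarrow> 'a \<Rightarrow> real" where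
  "phi_star \<zeta> x s = (if norm s \<le> \<zeta> x then (norm s)\<^sup>2 / 2 else \<zeta> x * norm s - (\<zeta> x)\<^sup>2 / 2)"

lemma phi_star_is_conjugate:
  assumes "0 \<le> \<zeta> x"
  shows "fenchel_conjugate UNIV (phi \<zeta> x) (\<lambda>t. s \<bullet> t) = ereal (phi_star \<zeta> x s)"
  unfolding fenchel_conjugate_def
proof (rule antisym)
  show "(SUP t. ereal (s \<bullet> t) - phi \<zeta> x t) \<le> ereal (phi_star \<zeta> x s)"
  proof (rule SUP_least)
    fix t
    show "ereal (s \<bullet> t) - phi \<zeta> x t \<le> ereal (phi_star \<zeta> x s)"
    proof (cases "norm t \<le> \<zeta> x")
      case True
      have "s \<bullet> t \<le> norm s * norm t"
        by (rule norm_cauchy_schwarz)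
      moreover have "norm s * norm t - (norm t)\<^sup>2 / 2 \<le> phi_star \<zeta> x s"
      proof (cases "norm s \<le> \<zeta> x")
        case True
        have "0 \<le> (norm s - norm t)\<^sup>2" by simp
        then show ?thesis using True by (simp add: phi_star_def power2_eq_square algebra_simps)
      next
        case False
        have "0 \<le> (\<zeta> x - norm t) * (2 * norm s - \<zeta> x - norm t)"
          using False \<open>norm t \<le> \<zeta> x\<close> by (intro mult_nonneg_nonneg) auto
        then show ?thesis using False by (simp add: phi_star_def power2_eq_square algebra_simps)
      qed
      ultimately show ?thesis using True by (simp add: phi_def)
    qed (simp add: phi_def)
  qed
next
  define t where "t = (if norm s \<le> \<zeta> x then s else (\<zeta> x / norm s) *\<^sub>R s)"
  have "ereal (phi_star \<zeta> x s) = ereal (s \<bullet> t) - phi \<zeta> x t"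
  proof (cases "norm s \<le> \<zeta> x")
    case True
    then show ?thesis
      by (simp add: t_def phi_def phi_star_def dot_square_norm)
  next
    case False
    then have "norm s > 0" using assms by linarith
    then have "norm t = \<zeta> x" "s \<bullet> t = \<zeta> x * norm s"
      using False assms by (auto simp: t_def dot_square_norm power2_eq_square)
    then show ?thesis using False by (simp add: phi_def phi_star_def)
  qed
  then show "ereal (phi_star \<zeta> x s) \<le> (SUP t. ereal (s \<bullet> t) - phi \<zeta> x t)"
    by (metis (no_types, lifting) SUP_upper UNIV_I)
qed

definition admissible :: "'a::euclidean_space set \<Rightarrow> 'a set \<Rightarrow> ('a \<Rightarrow> real) \<Rightarrow> ('a \<Rightarrow> real) \<Rightarrow>
    ('a \<Rightarrow> real) set" where
  "admissible \<Omega> \<Gamma>D \<zeta> uD = {v \<in> W1inf \<Omega>.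
     (AE x in lebesgue_on \<Omega>. norm (grad \<Omega> v x) \<le> \<zeta> x) \<and> surface_ae \<Gamma>D (\<lambda>x. bd_trace \<Omega> v x = uD x)}"

definition primal_I :: "'a::euclidean_space set \<Rightarrow> 'a set \<Rightarrow> ('a \<Rightarrow> real) \<Rightarrow> (('a \<Rightarrow> real) \<Rightarrow> real) \<Rightarrow>
    ('a \<Rightarrow> real) \<Rightarrow> ('a \<Rightarrow> real) \<Rightarrow> ('a \<Rightarrow> real) \<Rightarrow> ereal" where
  "primal_I \<Omega> \<Gamma>D f g \<zeta> uD v =
     (if v \<in> admissible \<Omega> \<Gamma>D \<zeta> uD
      then ereal ((LINT x|lebesgue_on \<Omega>. (norm (grad \<Omega> v x))\<^sup>2) / 2 - load \<Omega> f g v)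
      else \<infinity>)"

definition functional_G :: "'a::euclidean_space set \<Rightarrow> ('a \<Rightarrow> real) \<Rightarrow> ('a \<Rightarrow> 'a) \<Rightarrow> ereal" where
  "functional_G \<Omega> \<zeta> y = enn2ereal (\<integral>\<^sup>+x. e2ennreal (phi \<zeta> x (y x)) \<partial>lebesgue_on \<Omega>)"

definition functional_F :: "'a::euclidean_space set \<Rightarrow> 'a set \<Rightarrow> ('a \<Rightarrow> real) \<Rightarrow>
    (('a \<Rightarrow> real) \<Rightarrow> real) \<Rightarrow> ('a \<Rightarrow> real) \<Rightarrow> ('a \<Rightarrow> real) \<Rightarrow> ereal" where
  "functional_F \<Omega> \<Gamma>D f g uD v =
     (if surface_ae \<Gamma>D (\<lambda>x. bd_trace \<Omega> v x = uD x) then ereal (- load \<Omega> f g v) else \<infinity>)"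

definition grad_adjoint ::
    "'a::euclidean_space set \<Rightarrow> ('a set \<Rightarrow> 'a) \<Rightarrow> ('a \<Rightarrow> real) \<Rightarrow> real" where
  "grad_adjoint \<Omega> \<nu> v = ba_integral \<Omega> \<nu> (grad \<Omega> v)"

definition K_star :: "'a::euclidean_space set \<Rightarrow> 'a set \<Rightarrow> ('a \<Rightarrow> real) \<Rightarrow>
    (('a \<Rightarrow> real) \<Rightarrow> real) \<Rightarrow> ('a set \<Rightarrow> 'a) set" where
  "K_star \<Omega> \<Gamma>D f g =
     {\<nu> \<in> ba \<Omega>. \<forall>v\<in>W1inf_D \<Omega> \<Gamma>D. ba_integral \<Omega> \<nu> (grad \<Omega> v) = load \<Omega> f g v}"

text \<open>The choice is immaterial: a decomposition exists for every element of \<open>ba \<Omega>\<close>, its density is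
  unique almost everywhere and its singular part is unique on measurable sets.\<close>

definition dual_D :: "'a::euclidean_space set \<Rightarrow> 'a set \<Rightarrow> ('a \<Rightarrow> real) \<Rightarrow> (('a \<Rightarrow> real) \<Rightarrow> real) \<Rightarrow>
    ('a \<Rightarrow> real) \<Rightarrow> ('a \<Rightarrow> real) \<Rightarrow> ('a set \<Rightarrow> 'a) \<Rightarrow> ereal" where
  "dual_D \<Omega> \<Gamma>D f g \<zeta> uD_hat \<nu> =
     (if \<nu> \<in> K_star \<Omega> \<Gamma>D f g
      then (let (y, \<nu>s) = (SOME (y, \<nu>s). ba_decomposition \<Omega> \<nu> y \<nu>s) in
              - ereal (LINT x|lebesgue_on \<Omega>. phi_star \<zeta> x (y x))
              - enn2ereal (total_variation \<Omega> (ba_scale \<Omega> \<zeta> \<nu>s) \<Omega>)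
              + ereal (ba_integral \<Omega> \<nu> (grad \<Omega> uD_hat) - load \<Omega> f g uD_hat))
      else - \<infinity>)"

end

theory Submission
  imports Defs
begin

text \<open>
  Membership in \<open>K\<^sup>*\<close> makes \<open>F\<^sup>*(-\<nabla>\<^sup>*\<nu>)\<close> finite because \<open>W\<^sup>1\<^sup>,\<^sup>\<infinity>\<close> functions with trace \<open>u\<^sub>D\<close> form a coset of
  \<open>W\<^sup>1\<^sup>,\<^sup>\<infinity>\<^sub>D\<close>. This needs linearity of the trace, hence Lipschitz representatives up to the boundary: averages
  of \<open>v\<close> over two translated cubes differ by at most \<open>\<parallel>\<nabla>v\<parallel>\<^sub>\<infinity>\<close> times the translation, so \<open>v\<close> is Lipschitz along
  segments in \<open>\<Omega>\<close>, and in a boundary chart two points are joined inside \<open>\<Omega>\<close> by moving both up and across.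
  The conjugate \<open>G\<^sup>*(\<nu>)\<close> splits over the Yosida-Hewitt decomposition since the singular part lives on sets of
  arbitrarily small measure. A subgradient of \<open>G\<close> at \<open>\<nabla>u\<close> that extends \<open>\<nabla>v \<mapsto> (f, v) + \<langle>g, v\<rangle>\<close> exists by
  Hahn-Banach, because the gradient of the given extension of \<open>u\<^sub>D\<close> is interior to the constraint set,
  and it is the dual maximizer. The optimality relations are the equality cases of Fenchel's inequality for the two parts of \<open>\<mu>\<close>.\<close>

section \<open>The Hahn-Banach theorem for sublinear functionals\<close>

text \<open>The constraint confines gradients to bounded fields, and a continuous functional on
  those can charge sets of arbitrarily small measure. A maximizing sequence of densities may
  concentrate, so the maximizer is not extracted from one: it is built at the given minimizer
  \<open>u\<close>, as a functional that reproduces the load on gradients of \<open>W1inf_D\<close>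
  functions. Hahn-Banach by itself gives a linear functional without continuity; the bound comes
  from the same interior point that makes the dominating functional finite. The admissible radius
  there is \<open>(1 - q) * c\<close>, where \<open>q < 1\<close> bounds the ratio of the
  extension's gradient to \<open>\<zeta>\<close> and \<open>c\<close> bounds \<open>\<zeta>\<close>
  from below. The other recurring difficulty is that fields are concrete functions, while
  \<open>grad\<close>, \<open>bd_trace\<close> and the decomposition inside \<open>dual_D\<close>
  are arbitrary choices. Each choice is made harmless separately: gradients by uniqueness almost
  everywhere, traces by uniqueness of the continuous representative on the closure, decompositions
  because the conjugate of \<open>G\<close> has the same value for all of them.\<close>

definition sublinear_on :: "('x \<Rightarrow> 'b::real_vector) set \<Rightarrow> (('x \<Rightarrow> 'b) \<Rightarrow> real) \<Rightarrow> bool" where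
  "sublinear_on X p \<longleftrightarrow>
     (\<forall>y\<in>X. \<forall>z\<in>X. p (\<lambda>x. y x + z x) \<le> p y + p z) \<and>
     (\<forall>c>0. \<forall>y\<in>X. p (\<lambda>x. c *\<^sub>R y x) = c * p y) \<and> p (\<lambda>x. 0) = 0"

definition linear_on_functions :: "('x \<Rightarrow> 'b::real_vector) set \<Rightarrow> (('x \<Rightarrow> 'b) \<Rightarrow> real) \<Rightarrow> bool" where
  "linear_on_functions X l \<longleftrightarrow>
     (\<forall>y\<in>X. \<forall>z\<in>X. l (\<lambda>x. y x + z x) = l y + l z) \<and> (\<forall>c. \<forall>y\<in>X. l (\<lambda>x. c *\<^sub>R y x) = c * l y)"

definition function_subspace :: "('x \<Rightarrow> 'b::real_vector) set \<Rightarrow> bool" where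
  "function_subspace X \<longleftrightarrow> (\<lambda>x. 0) \<in> X \<and> (\<forall>y\<in>X. \<forall>z\<in>X. (\<lambda>x. y x + z x) \<in> X) \<and>
     (\<forall>c. \<forall>y\<in>X. (\<lambda>x. c *\<^sub>R y x) \<in> X)"

lemma sublinear_on_add:
  "sublinear_on X q \<Longrightarrow> y \<in> X \<Longrightarrow> z \<in> X \<Longrightarrow> q (\<lambda>x. y x + z x) \<le> q y + q z"
  unfolding sublinear_on_def by blast

lemma sublinear_on_lower_bound:
  assumes X: "function_subspace X" and q: "sublinear_on X q" and y: "y \<in> X"
  shows "- q (\<lambda>x. - y x) \<le> q y"
proof -
  have "(\<lambda>x. (-1) *\<^sub>R y x) \<in> X" using X y unfolding function_subspace_def by blast
  then have "(\<lambda>x. - y x) \<in> X" by simp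
  then have "q (\<lambda>x. y x + - y x) \<le> q y + q (\<lambda>x. - y x)"
    using sublinear_on_add[OF q y] by blast
  moreover have "q (\<lambda>x. 0) = 0" using q unfolding sublinear_on_def by blast
  ultimately show ?thesis by simp
qed

text \<open>A pointwise minimal sublinear functional is linear: otherwise some
  \<open>y \<mapsto> inf\<^bsub>t \<ge> 0\<^esub> (q (y + t a) - t q a)\<close> would lie strictly below it.\<close>

lemma minimal_sublinear_on_superadditive:
  assumes X: "function_subspace X" and q: "sublinear_on X q" and a: "a \<in> X" and y: "y \<in> X"
    and minimal: "\<And>r. sublinear_on X r \<Longrightarrow> (\<And>y. y \<in> X \<Longrightarrow> r y \<le> q y) \<Longrightarrow> (\<And>y. y \<in> X \<Longrightarrow> r y = q y)"
  shows "q y + q a \<le> q (\<lambda>x. y x + a x)"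
proof -
  define S where "S y = (\<lambda>t. q (\<lambda>x. y x + t *\<^sub>R a x) - t * q a) ` {0..}" for y
  define r where "r y = Inf (S y)" for y
  have cl: "\<And>z t. z \<in> X \<Longrightarrow> (\<lambda>x. t *\<^sub>R z x) \<in> X" "\<And>z w. z \<in> X \<Longrightarrow> w \<in> X \<Longrightarrow> (\<lambda>x. z x + w x) \<in> X"
    using X unfolding function_subspace_def by blast+
  have qs: "\<And>z w. z \<in> X \<Longrightarrow> w \<in> X \<Longrightarrow> q (\<lambda>x. z x + w x) \<le> q z + q w"
    "\<And>c z. c > 0 \<Longrightarrow> z \<in> X \<Longrightarrow> q (\<lambda>x. c *\<^sub>R z x) = c * q z" "q (\<lambda>x. 0) = 0"
    using q unfolding sublinear_on_def by blast+
  have qh: "q (\<lambda>x. c *\<^sub>R z x) = c * q z" if "c \<ge> 0" "z \<in> X" for c z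
    using qs(2)[of c z] qs(3) that by (cases "c = 0") auto
  have neg: "(\<lambda>x. - z x) \<in> X" if "z \<in> X" for z using cl(1)[OF that, of "-1"] by simp
  \<comment> \<open>The infimum is finite: writing t a as (y + t a) - y and using subadditivity
    gives a lower bound that is independent of t.\<close>
  have lb: "- q (\<lambda>x. - y x) \<le> s" if "s \<in> S y" "y \<in> X" for s y
  proof -
    obtain t where t: "t \<ge> 0" "s = q (\<lambda>x. y x + t *\<^sub>R a x) - t * q a" using \<open>s \<in> S y\<close> by (auto simp: S_def)
    have "q (\<lambda>x. (y x + t *\<^sub>R a x) + - y x) \<le> q (\<lambda>x. y x + t *\<^sub>R a x) + q (\<lambda>x. - y x)"
      by (rule qs(1)) (use cl neg that a in auto)
    then have "q (\<lambda>x. t *\<^sub>R a x) \<le> q (\<lambda>x. y x + t *\<^sub>R a x) + q (\<lambda>x. - y x)" by simp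
    then show ?thesis using t qh[OF t(1) a] by simp
  qed
  then have bdd: "bdd_below (S y)" if "y \<in> X" for y using that by (meson bdd_belowI)
  have ne: "S y \<noteq> {}" for y by (auto simp: S_def)
  have r_le: "r y \<le> q (\<lambda>x. y x + t *\<^sub>R a x) - t * q a" if "y \<in> X" "t \<ge> 0" for y t
    unfolding r_def by (rule cInf_lower[OF _ bdd]) (use that in \<open>auto simp: S_def\<close>)
  have "sublinear_on X r"
    unfolding sublinear_on_def
  proof (intro conjI ballI allI impI)
    fix y z assume yz: "y \<in> X" "z \<in> X"
    \<comment> \<open>The parameters add: t for y and t' for z give the admissible parameter t + t'
      for the sum.\<close>
    have step: "r (\<lambda>x. y x + z x) \<le> s + s'" if "s \<in> S y" "s' \<in> S z" for s s'
    proof -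
      obtain t t' where t: "t \<ge> 0" "s = q (\<lambda>x. y x + t *\<^sub>R a x) - t * q a"
        "t' \<ge> 0" "s' = q (\<lambda>x. z x + t' *\<^sub>R a x) - t' * q a" using \<open>s \<in> S y\<close> \<open>s' \<in> S z\<close> by (auto simp: S_def)
      have "r (\<lambda>x. y x + z x) \<le> q (\<lambda>x. y x + z x + (t + t') *\<^sub>R a x) - (t + t') * q a"
        using r_le[OF cl(2)[OF yz]] t by simp
      also have "(\<lambda>x. y x + z x + (t + t') *\<^sub>R a x) = (\<lambda>x. (y x + t *\<^sub>R a x) + (z x + t' *\<^sub>R a x))"
        by (simp add: algebra_simps)
      also have "q \<dots> \<le> q (\<lambda>x. y x + t *\<^sub>R a x) + q (\<lambda>x. z x + t' *\<^sub>R a x)"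
        by (intro qs(1) cl yz a)
      finally show ?thesis using t by (simp add: algebra_simps)
    qed
    have "r (\<lambda>x. y x + z x) - s \<le> r z" if "s \<in> S y" for s
      unfolding r_def[of z] by (rule cInf_greatest[OF ne]) (use step[OF that] in \<open>simp add: algebra_simps\<close>)
    then have "r (\<lambda>x. y x + z x) - r z \<le> r y"
      unfolding r_def[of y] by (intro cInf_greatest[OF ne]) (simp add: algebra_simps)
    then show "r (\<lambda>x. y x + z x) \<le> r y + r z" by simp
  next
    have scale: "r (\<lambda>x. c *\<^sub>R y x) \<le> c * r y" if "c > 0" "y \<in> X" for c y
    proof -
      have "r (\<lambda>x. c *\<^sub>R y x) / c \<le> r y"
        unfolding r_def[of y]
      proof (rule cInf_greatest[OF ne])
        fix s assume "s \<in> S y"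
        then obtain t where t: "t \<ge> 0" "s = q (\<lambda>x. y x + t *\<^sub>R a x) - t * q a" by (auto simp: S_def)
        have "r (\<lambda>x. c *\<^sub>R y x) \<le> q (\<lambda>x. c *\<^sub>R y x + (c * t) *\<^sub>R a x) - (c * t) * q a"
          by (rule r_le) (use that t cl in auto)
        also have "(\<lambda>x. c *\<^sub>R y x + (c * t) *\<^sub>R a x) = (\<lambda>x. c *\<^sub>R (y x + t *\<^sub>R a x))"
          by (simp add: algebra_simps)
        also have "q \<dots> = c * q (\<lambda>x. y x + t *\<^sub>R a x)"
          by (rule qs(2)) (use that cl a in auto)
        finally show "r (\<lambda>x. c *\<^sub>R y x) / c \<le> s"
          using that by (simp add: t(2) pos_divide_le_eq right_diff_distrib mult.commute mult.left_commute)
      qed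
      then show ?thesis using that by (simp add: field_simps)
    qed
    fix c :: real and y assume c: "c > 0" and y: "y \<in> X"
    \<comment> \<open>The opposite inequality is \<open>scale\<close> with factor 1/c, applied to c
      y.\<close>
    have "r (\<lambda>x. inverse c *\<^sub>R (c *\<^sub>R y x)) \<le> inverse c * r (\<lambda>x. c *\<^sub>R y x)"
      by (rule scale) (use c y cl in auto)
    then have "c * r y \<le> r (\<lambda>x. c *\<^sub>R y x)" using c by (simp add: field_simps)
    then show "r (\<lambda>x. c *\<^sub>R y x) = c * r y" using scale[OF c y] by simp
  next
    have 0: "(\<lambda>x. 0) \<in> X" using X by (simp add: function_subspace_def)
    have "r (\<lambda>x. 0) \<le> 0" using r_le[OF 0, of 0] qs(3) by simp
    moreover have "0 \<le> r (\<lambda>x. 0)"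
      unfolding r_def by (rule cInf_greatest[OF ne]) (use lb[OF _ 0] qs(3) in force)
    ultimately show "r (\<lambda>x. 0) = 0" by simp
  qed
  moreover have "r y \<le> q y" if "y \<in> X" for y using r_le[OF that, of 0] by simp
  ultimately have "r y = q y" using minimal y by blast
  \<comment> \<open>At t = 1 the bound on r y = q y is exactly superadditivity.\<close>
  then show ?thesis using r_le[OF y, of 1] by simp
qed

text \<open>Zorn's lemma, with the order reversed, yields a minimal sublinear functional below p,
  and minimal ones are linear. No subspace is prescribed: in the application p is built so that
  domination alone forces the values on the subspace.\<close>

theorem sublinear_on_dominates_linear:
  fixes p :: "('x \<Rightarrow> 'b::real_vector) \<Rightarrow> real"
  assumes X: "function_subspace X" and p: "sublinear_on X p"
  obtains l where "linear_on_functions X l" "\<And>y. y \<in> X \<Longrightarrow> l y \<le> p y"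
proof -
  \<comment> \<open>Values outside X are pinned to 0. The order compares functionals at all
    functions, and sublinearity on X says nothing outside X.\<close>
  define A where "A = {q. sublinear_on X q \<and> (\<forall>y\<in>X. q y \<le> p y) \<and> (\<forall>y. y \<notin> X \<longrightarrow> q y = 0)}"
  define P where "P = (\<lambda>q r :: ('x \<Rightarrow> 'b) \<Rightarrow> real. \<forall>y. r y \<le> q y)"
  have cl: "\<And>z t. z \<in> X \<Longrightarrow> (\<lambda>x. t *\<^sub>R z x) \<in> X" "\<And>z w. z \<in> X \<Longrightarrow> w \<in> X \<Longrightarrow> (\<lambda>x. z x + w x) \<in> X"
    using X unfolding function_subspace_def by blast+
  have X0: "(\<lambda>x. 0) \<in> X" using X by (simp add: function_subspace_def)
  have neg: "(\<lambda>x. - z x) \<in> X" if "z \<in> X" for z using cl(1)[OF that, of "-1"] by simp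
  have p0A: "(\<lambda>y. if y \<in> X then p y else 0) \<in> A"
    using p X0 unfolding A_def sublinear_on_def by (auto simp: cl)
  have po: "partial_order_on A (relation_of P A)"
    by (rule partial_order_on_relation_ofI) (auto simp: P_def fun_eq_iff intro: order_trans antisym)
  have "\<exists>m\<in>A. \<forall>a\<in>A. P m a \<longrightarrow> a = m"
  proof (rule predicate_Zorn[OF po])
    fix C assume C: "C \<in> Chains (relation_of P A)"
    show "\<exists>u\<in>A. \<forall>a\<in>C. P a u"
    proof (cases "C = {}")
      case True then show ?thesis using p0A by blast
    next
      case False
      have CA: "C \<subseteq> A" using C unfolding Chains_def relation_of_def by auto
      have chain: "(\<forall>y. b y \<le> a y) \<or> (\<forall>y. a y \<le> b y)" if "a \<in> C" "b \<in> C" for a b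
        using C that unfolding Chains_def relation_of_def P_def by blast
      define u where "u y = (if y \<in> X then (INF q\<in>C. q y) else 0)" for y
      \<comment> \<open>All members of the chain share the lower bound -p(-y), since q y is at least
        -q(-y) and q is below p at -y.\<close>
      have bdd: "bdd_below ((\<lambda>q. q y) ` C)" if "y \<in> X" for y
      proof (rule bdd_belowI2)
        fix q assume q: "q \<in> C"
        then have "- q (\<lambda>x. - y x) \<le> q y"
          using sublinear_on_lower_bound[OF X _ that] CA unfolding A_def by blast
        moreover have "q (\<lambda>x. - y x) \<le> p (\<lambda>x. - y x)" using q CA neg[OF that] unfolding A_def by blast
        ultimately show "- p (\<lambda>x. - y x) \<le> q y" by simp
      qed
      have le: "u y \<le> q y" if "q \<in> C" "y \<in> X" for q y
        using that by (auto simp: u_def intro: cINF_lower bdd)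
      have sub: "sublinear_on X u"
        unfolding sublinear_on_def
      proof (intro conjI ballI allI impI)
        fix y z assume yz: "y \<in> X" "z \<in> X"
        have step: "u (\<lambda>x. y x + z x) \<le> a y + b z" if "a \<in> C" "b \<in> C" for a b
        proof -
          \<comment> \<open>The smaller of the two members of the chain is good at both points, so
            its subadditivity can be used.\<close>
          obtain q where q: "q \<in> C" "q y \<le> a y" "q z \<le> b z"
            using chain[OF \<open>a \<in> C\<close> \<open>b \<in> C\<close>] \<open>a \<in> C\<close> \<open>b \<in> C\<close> by (metis order_refl)
          have "u (\<lambda>x. y x + z x) \<le> q (\<lambda>x. y x + z x)" by (intro le q cl yz)
          also have "\<dots> \<le> q y + q z" using q CA yz unfolding A_def sublinear_on_def by blast
          finally show ?thesis using q by linarith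
        qed
        have uz: "u z = (INF q\<in>C. q z)" and uy: "u y = (INF q\<in>C. q y)" using yz by (simp_all add: u_def)
        have "u (\<lambda>x. y x + z x) - a y \<le> u z" if "a \<in> C" for a
          unfolding uz
        proof (rule cINF_greatest[OF False])
          fix b assume "b \<in> C"
          then show "u (\<lambda>x. y x + z x) - a y \<le> b z" using step[OF that] by force
        qed
        then have "u (\<lambda>x. y x + z x) - u z \<le> u y"
          unfolding uy by (intro cINF_greatest[OF False]) (simp add: algebra_simps)
        then show "u (\<lambda>x. y x + z x) \<le> u y + u z" by simp
      next
        have hom: "q (\<lambda>x. c *\<^sub>R y x) = c * q y" if "q \<in> C" "c > 0" "y \<in> X" for q c y
          using that CA unfolding A_def sublinear_on_def by blast
        have scale: "c * u y \<le> u (\<lambda>x. c *\<^sub>R y x)" if "c > 0" "y \<in> X" for c y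
        proof -
          have "u (\<lambda>x. c *\<^sub>R y x) = (INF q\<in>C. q (\<lambda>x. c *\<^sub>R y x))" using that cl by (simp add: u_def)
          moreover have "c * u y \<le> q (\<lambda>x. c *\<^sub>R y x)" if "q \<in> C" for q
            unfolding hom[OF that \<open>c > 0\<close> \<open>y \<in> X\<close>] using le[OF that \<open>y \<in> X\<close>] \<open>c > 0\<close> by simp
          ultimately show ?thesis using False by (simp add: cINF_greatest)
        qed
        fix c :: real and y assume c: "c > 0" and y: "y \<in> X"
        have "inverse c * u (\<lambda>x. c *\<^sub>R y x) \<le> u (\<lambda>x. inverse c *\<^sub>R (c *\<^sub>R y x))"
          by (rule scale) (use c y cl in auto)
        then have "u (\<lambda>x. c *\<^sub>R y x) \<le> c * u y" using c by (simp add: field_simps)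
        then show "u (\<lambda>x. c *\<^sub>R y x) = c * u y" using scale[OF c y] by simp
      next
        have "q (\<lambda>x. 0) = 0" if "q \<in> C" for q using that CA unfolding A_def sublinear_on_def by blast
        then have "(\<lambda>q. q (\<lambda>x. 0)) ` C = (\<lambda>q. 0) ` C" by (intro image_cong refl)
        then have "(\<lambda>q. q (\<lambda>x. 0)) ` C = {0}" using False by auto
        then show "u (\<lambda>x. 0) = 0" using X0 by (simp add: u_def)
      qed
      obtain q where q: "q \<in> C" using False by blast
      have "u y \<le> p y" if "y \<in> X" for y
        using le[OF q that] q CA that unfolding A_def by force
      then have "u \<in> A" using sub by (auto simp: A_def u_def)
      moreover have "P a u" if "a \<in> C" for a
        using le[OF that] that CA unfolding P_def A_def by (metis (mono_tags, lifting) mem_Collect_eq order_refl subsetD u_def)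
      ultimately show ?thesis by blast
    qed
  qed
  then obtain q where q: "q \<in> A" and qmin: "\<And>r. r \<in> A \<Longrightarrow> P q r \<Longrightarrow> r = q" by blast
  have qsub: "sublinear_on X q" and qp: "\<And>y. y \<in> X \<Longrightarrow> q y \<le> p y" using q unfolding A_def by auto
  have minimal: "r y = q y" if r: "sublinear_on X r" "\<And>y. y \<in> X \<Longrightarrow> r y \<le> q y" and y: "y \<in> X" for r y
  proof -
    define r' where "r' = (\<lambda>y. if y \<in> X then r y else 0)"
    have "sublinear_on X r'" using r(1) X0 unfolding r'_def sublinear_on_def by (auto simp: cl)
    moreover have "\<forall>y\<in>X. r' y \<le> p y" using r(2) qp by (force simp: r'_def)
    ultimately have "r' \<in> A" by (auto simp: A_def r'_def)
    moreover have "P q r'" using r(2) q by (auto simp: P_def r'_def A_def)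
    ultimately have "r' = q" by (rule qmin)
    then show ?thesis using y by (auto simp: r'_def)
  qed
  have add: "q (\<lambda>x. y x + z x) = q y + q z" if "y \<in> X" "z \<in> X" for y z
  proof (rule antisym)
    show "q (\<lambda>x. y x + z x) \<le> q y + q z" using qsub that unfolding sublinear_on_def by blast
    show "q y + q z \<le> q (\<lambda>x. y x + z x)"
      by (rule minimal_sublinear_on_superadditive[OF X qsub that(2,1)]) (fact minimal)
  qed
  have q0: "q (\<lambda>x. 0) = 0" using qsub unfolding sublinear_on_def by blast
  have qpos: "q (\<lambda>x. c *\<^sub>R y x) = c * q y" if "c > 0" "y \<in> X" for c y
    using qsub that unfolding sublinear_on_def by blast
  have qneg: "q (\<lambda>x. - y x) = - q y" if "y \<in> X" for y
    using add[OF that neg[OF that]] q0 by simp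
  have "q (\<lambda>x. c *\<^sub>R y x) = c * q y" if "y \<in> X" for c y
  proof (cases c "0::real" rule: linorder_cases)
    case less
    then have "q (\<lambda>x. - ((-c) *\<^sub>R y x)) = - q (\<lambda>x. (-c) *\<^sub>R y x)" by (intro qneg cl that)
    then show ?thesis using qpos[of "-c" y] less that by simp
  qed (use q0 qpos that in auto)
  then have "linear_on_functions X q" using add by (auto simp: linear_on_functions_def)
  then show ?thesis using that qp by blast
qed

section \<open>Essentially bounded fields and their dual\<close>

locale bounded_open_set =
  fixes \<Omega> :: "'a::euclidean_space set"
  assumes open_Omega: "open \<Omega>" and bounded_Omega: "bounded \<Omega>" and nonempty_Omega: "\<Omega> \<noteq> {}"
begin

abbreviation L :: "'a measure" where "L \<equiv> lebesgue_on \<Omega>"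

lemma Omega_sets [simp]: "\<Omega> \<in> sets lebesgue"
  using open_Omega by (simp add: borel_open)

lemma space_L [simp]: "space L = \<Omega>"
  by simp

lemma Omega_sets_L [simp]: "\<Omega> \<in> sets L"
  using sets.top[of L] by simp

lemma sets_L_iff: "A \<in> sets L \<longleftrightarrow> A \<in> sets lebesgue \<and> A \<subseteq> \<Omega>"
  by (auto simp: sets_restrict_space_iff)

lemma emeasure_L_finite: "emeasure L \<Omega> < \<infinity>"
  using fmeasurableD2[OF lmeasurable_open[OF bounded_Omega open_Omega]]
  by (simp add: emeasure_restrict_space top.not_eq_extremum)

sublocale finite_measure L
  by standard (use emeasure_L_finite in auto)

lemma emeasure_L_pos: "emeasure L \<Omega> > 0"
proof -
  have "\<not> negligible \<Omega>" using open_Omega nonempty_Omega open_not_negligible by blast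
  then have "\<Omega> \<notin> null_sets lebesgue" by (simp add: negligible_iff_null_sets)
  then have "emeasure lebesgue \<Omega> \<noteq> 0" by (auto simp: null_sets_def)
  then show ?thesis by (simp add: emeasure_restrict_space zero_less_iff_neq_zero)
qed

text \<open>A nonempty open set has positive measure, so the almost everywhere filter is not
  trivial.\<close>

lemma AE_L_imp_ex: "AE x in L. P x \<Longrightarrow> \<exists>x\<in>\<Omega>. P x"
proof (rule ccontr)
  assume ae: "AE x in L. P x" and no: "\<not> (\<exists>x\<in>\<Omega>. P x)"
  have "AE x in L. P x \<longrightarrow> False" by (rule AE_I2) (use no in auto)
  from AE_mp[OF ae this] have "AE x in L. False" .
  then have "ae_filter L = bot" by (simp add: trivial_limit_def)
  then show False using emeasure_L_pos by (simp add: ae_filter_eq_bot_iff)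
qed

lemma Linf_norm_le_iff:
  assumes "y \<in> borel_measurable L"
  shows "Linf_norm \<Omega> y \<le> ereal C \<longleftrightarrow> (AE x in L. norm (y x) \<le> C)"
proof
  assume "Linf_norm \<Omega> y \<le> ereal C"
  then have "AE x in L. ereal (norm (y x)) \<le> ereal C"
    using esssup_AE[where M = L and f = "\<lambda>x. ereal (norm (y x))"] unfolding Linf_norm_def
    by (elim eventually_mono) (rule order_trans)
  then show "AE x in L. norm (y x) \<le> C" by simp
next
  assume "AE x in L. norm (y x) \<le> C"
  then show "Linf_norm \<Omega> y \<le> ereal C" unfolding Linf_norm_def using assms
    by (intro esssup_I) auto
qed

lemma Linf_norm_nonneg: "0 \<le> Linf_norm \<Omega> y"
proof (cases "(\<lambda>x. ereal (norm (y x))) \<in> borel_measurable L")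
  case True
  show ?thesis
  proof (rule ccontr)
    assume "\<not> ?thesis"
    then have neg: "Linf_norm \<Omega> y < 0" by simp
    have "AE x in L. ereal (norm (y x)) \<le> Linf_norm \<Omega> y"
      unfolding Linf_norm_def by (rule esssup_AE)
    then obtain x where "ereal (norm (y x)) \<le> Linf_norm \<Omega> y" using AE_L_imp_ex by blast
    also note neg
    finally show False by (simp add: zero_ereal_def)
  qed
\<comment> \<open>Without measurability \<open>esssup\<close> takes by convention the top
  value.\<close>
qed (simp add: Linf_norm_def esssup_non_measurable top_ereal_def)

lemma Linf_iff:
  "y \<in> Linf \<Omega> \<longleftrightarrow> y \<in> borel_measurable L \<and> (\<exists>C\<ge>0. AE x in L. norm (y x) \<le> C)"
proof
  assume y: "y \<in> Linf \<Omega>"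
  then have m: "y \<in> borel_measurable L" and "Linf_norm \<Omega> y < \<infinity>" by (auto simp: Linf_def)
  then obtain C where C: "Linf_norm \<Omega> y = ereal C" using Linf_norm_nonneg[of y] by (cases "Linf_norm \<Omega> y") auto
  then have "C \<ge> 0" using Linf_norm_nonneg[of y] by simp
  then show "y \<in> borel_measurable L \<and> (\<exists>C\<ge>0. AE x in L. norm (y x) \<le> C)"
    using m C Linf_norm_le_iff[OF m, of C] by auto
next
  assume "y \<in> borel_measurable L \<and> (\<exists>C\<ge>0. AE x in L. norm (y x) \<le> C)"
  then obtain C where "y \<in> borel_measurable L" "Linf_norm \<Omega> y \<le> ereal C" using Linf_norm_le_iff by blast
  then show "y \<in> Linf \<Omega>" unfolding Linf_def by (auto intro: order.strict_trans1)
qed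

lemma Linf_measurable [measurable_dest]: "y \<in> Linf \<Omega> \<Longrightarrow> y \<in> borel_measurable L"
  by (simp add: Linf_def)

lemma LinfE:
  assumes "y \<in> Linf \<Omega>"
  obtains C where "C \<ge> 0" "AE x in L. norm (y x) \<le> C"
  using assms Linf_iff by blast

lemma LinfI: "y \<in> borel_measurable L \<Longrightarrow> AE x in L. norm (y x) \<le> C \<Longrightarrow> y \<in> Linf \<Omega>"
  unfolding Linf_iff
proof (intro conjI exI[of _ "max C 0"])
  show "AE x in L. norm (y x) \<le> max C 0" if "AE x in L. norm (y x) \<le> C"
    using that by (auto elim!: eventually_mono)
qed auto

lemma Linf_add: "y \<in> Linf \<Omega> \<Longrightarrow> z \<in> Linf \<Omega> \<Longrightarrow> (\<lambda>x. y x + z x) \<in> Linf \<Omega>"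
proof -
  assume y: "y \<in> Linf \<Omega>" and z: "z \<in> Linf \<Omega>"
  obtain C where C: "AE x in L. norm (y x) \<le> C" using y by (rule LinfE)
  obtain D where D: "AE x in L. norm (z x) \<le> D" using z by (rule LinfE)
  show ?thesis
  proof (rule LinfI)
    show "AE x in L. norm (y x + z x) \<le> C + D"
      using C D by eventually_elim (meson add_mono norm_triangle_le)
  qed (use y z in measurable)
qed

lemma Linf_scaleR: "y \<in> Linf \<Omega> \<Longrightarrow> (\<lambda>x. c *\<^sub>R y x) \<in> Linf \<Omega>"
proof -
  assume y: "y \<in> Linf \<Omega>"
  obtain C where C: "AE x in L. norm (y x) \<le> C" using y by (rule LinfE)
  show ?thesis
  proof (rule LinfI)
    show "AE x in L. norm (c *\<^sub>R y x) \<le> \<bar>c\<bar> * C"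
      using C by eventually_elim (simp add: mult_left_mono)
  qed (use y in measurable)
qed

lemma Linf_mult:
  fixes w :: "'a \<Rightarrow> real"
  assumes "w \<in> Linf \<Omega>" "y \<in> Linf \<Omega>" shows "(\<lambda>x. w x *\<^sub>R y x) \<in> Linf \<Omega>"
proof -
  obtain C where C: "AE x in L. norm (w x) \<le> C" "C \<ge> 0" using assms(1) by (rule LinfE)
  obtain D where D: "AE x in L. norm (y x) \<le> D" using assms(2) by (rule LinfE)
  show ?thesis
  proof (rule LinfI)
    show "AE x in L. norm (w x *\<^sub>R y x) \<le> C * D"
      using C(1) D by eventually_elim (use C(2) in \<open>auto intro!: mult_mono\<close>)
  qed (use assms in measurable)
qed

lemma Linf_minus: "y \<in> Linf \<Omega> \<Longrightarrow> (\<lambda>x. - y x) \<in> Linf \<Omega>"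
  using Linf_scaleR[of y "-1"] by simp

lemma Linf_diff: "y \<in> Linf \<Omega> \<Longrightarrow> z \<in> Linf \<Omega> \<Longrightarrow> (\<lambda>x. y x - z x) \<in> Linf \<Omega>"
  using Linf_add[OF _ Linf_minus, of y z] by simp

lemma Linf_const [simp]: "(\<lambda>x. c) \<in> Linf \<Omega>"
  by (rule LinfI[of _ "norm c"]) auto

lemma Linf_indicator: "A \<in> sets L \<Longrightarrow> y \<in> Linf \<Omega> \<Longrightarrow> (\<lambda>x. indicator A x *\<^sub>R y x) \<in> Linf \<Omega>"
  by (rule Linf_mult) (auto intro!: LinfI[of _ 1] simp: indicator_def)

lemma simple_imp_Linf: "simple_function L s \<Longrightarrow> s \<in> Linf \<Omega>"
proof (rule LinfI)
  assume s: "simple_function L s"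
  then have fin: "finite (s ` \<Omega>)" by (simp add: simple_function_def)
  show "AE x in L. norm (s x) \<le> (\<Sum>c\<in>s ` \<Omega>. norm c)"
    by (rule AE_I2) (auto intro!: member_le_sum[of _ "s ` \<Omega>" norm] fin)
qed (simp add: borel_measurable_simple_function)

lemma function_subspace_Linf: "function_subspace (Linf \<Omega>)"
  unfolding function_subspace_def using Linf_add Linf_scaleR by auto

text \<open>Continuity is phrased through almost everywhere bounds rather than the extended real
  norm. The bound C = 0 is included, so such a functional cannot separate fields that agree almost
  everywhere.\<close>

definition Linf_functional :: "(('a \<Rightarrow> 'a) \<Rightarrow> real) \<Rightarrow> bool" where
  "Linf_functional l \<longleftrightarrow> linear_on_functions (Linf \<Omega>) l \<and>
     (\<exists>K\<ge>0. \<forall>y\<in>Linf \<Omega>. \<forall>C\<ge>0. (AE x in L. norm (y x) \<le> C) \<longrightarrow> \<bar>l y\<bar> \<le> K * C)"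

lemma Linf_functional_add:
  "Linf_functional l \<Longrightarrow> y \<in> Linf \<Omega> \<Longrightarrow> z \<in> Linf \<Omega> \<Longrightarrow> l (\<lambda>x. y x + z x) = l y + l z"
  unfolding Linf_functional_def linear_on_functions_def by blast

lemma Linf_functional_scaleR:
  "Linf_functional l \<Longrightarrow> y \<in> Linf \<Omega> \<Longrightarrow> l (\<lambda>x. c *\<^sub>R y x) = c * l y"
  unfolding Linf_functional_def linear_on_functions_def by blast

lemma Linf_functional_minus:
  "Linf_functional l \<Longrightarrow> y \<in> Linf \<Omega> \<Longrightarrow> l (\<lambda>x. - y x) = - l y"
  using Linf_functional_scaleR[of l y "-1"] by simp

lemma Linf_functional_diff:
  "Linf_functional l \<Longrightarrow> y \<in> Linf \<Omega> \<Longrightarrow> z \<in> Linf \<Omega> \<Longrightarrow> l (\<lambda>x. y x - z x) = l y - l z"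
  using Linf_functional_add[of l y "\<lambda>x. - z x"] Linf_functional_minus[of l z] Linf_minus[of z] by simp

lemma Linf_functional_zero: "Linf_functional l \<Longrightarrow> l (\<lambda>x. 0) = 0"
  using Linf_functional_scaleR[of l "\<lambda>x. 0" 0] by simp

lemma Linf_functional_bound:
  assumes "Linf_functional l"
  obtains K where "K \<ge> 0" "\<And>y C. y \<in> Linf \<Omega> \<Longrightarrow> C \<ge> 0 \<Longrightarrow> (AE x in L. norm (y x) \<le> C) \<Longrightarrow> \<bar>l y\<bar> \<le> K * C"
  using assms unfolding Linf_functional_def by blast

lemma Linf_functional_cong:
  assumes l: "Linf_functional l" and y: "y \<in> Linf \<Omega>" "z \<in> Linf \<Omega>" and ae: "AE x in L. y x = z x"
  shows "l y = l z"
proof -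
  obtain K where K: "\<And>y C. y \<in> Linf \<Omega> \<Longrightarrow> C \<ge> 0 \<Longrightarrow> (AE x in L. norm (y x) \<le> C) \<Longrightarrow> \<bar>l y\<bar> \<le> K * C"
    using Linf_functional_bound[OF l] by blast
  have "\<bar>l (\<lambda>x. y x - z x)\<bar> \<le> K * 0"
    by (rule K) (use ae Linf_diff y in auto)
  then show ?thesis using Linf_functional_diff[OF l y] by simp
qed

lemma Linf_functional_sum:
  assumes l: "Linf_functional l" and fin: "finite I" and y: "\<And>i. i \<in> I \<Longrightarrow> y i \<in> Linf \<Omega>"
  shows "l (\<lambda>x. \<Sum>i\<in>I. y i x) = (\<Sum>i\<in>I. l (y i)) \<and> (\<lambda>x. \<Sum>i\<in>I. y i x) \<in> Linf \<Omega>"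
  using fin y
proof (induction I rule: finite_induct)
  case empty then show ?case using Linf_functional_zero[OF l] by simp
next
  case (insert i I)
  then show ?case using Linf_functional_add[OF l, of "y i" "\<lambda>x. \<Sum>i\<in>I. y i x"] Linf_add[of "y i" "\<lambda>x. \<Sum>i\<in>I. y i x"]
    by simp
qed

lemma Linf_norm_tendstoD:
  assumes "\<And>n. y n \<in> borel_measurable L" "(\<lambda>n::nat. Linf_norm \<Omega> (y n)) \<longlonglongrightarrow> 0" "e > 0"
  obtains N where "\<And>n. n \<ge> N \<Longrightarrow> AE x in L. norm (y n x) \<le> e"
proof -
  have "eventually (\<lambda>n. Linf_norm \<Omega> (y n) < ereal e) sequentially"
    using assms(2,3) by (intro order_tendstoD) auto
  then obtain N where N: "\<And>n. n \<ge> N \<Longrightarrow> Linf_norm \<Omega> (y n) < ereal e"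
    unfolding eventually_sequentially by blast
  have "AE x in L. norm (y n x) \<le> e" if "n \<ge> N" for n
    using less_imp_le[OF N[OF that]] Linf_norm_le_iff[OF assms(1), of n e] by blast
  then show thesis using that by blast
qed

lemma Linf_functional_tendsto:
  assumes l: "Linf_functional l" and y: "y \<in> Linf \<Omega>" "\<And>n. s n \<in> Linf \<Omega>"
    and lim: "(\<lambda>n. Linf_norm \<Omega> (\<lambda>x. s n x - y x)) \<longlonglongrightarrow> 0"
  shows "(\<lambda>n::nat. l (s n)) \<longlonglongrightarrow> l y"
proof -
  have d: "(\<lambda>x. s n x - y x) \<in> Linf \<Omega>" for n using Linf_diff y by blast
  obtain K where K: "K \<ge> 0" "\<And>y C. y \<in> Linf \<Omega> \<Longrightarrow> C \<ge> 0 \<Longrightarrow> (AE x in L. norm (y x) \<le> C) \<Longrightarrow> \<bar>l y\<bar> \<le> K * C"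
    using l by (rule Linf_functional_bound) blast
  show ?thesis
  proof (rule LIMSEQ_I)
    fix r :: real assume r: "r > 0"
    define e where "e = r / (2 * (K + 1))"
    have e: "e > 0" using r K(1) by (simp add: e_def)
    have "K * e < r" using r K(1) by (simp add: e_def field_simps add_strict_increasing2)
    obtain N where N: "\<And>n. n \<ge> N \<Longrightarrow> AE x in L. norm (s n x - y x) \<le> e"
      using Linf_norm_tendstoD[OF Linf_measurable[OF d] lim e] by blast
    have "norm (l (s n) - l y) < r" if "n \<ge> N" for n
    proof -
      have "\<bar>l (\<lambda>x. s n x - y x)\<bar> \<le> K * e" using K(2)[OF d _ N[OF that]] e by simp
      then show ?thesis using \<open>K * e < r\<close> Linf_functional_diff[OF l y(2,1)] by simp
    qed
    then show "\<exists>N. \<forall>n\<ge>N. norm (l (s n) - l y) < r" by blast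
  qed
qed

text \<open>Every coordinate is rounded down to the grid of width 1/(n+1). Each coordinate
  contributes an error of at most one grid width, which explains the factor
  \<open>DIM('a)\<close>.\<close>

lemma uniform_simple_approximation:
  fixes y :: "'a \<Rightarrow> 'a"
  assumes y: "y \<in> Linf \<Omega>"
  obtains s where "\<And>n::nat. simple_function L (s n)"
    "\<And>n. AE x in L. norm (s n x - y x) \<le> real DIM('a) / real (Suc n)"
proof -
  obtain C where C: "C \<ge> 0" "AE x in L. norm (y x) \<le> C" using y by (rule LinfE)
  define q where "q n t = real_of_int \<lfloor>t * real (Suc n)\<rfloor> / real (Suc n)" for n :: nat and t :: real
  \<comment> \<open>Where y exceeds its essential bound, a null set, the value 0 is used; otherwise
    the rounded field could take infinitely many values.\<close>
  define s where "s n x = (if norm (y x) \<le> C then \<Sum>b\<in>Basis. q n (y x \<bullet> b) *\<^sub>R b else 0)" for n x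
  have [measurable]: "y \<in> borel_measurable L" using y by (rule Linf_measurable)
  have q_err: "\<bar>q n t - t\<bar> \<le> 1 / real (Suc n)" for n t
  proof -
    have "\<bar>real_of_int \<lfloor>t * real (Suc n)\<rfloor> - t * real (Suc n)\<bar> \<le> 1" by linarith
    then have "\<bar>(real_of_int \<lfloor>t * real (Suc n)\<rfloor> - t * real (Suc n)) / real (Suc n)\<bar> \<le> 1 / real (Suc n)"
      unfolding abs_divide by (simp add: divide_right_mono)
    then show ?thesis by (simp add: q_def diff_divide_distrib)
  qed
  show thesis
  proof
    fix n
    define Q where "Q = (\<lambda>k::int. real_of_int k / real (Suc n)) ` {\<lfloor>- C * real (Suc n)\<rfloor>..\<lfloor>C * real (Suc n)\<rfloor>}"
    have "finite Q" by (simp add: Q_def)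
    have qQ: "q n (y x \<bullet> b) \<in> Q" if "b \<in> Basis" "norm (y x) \<le> C" for x b
    proof -
      have "\<bar>y x \<bullet> b\<bar> \<le> C" using that Basis_le_norm[of b "y x"] by linarith
      then have "- C * real (Suc n) \<le> (y x \<bullet> b) * real (Suc n)" "(y x \<bullet> b) * real (Suc n) \<le> C * real (Suc n)"
        by (intro mult_right_mono; simp)+
      then show ?thesis unfolding Q_def q_def by (intro imageI) (auto intro!: floor_mono simp del: of_nat_Suc)
    qed
    have "s n ` \<Omega> \<subseteq> insert 0 ((\<lambda>g. \<Sum>b\<in>Basis. g b *\<^sub>R b) ` (Basis \<rightarrow>\<^sub>E Q))"
    proof clarify
      fix x assume neq: "s n x \<notin> (\<lambda>g. \<Sum>b\<in>Basis. g b *\<^sub>R b) ` (Basis \<rightarrow>\<^sub>E Q)"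
      show "s n x = 0"
      proof (rule ccontr)
        assume "s n x \<noteq> 0"
        then have le: "norm (y x) \<le> C" by (auto simp: s_def split: if_splits)
        have "s n x = (\<Sum>b\<in>Basis. restrict (\<lambda>b. q n (y x \<bullet> b)) Basis b *\<^sub>R b)" using le by (simp add: s_def)
        moreover have "restrict (\<lambda>b. q n (y x \<bullet> b)) Basis \<in> Basis \<rightarrow>\<^sub>E Q" using qQ le by auto
        ultimately show False using neq by blast
      qed
    qed
    moreover have "finite (insert 0 ((\<lambda>g. \<Sum>b\<in>Basis. g b *\<^sub>R b) ` ((Basis::'a set) \<rightarrow>\<^sub>E Q)))"
      using \<open>finite Q\<close> by (auto intro!: finite_PiE)
    ultimately have "finite (s n ` space L)" using finite_subset by auto
    moreover have "s n \<in> borel_measurable L" unfolding s_def q_def by measurable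
    ultimately show "simple_function L (s n)" by (intro simple_function_borel_measurable)
    show "AE x in L. norm (s n x - y x) \<le> real DIM('a) / real (Suc n)"
      using C(2)
    proof eventually_elim
      case (elim x)
      have "s n x - y x = (\<Sum>b\<in>Basis. (q n (y x \<bullet> b) - y x \<bullet> b) *\<^sub>R b)"
        using elim by (simp add: s_def scaleR_diff_left sum_subtractf euclidean_representation)
      also have "norm \<dots> \<le> (\<Sum>b\<in>(Basis::'a set). 1 / real (Suc n))"
        by (rule sum_norm_le) (use q_err in auto)
      finally show ?case by simp
    qed
  qed
qed

lemma Linf_norm_tendsto_0:
  assumes "\<And>n. y n \<in> borel_measurable L" "\<And>n. AE x in L. norm (y n x) \<le> e n" "e \<longlonglongrightarrow> 0"
  shows "(\<lambda>n::nat. Linf_norm \<Omega> (y n)) \<longlonglongrightarrow> 0"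
proof (rule tendsto_sandwich[of "\<lambda>n. 0" _ _ "\<lambda>n. ereal (e n)"])
  show "\<forall>\<^sub>F n in sequentially. Linf_norm \<Omega> (y n) \<le> ereal (e n)"
    using assms Linf_norm_le_iff by (intro always_eventually) blast
  show "(\<lambda>n. ereal (e n)) \<longlonglongrightarrow> 0" using assms(3) by (simp add: zero_ereal_def)
qed (auto simp: Linf_norm_nonneg)

lemma uniform_simple_approximation':
  fixes y :: "'a \<Rightarrow> 'a"
  assumes y: "y \<in> Linf \<Omega>"
  obtains s where "\<And>n::nat. simple_function L (s n)" "(\<lambda>n. Linf_norm \<Omega> (\<lambda>x. s n x - y x)) \<longlonglongrightarrow> 0"
proof -
  obtain s where s: "\<And>n::nat. simple_function L (s n)"
    "\<And>n. AE x in L. norm (s n x - y x) \<le> real DIM('a) / real (Suc n)"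
    using uniform_simple_approximation[OF y] by blast
  have "(\<lambda>n. real DIM('a) / real (Suc n)) \<longlonglongrightarrow> 0"
    using LIMSEQ_Suc[OF lim_const_over_n[of "real DIM('a)"]] by simp
  then have "(\<lambda>n. Linf_norm \<Omega> (\<lambda>x. s n x - y x)) \<longlonglongrightarrow> 0"
    by (intro Linf_norm_tendsto_0[where e = "\<lambda>n. real DIM('a) / real (Suc n)"] s Linf_measurable Linf_diff simple_imp_Linf y)
  then show thesis using that s by blast
qed

lemma Linf_functional_simple:
  assumes l: "Linf_functional l" and \<nu>: "\<And>A c. A \<in> sets L \<Longrightarrow> l (\<lambda>x. indicator A x *\<^sub>R c) = c \<bullet> \<nu> A"
    and s: "simple_function L s"
  shows "l s = ba_simple_integral \<Omega> \<nu> s"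
proof -
  have fin: "finite (s ` \<Omega>)" using s by (simp add: simple_function_def)
  have sets: "{x\<in>\<Omega>. s x = c} \<in> sets L" for c
    using simple_functionD(2)[OF s, of "{c}"] by (simp add: vimage_def Int_def conj_commute)
  have lin: "(\<lambda>x. indicator {x\<in>\<Omega>. s x = c} x *\<^sub>R c) \<in> Linf \<Omega>" for c
    by (intro Linf_indicator sets) simp
  note sum = Linf_functional_sum[OF l fin, of "\<lambda>c x. indicator {x\<in>\<Omega>. s x = c} x *\<^sub>R c", OF lin]
  have "l s = l (\<lambda>x. \<Sum>c\<in>s ` \<Omega>. indicator {x\<in>\<Omega>. s x = c} x *\<^sub>R c)"
  proof (rule Linf_functional_cong[OF l simple_imp_Linf[OF s]])
    show "AE x in L. s x = (\<Sum>c\<in>s ` \<Omega>. indicator {x\<in>\<Omega>. s x = c} x *\<^sub>R c)"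
    proof (rule AE_I2)
      fix x assume "x \<in> space L"
      then have "(\<Sum>c\<in>s ` \<Omega>. indicator {x\<in>\<Omega>. s x = c} x *\<^sub>R c) = (\<Sum>c\<in>s ` \<Omega>. if c = s x then c else 0)"
        by (intro sum.cong) (auto simp: indicator_def)
      also have "\<dots> = s x" using fin \<open>x \<in> space L\<close> by (simp add: sum.delta')
      finally show "s x = (\<Sum>c\<in>s ` \<Omega>. indicator {x\<in>\<Omega>. s x = c} x *\<^sub>R c)" by simp
    qed
  qed (use sum in blast)
  also have "\<dots> = (\<Sum>c\<in>s ` \<Omega>. l (\<lambda>x. indicator {x\<in>\<Omega>. s x = c} x *\<^sub>R c))"
    using sum by blast
  also have "\<dots> = ba_simple_integral \<Omega> \<nu> s" by (simp add: \<nu>[OF sets] ba_simple_integral_def)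
  finally show ?thesis .
qed

text \<open>Indicators determine a bounded functional on simple fields, and these are uniformly
  dense. Integrals are recognised by this criterion throughout.\<close>

lemma ba_integral_eqI:
  assumes l: "Linf_functional l" and \<nu>: "\<And>A c. A \<in> sets L \<Longrightarrow> l (\<lambda>x. indicator A x *\<^sub>R c) = c \<bullet> \<nu> A"
    and y: "y \<in> Linf \<Omega>"
  shows "ba_integral \<Omega> \<nu> y = l y"
  unfolding ba_integral_def
proof (rule the_equality)
  obtain s where s: "\<And>n::nat. simple_function L (s n)" "(\<lambda>n. Linf_norm \<Omega> (\<lambda>x. s n x - y x)) \<longlonglongrightarrow> 0"
    using uniform_simple_approximation'[OF y] by blast
  have "(\<lambda>n. l (s n)) \<longlonglongrightarrow> l y"
    by (rule Linf_functional_tendsto[OF l y simple_imp_Linf[OF s(1)] s(2)])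
  then show "has_ba_integral \<Omega> \<nu> y (l y)"
    unfolding has_ba_integral_def using s Linf_functional_simple[OF l \<nu> s(1)] by auto
next
  fix I assume "has_ba_integral \<Omega> \<nu> y I"
  then obtain s where s: "\<And>n::nat. simple_function L (s n)" "(\<lambda>n. Linf_norm \<Omega> (\<lambda>x. s n x - y x)) \<longlonglongrightarrow> 0"
    "(\<lambda>n. ba_simple_integral \<Omega> \<nu> (s n)) \<longlonglongrightarrow> I" unfolding has_ba_integral_def by blast
  have "(\<lambda>n. l (s n)) \<longlonglongrightarrow> l y"
    by (rule Linf_functional_tendsto[OF l y simple_imp_Linf[OF s(1)] s(2)])
  then show "I = l y" using s(3) Linf_functional_simple[OF l \<nu> s(1)] LIMSEQ_unique by auto
qed

end

text \<open>Along even indices the partial sums split exactly, and a subsequence suffices to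
  identify the limit. Merging by parity serves below for joining partitions and for joining
  covers.\<close>

lemma suminf_interleave:
  fixes f g :: "nat \<Rightarrow> ennreal"
  shows "(\<Sum>n. if even n then f (n div 2) else g (n div 2)) = (\<Sum>n. f n) + (\<Sum>n. g n)"
proof (rule LIMSEQ_unique)
  let ?h = "\<lambda>n. if even n then f (n div 2) else g (n div 2)"
  have "(\<Sum>i<2 * n. ?h i) = (\<Sum>i<n. f i) + (\<Sum>i<n. g i)" for n
    by (induction n) (auto simp: algebra_simps)
  moreover have "(\<lambda>n. \<Sum>i<2 * n. ?h i) \<longlonglongrightarrow> (\<Sum>n. ?h n)"
    using LIMSEQ_subseq_LIMSEQ[OF summable_LIMSEQ[OF summableI, of ?h], of "\<lambda>n. 2 * n"]
    by (simp add: strict_mono_def comp_def)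
  ultimately show "(\<lambda>n. (\<Sum>i<n. f i) + (\<Sum>i<n. g i)) \<longlonglongrightarrow> (\<Sum>n. ?h n)" by simp
  show "(\<lambda>n. (\<Sum>i<n. f i) + (\<Sum>i<n. g i)) \<longlonglongrightarrow> (\<Sum>n. f n) + (\<Sum>n. g n)"
    by (intro tendsto_add summable_LIMSEQ summableI)
qed

lemma UN_interleave:
  "(\<Union>n::nat. if even n then P (n div 2) else Q (n div 2)) = (\<Union>n. P n) \<union> (\<Union>n. Q n)"
proof -
  have "P n \<subseteq> (\<Union>n::nat. if even n then P (n div 2) else Q (n div 2))" for n
    by (rule subset_trans[OF _ UN_upper[of "2 * n"]]) auto
  moreover have "Q n \<subseteq> (\<Union>n::nat. if even n then P (n div 2) else Q (n div 2))" for n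
    by (rule subset_trans[OF _ UN_upper[of "2 * n + 1"]]) auto
  moreover have "(if even n then P (n div 2) else Q (n div 2)) \<subseteq> (\<Union>n. P n) \<union> (\<Union>n. Q n)" for n by auto
  ultimately show ?thesis by (intro antisym UN_least Un_least)
qed

text \<open>By disjointness at most one summand is nonzero at a point, and that one is zero or a
  unit vector. Such sign fields are the test fields that detect the variation on finitely many
  pieces.\<close>

lemma norm_sum_indicator_sgn:
  fixes A :: "nat \<Rightarrow> 'a set" and \<nu> :: "'a set \<Rightarrow> 'b::real_normed_vector"
  assumes A: "disjoint_family A"
  shows "norm (\<Sum>i<n. indicator (A i) x *\<^sub>R sgn (\<nu> (A i))) \<le> 1"
    (is "norm (\<Sum>i<n. ?y i x) \<le> 1")
proof (cases "\<exists>i<n. x \<in> A i")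
  case True
  then obtain i where i: "i < n" "x \<in> A i" by blast
  have no: "x \<notin> A j" if "j \<noteq> i" for j using disjoint_family_onD[OF A, of j i] i(2) that by blast
  have "?y j x = (if j = i then sgn (\<nu> (A i)) else 0)" for j
    using no[of j] i(2) by (cases "j = i") simp_all
  then show ?thesis using i(1) by (simp add: norm_sgn)
next
  case False
  then have "?y j x = 0" if "j < n" for j using that by (simp add: indicator_def)
  then have "(\<Sum>j<n. ?y j x) = 0" by (intro sum.neutral) auto
  then show ?thesis by (metis norm_zero zero_le_one)
qed

lemma DIM_over_n_tendsto_0: "(\<lambda>n. c * (real DIM('b::euclidean_space) / real (Suc n))) \<longlonglongrightarrow> 0"
  using tendsto_mult_right_zero[OF LIMSEQ_Suc[OF lim_const_over_n[of "real DIM('b)"]]] by simp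

section \<open>Total variation of finitely additive measures\<close>

context bounded_open_set begin

lemma ba_add: "\<nu> \<in> ba \<Omega> \<Longrightarrow> A \<in> sets L \<Longrightarrow> B \<in> sets L \<Longrightarrow> A \<inter> B = {} \<Longrightarrow> \<nu> (A \<union> B) = \<nu> A + \<nu> B"
  unfolding ba_def by blast

lemma ba_null: "\<nu> \<in> ba \<Omega> \<Longrightarrow> A \<in> null_sets L \<Longrightarrow> \<nu> A = 0"
  unfolding ba_def by blast

lemma ba_empty: "\<nu> \<in> ba \<Omega> \<Longrightarrow> \<nu> {} = 0"
  by (rule ba_null) auto

lemma ba_finite_sum:
  assumes "\<nu> \<in> ba \<Omega>" "finite I" "\<And>i. i \<in> I \<Longrightarrow> A i \<in> sets L" "disjoint_family_on A I"
  shows "\<nu> (\<Union>i\<in>I. A i) = (\<Sum>i\<in>I. \<nu> (A i))"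
  using assms(2,3,4)
proof (induction I rule: finite_induct)
  case empty then show ?case using ba_empty[OF assms(1)] by simp
next
  case (insert i I)
  have "A i \<inter> (\<Union>i\<in>I. A i) = {}" using insert.hyps insert.prems(2) by (auto simp: disjoint_family_on_def)
  then have "\<nu> (A i \<union> (\<Union>i\<in>I. A i)) = \<nu> (A i) + \<nu> (\<Union>i\<in>I. A i)"
    using insert.prems(1) insert.hyps by (intro ba_add[OF assms(1)] sets.finite_UN) auto
  moreover have "disjoint_family_on A I" using insert.prems(2) by (auto simp: disjoint_family_on_def)
  ultimately show ?case using insert by simp
qed

lemma suminf_le_total_variation:
  assumes "\<And>n::nat. P n \<in> sets L" "disjoint_family P"
  shows "(\<Sum>n. ennreal (norm (\<nu> (P n)))) \<le> total_variation \<Omega> \<nu> (\<Union>n. P n)"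
  unfolding total_variation_def by (rule SUP_upper) (use assms in auto)

lemma total_variation_least:
  assumes "\<And>P. (\<And>n::nat. P n \<in> sets L) \<Longrightarrow> disjoint_family P \<Longrightarrow> (\<Union>n. P n) = A \<Longrightarrow> (\<Sum>n. ennreal (norm (\<nu> (P n)))) \<le> c"
  shows "total_variation \<Omega> \<nu> A \<le> c"
  unfolding total_variation_def by (rule SUP_least) (use assms in auto)

text \<open>Partitions of A and of B interleave to a partition of the union whose sum is the sum of
  the two; suprema are then taken one after the other.\<close>

lemma total_variation_superadditive:
  assumes A: "A \<in> sets L" and B: "B \<in> sets L" and disj: "A \<inter> B = {}"
  shows "total_variation \<Omega> \<nu> A + total_variation \<Omega> \<nu> B \<le> total_variation \<Omega> \<nu> (A \<union> B)"
proof -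
  define parts where "parts A = {P :: nat \<Rightarrow> 'a set. range P \<subseteq> sets L \<and> disjoint_family P \<and> (\<Union>i. P i) = A}" for A
  define S where "S P = (\<Sum>i. ennreal (norm (\<nu> (P i))))" for P :: "nat \<Rightarrow> 'a set"
  have tv: "total_variation \<Omega> \<nu> A = (SUP P\<in>parts A. S P)" for A
    by (simp add: total_variation_def parts_def S_def)
  have ne: "parts A \<noteq> {}" if "A \<in> sets L" for A
  proof -
    have "(\<lambda>n. if n = 0 then A else {}) \<in> parts A"
      using that by (auto simp: parts_def disjoint_family_on_def)
    then show ?thesis by blast
  qed
  have step: "S P + S Q \<le> total_variation \<Omega> \<nu> (A \<union> B)" if P: "P \<in> parts A" and Q: "Q \<in> parts B" for P Q
  proof -
    define R where "R n = (if even n then P (n div 2) else Q (n div 2))" for n :: nat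
    have UR: "(\<Union>n. R n) = A \<union> B" unfolding R_def UN_interleave using P Q by (simp add: parts_def)
    have PA: "P n \<subseteq> A" and QB: "Q n \<subseteq> B" for n using P Q by (auto simp: parts_def)
    have "disjoint_family R"
      unfolding disjoint_family_on_def
    proof (intro ballI impI)
      fix m n :: nat assume "m \<noteq> n"
      have dP: "P i \<inter> P j = {}" and dQ: "Q i \<inter> Q j = {}" if "i \<noteq> j" for i j
        using P Q that by (auto simp: parts_def disjoint_family_on_def)
      have "even m \<noteq> even n \<or> m div 2 \<noteq> n div 2" using \<open>m \<noteq> n\<close> by presburger
      then show "R m \<inter> R n = {}"
        using dP[of "m div 2" "n div 2"] dQ[of "m div 2" "n div 2"] PA[of "m div 2"] PA[of "n div 2"]
          QB[of "m div 2"] QB[of "n div 2"] disj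
        by (auto simp: R_def)
    qed
    moreover have "R n \<in> sets L" for n using P Q by (auto simp: R_def parts_def)
    ultimately have "S R \<le> total_variation \<Omega> \<nu> (\<Union>n. R n)"
      unfolding S_def by (intro suminf_le_total_variation)
    then have "S R \<le> total_variation \<Omega> \<nu> (A \<union> B)" unfolding UR .
    moreover have "S R = S P + S Q"
      unfolding S_def suminf_interleave[symmetric] R_def by (intro suminf_cong) simp
    ultimately show ?thesis by simp
  qed
  have "S P + (SUP Q\<in>parts B. S Q) \<le> total_variation \<Omega> \<nu> (A \<union> B)" if "P \<in> parts A" for P
    unfolding ennreal_SUP_add_right[OF ne[OF B]] by (rule SUP_least) (rule step[OF that])
  then have "(SUP P\<in>parts A. S P + (SUP Q\<in>parts B. S Q)) \<le> total_variation \<Omega> \<nu> (A \<union> B)"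
    by (rule SUP_least)
  then show ?thesis unfolding tv[of A] tv[of B] ennreal_SUP_add_left[OF ne[OF A]] .
qed

text \<open>Each piece of a partition of the union is cut along A and B, and the triangle inequality
  is applied to the two halves.\<close>

lemma total_variation_subadditive:
  assumes \<nu>: "\<nu> \<in> ba \<Omega>" and A: "A \<in> sets L" and B: "B \<in> sets L" and disj: "A \<inter> B = {}"
  shows "total_variation \<Omega> \<nu> (A \<union> B) \<le> total_variation \<Omega> \<nu> A + total_variation \<Omega> \<nu> B"
proof (rule total_variation_least)
  fix P assume P: "\<And>n::nat. P n \<in> sets L" "disjoint_family P" "(\<Union>n. P n) = A \<union> B"
  have "norm (\<nu> (P n)) \<le> norm (\<nu> (P n \<inter> A)) + norm (\<nu> (P n \<inter> B))" for n
  proof -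
    have "P n = (P n \<inter> A) \<union> (P n \<inter> B)" using P(3) by blast
    then have "\<nu> (P n) = \<nu> (P n \<inter> A) + \<nu> (P n \<inter> B)"
      using ba_add[OF \<nu>, of "P n \<inter> A" "P n \<inter> B"] P(1) A B disj by (metis Int_assoc Int_commute Int_empty_right sets.Int)
    then show ?thesis by (simp add: norm_triangle_ineq)
  qed
  then have "(\<Sum>n. ennreal (norm (\<nu> (P n)))) \<le> (\<Sum>n. ennreal (norm (\<nu> (P n \<inter> A))) + ennreal (norm (\<nu> (P n \<inter> B))))"
    by (intro suminf_le) (auto simp flip: ennreal_plus intro: ennreal_leI)
  also have "\<dots> = (\<Sum>n. ennreal (norm (\<nu> (P n \<inter> A)))) + (\<Sum>n. ennreal (norm (\<nu> (P n \<inter> B))))"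
    by (rule suminf_add[symmetric]) auto
  also have "\<dots> \<le> total_variation \<Omega> \<nu> (\<Union>n. P n \<inter> A) + total_variation \<Omega> \<nu> (\<Union>n. P n \<inter> B)"
    using P A B by (intro add_mono suminf_le_total_variation sets.Int) (auto simp: disjoint_family_on_def)
  also have "(\<Union>n. P n \<inter> A) = A" using P(3) by blast
  also have "(\<Union>n. P n \<inter> B) = B" using P(3) by blast
  finally show "(\<Sum>n. ennreal (norm (\<nu> (P n)))) \<le> total_variation \<Omega> \<nu> A + total_variation \<Omega> \<nu> B" .
qed

text \<open>Since \<open>enn2real\<close> sends infinity to 0, this number carries information only
  where the variation is finite, which is the content of \<open>ennreal_tv\<close>.\<close>

definition tv :: "('a set \<Rightarrow> 'a) \<Rightarrow> 'a set \<Rightarrow> real" where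
  "tv \<nu> A = enn2real (total_variation \<Omega> \<nu> A)"

lemma total_variation_mono:
  assumes "A \<in> sets L" "B \<in> sets L" "A \<subseteq> B"
  shows "total_variation \<Omega> \<nu> A \<le> total_variation \<Omega> \<nu> B"
proof -
  have "total_variation \<Omega> \<nu> A + total_variation \<Omega> \<nu> (B - A) \<le> total_variation \<Omega> \<nu> (A \<union> (B - A))"
    using assms by (intro total_variation_superadditive) auto
  moreover have "A \<union> (B - A) = B" using assms by blast
  moreover have "total_variation \<Omega> \<nu> A \<le> total_variation \<Omega> \<nu> A + total_variation \<Omega> \<nu> (B - A)" by simp
  ultimately show ?thesis by (metis order_trans)
qed

lemma tv_nonneg: "tv \<nu> A \<ge> 0" by (simp add: tv_def)

lemma ennreal_tv: "\<nu> \<in> ba \<Omega> \<Longrightarrow> A \<in> sets L \<Longrightarrow> ennreal (tv \<nu> A) = total_variation \<Omega> \<nu> A"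
proof -
  assume \<nu>: "\<nu> \<in> ba \<Omega>" and A: "A \<in> sets L"
  have "total_variation \<Omega> \<nu> A \<le> total_variation \<Omega> \<nu> \<Omega>"
    using A sets.sets_into_space[OF A] by (intro total_variation_mono) auto
  also have "\<dots> < \<infinity>" using \<nu> unfolding ba_def by blast
  finally show ?thesis by (simp add: tv_def less_top)
qed

lemma tv_add:
  assumes "\<nu> \<in> ba \<Omega>" "A \<in> sets L" "B \<in> sets L" "A \<inter> B = {}"
  shows "tv \<nu> (A \<union> B) = tv \<nu> A + tv \<nu> B"
proof -
  have "total_variation \<Omega> \<nu> (A \<union> B) = total_variation \<Omega> \<nu> A + total_variation \<Omega> \<nu> B"
    using total_variation_superadditive[OF assms(2-4), of \<nu>] total_variation_subadditive[OF assms] by (rule antisym[rotated])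
  then have "ennreal (tv \<nu> (A \<union> B)) = ennreal (tv \<nu> A + tv \<nu> B)"
    using assms by (simp add: ennreal_tv tv_nonneg sets.Un)
  then show ?thesis using ennreal_inj[of "tv \<nu> (A \<union> B)" "tv \<nu> A + tv \<nu> B"] by (simp add: tv_nonneg)
qed

lemma tv_mono: "\<nu> \<in> ba \<Omega> \<Longrightarrow> A \<in> sets L \<Longrightarrow> B \<in> sets L \<Longrightarrow> A \<subseteq> B \<Longrightarrow> tv \<nu> A \<le> tv \<nu> B"
  using total_variation_mono[of A B \<nu>] ennreal_le_iff[OF tv_nonneg] by (metis ennreal_tv)

lemma norm_le_tv:
  assumes \<nu>: "\<nu> \<in> ba \<Omega>" and C: "C \<in> sets L"
  shows "norm (\<nu> C) \<le> tv \<nu> C"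
proof -
  define P where "P n = (if n = 0 then C else {})" for n :: nat
  have "(\<Sum>n. ennreal (norm (\<nu> (P n)))) \<le> total_variation \<Omega> \<nu> (\<Union>n. P n)"
    by (rule suminf_le_total_variation) (use C in \<open>auto simp: P_def disjoint_family_on_def\<close>)
  moreover have "(\<Union>n. P n) = C" by (auto simp: P_def split: if_splits)
  moreover have "(\<Sum>n. ennreal (norm (\<nu> (P n)))) = (\<Sum>n\<in>{0}. ennreal (norm (\<nu> (P n))))"
    by (rule suminf_finite) (auto simp: P_def ba_empty[OF \<nu>])
  moreover have "P 0 = C" by (simp add: P_def)
  ultimately have "ennreal (norm (\<nu> C)) \<le> ennreal (tv \<nu> C)" unfolding ennreal_tv[OF \<nu> C] by simp
  then show ?thesis using ennreal_le_iff[OF tv_nonneg] by blast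
qed

lemma tv_finite_sum:
  assumes "\<nu> \<in> ba \<Omega>" "finite I" "\<And>i. i \<in> I \<Longrightarrow> A i \<in> sets L" "disjoint_family_on A I"
  shows "tv \<nu> (\<Union>i\<in>I. A i) = (\<Sum>i\<in>I. tv \<nu> (A i))"
  using assms(2,3,4)
proof (induction I rule: finite_induct)
  case empty
  have "tv \<nu> {} = tv \<nu> {} + tv \<nu> {}" using tv_add[OF assms(1), of "{}" "{}"] by simp
  then show ?case by simp
next
  case (insert i I)
  have "A i \<inter> (\<Union>i\<in>I. A i) = {}" using insert.hyps insert.prems(2) by (auto simp: disjoint_family_on_def)
  then have "tv \<nu> (A i \<union> (\<Union>i\<in>I. A i)) = tv \<nu> (A i) + tv \<nu> (\<Union>i\<in>I. A i)"
    using insert.prems(1) insert.hyps by (intro tv_add[OF assms(1)] sets.finite_UN) auto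
  moreover have "disjoint_family_on A I" using insert.prems(2) by (auto simp: disjoint_family_on_def)
  ultimately show ?case using insert by simp
qed

lemma sum_norm_le_tv:
  assumes \<nu>: "\<nu> \<in> ba \<Omega>" and I: "finite I" and A: "\<And>i. i \<in> I \<Longrightarrow> A i \<in> sets L" "disjoint_family_on A I"
    and B: "B \<in> sets L" "\<And>i. i \<in> I \<Longrightarrow> A i \<subseteq> B"
  shows "(\<Sum>i\<in>I. norm (\<nu> (A i))) \<le> tv \<nu> B"
proof -
  have "(\<Sum>i\<in>I. norm (\<nu> (A i))) \<le> (\<Sum>i\<in>I. tv \<nu> (A i))"
    by (intro sum_mono norm_le_tv[OF \<nu>] A(1))
  also have "\<dots> = tv \<nu> (\<Union>i\<in>I. A i)" using tv_finite_sum[OF \<nu> I A] by simp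
  also have "\<dots> \<le> tv \<nu> B"
  proof (rule tv_mono[OF \<nu> _ B(1)])
    show "(\<Union>i\<in>I. A i) \<in> sets L" by (intro sets.finite_UN I A(1))
    show "(\<Union>i\<in>I. A i) \<subseteq> B" by (intro UN_least B(2))
  qed
  finally show ?thesis .
qed

lemma tv_null: "\<nu> \<in> ba \<Omega> \<Longrightarrow> A \<in> null_sets L \<Longrightarrow> tv \<nu> A = 0"
proof -
  assume \<nu>: "\<nu> \<in> ba \<Omega>" and A: "A \<in> null_sets L"
  have "total_variation \<Omega> \<nu> A \<le> 0"
  proof (rule total_variation_least)
    fix P assume P: "\<And>n::nat. P n \<in> sets L" "(\<Union>n. P n) = A"
    have "P n \<in> null_sets L" for n using null_sets_subset[OF A P(1)] P(2) by blast
    then show "(\<Sum>n. ennreal (norm (\<nu> (P n)))) \<le> 0" using ba_null[OF \<nu>] by simp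
  qed
  then show ?thesis by (simp add: tv_def)
qed

text \<open>Bounding finite disjoint families is enough because the partial sums of a countable
  partition are of this kind. Such bounds are what testing a functional on finite sums of indicators
  provides.\<close>

lemma baI_bounded:
  assumes add: "\<And>A B. A \<in> sets L \<Longrightarrow> B \<in> sets L \<Longrightarrow> A \<inter> B = {} \<Longrightarrow> \<nu> (A \<union> B) = \<nu> A + \<nu> B"
    and null: "\<And>A. A \<in> null_sets L \<Longrightarrow> \<nu> A = 0"
    and bound: "\<And>A n. (\<And>i::nat. A i \<in> sets L) \<Longrightarrow> disjoint_family A \<Longrightarrow> (\<Sum>i<n. norm (\<nu> (A i))) \<le> K"
  shows "\<nu> \<in> ba \<Omega>"
proof -
  have "total_variation \<Omega> \<nu> \<Omega> \<le> ennreal K"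
  proof (rule total_variation_least)
    fix P assume P: "\<And>n::nat. P n \<in> sets L" "disjoint_family P"
    have "(\<Sum>i<n. ennreal (norm (\<nu> (P i)))) \<le> ennreal K" for n
      using bound[of P n] P by (subst sum_ennreal) (auto intro: ennreal_leI)
    then show "(\<Sum>n. ennreal (norm (\<nu> (P n)))) \<le> ennreal K" by (intro suminf_le_const summableI)
  qed
  then have "total_variation \<Omega> \<nu> \<Omega> < \<infinity>" by (simp add: le_less_trans)
  then show ?thesis using add null unfolding ba_def by blast
qed

section \<open>Integration against finitely additive measures and the dual of bounded fields\<close>

lemma ba_simple_integral_compose:
  assumes \<nu>: "\<nu> \<in> ba \<Omega>" and h: "simple_function L h"
  shows "ba_simple_integral \<Omega> \<nu> (\<lambda>x. F (h x)) = (\<Sum>k\<in>h ` \<Omega>. F k \<bullet> \<nu> {x\<in>\<Omega>. h x = k})"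
proof -
  have fin: "finite (h ` \<Omega>)" using h by (simp add: simple_function_def)
  have sets: "{x\<in>\<Omega>. h x = k} \<in> sets L" for k
    using simple_functionD(2)[OF h, of "{k}"] by (simp add: vimage_def Int_def conj_commute)
  have "c \<bullet> \<nu> {x\<in>\<Omega>. F (h x) = c} = (\<Sum>k\<in>{k\<in>h ` \<Omega>. F k = c}. F k \<bullet> \<nu> {x\<in>\<Omega>. h x = k})" for c
  proof -
    have "{x\<in>\<Omega>. F (h x) = c} = (\<Union>k\<in>{k\<in>h ` \<Omega>. F k = c}. {x\<in>\<Omega>. h x = k})" by auto
    then have "\<nu> {x\<in>\<Omega>. F (h x) = c} = (\<Sum>k\<in>{k\<in>h ` \<Omega>. F k = c}. \<nu> {x\<in>\<Omega>. h x = k})"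
      using ba_finite_sum[OF \<nu>, of "{k\<in>h ` \<Omega>. F k = c}" "\<lambda>k. {x\<in>\<Omega>. h x = k}"] fin sets
      by (auto simp: disjoint_family_on_def)
    then show ?thesis by (simp add: inner_sum_right)
  qed
  then have "ba_simple_integral \<Omega> \<nu> (\<lambda>x. F (h x)) =
      (\<Sum>c\<in>F ` h ` \<Omega>. \<Sum>k\<in>{k\<in>h ` \<Omega>. F k = c}. F k \<bullet> \<nu> {x\<in>\<Omega>. h x = k})"
    by (simp add: ba_simple_integral_def image_image)
  also have "\<dots> = (\<Sum>k\<in>h ` \<Omega>. F k \<bullet> \<nu> {x\<in>\<Omega>. h x = k})"
    using sum.group[of "h ` \<Omega>" "F ` h ` \<Omega>" F "\<lambda>k. F k \<bullet> \<nu> {x\<in>\<Omega>. h x = k}"] fin by simp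
  finally show ?thesis .
qed

text \<open>The pair (s, t) is a simple function whose level sets refine those of s, t and s + t.
  All three integrals become sums over this common partition.\<close>

lemma ba_simple_integral_add:
  assumes "\<nu> \<in> ba \<Omega>" "simple_function L s" "simple_function L t"
  shows "ba_simple_integral \<Omega> \<nu> (\<lambda>x. s x + t x) = ba_simple_integral \<Omega> \<nu> s + ba_simple_integral \<Omega> \<nu> t"
proof -
  have h: "simple_function L (\<lambda>x. (s x, t x))" using assms by (intro simple_function_Pair)
  show ?thesis
    using ba_simple_integral_compose[OF assms(1) h, of "\<lambda>(a, b). a + b"]
      ba_simple_integral_compose[OF assms(1) h, of fst] ba_simple_integral_compose[OF assms(1) h, of snd]
    by (simp add: case_prod_unfold inner_add_left sum.distrib)
qed

lemma ba_simple_integral_scaleR: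
  assumes "\<nu> \<in> ba \<Omega>" "simple_function L s"
  shows "ba_simple_integral \<Omega> \<nu> (\<lambda>x. c *\<^sub>R s x) = c * ba_simple_integral \<Omega> \<nu> s"
  using ba_simple_integral_compose[OF assms, of "\<lambda>a. c *\<^sub>R a"] ba_simple_integral_compose[OF assms, of "\<lambda>a. a"]
  by (simp add: sum_distrib_left)

lemma ba_simple_integral_bound:
  assumes \<nu>: "\<nu> \<in> ba \<Omega>" and s: "simple_function L s" and C: "C \<ge> 0" "AE x in L. norm (s x) \<le> C"
  shows "\<bar>ba_simple_integral \<Omega> \<nu> s\<bar> \<le> tv \<nu> \<Omega> * C"
proof -
  have fin: "finite (s ` \<Omega>)" using s by (simp add: simple_function_def)
  have sets: "{x\<in>\<Omega>. s x = k} \<in> sets L" for k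
    using simple_functionD(2)[OF s, of "{k}"] by (simp add: vimage_def Int_def conj_commute)
  have bnd: "\<bar>c \<bullet> \<nu> {x\<in>\<Omega>. s x = c}\<bar> \<le> C * norm (\<nu> {x\<in>\<Omega>. s x = c})" for c
  proof (cases "norm c \<le> C")
    case True
    have "\<bar>c \<bullet> \<nu> {x\<in>\<Omega>. s x = c}\<bar> \<le> norm c * norm (\<nu> {x\<in>\<Omega>. s x = c})" by (rule Cauchy_Schwarz_ineq2)
    also have "\<dots> \<le> C * norm (\<nu> {x\<in>\<Omega>. s x = c})" using True by (intro mult_right_mono) auto
    finally show ?thesis .
  next
    case False
    \<comment> \<open>A value larger than C can only be taken on a null set, where the measure
      vanishes.\<close>
    have "AE x in L. x \<notin> {x\<in>\<Omega>. s x = c}" using C(2) by eventually_elim (use False in auto)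
    then have "{x\<in>\<Omega>. s x = c} \<in> null_sets L" using sets by (simp add: AE_iff_null_sets)
    then show ?thesis using ba_null[OF \<nu>] by simp
  qed
  have "\<bar>ba_simple_integral \<Omega> \<nu> s\<bar> \<le> (\<Sum>c\<in>s ` \<Omega>. C * norm (\<nu> {x\<in>\<Omega>. s x = c}))"
    unfolding ba_simple_integral_def by (rule order_trans[OF sum_abs sum_mono]) (rule bnd)
  also have "\<dots> = C * (\<Sum>c\<in>s ` \<Omega>. norm (\<nu> {x\<in>\<Omega>. s x = c}))" by (simp add: sum_distrib_left)
  also have "\<dots> \<le> C * tv \<nu> \<Omega>"
    by (intro mult_left_mono C sum_norm_le_tv[OF \<nu> fin sets]) (auto simp: disjoint_family_on_def)
  finally show ?thesis by (simp add: mult.commute)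
qed

lemma ba_simple_integral_diff:
  assumes "\<nu> \<in> ba \<Omega>" "simple_function L s" "simple_function L t"
  shows "ba_simple_integral \<Omega> \<nu> (\<lambda>x. s x - t x) = ba_simple_integral \<Omega> \<nu> s - ba_simple_integral \<Omega> \<nu> t"
proof -
  have "simple_function L (\<lambda>x. (-1) *\<^sub>R t x)" by (rule simple_function_compose1[OF assms(3)])
  then show ?thesis
    using ba_simple_integral_add[OF assms(1,2), of "\<lambda>x. (-1) *\<^sub>R t x"] ba_simple_integral_scaleR[OF assms(1,3), of "-1"] by simp
qed

text \<open>Two approximating sequences are compared with independent indices. Taking them equal
  gives the Cauchy property, taking them different gives uniqueness of the integral.\<close>

lemma ba_simple_integral_limit:
  assumes \<nu>: "\<nu> \<in> ba \<Omega>" and y: "y \<in> Linf \<Omega>"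
    and s: "\<And>n::nat. simple_function L (s n)" "(\<lambda>n. Linf_norm \<Omega> (\<lambda>x. s n x - y x)) \<longlonglongrightarrow> 0"
    and t: "\<And>n::nat. simple_function L (t n)" "(\<lambda>n. Linf_norm \<Omega> (\<lambda>x. t n x - y x)) \<longlonglongrightarrow> 0"
    and e: "e > 0"
  shows "\<exists>N. \<forall>m\<ge>N. \<forall>n\<ge>N. \<bar>ba_simple_integral \<Omega> \<nu> (s m) - ba_simple_integral \<Omega> \<nu> (t n)\<bar> < e"
proof -
  \<comment> \<open>Two errors of size d, weighted by the variation, stay below e; the summand 1
    guards against zero variation.\<close>
  define d where "d = e / (4 * (tv \<nu> \<Omega> + 1))"
  have tv0: "tv \<nu> \<Omega> \<ge> 0" by (rule tv_nonneg)
  have d: "d > 0" using e tv0 by (simp add: d_def)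
  have "d * tv \<nu> \<Omega> \<le> e / 4" using e tv0 by (simp add: d_def divide_simps algebra_simps)
  then have de: "tv \<nu> \<Omega> * (d + d) < e" using e by (simp add: algebra_simps)
  have m: "(\<lambda>x. s n x - y x) \<in> borel_measurable L" "(\<lambda>x. t n x - y x) \<in> borel_measurable L" for n
    using s(1) t(1) y by (auto intro!: Linf_measurable Linf_diff intro: simple_imp_Linf)
  obtain N1 where N1: "\<And>n. n \<ge> N1 \<Longrightarrow> AE x in L. norm (s n x - y x) \<le> d"
    using Linf_norm_tendstoD[OF m(1) s(2) d] by blast
  obtain N2 where N2: "\<And>n. n \<ge> N2 \<Longrightarrow> AE x in L. norm (t n x - y x) \<le> d"
    using Linf_norm_tendstoD[OF m(2) t(2) d] by blast
  have "\<bar>ba_simple_integral \<Omega> \<nu> (s m) - ba_simple_integral \<Omega> \<nu> (t n)\<bar> < e" if "m \<ge> max N1 N2" "n \<ge> max N1 N2" for m n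
  proof -
    have "AE x in L. norm (s m x - t n x) \<le> d + d"
      using N1[OF max.cobounded1[THEN order_trans, OF that(1)]] N2[OF max.cobounded2[THEN order_trans, OF that(2)]]
    proof eventually_elim
      case (elim x)
      then show ?case using norm_triangle_ineq4[of "s m x - y x" "t n x - y x"] by simp
    qed
    then have "\<bar>ba_simple_integral \<Omega> \<nu> (\<lambda>x. s m x - t n x)\<bar> \<le> tv \<nu> \<Omega> * (d + d)"
      using s(1) t(1) d by (intro ba_simple_integral_bound[OF \<nu>] simple_function_diff) auto
    then show ?thesis using de ba_simple_integral_diff[OF \<nu> s(1) t(1)] by simp
  qed
  then show ?thesis by blast
qed

lemma has_ba_integral_unique:
  assumes \<nu>: "\<nu> \<in> ba \<Omega>" and y: "y \<in> Linf \<Omega>" and I: "has_ba_integral \<Omega> \<nu> y I" and J: "has_ba_integral \<Omega> \<nu> y J"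
  shows "I = J"
proof (rule ccontr)
  assume "I \<noteq> J"
  define e where "e = \<bar>I - J\<bar> / 3"
  have e: "e > 0" using \<open>I \<noteq> J\<close> by (simp add: e_def)
  obtain s :: "nat \<Rightarrow> 'a \<Rightarrow> 'a" where s: "\<And>n. simple_function L (s n)" "(\<lambda>n. Linf_norm \<Omega> (\<lambda>x. s n x - y x)) \<longlonglongrightarrow> 0"
    "(\<lambda>n. ba_simple_integral \<Omega> \<nu> (s n)) \<longlonglongrightarrow> I" using I unfolding has_ba_integral_def by blast
  obtain t :: "nat \<Rightarrow> 'a \<Rightarrow> 'a" where t: "\<And>n. simple_function L (t n)" "(\<lambda>n. Linf_norm \<Omega> (\<lambda>x. t n x - y x)) \<longlonglongrightarrow> 0"
    "(\<lambda>n. ba_simple_integral \<Omega> \<nu> (t n)) \<longlonglongrightarrow> J" using J unfolding has_ba_integral_def by blast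
  obtain N where N: "\<And>n. n \<ge> N \<Longrightarrow> \<bar>ba_simple_integral \<Omega> \<nu> (s n) - ba_simple_integral \<Omega> \<nu> (t n)\<bar> < e"
    using ba_simple_integral_limit[OF \<nu> y s(1,2) t(1,2) e] by blast
  have "(\<lambda>n. \<bar>ba_simple_integral \<Omega> \<nu> (s n) - ba_simple_integral \<Omega> \<nu> (t n)\<bar>) \<longlonglongrightarrow> \<bar>I - J\<bar>"
    by (intro tendsto_intros s t)
  then have "\<bar>I - J\<bar> \<le> e" by (rule LIMSEQ_le_const2) (use N less_imp_le in blast)
  then show False using e by (simp add: e_def)
qed

lemma has_ba_integral_ba_integral:
  assumes \<nu>: "\<nu> \<in> ba \<Omega>" and y: "y \<in> Linf \<Omega>"
  shows "has_ba_integral \<Omega> \<nu> y (ba_integral \<Omega> \<nu> y)"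
  unfolding ba_integral_def
proof (rule theI')
  obtain s :: "nat \<Rightarrow> 'a \<Rightarrow> 'a" where s: "\<And>n. simple_function L (s n)" "(\<lambda>n. Linf_norm \<Omega> (\<lambda>x. s n x - y x)) \<longlonglongrightarrow> 0"
    using uniform_simple_approximation'[OF y] by blast
  have "Cauchy (\<lambda>n. ba_simple_integral \<Omega> \<nu> (s n))"
    using ba_simple_integral_limit[OF \<nu> y s s] by (auto simp: Cauchy_def dist_real_def)
  then obtain I where "(\<lambda>n. ba_simple_integral \<Omega> \<nu> (s n)) \<longlonglongrightarrow> I"
    using Cauchy_convergent convergent_def by blast
  then show "\<exists>!I. has_ba_integral \<Omega> \<nu> y I"
    using s has_ba_integral_unique[OF \<nu> y] unfolding has_ba_integral_def by blast
qed

lemma ba_integral_eq: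
  "\<nu> \<in> ba \<Omega> \<Longrightarrow> y \<in> Linf \<Omega> \<Longrightarrow> has_ba_integral \<Omega> \<nu> y I \<Longrightarrow> ba_integral \<Omega> \<nu> y = I"
  using has_ba_integral_ba_integral has_ba_integral_unique by blast

lemma ba_integral_approximation:
  assumes \<nu>: "\<nu> \<in> ba \<Omega>" and y: "y \<in> Linf \<Omega>"
  obtains s :: "nat \<Rightarrow> 'a \<Rightarrow> 'a" where "\<And>n. simple_function L (s n)"
    "\<And>n. AE x in L. norm (s n x - y x) \<le> real DIM('a) / real (Suc n)"
    "(\<lambda>n. ba_simple_integral \<Omega> \<nu> (s n)) \<longlonglongrightarrow> ba_integral \<Omega> \<nu> y"
proof -
  obtain s :: "nat \<Rightarrow> 'a \<Rightarrow> 'a" where s: "\<And>n. simple_function L (s n)"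
    "\<And>n. AE x in L. norm (s n x - y x) \<le> real DIM('a) / real (Suc n)"
    using uniform_simple_approximation[OF y] by blast
  have "(\<lambda>n. real DIM('a) / real (Suc n)) \<longlonglongrightarrow> 0"
    using LIMSEQ_Suc[OF lim_const_over_n[of "real DIM('a)"]] by simp
  then have s0: "(\<lambda>n. Linf_norm \<Omega> (\<lambda>x. s n x - y x)) \<longlonglongrightarrow> 0"
    by (intro Linf_norm_tendsto_0[where e = "\<lambda>n. real DIM('a) / real (Suc n)"] s Linf_measurable Linf_diff simple_imp_Linf y)
  have "Cauchy (\<lambda>n. ba_simple_integral \<Omega> \<nu> (s n))"
    using ba_simple_integral_limit[OF \<nu> y s(1) s0 s(1) s0] by (auto simp: Cauchy_def dist_real_def)
  then obtain I where I: "(\<lambda>n. ba_simple_integral \<Omega> \<nu> (s n)) \<longlonglongrightarrow> I" using Cauchy_convergent convergent_def by blast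
  then have "ba_integral \<Omega> \<nu> y = I" using s s0 by (intro ba_integral_eq[OF \<nu> y]) (auto simp: has_ba_integral_def)
  then show thesis using that s I by blast
qed

lemma ba_integral_bound:
  assumes \<nu>: "\<nu> \<in> ba \<Omega>" and y: "y \<in> Linf \<Omega>" and C: "C \<ge> 0" "AE x in L. norm (y x) \<le> C"
  shows "\<bar>ba_integral \<Omega> \<nu> y\<bar> \<le> tv \<nu> \<Omega> * C"
proof -
  obtain s :: "nat \<Rightarrow> 'a \<Rightarrow> 'a" where s: "\<And>n. simple_function L (s n)"
    "\<And>n. AE x in L. norm (s n x - y x) \<le> real DIM('a) / real (Suc n)" "(\<lambda>n. ba_simple_integral \<Omega> \<nu> (s n)) \<longlonglongrightarrow> ba_integral \<Omega> \<nu> y"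
    using ba_integral_approximation[OF \<nu> y] by blast
  have "\<bar>ba_simple_integral \<Omega> \<nu> (s n)\<bar> \<le> tv \<nu> \<Omega> * (C + 1 * (real DIM('a) / real (Suc n)))" for n
  proof (rule ba_simple_integral_bound[OF \<nu> s(1)])
    show "AE x in L. norm (s n x) \<le> C + 1 * (real DIM('a) / real (Suc n))"
      using s(2)[of n] C(2)
    proof eventually_elim
      case (elim x)
      then show ?case using norm_triangle_ineq[of "y x" "s n x - y x"] by simp
    qed
  qed (use C in simp)
  moreover have "(\<lambda>n. tv \<nu> \<Omega> * (C + 1 * (real DIM('a) / real (Suc n)))) \<longlonglongrightarrow> tv \<nu> \<Omega> * (C + 0)"
    by (intro tendsto_intros DIM_over_n_tendsto_0)
  moreover have "(\<lambda>n. \<bar>ba_simple_integral \<Omega> \<nu> (s n)\<bar>) \<longlonglongrightarrow> \<bar>ba_integral \<Omega> \<nu> y\<bar>" by (intro tendsto_intros s)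
  ultimately have "\<bar>ba_integral \<Omega> \<nu> y\<bar> \<le> tv \<nu> \<Omega> * (C + 0)" by (intro LIMSEQ_le) auto
  then show "\<bar>ba_integral \<Omega> \<nu> y\<bar> \<le> tv \<nu> \<Omega> * C" by simp
qed

lemma Linf_functional_ba_integral:
  assumes \<nu>: "\<nu> \<in> ba \<Omega>"
  shows "Linf_functional (ba_integral \<Omega> \<nu>)"
proof -
  let ?l = "ba_integral \<Omega> \<nu>" and ?S = "ba_simple_integral \<Omega> \<nu>"
  show ?thesis
    unfolding Linf_functional_def linear_on_functions_def
  proof (intro conjI ballI allI)
    fix y z :: "'a \<Rightarrow> 'a" assume y: "y \<in> Linf \<Omega>" and z: "z \<in> Linf \<Omega>"
    obtain s :: "nat \<Rightarrow> 'a \<Rightarrow> 'a" where s: "\<And>n. simple_function L (s n)"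
      "\<And>n. AE x in L. norm (s n x - y x) \<le> real DIM('a) / real (Suc n)" "(\<lambda>n. ?S (s n)) \<longlonglongrightarrow> ?l y"
      using ba_integral_approximation[OF \<nu> y] by blast
    obtain t :: "nat \<Rightarrow> 'a \<Rightarrow> 'a" where t: "\<And>n. simple_function L (t n)"
      "\<And>n. AE x in L. norm (t n x - z x) \<le> real DIM('a) / real (Suc n)" "(\<lambda>n. ?S (t n)) \<longlonglongrightarrow> ?l z"
      using ba_integral_approximation[OF \<nu> z] by blast
    have "(\<lambda>n. Linf_norm \<Omega> (\<lambda>x. (s n x + t n x) - (y x + z x))) \<longlonglongrightarrow> 0"
    proof (rule Linf_norm_tendsto_0[OF _ _ DIM_over_n_tendsto_0[of 2]])
      show "AE x in L. norm ((s n x + t n x) - (y x + z x)) \<le> 2 * (real DIM('a) / real (Suc n))" for n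
        using s(2)[of n] t(2)[of n]
      proof eventually_elim
        case (elim x)
        have "(s n x + t n x) - (y x + z x) = (s n x - y x) + (t n x - z x)" by simp
        also have "norm \<dots> \<le> norm (s n x - y x) + norm (t n x - z x)" by (rule norm_triangle_ineq)
        finally show ?case using elim by linarith
      qed
    qed (intro Linf_measurable Linf_diff Linf_add simple_imp_Linf s t y z)
    moreover have "(\<lambda>n. ?S (\<lambda>x. s n x + t n x)) \<longlonglongrightarrow> ?l y + ?l z"
      using tendsto_add[OF s(3) t(3)] ba_simple_integral_add[OF \<nu> s(1) t(1)] by simp
    ultimately have "has_ba_integral \<Omega> \<nu> (\<lambda>x. y x + z x) (?l y + ?l z)"
      unfolding has_ba_integral_def
      by (intro exI[of _ "\<lambda>n x. s n x + t n x"] conjI allI simple_function_add s(1) t(1))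
    then show "?l (\<lambda>x. y x + z x) = ?l y + ?l z" by (intro ba_integral_eq[OF \<nu> Linf_add[OF y z]])
  next
    fix c and y :: "'a \<Rightarrow> 'a" assume y: "y \<in> Linf \<Omega>"
    obtain s :: "nat \<Rightarrow> 'a \<Rightarrow> 'a" where s: "\<And>n. simple_function L (s n)"
      "\<And>n. AE x in L. norm (s n x - y x) \<le> real DIM('a) / real (Suc n)" "(\<lambda>n. ?S (s n)) \<longlonglongrightarrow> ?l y"
      using ba_integral_approximation[OF \<nu> y] by blast
    have "(\<lambda>n. Linf_norm \<Omega> (\<lambda>x. c *\<^sub>R s n x - c *\<^sub>R y x)) \<longlonglongrightarrow> 0"
    proof (rule Linf_norm_tendsto_0[OF _ _ DIM_over_n_tendsto_0[of "\<bar>c\<bar>"]])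
      show "AE x in L. norm (c *\<^sub>R s n x - c *\<^sub>R y x) \<le> \<bar>c\<bar> * (real DIM('a) / real (Suc n))" for n
        using s(2)[of n]
      proof eventually_elim
        case (elim x)
        then have "\<bar>c\<bar> * norm (s n x - y x) \<le> \<bar>c\<bar> * (real DIM('a) / real (Suc n))" by (intro mult_left_mono) auto
        then show ?case by (simp flip: scaleR_diff_right)
      qed
    qed (intro Linf_measurable Linf_diff Linf_scaleR simple_imp_Linf s y)
    moreover have "(\<lambda>n. ?S (\<lambda>x. c *\<^sub>R s n x)) \<longlonglongrightarrow> c * ?l y"
      using tendsto_mult_left[OF s(3), of c] ba_simple_integral_scaleR[OF \<nu> s(1)] by simp
    moreover have "simple_function L (\<lambda>x. c *\<^sub>R s n x)" for n by (rule simple_function_compose1[OF s(1)])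
    ultimately have "has_ba_integral \<Omega> \<nu> (\<lambda>x. c *\<^sub>R y x) (c * ?l y)"
      unfolding has_ba_integral_def by (intro exI[of _ "\<lambda>n x. c *\<^sub>R s n x"] conjI allI)
    then show "?l (\<lambda>x. c *\<^sub>R y x) = c * ?l y" by (intro ba_integral_eq[OF \<nu> Linf_scaleR[OF y]])
  next
    show "\<exists>K\<ge>0. \<forall>y\<in>Linf \<Omega>. \<forall>C\<ge>0. (AE x in L. norm (y x) \<le> C) \<longrightarrow> \<bar>?l y\<bar> \<le> K * C"
    proof (intro exI[of _ "tv \<nu> \<Omega>"] conjI ballI allI impI tv_nonneg)
      fix y :: "'a \<Rightarrow> 'a" and C assume "y \<in> Linf \<Omega>" "C \<ge> 0" "AE x in L. norm (y x) \<le> C"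
      then show "\<bar>?l y\<bar> \<le> tv \<nu> \<Omega> * C" by (rule ba_integral_bound[OF \<nu>])
    qed
  qed
qed

lemma ba_integral_simple:
  assumes \<nu>: "\<nu> \<in> ba \<Omega>" and s: "simple_function L s"
  shows "ba_integral \<Omega> \<nu> s = ba_simple_integral \<Omega> \<nu> s"
proof (rule ba_integral_eq[OF \<nu> simple_imp_Linf[OF s]])
  have "(\<lambda>n::nat. Linf_norm \<Omega> (\<lambda>x. s x - s x)) \<longlonglongrightarrow> 0"
    by (rule Linf_norm_tendsto_0[where e = "\<lambda>n. 0"]) auto
  then show "has_ba_integral \<Omega> \<nu> s (ba_simple_integral \<Omega> \<nu> s)"
    unfolding has_ba_integral_def using s by (intro exI[of _ "\<lambda>n. s"]) auto
qed

lemma ba_integral_indicator: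
  assumes \<nu>: "\<nu> \<in> ba \<Omega>" and A: "A \<in> sets L"
  shows "ba_integral \<Omega> \<nu> (\<lambda>x. indicator A x *\<^sub>R c) = c \<bullet> \<nu> A"
proof -
  have h: "simple_function L (indicator A :: 'a \<Rightarrow> real)" using A by (rule simple_function_indicator)
  have sub: "A \<subseteq> \<Omega>" using A by (simp add: sets_L_iff)
  have "simple_function L (\<lambda>x. indicator A x *\<^sub>R c)" by (rule simple_function_compose1[OF h])
  then have "ba_integral \<Omega> \<nu> (\<lambda>x. indicator A x *\<^sub>R c) = (\<Sum>k\<in>(indicator A ` \<Omega> :: real set). (k *\<^sub>R c) \<bullet> \<nu> {x\<in>\<Omega>. indicator A x = k})"
    using ba_integral_simple[OF \<nu>] ba_simple_integral_compose[OF \<nu> h, of "\<lambda>k. k *\<^sub>R c"] by simp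
  \<comment> \<open>The indicator may fail to take one of the values 0 and 1 on \<Omega>; the level
    set added for it is then empty.\<close>
  also have "\<dots> = (\<Sum>k\<in>{0, 1::real}. (k *\<^sub>R c) \<bullet> \<nu> {x\<in>\<Omega>. indicator A x = k})"
  proof (rule sum.mono_neutral_left)
    have "{x\<in>\<Omega>. indicator A x = k} = {}" if "k \<notin> indicator A ` \<Omega>" for k :: real using that by auto
    then have "\<nu> {x\<in>\<Omega>. indicator A x = k} = 0" if "k \<notin> indicator A ` \<Omega>" for k :: real
      using that ba_empty[OF \<nu>] by metis
    then show "\<forall>k\<in>{0, 1} - indicator A ` \<Omega>. (k *\<^sub>R c) \<bullet> \<nu> {x\<in>\<Omega>. indicator A x = k} = 0"
      by simp
  qed (auto simp: indicator_def)
  also have "{x\<in>\<Omega>. indicator A x = (1::real)} = A" using sub by (auto simp: indicator_def)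
  ultimately show ?thesis by simp
qed

text \<open>The measure is read off, coordinate by coordinate, from indicator fields with constant
  basis direction. Its variation is bounded by testing l on sign fields: these have norm at most 1,
  while l returns the sum of the norms of the measure on the pieces.\<close>

theorem Linf_functional_representation:
  assumes l: "Linf_functional l"
  obtains \<nu> where "\<nu> \<in> ba \<Omega>" "\<And>y. y \<in> Linf \<Omega> \<Longrightarrow> ba_integral \<Omega> \<nu> y = l y"
    "\<And>A c. A \<in> sets L \<Longrightarrow> l (\<lambda>x. indicator A x *\<^sub>R c) = c \<bullet> \<nu> A"
proof -
  define \<nu> where "\<nu> A = (\<Sum>b\<in>Basis. l (\<lambda>x. indicator A x *\<^sub>R b) *\<^sub>R b)" for A
  have ind: "(\<lambda>x. indicator A x *\<^sub>R c) \<in> Linf \<Omega>" if "A \<in> sets L" for A c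
    by (rule Linf_indicator[OF that]) simp
  have \<nu>: "l (\<lambda>x. indicator A x *\<^sub>R c) = c \<bullet> \<nu> A" if A: "A \<in> sets L" for A c
  proof -
    have "(\<lambda>x. indicator A x *\<^sub>R c) = (\<lambda>x. \<Sum>b\<in>Basis. (c \<bullet> b) *\<^sub>R (indicator A x *\<^sub>R b))"
      by (subst (1) euclidean_representation[of c, symmetric]) (simp add: scaleR_sum_right mult.commute)
    then have "l (\<lambda>x. indicator A x *\<^sub>R c) = l (\<lambda>x. \<Sum>b\<in>Basis. (c \<bullet> b) *\<^sub>R (indicator A x *\<^sub>R b))" by metis
    also have "\<dots> = (\<Sum>b\<in>Basis. l (\<lambda>x. (c \<bullet> b) *\<^sub>R (indicator A x *\<^sub>R b)))"
      using Linf_functional_sum[OF l finite_Basis, of "\<lambda>b x. (c \<bullet> b) *\<^sub>R (indicator A x *\<^sub>R b)"] Linf_scaleR[OF ind[OF A]]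
      by blast
    also have "\<dots> = (\<Sum>b\<in>Basis. (c \<bullet> b) * l (\<lambda>x. indicator A x *\<^sub>R b))"
      using Linf_functional_scaleR[OF l ind[OF A]] by simp
    also have "\<dots> = c \<bullet> \<nu> A" by (simp add: \<nu>_def inner_sum_right mult.commute)
    finally show ?thesis .
  qed
  obtain K where K: "K \<ge> 0" "\<And>y C. y \<in> Linf \<Omega> \<Longrightarrow> C \<ge> 0 \<Longrightarrow> (AE x in L. norm (y x) \<le> C) \<Longrightarrow> \<bar>l y\<bar> \<le> K * C"
    using Linf_functional_bound[OF l] by blast
  have "\<nu> \<in> ba \<Omega>"
  proof (rule baI_bounded)
    fix A B assume AB: "A \<in> sets L" "B \<in> sets L" "A \<inter> B = {}"
    have "c \<bullet> \<nu> (A \<union> B) = c \<bullet> (\<nu> A + \<nu> B)" for c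
    proof -
      have "(\<lambda>x. indicator (A \<union> B) x *\<^sub>R c) = (\<lambda>x. indicator A x *\<^sub>R c + indicator B x *\<^sub>R c)"
        using AB(3) by (auto simp: indicator_def fun_eq_iff)
      then have "l (\<lambda>x. indicator (A \<union> B) x *\<^sub>R c) = l (\<lambda>x. indicator A x *\<^sub>R c) + l (\<lambda>x. indicator B x *\<^sub>R c)"
        using Linf_functional_add[OF l ind[OF AB(1), of c] ind[OF AB(2), of c]] by metis
      then show ?thesis using \<nu>[OF AB(1)] \<nu>[OF AB(2)] \<nu>[OF sets.Un[OF AB(1,2)]] by (simp add: inner_add_right)
    qed
    then show "\<nu> (A \<union> B) = \<nu> A + \<nu> B" using vector_eq_ldot[of "\<nu> (A \<union> B)" "\<nu> A + \<nu> B"] by blast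
  next
    fix A assume A: "A \<in> null_sets L"
    then have AE: "AE x in L. x \<notin> A" by (simp add: AE_not_in)
    have "c \<bullet> \<nu> A = c \<bullet> 0" for c
    proof -
      have "l (\<lambda>x. indicator A x *\<^sub>R c) = l (\<lambda>x. 0)"
        using AE A by (intro Linf_functional_cong[OF l] ind) (auto elim!: eventually_mono)
      then show ?thesis using \<nu>[of A c] A Linf_functional_zero[OF l] by (simp add: null_setsD2)
    qed
    then show "\<nu> A = 0" using vector_eq_ldot[of "\<nu> A" 0] by blast
  next
    fix A :: "nat \<Rightarrow> 'a set" and n assume A: "\<And>i. A i \<in> sets L" "disjoint_family A"
    define y where "y i x = indicator (A i) x *\<^sub>R sgn (\<nu> (A i))" for i x
    note sum = Linf_functional_sum[OF l, of "{..<n}" y]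
    have "norm (\<Sum>i<n. y i x) \<le> 1" for x unfolding y_def by (rule norm_sum_indicator_sgn[OF A(2)])
    moreover have yL: "y i \<in> Linf \<Omega>" for i unfolding y_def using ind[OF A(1)] by blast
    ultimately have "\<bar>l (\<lambda>x. \<Sum>i<n. y i x)\<bar> \<le> K * 1" using sum by (intro K) auto
    moreover have "l (\<lambda>x. \<Sum>i<n. y i x) = (\<Sum>i<n. l (y i))" using sum yL by simp
    moreover have "l (y i) = norm (\<nu> (A i))" for i
      unfolding y_def \<nu>[OF A(1)]
      by (cases "\<nu> (A i) = 0") (simp_all add: sgn_div_norm dot_square_norm power2_eq_square)
    ultimately show "(\<Sum>i<n. norm (\<nu> (A i))) \<le> K" by simp
  qed
  then show thesis using that \<nu> ba_integral_eqI[OF l \<nu>] by blast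
qed

end

section \<open>The Yosida-Hewitt decomposition\<close>

text \<open>Absolute continuity in the epsilon-delta form forces countable additivity: along sets
  decreasing to the empty set the finite measure tends to 0, hence so does m. The classical
  Radon-Nikodym theorem then applies.\<close>

lemma (in finite_measure) Radon_Nikodym_finitely_additive:
  fixes m :: "'a set \<Rightarrow> real"
  assumes nonneg: "\<And>A. A \<in> sets M \<Longrightarrow> 0 \<le> m A"
    and add: "\<And>A B. A \<in> sets M \<Longrightarrow> B \<in> sets M \<Longrightarrow> A \<inter> B = {} \<Longrightarrow> m (A \<union> B) = m A + m B"
    and ac: "\<And>e. e > 0 \<Longrightarrow> \<exists>d>0. \<forall>A\<in>sets M. measure M A < d \<longrightarrow> m A \<le> e"
  obtains h where "integrable M h" "\<And>A. A \<in> sets M \<Longrightarrow> m A = (LINT x:A|M. h x)"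
proof -
  define N where "N = measure_of (space M) (sets M) (\<lambda>A. ennreal (m A))"
  have [simp]: "space N = space M" "sets N = sets M" by (simp_all add: N_def)
  have m0: "m {} = 0" using add[of "{}" "{}"] by simp
  have "countably_additive (sets M) (\<lambda>A. ennreal (m A))"
  proof (rule sets.empty_continuous_imp_countably_additive)
    show "positive (sets M) (\<lambda>A. ennreal (m A))" by (simp add: positive_def m0)
    show "additive (sets M) (\<lambda>A. ennreal (m A))" using add nonneg by (simp add: additive_def)
    fix A :: "nat \<Rightarrow> 'a set" assume A: "range A \<subseteq> sets M" "decseq A" "(\<Inter>i. A i) = {}"
    have lim: "(\<lambda>i. measure M (A i)) \<longlonglongrightarrow> 0"
      using finite_Lim_measure_decseq[OF A(1,2)] A(3) by simp
    have "(\<lambda>i. m (A i)) \<longlonglongrightarrow> 0"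
    proof (rule LIMSEQ_I)
      fix r :: real assume r: "r > 0"
      obtain d where d: "d > 0" "\<And>A. A \<in> sets M \<Longrightarrow> measure M A < d \<Longrightarrow> m A \<le> r / 2"
        using ac[of "r / 2"] r by auto
      obtain N where "\<And>n. n \<ge> N \<Longrightarrow> measure M (A n) < d"
        using order_tendstoD(2)[OF lim d(1)] unfolding eventually_sequentially by blast
      then have "norm (m (A n) - 0) < r" if "n \<ge> N" for n
        using d(2)[of "A n"] nonneg[of "A n"] A(1) that r by force
      then show "\<exists>no. \<forall>n\<ge>no. norm (m (A n) - 0) < r" by blast
    qed
    then show "(\<lambda>i. ennreal (m (A i))) \<longlonglongrightarrow> 0" using tendsto_ennrealI by fastforce
  qed auto
  then have emeasure_N: "emeasure N A = ennreal (m A)" if "A \<in> sets M" for A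
    unfolding N_def using that sets.sets_into_space
    by (intro emeasure_measure_of) (auto simp: positive_def m0)
  interpret N: finite_measure N by standard (simp add: emeasure_N)
  have "absolutely_continuous M N"
    unfolding absolutely_continuous_def
  proof
    fix A assume A: "A \<in> null_sets M"
    then have [measurable]: "A \<in> sets M" by auto
    have "m A \<le> e" if e: "e > 0" for e
    proof -
      obtain d where "d > 0" "\<And>A. A \<in> sets M \<Longrightarrow> measure M A < d \<Longrightarrow> m A \<le> e" using ac[OF e] by blast
      then show ?thesis using A by (auto simp: measure_eq_0_null_sets)
    qed
    then have "m A \<le> 0" by (rule field_le_epsilon) simp
    then show "A \<in> null_sets N" by (auto simp: null_sets_def emeasure_N ennreal_neg)
  qed
  then obtain D where D: "D \<in> borel_measurable M" "AE x in M. RN_deriv M N x = ennreal (D x)" "\<And>x. 0 \<le> D x"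
    using real_RN_deriv[OF N.finite_measure_axioms] by auto
  have dens: "density M (RN_deriv M N) = N"
    by (rule density_RN_deriv) (use \<open>absolutely_continuous M N\<close> in auto)
  have nn: "(\<integral>\<^sup>+x. ennreal (indicator A x *\<^sub>R D x) \<partial>M) = ennreal (m A)" if A: "A \<in> sets M" for A
  proof -
    have "ennreal (m A) = (\<integral>\<^sup>+x. RN_deriv M N x * indicator A x \<partial>M)"
      using emeasure_density[of "RN_deriv M N" M A] A dens emeasure_N by simp
    also have "\<dots> = (\<integral>\<^sup>+x. ennreal (indicator A x *\<^sub>R D x) \<partial>M)"
    proof (rule nn_integral_cong_AE)
      show "AE x in M. RN_deriv M N x * indicator A x = ennreal (indicator A x *\<^sub>R D x)"
        using D(2) by eventually_elim (auto simp: indicator_def)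
    qed
    finally show ?thesis ..
  qed
  have int: "integrable M (\<lambda>x. indicator A x *\<^sub>R D x)" "m A = (LINT x|M. indicator A x *\<^sub>R D x)" if A: "A \<in> sets M" for A
  proof -
    have "(\<lambda>x. indicator A x *\<^sub>R D x) \<in> borel_measurable M" using D(1) A by measurable
    then show "integrable M (\<lambda>x. indicator A x *\<^sub>R D x)" using D(3) nn[OF A]
      by (intro integrableI_nonneg) (auto simp: indicator_def)
    then show "m A = (LINT x|M. indicator A x *\<^sub>R D x)"
      using nn_integral_eq_integral[of M "\<lambda>x. indicator A x *\<^sub>R D x"] D(3) nn[OF A] nonneg[OF A]
      by (auto simp: indicator_def integral_nonneg)
  qed
  have "integrable M (\<lambda>x. indicator (space M) x *\<^sub>R D x)" by (rule int(1)) simp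
  moreover have "integrable M (\<lambda>x. indicator (space M) x *\<^sub>R D x) = integrable M D"
    by (rule Bochner_Integration.integrable_cong) auto
  ultimately have "integrable M D" by blast
  then show thesis using int(2) that[of D] unfolding set_lebesgue_integral_def by blast
qed

context bounded_open_set begin

lemma ba_diff:
  assumes \<nu>: "\<nu> \<in> ba \<Omega>" and "A \<in> sets L" "B \<in> sets L" "B \<subseteq> A"
  shows "\<nu> (A - B) = \<nu> A - \<nu> B"
proof -
  have "\<nu> (B \<union> (A - B)) = \<nu> B + \<nu> (A - B)" using assms by (intro ba_add[OF \<nu>]) auto
  moreover have "B \<union> (A - B) = A" using assms by blast
  ultimately show ?thesis by simp
qed

lemma tv_diff:
  assumes \<nu>: "\<nu> \<in> ba \<Omega>" and "A \<in> sets L" "B \<in> sets L" "B \<subseteq> A"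
  shows "tv \<nu> (A - B) = tv \<nu> A - tv \<nu> B"
proof -
  have "tv \<nu> (B \<union> (A - B)) = tv \<nu> B + tv \<nu> (A - B)" using assms by (intro tv_add[OF \<nu>]) auto
  moreover have "B \<union> (A - B) = A" using assms by blast
  ultimately show ?thesis by simp
qed

lemma tv_le_tv_Omega: "\<nu> \<in> ba \<Omega> \<Longrightarrow> A \<in> sets L \<Longrightarrow> tv \<nu> A \<le> tv \<nu> \<Omega>"
  by (rule tv_mono) (auto simp: sets_L_iff)

text \<open>The sets \<open>F n\<close> concentrate, in the limit of vanishing measure, as much variation as possible.
  The singular part is what \<open>\<nu>\<close> leaves on them.\<close>

lemma tv_concentration:
  assumes \<nu>: "\<nu> \<in> ba \<Omega>"
  obtains F \<alpha> where "decseq F" "\<And>n::nat. F n \<in> sets L" "(\<lambda>n. measure L (F n)) \<longlonglongrightarrow> 0"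
    "(\<lambda>n. tv \<nu> (F n)) \<longlonglongrightarrow> \<alpha>"
    "\<And>e. e > 0 \<Longrightarrow> \<exists>d>0. \<forall>A\<in>sets L. measure L A < d \<longrightarrow> tv \<nu> A \<le> \<alpha> + e"
proof -
  \<comment> \<open>\<open>T d\<close> is the largest variation available on sets of measure below
    d, and \<alpha> is its limit as d shrinks: the variation that cannot be separated from null
    sets.\<close>
  define T where "T d = (SUP A\<in>{A\<in>sets L. measure L A < d}. tv \<nu> A)" for d :: real
  define \<alpha> where "\<alpha> = (INF d\<in>{0<..}. T d)"
  have bdd: "bdd_above (tv \<nu> ` {A\<in>sets L. measure L A < d})" for d
    by (rule bdd_aboveI2[of _ _ "tv \<nu> \<Omega>"]) (use tv_le_tv_Omega[OF \<nu>] in auto)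
  have ne: "{A\<in>sets L. measure L A < d} \<noteq> {}" if "d > 0" for d using that by (auto intro!: exI[of _ "{}"])
  have T_upper: "tv \<nu> A \<le> T d" if "A \<in> sets L" "measure L A < d" for A d
    unfolding T_def by (rule cSUP_upper[OF _ bdd]) (use that in auto)
  have T0: "0 \<le> T d" if "d > 0" for d
    using T_upper[of "{}" d] tv_nonneg[of \<nu> "{}"] that by simp
  have bddT: "bdd_below (T ` {0<..})" by (rule bdd_belowI2[of _ 0]) (use T0 in auto)
  have \<alpha>_le: "\<alpha> \<le> T d" if "d > 0" for d unfolding \<alpha>_def by (rule cINF_lower[OF bddT]) (use that in auto)
  have up: "\<exists>d>0. \<forall>A\<in>sets L. measure L A < d \<longrightarrow> tv \<nu> A \<le> \<alpha> + e" if "e > 0" for e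
  proof -
    have "\<exists>d\<in>{0<..}. T d < \<alpha> + e"
      unfolding \<alpha>_def by (rule cINF_less_iff[THEN iffD1, OF _ bddT]) (use that in \<open>auto simp: \<alpha>_def[symmetric]\<close>)
    then show ?thesis using T_upper by (meson greaterThan_iff less_imp_le order_trans)
  qed
  \<comment> \<open>Near-optimal sets are taken with measures below a geometric series. The unions
    of their tails are then decreasing, still have vanishing measure, and have at least as much
    variation.\<close>
  have "\<exists>A\<in>sets L. measure L A < (1/2) ^ Suc n \<and> \<alpha> - (1/2) ^ n < tv \<nu> A" for n :: nat
  proof -
    have "\<alpha> - (1/2) ^ n < T ((1/2) ^ Suc n)" by (rule order.strict_trans2[OF _ \<alpha>_le]) simp_all
    moreover have "(0::real) < (1/2) ^ Suc n" by simp
    note less_cSUP_iff[OF ne[OF this] bdd]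
    ultimately show ?thesis unfolding T_def by blast
  qed
  then obtain E where E: "\<And>n::nat. E n \<in> sets L" "\<And>n. measure L (E n) < (1/2) ^ Suc n" "\<And>n. \<alpha> - (1/2) ^ n < tv \<nu> (E n)"
    by metis
  define F where "F n = (\<Union>k. E (n + k))" for n
  have F_sets: "F n \<in> sets L" for n unfolding F_def using E(1) by auto
  have F_meas: "measure L (F n) \<le> (1/2) ^ n" for n
  proof -
    have s: "(\<lambda>k. (1/2) ^ Suc (n + k) :: real) sums ((1/2) ^ n)"
      using sums_mult[OF power_half_series, of "(1/2) ^ n"] by (simp add: power_add algebra_simps)
    have le: "measure L (E (n + k)) \<le> (1/2) ^ Suc (n + k)" for k using E(2)[of "n + k"] by simp
    have summ: "summable (\<lambda>k. measure L (E (n + k)))"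
      by (rule summable_comparison_test'[OF sums_summable[OF s], of 0]) (use le in auto)
    have "measure L (F n) \<le> (\<Sum>k. measure L (E (n + k)))"
      unfolding F_def by (rule finite_measure_subadditive_countably) (use E(1) summ in auto)
    also have "\<dots> \<le> (\<Sum>k. (1/2) ^ Suc (n + k))"
      by (rule suminf_le[OF le summ sums_summable[OF s]])
    finally show ?thesis using sums_unique[OF s] by simp
  qed
  have half: "(\<lambda>n. (1/2) ^ n :: real) \<longlonglongrightarrow> 0" by (rule LIMSEQ_power_zero) simp
  have F0: "(\<lambda>n. measure L (F n)) \<longlonglongrightarrow> 0"
    by (rule tendsto_sandwich[OF _ _ tendsto_const half]) (use F_meas in auto)
  have dec: "decseq F" unfolding decseq_def F_def
  proof (intro allI impI UN_least)
    fix m n k :: nat assume "m \<le> n"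
    then have "E (n + k) = E (m + (n - m + k))" by simp
    then show "E (n + k) \<subseteq> (\<Union>k. E (m + k))" by blast
  qed
  have "(\<lambda>n. tv \<nu> (F n)) \<longlonglongrightarrow> \<alpha>"
  proof (rule LIMSEQ_I)
    fix r :: real assume r: "r > 0"
    obtain d where d: "d > 0" "\<And>A. A \<in> sets L \<Longrightarrow> measure L A < d \<Longrightarrow> tv \<nu> A \<le> \<alpha> + r / 2"
      using up[of "r / 2"] r by auto
    obtain N1 where N1: "\<And>n. n \<ge> N1 \<Longrightarrow> measure L (F n) < d"
      using order_tendstoD(2)[OF F0 d(1)] unfolding eventually_sequentially by blast
    obtain N2 where N2: "\<And>n. n \<ge> N2 \<Longrightarrow> (1/2) ^ n < r"
      using order_tendstoD(2)[OF half r] unfolding eventually_sequentially by blast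
    have "norm (tv \<nu> (F n) - \<alpha>) < r" if "n \<ge> max N1 N2" for n
    proof -
      have "E n \<subseteq> F n" unfolding F_def by (metis UN_upper UNIV_I add_0_right)
      then have "tv \<nu> (E n) \<le> tv \<nu> (F n)" by (intro tv_mono[OF \<nu>] E F_sets)
      then have "\<alpha> - r < tv \<nu> (F n)" using E(3)[of n] N2[of n] that by simp
      moreover have "tv \<nu> (F n) \<le> \<alpha> + r / 2" using d(2)[OF F_sets N1] that by simp
      ultimately show ?thesis using r by (simp add: abs_less_iff)
    qed
    then show "\<exists>no. \<forall>n\<ge>no. norm (tv \<nu> (F n) - \<alpha>) < r" by blast
  qed
  then show thesis using that dec F_sets F0 up by blast
qed

text \<open>The singular part is the limit of \<nu> on \<open>A \<inter> F n\<close>; the limit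
  \<open>\<rho>\<close> of the variations off \<open>F n\<close> dominates the remainder.
  \<open>\<rho>\<close> is absolutely continuous because \<alpha> is extremal: \<open>F n\<close>
  already carries almost \<alpha>, while adding to it a set of small measure cannot push the
  variation noticeably above \<alpha>, so little can lie on that set off \<open>F n\<close>.\<close>

theorem Yosida_Hewitt_decomposition:
  assumes \<nu>: "\<nu> \<in> ba \<Omega>"
  obtains y \<nu>s where "ba_decomposition \<Omega> \<nu> y \<nu>s"
proof -
  obtain F \<alpha> where dec: "decseq F" and F: "\<And>n::nat. F n \<in> sets L" and F0: "(\<lambda>n. measure L (F n)) \<longlonglongrightarrow> 0"
    and lim: "(\<lambda>n. tv \<nu> (F n)) \<longlonglongrightarrow> \<alpha>"
    and up: "\<And>e. e > 0 \<Longrightarrow> \<exists>d>0. \<forall>A\<in>sets L. measure L A < d \<longrightarrow> tv \<nu> A \<le> \<alpha> + e"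
    using tv_concentration[OF \<nu>] by blast
  have sub: "F n \<subseteq> F m" if "m \<le> n" for m n using dec that by (simp add: decseq_def)
  define \<nu>s where "\<nu>s A = lim (\<lambda>n. \<nu> (A \<inter> F n))" for A
  define \<rho> where "\<rho> A = lim (\<lambda>n. tv \<nu> (A - F n))" for A
  have conv: "convergent (\<lambda>n. \<nu> (A \<inter> F n))" "convergent (\<lambda>n. tv \<nu> (A - F n))" if A: "A \<in> sets L" for A
  proof -
    \<comment> \<open>Increments of both sequences are controlled by the variation on
      \<open>F m - F n\<close>, that is, by a difference of terms of the convergent sequence of the
      variations of \<open>F n\<close>.\<close>
    have key: "\<exists>N. \<forall>m\<ge>N. \<forall>n\<ge>N. norm (g m - g n) < e"
      if e: "e > 0" and g: "\<And>m n. m \<le> n \<Longrightarrow> norm (g m - g n) \<le> tv \<nu> (F m - F n)" for e and g :: "nat \<Rightarrow> 'b::real_normed_vector"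
    proof -
      have "Cauchy (\<lambda>n. tv \<nu> (F n))" using lim by (rule LIMSEQ_imp_Cauchy)
      then obtain N where N: "\<And>m n. m \<ge> N \<Longrightarrow> n \<ge> N \<Longrightarrow> norm (tv \<nu> (F m) - tv \<nu> (F n)) < e"
        using e by (metis CauchyD)
      have "norm (g m - g n) < e" if "m \<ge> N" "n \<ge> N" "m \<le> n" for m n
        using g[OF that(3)] tv_diff[OF \<nu> F F sub[OF that(3)]] N[OF that(1,2)] by simp
      then show ?thesis by (metis linear norm_minus_commute)
    qed
    have "Cauchy (\<lambda>n. \<nu> (A \<inter> F n))"
    proof (rule CauchyI, rule key)
      fix m n :: nat assume mn: "m \<le> n"
      have "\<nu> ((A \<inter> F m) - (A \<inter> F n)) = \<nu> (A \<inter> F m) - \<nu> (A \<inter> F n)"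
        using A F sub[OF mn] by (intro ba_diff[OF \<nu>]) auto
      moreover have "norm (\<nu> ((A \<inter> F m) - (A \<inter> F n))) \<le> tv \<nu> ((A \<inter> F m) - (A \<inter> F n))"
        using A F by (intro norm_le_tv[OF \<nu>]) auto
      moreover have "\<dots> \<le> tv \<nu> (F m - F n)" using A F by (intro tv_mono[OF \<nu>]) auto
      ultimately show "norm (\<nu> (A \<inter> F m) - \<nu> (A \<inter> F n)) \<le> tv \<nu> (F m - F n)" by simp
    qed
    then show "convergent (\<lambda>n. \<nu> (A \<inter> F n))" by (rule Cauchy_convergent)
    have "Cauchy (\<lambda>n. tv \<nu> (A - F n))"
    proof (rule CauchyI, rule key)
      fix m n :: nat assume mn: "m \<le> n"
      have "tv \<nu> ((A - F n) - (A - F m)) = tv \<nu> (A - F n) - tv \<nu> (A - F m)"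
        using A F sub[OF mn] by (intro tv_diff[OF \<nu>]) auto
      moreover have "tv \<nu> ((A - F n) - (A - F m)) \<le> tv \<nu> (F m - F n)" using A F by (intro tv_mono[OF \<nu>]) auto
      moreover have "0 \<le> tv \<nu> ((A - F n) - (A - F m))" by (rule tv_nonneg)
      ultimately show "norm (tv \<nu> (A - F m) - tv \<nu> (A - F n)) \<le> tv \<nu> (F m - F n)" by simp
    qed
    then show "convergent (\<lambda>n. tv \<nu> (A - F n))" by (rule Cauchy_convergent)
  qed
  have \<nu>s: "(\<lambda>n. \<nu> (A \<inter> F n)) \<longlonglongrightarrow> \<nu>s A" and \<rho>: "(\<lambda>n. tv \<nu> (A - F n)) \<longlonglongrightarrow> \<rho> A" if A: "A \<in> sets L" for A
    using conv[OF A] unfolding \<nu>s_def \<rho>_def by (simp_all add: convergent_LIMSEQ_iff)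
  have \<nu>s_le: "norm (\<nu>s A) \<le> tv \<nu> A" if A: "A \<in> sets L" for A
  proof (rule LIMSEQ_le_const2[OF tendsto_norm[OF \<nu>s[OF A]]], intro exI allI impI)
    fix n
    have "norm (\<nu> (A \<inter> F n)) \<le> tv \<nu> (A \<inter> F n)" using A F by (intro norm_le_tv[OF \<nu>]) auto
    also have "\<dots> \<le> tv \<nu> A" using A F by (intro tv_mono[OF \<nu>]) auto
    finally show "norm (\<nu> (A \<inter> F n)) \<le> tv \<nu> A" .
  qed
  have \<nu>s_ba: "\<nu>s \<in> ba \<Omega>"
  proof (rule baI_bounded)
    fix A B assume AB: "A \<in> sets L" "B \<in> sets L" "A \<inter> B = {}"
    have "\<nu> ((A \<union> B) \<inter> F n) = \<nu> (A \<inter> F n) + \<nu> (B \<inter> F n)" for n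
      unfolding Int_Un_distrib2 using AB F by (intro ba_add[OF \<nu>]) auto
    then have "(\<lambda>n. \<nu> ((A \<union> B) \<inter> F n)) \<longlonglongrightarrow> \<nu>s A + \<nu>s B" using tendsto_add[OF \<nu>s[OF AB(1)] \<nu>s[OF AB(2)]] by simp
    then show "\<nu>s (A \<union> B) = \<nu>s A + \<nu>s B" using LIMSEQ_unique[OF \<nu>s[OF sets.Un[OF AB(1,2)]]] by blast
  next
    fix A assume "A \<in> null_sets L"
    then show "\<nu>s A = 0" using \<nu>s_le[of A] tv_null[OF \<nu>, of A] by (simp add: null_setsD2)
  next
    fix A :: "nat \<Rightarrow> 'a set" and n assume A: "\<And>i. A i \<in> sets L" "disjoint_family A"
    have "(\<Sum>i<n. norm (\<nu>s (A i))) \<le> (\<Sum>i<n. tv \<nu> (A i))" by (intro sum_mono \<nu>s_le A(1))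
    also have "\<dots> = tv \<nu> (\<Union>i<n. A i)"
      by (rule tv_finite_sum[OF \<nu>, symmetric]) (use A in \<open>auto intro: disjoint_family_on_mono\<close>)
    also have "\<dots> \<le> tv \<nu> \<Omega>" using A(1) by (intro tv_le_tv_Omega[OF \<nu>]) auto
    finally show "(\<Sum>i<n. norm (\<nu>s (A i))) \<le> tv \<nu> \<Omega>" .
  qed
  have sing: "ba_singular \<Omega> \<nu>s"
    unfolding ba_singular_def
  proof (intro exI[of _ F] conjI allI dec)
    show "range F \<subseteq> sets L" using F by blast
    show "(\<lambda>n. emeasure L (F n)) \<longlonglongrightarrow> 0"
      using tendsto_ennrealI[OF F0] by (simp add: emeasure_eq_measure)
    fix n
    have "total_variation \<Omega> \<nu>s (\<Omega> - F n) \<le> 0"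
    proof (rule total_variation_least)
      fix P assume P: "\<And>n::nat. P n \<in> sets L" "(\<Union>n. P n) = \<Omega> - F n"
      have "\<nu>s (P k) = 0" for k
      proof (rule LIMSEQ_unique[OF \<nu>s[OF P(1)]])
        \<comment> \<open>Pieces lying off \<open>F n\<close> do not meet any later
          \<open>F m\<close>, so the limit that defines \<open>\<nu>s\<close> is eventually 0 on
          them.\<close>
        have "\<nu> (P k \<inter> F m) = 0" if "m \<ge> n" for m
        proof -
          have "P k \<inter> F m = {}" using P(2) sub[OF that] by blast
          then show ?thesis using ba_empty[OF \<nu>] by simp
        qed
        then show "(\<lambda>m. \<nu> (P k \<inter> F m)) \<longlonglongrightarrow> 0"
          by (intro tendsto_eventually) (auto simp: eventually_sequentially)
      qed
      then show "(\<Sum>k. ennreal (norm (\<nu>s (P k)))) \<le> 0" by simp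
    qed
    then show "total_variation \<Omega> \<nu>s (\<Omega> - F n) = 0" by simp
  qed
  have \<rho>_add: "\<rho> (A \<union> B) = \<rho> A + \<rho> B" if AB: "A \<in> sets L" "B \<in> sets L" "A \<inter> B = {}" for A B
  proof -
    have "tv \<nu> ((A \<union> B) - F n) = tv \<nu> (A - F n) + tv \<nu> (B - F n)" for n
      unfolding Un_Diff using AB F by (intro tv_add[OF \<nu>]) auto
    then have "(\<lambda>n. tv \<nu> ((A \<union> B) - F n)) \<longlonglongrightarrow> \<rho> A + \<rho> B" using tendsto_add[OF \<rho>[OF AB(1)] \<rho>[OF AB(2)]] by simp
    then show ?thesis using LIMSEQ_unique[OF \<rho>[OF sets.Un[OF AB(1,2)]]] by blast
  qed
  have \<nu>a_le: "norm (\<nu> A - \<nu>s A) \<le> \<rho> A" if A: "A \<in> sets L" for A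
  proof (rule LIMSEQ_le[OF tendsto_norm[OF tendsto_diff[OF tendsto_const \<nu>s[OF A]]] \<rho>[OF A]], intro exI allI impI)
    fix n
    have "\<nu> A - \<nu> (A \<inter> F n) = \<nu> (A - A \<inter> F n)" using A F by (intro ba_diff[OF \<nu>, symmetric]) auto
    also have "A - A \<inter> F n = A - F n" by blast
    finally show "norm (\<nu> A - \<nu> (A \<inter> F n)) \<le> tv \<nu> (A - F n)" using norm_le_tv[OF \<nu>, of "A - F n"] A F by auto
  qed
  have \<rho>_nonneg: "\<rho> A \<ge> 0" if "A \<in> sets L" for A
    using \<nu>a_le[OF that] norm_ge_zero order_trans by blast
  have ac: "\<exists>d>0. \<forall>A\<in>sets L. measure L A < d \<longrightarrow> \<rho> A \<le> e" if e: "e > 0" for e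
  proof -
    obtain d where d: "d > 0" "\<And>A. A \<in> sets L \<Longrightarrow> measure L A < d \<Longrightarrow> tv \<nu> A \<le> \<alpha> + e / 2"
      using up[of "e / 2"] e by auto
    obtain N1 where N1: "\<And>n. n \<ge> N1 \<Longrightarrow> measure L (F n) < d / 2"
      using order_tendstoD(2)[OF F0, of "d / 2"] d(1) unfolding eventually_sequentially by auto
    obtain N2 where N2: "\<And>n. n \<ge> N2 \<Longrightarrow> tv \<nu> (F n) > \<alpha> - e / 2"
      using order_tendstoD(1)[OF lim, of "\<alpha> - e / 2"] e unfolding eventually_sequentially by auto
    have "\<rho> A \<le> e" if A: "A \<in> sets L" "measure L A < d / 2" for A
    proof (rule LIMSEQ_le_const2[OF \<rho>[OF A(1)]], intro exI allI impI)
      fix n assume n: "max N1 N2 \<le> n"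
      have "measure L (A \<union> F n) \<le> measure L A + measure L (F n)" by (rule measure_Un_le) (use A F in auto)
      then have "measure L (A \<union> F n) < d" using A(2) N1[of n] n by simp
      then have "tv \<nu> (A \<union> F n) \<le> \<alpha> + e / 2" using A(1) F d(2) by auto
      moreover have "tv \<nu> ((A \<union> F n) - F n) = tv \<nu> (A \<union> F n) - tv \<nu> (F n)"
        using A(1) F by (intro tv_diff[OF \<nu>]) auto
      moreover have "(A \<union> F n) - F n = A - F n" by blast
      ultimately show "tv \<nu> (A - F n) \<le> e" using N2[of n] n by simp
    qed
    then show ?thesis using d(1) by (intro exI[of _ "d / 2"]) auto
  qed
  obtain h0 where h0: "integrable L h0" "\<And>A. A \<in> sets L \<Longrightarrow> \<rho> A = (LINT x:A|L. h0 x)"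
    using Radon_Nikodym_finitely_additive[of \<rho>] \<rho>_nonneg \<rho>_add ac by blast
  have "\<exists>h. integrable L h \<and> (\<forall>A\<in>sets L. (\<nu> A - \<nu>s A) \<bullet> b = (LINT x:A|L. h x))" if b: "b \<in> Basis" for b
  proof -
    \<comment> \<open>A coordinate of the remainder is signed. Adding \<open>\<rho>\<close>, which
      dominates it, makes it nonnegative, and the density of \<open>\<rho>\<close> is subtracted
      again afterwards.\<close>
    define m where "m A = (\<nu> A - \<nu>s A) \<bullet> b + \<rho> A" for A
    have le: "\<bar>(\<nu> A - \<nu>s A) \<bullet> b\<bar> \<le> \<rho> A" if "A \<in> sets L" for A
      using \<nu>a_le[OF that] Basis_le_norm[OF b, of "\<nu> A - \<nu>s A"] by linarith
    obtain h where h: "integrable L h" "\<And>A. A \<in> sets L \<Longrightarrow> m A = (LINT x:A|L. h x)"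
    proof (rule Radon_Nikodym_finitely_additive[of m])
      show "0 \<le> m A" if "A \<in> sets L" for A using le[OF that] by (simp add: m_def abs_le_iff)
      show "m (A \<union> B) = m A + m B" if "A \<in> sets L" "B \<in> sets L" "A \<inter> B = {}" for A B
        using ba_add[OF \<nu> that] ba_add[OF \<nu>s_ba that] \<rho>_add[OF that]
        by (simp add: m_def inner_add_left inner_diff_left)
      fix e :: real assume "e > 0"
      then obtain d where d: "d > 0" "\<And>A. A \<in> sets L \<Longrightarrow> measure L A < d \<Longrightarrow> \<rho> A \<le> e / 2" using ac[of "e / 2"] by auto
      have "m A \<le> e" if "A \<in> sets L" "measure L A < d" for A
        using d(2)[OF that] le[OF that(1)] by (simp add: m_def abs_le_iff)
      then show "\<exists>d>0. \<forall>A\<in>sets L. measure L A < d \<longrightarrow> m A \<le> e" using d(1) by blast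
    qed blast
    have "(\<nu> A - \<nu>s A) \<bullet> b = (LINT x:A|L. h x - h0 x)" if A: "A \<in> sets L" for A
    proof -
      have "(LINT x:A|L. h x - h0 x) = (LINT x:A|L. h x) - (LINT x:A|L. h0 x)"
        by (intro set_integral_diff; unfold set_integrable_def; intro integrable_mult_indicator A h(1) h0(1))
      then show ?thesis using h(2)[OF A] h0(2)[OF A] by (simp add: m_def)
    qed
    then show ?thesis using h(1) h0(1) by (intro exI[of _ "\<lambda>x. h x - h0 x"]) auto
  qed
  then obtain h where h: "\<And>b. b \<in> Basis \<Longrightarrow> integrable L (h b)"
    "\<And>b A. b \<in> Basis \<Longrightarrow> A \<in> sets L \<Longrightarrow> (\<nu> A - \<nu>s A) \<bullet> b = (LINT x:A|L. h b x)" by metis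
  define y where "y x = (\<Sum>b\<in>Basis. h b x *\<^sub>R b)" for x
  have y: "integrable L y" unfolding y_def using h(1) by auto
  have "\<nu> A = (LINT x:A|L. y x) + \<nu>s A" if A: "A \<in> sets L" for A
  proof -
    have "(LINT x:A|L. y x) \<bullet> b = (\<nu> A - \<nu>s A) \<bullet> b" if b: "b \<in> Basis" for b
    proof -
      have "integrable L (\<lambda>x. indicator A x *\<^sub>R y x)" using integrable_mult_indicator[OF A y] .
      then have "(LINT x:A|L. y x) \<bullet> b = (LINT x|L. (indicator A x *\<^sub>R y x) \<bullet> b)"
        unfolding set_lebesgue_integral_def by (rule integral_inner_left[symmetric])
      also have "\<dots> = (LINT x:A|L. h b x)"
        unfolding set_lebesgue_integral_def using b by (simp add: y_def inner_sum_left inner_Basis if_distrib sum.delta cong: if_cong)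
      finally show ?thesis using h(2)[OF b A] by simp
    qed
    then have "(LINT x:A|L. y x) = \<nu> A - \<nu>s A" by (rule euclidean_eqI)
    then show ?thesis by simp
  qed
  then show thesis using that y \<nu>s_ba sing unfolding ba_decomposition_def by blast
qed

end

section \<open>Weak gradients and bounded Sobolev functions\<close>

text \<open>Squaring the positive part removes its kink, and one continuous derivative is all that
  \<open>test_function\<close> demands.\<close>

lemma DERIV_positive_part_square:
  "((\<lambda>x::real. (max 0 x)\<^sup>2) has_real_derivative 2 * max 0 x) (at x)"
proof (cases x "0::real" rule: linorder_cases)
  case less
  have "((\<lambda>x::real. (max 0 x)\<^sup>2) has_real_derivative 0) (at x)"
    by (rule has_field_derivative_transform_within_open[OF DERIV_const[of 0], of "{..<0}"])
      (use less in \<open>auto simp: max_def\<close>)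
  then show ?thesis using less by simp
next
  case equal
  have "(\<lambda>h. ((max 0 (0 + h))\<^sup>2 - (max 0 0)\<^sup>2) / h) \<midarrow>0\<rightarrow> (0::real)"
  proof (rule tendsto_sandwich[where f = "\<lambda>h. 0" and h = "\<lambda>h::real. \<bar>h\<bar>"])
    show "\<forall>\<^sub>F h in at 0. ((max 0 (0 + h))\<^sup>2 - (max 0 0)\<^sup>2) / h \<le> \<bar>h::real\<bar>"
      by (rule always_eventually) (auto simp: max_def power2_eq_square)
    show "\<forall>\<^sub>F h in at 0. (0::real) \<le> ((max 0 (0 + h))\<^sup>2 - (max 0 0)\<^sup>2) / h"
      by (rule always_eventually) (auto simp: max_def power2_eq_square)
  qed (auto intro!: tendsto_eq_intros)
  then show ?thesis using equal by (simp add: DERIV_def)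
next
  case greater
  have "((\<lambda>x::real. x\<^sup>2) has_real_derivative 2 * x) (at x)" by (auto intro!: derivative_eq_intros)
  then have "((\<lambda>x::real. (max 0 x)\<^sup>2) has_real_derivative 2 * x) (at x)"
    by (rule has_field_derivative_transform_within_open[of _ _ _ "{0<..}"]) (use greater in \<open>auto simp: max_def\<close>)
  then show ?thesis using greater by simp
qed

text \<open>For ordered corners, each factor is the squared positive part of a quadratic that
  vanishes at two opposite faces. The product is therefore of class C^1 and positive exactly on the
  open box.\<close>

definition box_bump :: "'a::euclidean_space \<Rightarrow> 'a \<Rightarrow> 'a \<Rightarrow> real" where
  "box_bump a b y = (\<Prod>i\<in>Basis. (max 0 ((y \<bullet> i - a \<bullet> i) * (b \<bullet> i - y \<bullet> i)))\<^sup>2)"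

definition box_bump_grad :: "'a::euclidean_space \<Rightarrow> 'a \<Rightarrow> 'a \<Rightarrow> 'a" where
  "box_bump_grad a b y = (\<Sum>i\<in>Basis.
     (2 * max 0 ((y \<bullet> i - a \<bullet> i) * (b \<bullet> i - y \<bullet> i)) * (a \<bullet> i + b \<bullet> i - 2 * (y \<bullet> i)) *
       (\<Prod>j\<in>Basis - {i}. (max 0 ((y \<bullet> j - a \<bullet> j) * (b \<bullet> j - y \<bullet> j)))\<^sup>2)) *\<^sub>R i)"

lemma GDERIV_box_bump: "GDERIV (box_bump a b) y :> box_bump_grad a b y"
proof -
  let ?q = "\<lambda>i y. (y \<bullet> i - a \<bullet> i) * (b \<bullet> i - y \<bullet> i)"
  have "((\<lambda>y. (max 0 (?q i y))\<^sup>2) has_derivative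
      (\<lambda>h. 2 * max 0 (?q i y) * ((a \<bullet> i + b \<bullet> i - 2 * (y \<bullet> i)) * (h \<bullet> i)))) (at y)" for i
  proof -
    have "(?q i has_derivative (\<lambda>h. (a \<bullet> i + b \<bullet> i - 2 * (y \<bullet> i)) * (h \<bullet> i))) (at y)"
      by (auto intro!: derivative_eq_intros simp: fun_eq_iff algebra_simps)
    from has_derivative_compose[OF this DERIV_positive_part_square[of "?q i y", unfolded has_field_derivative_def]]
    show ?thesis by simp
  qed
  then have "((\<lambda>y. \<Prod>i\<in>Basis. (max 0 (?q i y))\<^sup>2) has_derivative
      (\<lambda>h. \<Sum>i\<in>Basis. (2 * max 0 (?q i y) * ((a \<bullet> i + b \<bullet> i - 2 * (y \<bullet> i)) * (h \<bullet> i))) *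
         (\<Prod>j\<in>Basis - {i}. (max 0 (?q j y))\<^sup>2))) (at y)"
    by (intro has_derivative_prod) auto
  then show ?thesis
    unfolding gderiv_def box_bump_def[abs_def] box_bump_grad_def
    by (simp add: inner_sum_right algebra_simps)
qed

lemma continuous_on_box_bump_grad: "continuous_on S (box_bump_grad a b)"
  unfolding box_bump_grad_def by (intro continuous_intros)

lemma box_bump_nonneg: "0 \<le> box_bump a b y"
  by (simp add: box_bump_def prod_nonneg)

lemma box_bump_eq_0_iff: "box_bump a b y = 0 \<longleftrightarrow> (\<exists>i\<in>Basis. (y \<bullet> i - a \<bullet> i) * (b \<bullet> i - y \<bullet> i) \<le> 0)"
proof -
  have "max 0 t = 0 \<longleftrightarrow> t \<le> 0" for t :: real by (auto simp: max_def)
  then show ?thesis by (simp add: box_bump_def)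
qed

lemma box_bump_pos_iff:
  assumes "\<And>i. i \<in> Basis \<Longrightarrow> a \<bullet> i \<le> b \<bullet> i"
  shows "box_bump a b y \<noteq> 0 \<longleftrightarrow> y \<in> box a b"
proof -
  have "(y \<bullet> i - a \<bullet> i) * (b \<bullet> i - y \<bullet> i) \<le> 0 \<longleftrightarrow> \<not> (a \<bullet> i < y \<bullet> i \<and> y \<bullet> i < b \<bullet> i)" if "i \<in> Basis" for i
    using assms[OF that] by (auto simp: mult_le_0_iff)
  then show ?thesis by (auto simp: box_bump_eq_0_iff mem_box)
qed

text \<open>The map t / (t + 1/(n+1)) keeps the zero set of the bump, bounds it by 1 and pushes its
  positive values to 1. The limit is the indicator of the open box.\<close>

definition smooth_box :: "'a::euclidean_space \<Rightarrow> 'a \<Rightarrow> nat \<Rightarrow> 'a \<Rightarrow> real" where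
  "smooth_box a b n y = box_bump a b y / (box_bump a b y + 1 / real (Suc n))"

definition smooth_box_grad :: "'a::euclidean_space \<Rightarrow> 'a \<Rightarrow> nat \<Rightarrow> 'a \<Rightarrow> 'a" where
  "smooth_box_grad a b n y = (1 / real (Suc n) / (box_bump a b y + 1 / real (Suc n))\<^sup>2) *\<^sub>R box_bump_grad a b y"

lemma smooth_box_denominator_pos: "0 < box_bump a b y + 1 / real (Suc n)"
  using box_bump_nonneg[of a b y] by (simp add: add_nonneg_pos)

lemma smooth_box_denominator_nonzero: "box_bump a b y + 1 / real (Suc n) \<noteq> 0"
  using smooth_box_denominator_pos[of a b y n] by (metis less_irrefl)

lemma GDERIV_smooth_box: "GDERIV (smooth_box a b n) y :> smooth_box_grad a b n y"
proof -
  let ?e = "1 / real (Suc n)"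
  have "((\<lambda>t. t / (t + ?e)) has_real_derivative ?e / (box_bump a b y + ?e)\<^sup>2) (at (box_bump a b y))"
    using smooth_box_denominator_pos[of a b y n]
    by (auto intro!: derivative_eq_intros simp: power2_eq_square)
  from GDERIV_DERIV_compose[OF GDERIV_box_bump this] show ?thesis
    by (simp add: smooth_box_def[abs_def] smooth_box_grad_def)
qed

lemma continuous_on_box_bump: "continuous_on S (box_bump a b)"
  unfolding box_bump_def by (intro continuous_intros)

lemma continuous_on_smooth_box: "continuous_on S (smooth_box a b n)"
  unfolding smooth_box_def
  by (intro continuous_intros continuous_on_box_bump ballI smooth_box_denominator_nonzero)

lemma continuous_on_smooth_box_grad: "continuous_on S (smooth_box_grad a b n)"
  unfolding smooth_box_grad_def
  by (intro continuous_intros continuous_on_box_bump continuous_on_box_bump_grad ballI power_not_zero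
      smooth_box_denominator_nonzero)

lemma smooth_box_bounds:
  assumes "\<And>i. i \<in> Basis \<Longrightarrow> a \<bullet> i \<le> b \<bullet> i"
  shows "0 \<le> smooth_box a b n y" "smooth_box a b n y \<le> indicator (box a b) y"
proof -
  show "0 \<le> smooth_box a b n y"
    unfolding smooth_box_def using smooth_box_denominator_pos[of a b y n] box_bump_nonneg[of a b y] by simp
  show "smooth_box a b n y \<le> indicator (box a b) y"
  proof (cases "y \<in> box a b")
    case False
    then show ?thesis using box_bump_pos_iff[OF assms, of y] by (simp add: smooth_box_def)
  next
    case True
    then show ?thesis unfolding smooth_box_def
      using smooth_box_denominator_pos[of a b y n] by (simp del: of_nat_Suc)
  qed
qed

lemma abs_smooth_box_le_1:
  assumes "\<And>i. i \<in> Basis \<Longrightarrow> a \<bullet> i \<le> b \<bullet> i"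
  shows "\<bar>smooth_box a b n y\<bar> \<le> 1"
  using smooth_box_bounds[OF assms, of n y] by (cases "y \<in> box a b") auto

lemma smooth_box_tendsto:
  assumes "\<And>i. i \<in> Basis \<Longrightarrow> a \<bullet> i \<le> b \<bullet> i"
  shows "(\<lambda>n. smooth_box a b n y) \<longlonglongrightarrow> indicator (box a b) y"
proof (cases "y \<in> box a b")
  case False
  then show ?thesis using box_bump_pos_iff[OF assms, of y] by (simp add: smooth_box_def)
next
  case True
  then have "box_bump a b y \<noteq> 0" using box_bump_pos_iff[OF assms] by blast
  then have "(\<lambda>n. box_bump a b y / (box_bump a b y + 1 / real (Suc n))) \<longlonglongrightarrow> box_bump a b y / (box_bump a b y + 0)"
    by (intro tendsto_intros LIMSEQ_Suc[OF lim_const_over_n]) simp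
  then show ?thesis using True \<open>box_bump a b y \<noteq> 0\<close> by (simp add: smooth_box_def)
qed

lemma test_function_smooth_box:
  assumes ab: "\<And>i. i \<in> Basis \<Longrightarrow> a \<bullet> i \<le> b \<bullet> i" and sub: "cbox a b \<subseteq> \<Omega>"
  shows "test_function \<Omega> (smooth_box a b n) (smooth_box_grad a b n)"
proof -
  have "{y. smooth_box a b n y \<noteq> 0} \<subseteq> cbox a b"
    using box_bump_pos_iff[OF ab] box_subset_cbox by (auto simp: smooth_box_def)
  then have cl: "closure {y. smooth_box a b n y \<noteq> 0} \<subseteq> cbox a b" by (intro closure_minimal) auto
  then have "compact (closure {y. smooth_box a b n y \<noteq> 0})"
    using bounded_subset[OF bounded_cbox] by (auto simp: compact_eq_bounded_closed)
  then show ?thesis unfolding test_function_def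
    using cl sub GDERIV_smooth_box continuous_on_smooth_box_grad by blast
qed

lemma smooth_box_translate: "smooth_box (a + c) (b + c) n y = smooth_box a b n (y - c)"
  by (simp add: smooth_box_def box_bump_def inner_diff_left inner_add_left algebra_simps)

lemma smooth_box_grad_translate: "smooth_box_grad (a + c) (b + c) n y = smooth_box_grad a b n (y - c)"
  by (simp add: smooth_box_grad_def box_bump_def box_bump_grad_def inner_diff_left inner_add_left algebra_simps)

lemma (in finite_measure) integrable_bounded_mult:
  fixes f :: "'a \<Rightarrow> real" and g :: "'a \<Rightarrow> 'b::{banach, second_countable_topology}"
  assumes f: "f \<in> borel_measurable M" "AE x in M. \<bar>f x\<bar> \<le> C" and g: "integrable M g"
  shows "integrable M (\<lambda>x. f x *\<^sub>R g x)"
proof (rule Bochner_Integration.integrable_bound)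
  show "integrable M (\<lambda>x. C *\<^sub>R norm (g x))" using g by auto
  show "AE x in M. norm (f x *\<^sub>R g x) \<le> norm (C *\<^sub>R norm (g x))"
    using f(2) by eventually_elim (auto simp: abs_mult intro!: mult_right_mono)
qed (use f g in measurable)

section \<open>Cube averages, uniqueness and linearity of the weak gradient, Lipschitz estimates on
  segments\<close>

context bounded_open_set begin

lemma integrable_Linf:
  fixes y :: "'a \<Rightarrow> 'b::euclidean_space"
  shows "y \<in> Linf \<Omega> \<Longrightarrow> integrable L y"
  by (metis LinfE Linf_measurable integrable_const_bound)

lemma continuous_measurable_L: "continuous_on UNIV f \<Longrightarrow> f \<in> borel_measurable L"
  by (intro measurable_restrict_space1 measurable_completion) (simp add: borel_measurable_continuous_onI)

lemma smooth_box_integral_tendsto: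
  fixes w :: "'a \<Rightarrow> 'b::euclidean_space"
  assumes ab: "\<And>i. i \<in> Basis \<Longrightarrow> a \<bullet> i \<le> b \<bullet> i" and w: "integrable L w"
  shows "(\<lambda>n. LINT y|L. smooth_box a b n y *\<^sub>R w y) \<longlonglongrightarrow> (LINT y|L. indicator (box a b) y *\<^sub>R w y)"
proof (rule integral_dominated_convergence[where w = "\<lambda>y. norm (w y)"])
  show "AE y in L. (\<lambda>n. smooth_box a b n y *\<^sub>R w y) \<longlonglongrightarrow> indicator (box a b) y *\<^sub>R w y"
    by (intro AE_I2 tendsto_intros smooth_box_tendsto ab)
  show "AE y in L. norm (smooth_box a b n y *\<^sub>R w y) \<le> norm (w y)" for n
  proof (rule AE_I2)
    fix y
    have "\<bar>smooth_box a b n y\<bar> \<le> 1" by (rule abs_smooth_box_le_1[OF ab])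
    then show "norm (smooth_box a b n y *\<^sub>R w y) \<le> norm (w y)" by (simp add: mult_left_le_one_le)
  qed
  have [measurable]: "smooth_box a b n \<in> borel_measurable L" for n
    by (intro continuous_measurable_L continuous_on_smooth_box)
  have [measurable]: "w \<in> borel_measurable L" using w by auto
  show "(\<lambda>y. smooth_box a b n y *\<^sub>R w y) \<in> borel_measurable L" for n by measurable
  have [measurable]: "box a b \<inter> \<Omega> \<in> sets L" using open_Omega by (simp add: sets_restrict_space_iff borel_open)
  have "(\<lambda>y. indicator (box a b \<inter> \<Omega>) y *\<^sub>R w y) \<in> borel_measurable L" by measurable
  then show "(\<lambda>y. indicator (box a b) y *\<^sub>R w y) \<in> borel_measurable L"
    by (rule measurable_cong[THEN iffD1, rotated]) (auto simp: indicator_def)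
qed (use w in auto)

text \<open>Lebesgue differentiation is available for gauge integrals over closed cubes of functions
  on the whole space, whereas test functions produce Bochner integrals over open boxes in \<Omega>.
  The two agree after extension by zero because faces of boxes are negligible.\<close>

lemma integral_cbox_extension:
  fixes w :: "'a \<Rightarrow> 'b::euclidean_space"
  assumes w: "integrable L w"
  shows "(\<lambda>x. indicator \<Omega> x *\<^sub>R w x) integrable_on cbox a b"
    and "integral (cbox a b) (\<lambda>x. indicator \<Omega> x *\<^sub>R w x) = (LINT y|L. indicator (box a b) y *\<^sub>R w y)"
proof -
  let ?w = "\<lambda>x. indicator \<Omega> x *\<^sub>R w x"
  have i: "integrable lebesgue ?w" using w integrable_restrict_space[of \<Omega> lebesgue w] by simp
  have s: "set_integrable lebesgue (cbox a b) ?w" unfolding set_integrable_def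
    by (rule integrable_mult_indicator[OF _ i]) simp
  show "?w integrable_on cbox a b" by (rule set_lebesgue_integral_eq_integral(1)[OF s])
  have "integral (cbox a b) ?w = (LINT x|lebesgue. indicator (cbox a b) x *\<^sub>R ?w x)"
    using set_lebesgue_integral_eq_integral(2)[OF s] by (simp add: set_lebesgue_integral_def)
  also have "\<dots> = (LINT x|lebesgue. indicator \<Omega> x *\<^sub>R (indicator (box a b) x *\<^sub>R w x))"
  proof (rule integral_cong_AE)
    have "negligible (cbox a b - box a b)" by (rule negligible_frontier_interval)
    then have "AE x in lebesgue. x \<notin> cbox a b - box a b"
      unfolding negligible_iff_null_sets by (rule AE_not_in)
    then show "AE x in lebesgue. indicator (cbox a b) x *\<^sub>R ?w x = indicator \<Omega> x *\<^sub>R (indicator (box a b) x *\<^sub>R w x)"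
      by eventually_elim (use box_subset_cbox in \<open>auto simp: indicator_def\<close>)
    have m: "?w \<in> borel_measurable lebesgue" using i by auto
    show "(\<lambda>x. indicator (cbox a b) x *\<^sub>R ?w x) \<in> borel_measurable lebesgue"
      by (rule borel_measurable_scaleR[OF borel_measurable_indicator m]) simp
    have "(\<lambda>x. indicator (box a b) x *\<^sub>R ?w x) \<in> borel_measurable lebesgue"
      by (rule borel_measurable_scaleR[OF borel_measurable_indicator m]) simp
    then show "(\<lambda>x. indicator \<Omega> x *\<^sub>R (indicator (box a b) x *\<^sub>R w x)) \<in> borel_measurable lebesgue"
      by (simp only: scaleR_left_commute)
  qed
  also have "\<dots> = (LINT y|L. indicator (box a b) y *\<^sub>R w y)"
    by (rule integral_restrict_space[symmetric]) simp
  finally show "integral (cbox a b) ?w = (LINT y|L. indicator (box a b) y *\<^sub>R w y)" .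
qed

lemma Lebesgue_differentiation_cubes:
  fixes w :: "'a \<Rightarrow> 'b::euclidean_space"
  assumes w: "integrable L w"
  shows "\<exists>N. negligible N \<and> (\<forall>x e. x \<in> \<Omega> \<longrightarrow> x \<notin> N \<longrightarrow> e > 0 \<longrightarrow> (\<exists>d>0. \<forall>h. 0 < h \<and> h < d \<longrightarrow>
       norm ((LINT y|L. indicator (box x (x + h *\<^sub>R One)) y *\<^sub>R w y) /\<^sub>R h ^ DIM('a) - w x) < e))"
proof -
  obtain N where N: "negligible N" "\<And>x e. \<lbrakk>x \<notin> N; 0 < e\<rbrakk> \<Longrightarrow> \<exists>d>0. \<forall>h. 0 < h \<and> h < d \<longrightarrow>
      norm (integral (cbox x (x + h *\<^sub>R One)) (\<lambda>x. indicator \<Omega> x *\<^sub>R w x) /\<^sub>R h ^ DIM('a) - indicator \<Omega> x *\<^sub>R w x) < e"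
    using integrable_ccontinuous_explicit[of "\<lambda>x. indicator \<Omega> x *\<^sub>R w x"] integral_cbox_extension(1)[OF w] by blast
  show ?thesis
  proof (intro exI[of _ N] conjI N(1) allI impI)
    fix x e assume "x \<in> \<Omega>" "x \<notin> N" "(e::real) > 0"
    then show "\<exists>d>0. \<forall>h. 0 < h \<and> h < d \<longrightarrow>
       norm ((LINT y|L. indicator (box x (x + h *\<^sub>R One)) y *\<^sub>R w y) /\<^sub>R h ^ DIM('a) - w x) < e"
      using N(2)[of x e] by (simp add: integral_cbox_extension(2)[OF w])
  qed
qed

lemma small_cubes_in_Omega:
  assumes "compact K" "K \<subseteq> \<Omega>"
  obtains d where "d > 0" "\<And>x h. x \<in> K \<Longrightarrow> 0 < h \<Longrightarrow> h < d \<Longrightarrow> cbox x (x + h *\<^sub>R One) \<subseteq> \<Omega>"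
proof -
  obtain e where e: "e > 0" "(\<Union>x\<in>K. ball x e) \<subseteq> \<Omega>"
    using compact_subset_open_imp_ball_epsilon_subset[OF assms(1) open_Omega assms(2)] by blast
  show thesis
  \<comment> \<open>A point of the cube differs from its corner by at most h in every coordinate, so
    the l1 bound on the norm gives h times the dimension.\<close>
  proof (rule that[of "e / DIM('a)"])
    show "e / DIM('a) > 0" using e(1) by simp
    fix x h assume x: "x \<in> K" and h: "0 < h" "h < e / DIM('a)"
    show "cbox x (x + h *\<^sub>R One) \<subseteq> \<Omega>"
    proof
      fix z assume z: "z \<in> cbox x (x + h *\<^sub>R One)"
      have "norm (z - x) \<le> (\<Sum>i\<in>Basis. \<bar>(z - x) \<bullet> i\<bar>)" by (rule norm_le_l1)
      also have "\<dots> \<le> (\<Sum>i\<in>(Basis::'a set). h)"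
        by (rule sum_mono) (use z h in \<open>auto simp: mem_box inner_diff_left inner_add_left abs_le_iff\<close>)
      also have "\<dots> < e" using h by (simp add: field_simps)
      finally have "z \<in> ball x e" by (simp add: dist_norm norm_minus_commute)
      then show "z \<in> \<Omega>" using e(2) x by blast
    qed
  qed
qed

lemma AE_L_negligible:
  assumes "negligible N"
  shows "AE x in L. x \<notin> N"
proof -
  have "AE x in lebesgue. x \<notin> N" using assms unfolding negligible_iff_null_sets by (rule AE_not_in)
  then show ?thesis by (subst AE_restrict_space_iff) (auto elim: eventually_mono)
qed

text \<open>Testing with smoothed boxes shows that the difference has integral 0 over every closed
  box inside \<Omega>. Differentiation along shrinking cubes then makes it 0 almost everywhere. This
  fixes the class of \<open>grad\<close>, which is defined by choice.\<close>

lemma weak_gradient_unique: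
  assumes V: "V \<in> Linf \<Omega>" "weak_gradient \<Omega> v V" and W: "W \<in> Linf \<Omega>" "weak_gradient \<Omega> v W"
  shows "AE x in L. V x = W x"
proof -
  define Z where "Z x = V x - W x" for x
  have ints: "integrable L V" "integrable L W" using V W integrable_Linf by auto
  have Z: "integrable L Z" unfolding Z_def by (intro Bochner_Integration.integrable_diff ints)
  have box0: "(LINT y|L. indicator (box a b) y *\<^sub>R Z y) = 0"
    if ab: "\<And>i. i \<in> Basis \<Longrightarrow> a \<bullet> i \<le> b \<bullet> i" and sub: "cbox a b \<subseteq> \<Omega>" for a b
  proof (rule LIMSEQ_unique[OF smooth_box_integral_tendsto[OF ab Z]])
    have "(LINT y|L. smooth_box a b n y *\<^sub>R Z y) = 0" for n
    proof -
      have m: "smooth_box a b n \<in> borel_measurable L" by (intro continuous_measurable_L continuous_on_smooth_box)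
      have "AE y in L. \<bar>smooth_box a b n y\<bar> \<le> 1"
        by (intro AE_I2 abs_smooth_box_le_1 ab)
      then have "integrable L (\<lambda>y. smooth_box a b n y *\<^sub>R V y)" "integrable L (\<lambda>y. smooth_box a b n y *\<^sub>R W y)"
        by (rule integrable_bounded_mult[OF m _ ints(1)], rule integrable_bounded_mult[OF m _ ints(2)])
      moreover have "- (LINT y|L. smooth_box a b n y *\<^sub>R V y) = - (LINT y|L. smooth_box a b n y *\<^sub>R W y)"
        using V(2)[unfolded weak_gradient_def, rule_format, OF test_function_smooth_box[OF ab sub, of n]]
          W(2)[unfolded weak_gradient_def, rule_format, OF test_function_smooth_box[OF ab sub, of n]] by (rule trans[OF sym])
      ultimately show ?thesis unfolding Z_def scaleR_diff_right
        by (subst Bochner_Integration.integral_diff) simp_all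
    qed
    then show "(\<lambda>n. LINT y|L. smooth_box a b n y *\<^sub>R Z y) \<longlonglongrightarrow> 0" by simp
  qed
  obtain N where N: "negligible N"
    "\<forall>x e. x \<in> \<Omega> \<longrightarrow> x \<notin> N \<longrightarrow> e > 0 \<longrightarrow> (\<exists>d>0. \<forall>h. 0 < h \<and> h < d \<longrightarrow>
       norm ((LINT y|L. indicator (box x (x + h *\<^sub>R One)) y *\<^sub>R Z y) /\<^sub>R h ^ DIM('a) - Z x) < e)"
    using Lebesgue_differentiation_cubes[OF Z] by blast
  have "Z x = 0" if x: "x \<in> \<Omega>" "x \<notin> N" for x
  proof (rule ccontr)
    assume "Z x \<noteq> 0"
    then obtain d where d: "d > 0" "\<And>h. 0 < h \<Longrightarrow> h < d \<Longrightarrow>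
       norm ((LINT y|L. indicator (box x (x + h *\<^sub>R One)) y *\<^sub>R Z y) /\<^sub>R h ^ DIM('a) - Z x) < norm (Z x)"
      using N(2)[rule_format, OF x, of "norm (Z x)"] by auto
    obtain d' where d': "d' > 0" "\<And>h. 0 < h \<Longrightarrow> h < d' \<Longrightarrow> cbox x (x + h *\<^sub>R One) \<subseteq> \<Omega>"
      using small_cubes_in_Omega[of "{x}"] x(1) by (metis compact_sing empty_subsetI insert_subset singletonI)
    define h where "h = min d d' / 2"
    have h: "0 < h" "h < d" "h < d'" using d(1) d'(1) by (auto simp: h_def min_def)
    have "(LINT y|L. indicator (box x (x + h *\<^sub>R One)) y *\<^sub>R Z y) = 0"
      using h d'(2) by (intro box0) (auto simp: inner_add_left)
    then show False using d(2)[OF h(1,2)] by simp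
  qed
  then have "AE x in L. x \<notin> N \<longrightarrow> V x = W x" by (intro AE_I2) (auto simp: Z_def)
  with AE_L_negligible[OF N(1)] show ?thesis by (rule AE_mp)
qed

lemma W1inf_grad:
  assumes "v \<in> W1inf \<Omega>"
  shows "grad \<Omega> v \<in> Linf \<Omega>" "weak_gradient \<Omega> v (grad \<Omega> v)"
proof -
  have "\<exists>V. V \<in> Linf \<Omega> \<and> weak_gradient \<Omega> v V" using assms by (auto simp: W1inf_def)
  from someI_ex[OF this] show "grad \<Omega> v \<in> Linf \<Omega>" "weak_gradient \<Omega> v (grad \<Omega> v)" by (auto simp: grad_def)
qed

lemma W1infI: "v \<in> Linf \<Omega> \<Longrightarrow> V \<in> Linf \<Omega> \<Longrightarrow> weak_gradient \<Omega> v V \<Longrightarrow> v \<in> W1inf \<Omega>"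
  by (auto simp: W1inf_def)

lemma W1inf_Linf: "v \<in> W1inf \<Omega> \<Longrightarrow> v \<in> Linf \<Omega>"
  by (simp add: W1inf_def)

lemma test_function_bounded:
  assumes "test_function \<Omega> \<phi> d\<phi>"
  obtains B where "\<phi> \<in> borel_measurable L" "AE x in L. \<bar>\<phi> x\<bar> \<le> B" "d\<phi> \<in> Linf \<Omega>"
proof -
  have cont: "continuous_on UNIV \<phi>"
    using assms unfolding test_function_def gderiv_def
    by (meson continuous_at_imp_continuous_on has_derivative_continuous)
  have cont': "continuous_on UNIV d\<phi>" using assms by (simp add: test_function_def)
  have comp: "compact (closure \<Omega>)" using bounded_Omega by (simp add: compact_closure)
  obtain B where B: "\<And>x. x \<in> closure \<Omega> \<Longrightarrow> norm (\<phi> x) \<le> B"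
    using compact_imp_bounded[OF compact_continuous_image[OF continuous_on_subset[OF cont] comp]]
    by (auto simp: bounded_iff)
  obtain B' where B': "\<And>x. x \<in> closure \<Omega> \<Longrightarrow> norm (d\<phi> x) \<le> B'"
    using compact_imp_bounded[OF compact_continuous_image[OF continuous_on_subset[OF cont'] comp]]
    by (auto simp: bounded_iff)
  show thesis
  proof (rule that[of B])
    show "AE x in L. \<bar>\<phi> x\<bar> \<le> B" using B closure_subset by (intro AE_I2) force
    show "d\<phi> \<in> Linf \<Omega>" using B' closure_subset by (intro LinfI[of _ B'] continuous_measurable_L cont' AE_I2) force
  qed (rule continuous_measurable_L[OF cont])
qed

lemma weak_gradient_linear:
  assumes v: "v \<in> Linf \<Omega>" "V \<in> Linf \<Omega>" "weak_gradient \<Omega> v V"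
    and w: "w \<in> Linf \<Omega>" "W \<in> Linf \<Omega>" "weak_gradient \<Omega> w W"
  shows "weak_gradient \<Omega> (\<lambda>x. v x + c * w x) (\<lambda>x. V x + c *\<^sub>R W x)"
  unfolding weak_gradient_def
proof (intro allI impI)
  fix \<phi> d\<phi> assume t: "test_function \<Omega> \<phi> d\<phi>"
  obtain B where B: "\<phi> \<in> borel_measurable L" "AE x in L. \<bar>\<phi> x\<bar> \<le> B" "d\<phi> \<in> Linf \<Omega>"
    using test_function_bounded[OF t] by blast
  have i: "integrable L (\<lambda>x. v x *\<^sub>R d\<phi> x)" "integrable L (\<lambda>x. w x *\<^sub>R d\<phi> x)"
    by (intro integrable_Linf Linf_mult v w B)+
  have i': "integrable L (\<lambda>x. \<phi> x *\<^sub>R V x)" "integrable L (\<lambda>x. \<phi> x *\<^sub>R W x)"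
    by (intro integrable_bounded_mult[OF B(1,2)] integrable_Linf v w)+
  have "(LINT x|L. (v x + c * w x) *\<^sub>R d\<phi> x) = (LINT x|L. v x *\<^sub>R d\<phi> x) + c *\<^sub>R (LINT x|L. w x *\<^sub>R d\<phi> x)"
    using i by (simp add: scaleR_add_left flip: scaleR_scaleR)
  also have "\<dots> = - ((LINT x|L. \<phi> x *\<^sub>R V x) + c *\<^sub>R (LINT x|L. \<phi> x *\<^sub>R W x))"
    using v(3) w(3) t unfolding weak_gradient_def by simp
  also have "(LINT x|L. \<phi> x *\<^sub>R V x) + c *\<^sub>R (LINT x|L. \<phi> x *\<^sub>R W x) = (LINT x|L. \<phi> x *\<^sub>R V x + c *\<^sub>R (\<phi> x *\<^sub>R W x))"
    by (subst Bochner_Integration.integral_add[OF i'(1) integrable_scaleR_right[OF i'(2)]]) (simp only: integral_scaleR_right)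
  also have "(\<lambda>x. \<phi> x *\<^sub>R V x + c *\<^sub>R (\<phi> x *\<^sub>R W x)) = (\<lambda>x. \<phi> x *\<^sub>R (V x + c *\<^sub>R W x))"
    by (simp add: algebra_simps)
  finally show "(LINT x|L. (v x + c * w x) *\<^sub>R d\<phi> x) = - (LINT x|L. \<phi> x *\<^sub>R (V x + c *\<^sub>R W x))" .
qed

lemma
  assumes v: "v \<in> W1inf \<Omega>" and w: "w \<in> W1inf \<Omega>"
  shows W1inf_linear: "(\<lambda>x. v x + c * w x) \<in> W1inf \<Omega>"
    and grad_linear: "AE x in L. grad \<Omega> (\<lambda>x. v x + c * w x) x = grad \<Omega> v x + c *\<^sub>R grad \<Omega> w x"
proof -
  have l: "(\<lambda>x. v x + c * w x) \<in> Linf \<Omega>"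
    using Linf_add[OF W1inf_Linf[OF v] Linf_scaleR[OF W1inf_Linf[OF w], of c]] by simp
  have l': "(\<lambda>x. grad \<Omega> v x + c *\<^sub>R grad \<Omega> w x) \<in> Linf \<Omega>"
    by (rule Linf_add[OF W1inf_grad(1)[OF v] Linf_scaleR[OF W1inf_grad(1)[OF w]]])
  have wg: "weak_gradient \<Omega> (\<lambda>x. v x + c * w x) (\<lambda>x. grad \<Omega> v x + c *\<^sub>R grad \<Omega> w x)"
    by (rule weak_gradient_linear[OF W1inf_Linf[OF v] W1inf_grad[OF v] W1inf_Linf[OF w] W1inf_grad[OF w]])
  show W: "(\<lambda>x. v x + c * w x) \<in> W1inf \<Omega>" by (rule W1infI[OF l l' wg])
  show "AE x in L. grad \<Omega> (\<lambda>x. v x + c * w x) x = grad \<Omega> v x + c *\<^sub>R grad \<Omega> w x"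
    by (rule weak_gradient_unique[OF W1inf_grad[OF W] l' wg])
qed

lemma measure_L_box:
  assumes "\<And>i. i \<in> Basis \<Longrightarrow> a \<bullet> i \<le> b \<bullet> i" "cbox a b \<subseteq> \<Omega>"
  shows "box a b \<in> sets L" "measure L (box a b) = (\<Prod>i\<in>Basis. (b - a) \<bullet> i)"
proof -
  have sub: "box a b \<subseteq> \<Omega>" using assms(2) box_subset_cbox by blast
  then show "box a b \<in> sets L" by (simp add: sets_L_iff)
  have "measure L (box a b) = measure lborel (box a b)"
    using sub by (simp add: measure_restrict_space)
  then show "measure L (box a b) = (\<Prod>i\<in>Basis. (b - a) \<bullet> i)"
    using assms(1) by (simp add: measure_lborel_box_eq)
qed

lemma smooth_box_translate_has_derivative:
  "((\<lambda>s. smooth_box a b n (y - s *\<^sub>R c)) has_real_derivative - (c \<bullet> smooth_box_grad a b n (y - t *\<^sub>R c))) (at t)"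
proof -
  have 1: "((\<lambda>s. y - s *\<^sub>R c) has_derivative (\<lambda>s. - (s *\<^sub>R c))) (at t)"
    by (auto intro!: derivative_eq_intros)
  have 2: "(smooth_box a b n has_derivative (\<lambda>h. h \<bullet> smooth_box_grad a b n (y - t *\<^sub>R c))) (at (y - t *\<^sub>R c))"
    using GDERIV_smooth_box unfolding gderiv_def .
  from has_derivative_compose[OF 1 2] show ?thesis
    unfolding has_field_derivative_def by (rule has_derivative_eq_rhs) (auto simp: fun_eq_iff)
qed

text \<open>Integrating a smoothed indicator against \<open>v\<close> and moving the box by \<open>t c\<close> gives a function of \<open>t\<close>
  whose derivative is controlled by the weak gradient.\<close>

lemma translated_smooth_box_integrals:
  fixes v :: "'a \<Rightarrow> real"
  assumes v: "v \<in> Linf \<Omega>" and V: "V \<in> Linf \<Omega>" "weak_gradient \<Omega> v V"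
    and M: "AE x in L. norm (V x) \<le> M" "M \<ge> 0"
    and ab: "\<And>i. i \<in> Basis \<Longrightarrow> a \<bullet> i \<le> b \<bullet> i"
    and sub: "\<And>t. 0 \<le> t \<Longrightarrow> t \<le> 1 \<Longrightarrow> cbox (a + t *\<^sub>R c) (b + t *\<^sub>R c) \<subseteq> \<Omega>"
  shows "\<bar>(LINT y|L. smooth_box (a + c) (b + c) n y *\<^sub>R v y) - (LINT y|L. smooth_box a b n y *\<^sub>R v y)\<bar>
    \<le> M * norm c * (\<Prod>i\<in>Basis. (b - a) \<bullet> i)"
proof -
  define \<eta> where "\<eta> t y = smooth_box (a + t *\<^sub>R c) (b + t *\<^sub>R c) n y" for t y
  define d\<eta> where "d\<eta> t y = smooth_box_grad (a + t *\<^sub>R c) (b + t *\<^sub>R c) n y" for t y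
  define H where "H t = (LINT y|L. \<eta> t y *\<^sub>R v y)" for t
  have \<eta>_eq: "\<eta> t y = smooth_box a b n (y - t *\<^sub>R c)" for t y by (simp add: \<eta>_def smooth_box_translate)
  have d\<eta>_eq: "d\<eta> t y = smooth_box_grad a b n (y - t *\<^sub>R c)" for t y by (simp add: d\<eta>_def smooth_box_grad_translate)
  have abt: "(a + t *\<^sub>R c) \<bullet> i \<le> (b + t *\<^sub>R c) \<bullet> i" if "i \<in> Basis" for t i using ab[OF that] by (simp add: inner_add_left)
  have int_v: "integrable L v" by (rule integrable_Linf[OF v])
  have int_V: "integrable L V" by (rule integrable_Linf[OF V(1)])
  have \<eta>_meas: "\<eta> t \<in> borel_measurable L" for t
    unfolding \<eta>_def by (intro continuous_measurable_L continuous_on_smooth_box)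
  have \<eta>_le: "AE y in L. \<bar>\<eta> t y\<bar> \<le> 1" for t unfolding \<eta>_def by (intro AE_I2 abs_smooth_box_le_1 abt)
  have int_\<eta>v: "integrable L (\<lambda>y. \<eta> t y *\<^sub>R v y)" for t by (rule integrable_bounded_mult[OF \<eta>_meas \<eta>_le int_v])
  have int_\<eta>V: "integrable L (\<lambda>y. \<eta> t y *\<^sub>R V y)" for t by (rule integrable_bounded_mult[OF \<eta>_meas \<eta>_le int_V])
  obtain R where R: "\<And>y. y \<in> \<Omega> \<Longrightarrow> norm y \<le> R" using bounded_Omega by (auto simp: bounded_iff)
  \<comment> \<open>All arguments of the shifted gradient that occur lie in one compact ball. The
    resulting bound makes the difference quotients dominated.\<close>
  have "bounded (smooth_box_grad a b n ` cball 0 (R + norm c))"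
    by (intro compact_imp_bounded compact_continuous_image continuous_on_smooth_box_grad compact_cball)
  then have "\<exists>B. \<forall>z\<in>cball 0 (R + norm c). norm (smooth_box_grad a b n z) \<le> B" by (simp add: bounded_iff)
  then obtain B where B: "\<And>z. z \<in> cball 0 (R + norm c) \<Longrightarrow> norm (smooth_box_grad a b n z) \<le> B" by blast
  have in_ball: "y - s *\<^sub>R c \<in> cball 0 (R + norm c)" if "y \<in> \<Omega>" "s \<in> {0..1}" for y s
  proof -
    have "norm (y - s *\<^sub>R c) \<le> norm y + \<bar>s\<bar> * norm c" using norm_triangle_ineq4[of y "s *\<^sub>R c"] by simp
    moreover have "\<bar>s\<bar> * norm c \<le> 1 * norm c" using that(2) by (intro mult_right_mono) auto
    ultimately show ?thesis using R[OF that(1)] by simp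
  qed
  have lip: "\<bar>\<eta> s y - \<eta> t y\<bar> \<le> norm c * B * \<bar>s - t\<bar>" if y: "y \<in> \<Omega>" and st: "s \<in> {0..1}" "t \<in> {0..1}" for s t y
  proof -
    have "norm (\<eta> s y - \<eta> t y) \<le> norm c * B * norm (s - t)"
      unfolding \<eta>_eq
    proof (rule field_differentiable_bound[where S = "{0..1}" and f' = "\<lambda>t. - (c \<bullet> smooth_box_grad a b n (y - t *\<^sub>R c))"])
      fix z :: real assume z: "z \<in> {0..1}"
      show "((\<lambda>s. smooth_box a b n (y - s *\<^sub>R c)) has_field_derivative - (c \<bullet> smooth_box_grad a b n (y - z *\<^sub>R c))) (at z within {0..1})"
        by (rule has_field_derivative_at_within[OF smooth_box_translate_has_derivative])
      have "\<bar>c \<bullet> smooth_box_grad a b n (y - z *\<^sub>R c)\<bar> \<le> norm c * norm (smooth_box_grad a b n (y - z *\<^sub>R c))"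
        by (rule Cauchy_Schwarz_ineq2)
      also have "\<dots> \<le> norm c * B" by (intro mult_left_mono B in_ball y z) auto
      finally show "norm (- (c \<bullet> smooth_box_grad a b n (y - z *\<^sub>R c))) \<le> norm c * B" by simp
    qed (use st in auto)
    then show ?thesis by simp
  qed
  \<comment> \<open>Differentiation under the integral sign, by dominated convergence along
    sequences. At parameter t the moved box is still inside \<Omega>, so its smoothed indicator is a
    test function and the limit can be rewritten with V.\<close>
  have deriv: "(H has_field_derivative c \<bullet> (LINT y|L. \<eta> t y *\<^sub>R V y)) (at t within {0..1})" if t: "t \<in> {0..1}" for t
    unfolding has_field_derivative_iff tendsto_at_iff_sequentially
  proof (intro allI impI)
    fix X :: "nat \<Rightarrow> real" assume X: "\<forall>i. X i \<in> {0..1} - {t}" "X \<longlonglongrightarrow> t"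
    have quot: "(H (X i) - H t) / (X i - t) = (LINT y|L. ((\<eta> (X i) y - \<eta> t y) / (X i - t)) *\<^sub>R v y)" for i
    proof -
      have "(LINT y|L. ((\<eta> (X i) y - \<eta> t y) / (X i - t)) *\<^sub>R v y) =
          (LINT y|L. (1 / (X i - t)) *\<^sub>R (\<eta> (X i) y *\<^sub>R v y - \<eta> t y *\<^sub>R v y))"
        by (intro Bochner_Integration.integral_cong refl) (simp add: algebra_simps diff_divide_distrib)
      also have "\<dots> = (1 / (X i - t)) *\<^sub>R (H (X i) - H t)"
        unfolding H_def integral_scaleR_right Bochner_Integration.integral_diff[OF int_\<eta>v int_\<eta>v] ..
      finally have eq: "(LINT y|L. ((\<eta> (X i) y - \<eta> t y) / (X i - t)) *\<^sub>R v y) = (1 / (X i - t)) *\<^sub>R (H (X i) - H t)" .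
      show ?thesis unfolding eq by simp
    qed
    have "(\<lambda>i. LINT y|L. ((\<eta> (X i) y - \<eta> t y) / (X i - t)) *\<^sub>R v y)
        \<longlonglongrightarrow> (LINT y|L. (- (c \<bullet> d\<eta> t y)) *\<^sub>R v y)"
    proof (rule integral_dominated_convergence[where w = "\<lambda>y. (norm c * B) *\<^sub>R norm (v y)"])
      show "AE y in L. (\<lambda>i. ((\<eta> (X i) y - \<eta> t y) / (X i - t)) *\<^sub>R v y) \<longlonglongrightarrow> (- (c \<bullet> d\<eta> t y)) *\<^sub>R v y"
      proof (rule AE_I2)
        fix y
        have "((\<lambda>s. (\<eta> s y - \<eta> t y) / (s - t)) \<longlongrightarrow> - (c \<bullet> d\<eta> t y)) (at t within {0..1})"
          unfolding \<eta>_eq d\<eta>_eq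
          using has_field_derivative_at_within[OF smooth_box_translate_has_derivative[of a b n y c t], of "{0..1}"]
          by (simp only: has_field_derivative_iff)
        then have "(\<lambda>i. (\<eta> (X i) y - \<eta> t y) / (X i - t)) \<longlonglongrightarrow> - (c \<bullet> d\<eta> t y)"
          using X unfolding tendsto_at_iff_sequentially comp_def by blast
        then show "(\<lambda>i. ((\<eta> (X i) y - \<eta> t y) / (X i - t)) *\<^sub>R v y) \<longlonglongrightarrow> (- (c \<bullet> d\<eta> t y)) *\<^sub>R v y"
          by (intro tendsto_scaleR tendsto_const)
      qed
      show "AE y in L. norm (((\<eta> (X i) y - \<eta> t y) / (X i - t)) *\<^sub>R v y) \<le> (norm c * B) *\<^sub>R norm (v y)" for i
      proof (rule AE_I2)
        fix y assume "y \<in> space L"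
        then have "\<bar>\<eta> (X i) y - \<eta> t y\<bar> \<le> norm c * B * \<bar>X i - t\<bar>" using X(1) t by (intro lip) auto
        then have "\<bar>(\<eta> (X i) y - \<eta> t y) / (X i - t)\<bar> \<le> norm c * B"
          using X(1) by (simp add: abs_divide pos_divide_le_eq)
        then show "norm (((\<eta> (X i) y - \<eta> t y) / (X i - t)) *\<^sub>R v y) \<le> (norm c * B) *\<^sub>R norm (v y)"
          unfolding real_scaleR_def norm_mult by (intro mult_right_mono) auto
      qed
      have [measurable]: "v \<in> borel_measurable L" using v by (rule Linf_measurable)
      note [measurable] = \<eta>_meas
      show "(\<lambda>y. ((\<eta> (X i) y - \<eta> t y) / (X i - t)) *\<^sub>R v y) \<in> borel_measurable L" for i by measurable
      have [measurable]: "d\<eta> t \<in> borel_measurable L"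
        unfolding d\<eta>_def by (intro continuous_measurable_L continuous_on_smooth_box_grad)
      show "(\<lambda>y. (- (c \<bullet> d\<eta> t y)) *\<^sub>R v y) \<in> borel_measurable L" by measurable
      show "integrable L (\<lambda>y. (norm c * B) *\<^sub>R norm (v y))" using int_v by auto
    qed
    moreover have "(LINT y|L. (- (c \<bullet> d\<eta> t y)) *\<^sub>R v y) = c \<bullet> (LINT y|L. \<eta> t y *\<^sub>R V y)"
    proof -
      have tf: "test_function \<Omega> (\<eta> t) (d\<eta> t)"
        unfolding \<eta>_def d\<eta>_def using t by (intro test_function_smooth_box abt sub) auto
      have "integrable L (\<lambda>y. v y *\<^sub>R d\<eta> t y)"
        using test_function_bounded[OF tf] by (metis Linf_mult integrable_Linf v)
      then have "(LINT y|L. c \<bullet> (v y *\<^sub>R d\<eta> t y)) = c \<bullet> (LINT y|L. v y *\<^sub>R d\<eta> t y)"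
        by (rule integral_inner_right)
      also have "\<dots> = - (c \<bullet> (LINT y|L. \<eta> t y *\<^sub>R V y))"
        using V(2)[unfolded weak_gradient_def, rule_format, OF tf] by simp
      finally have "- (LINT y|L. c \<bullet> (v y *\<^sub>R d\<eta> t y)) = c \<bullet> (LINT y|L. \<eta> t y *\<^sub>R V y)" by simp
      then show ?thesis by (simp add: mult.commute)
    qed
    ultimately show "((\<lambda>s. (H s - H t) / (s - t)) \<circ> X) \<longlonglongrightarrow> c \<bullet> (LINT y|L. \<eta> t y *\<^sub>R V y)"
      by (simp add: comp_def quot)
  qed
  have bound: "norm (c \<bullet> (LINT y|L. \<eta> t y *\<^sub>R V y)) \<le> M * norm c * (\<Prod>i\<in>Basis. (b - a) \<bullet> i)" if t: "t \<in> {0..1}" for t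
  proof -
    let ?A = "box (a + t *\<^sub>R c) (b + t *\<^sub>R c)"
    have A: "?A \<in> sets L" "measure L ?A = (\<Prod>i\<in>Basis. (b - a) \<bullet> i)"
      using measure_L_box[of "a + t *\<^sub>R c" "b + t *\<^sub>R c", OF abt sub] t by auto
    have "norm (LINT y|L. \<eta> t y *\<^sub>R V y) \<le> (LINT y|L. norm (\<eta> t y *\<^sub>R V y))" by (rule integral_norm_bound)
    \<comment> \<open>The smoothed indicator lies below the indicator of the moved box, whose volume
      is independent of t.\<close>
    also have "\<dots> \<le> (LINT y|L. M * indicator ?A y)"
    proof (rule integral_mono_AE)
      show "integrable L (\<lambda>y. norm (\<eta> t y *\<^sub>R V y))" by (rule integrable_norm[OF int_\<eta>V])
      show "integrable L (\<lambda>y. M * indicator ?A y)"         by (intro integrable_mult_right integrable_real_indicator A(1)) (simp add: less_top[symmetric])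
      show "AE y in L. norm (\<eta> t y *\<^sub>R V y) \<le> M * indicator ?A y"
        using M(1)
      proof eventually_elim
        case (elim y)
        have "\<bar>\<eta> t y\<bar> \<le> indicator ?A y"
          unfolding \<eta>_def using smooth_box_bounds[of "a + t *\<^sub>R c" "b + t *\<^sub>R c", OF abt] by simp
        then have "\<bar>\<eta> t y\<bar> * norm (V y) \<le> indicator ?A y * M" using elim by (intro mult_mono) auto
        then show ?case by (simp add: mult.commute)
      qed
    qed
    also have "\<dots> = M * measure L ?A" using A(1) by (simp add: sets_L_iff Int_absorb2)
    finally have "norm (LINT y|L. \<eta> t y *\<^sub>R V y) \<le> M * (\<Prod>i\<in>Basis. (b - a) \<bullet> i)" using A(2) by simp
    then have "norm c * norm (LINT y|L. \<eta> t y *\<^sub>R V y) \<le> norm c * (M * (\<Prod>i\<in>Basis. (b - a) \<bullet> i))"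
      by (intro mult_left_mono) auto
    moreover have "norm (c \<bullet> (LINT y|L. \<eta> t y *\<^sub>R V y)) \<le> norm c * norm (LINT y|L. \<eta> t y *\<^sub>R V y)"
      using Cauchy_Schwarz_ineq2 by simp
    ultimately show ?thesis by (simp add: mult.assoc mult.left_commute)
  qed
  have "norm (H 1 - H 0) \<le> M * norm c * (\<Prod>i\<in>Basis. (b - a) \<bullet> i) * norm (1 - 0 :: real)"
    by (rule field_differentiable_bound[where S = "{0..1}", OF _ deriv bound]) auto
  then show ?thesis by (simp add: H_def \<eta>_def)
qed

lemma translated_box_integrals:
  fixes v :: "'a \<Rightarrow> real"
  assumes v: "v \<in> Linf \<Omega>" and V: "V \<in> Linf \<Omega>" "weak_gradient \<Omega> v V"
    and M: "AE x in L. norm (V x) \<le> M" "M \<ge> 0"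
    and ab: "\<And>i. i \<in> Basis \<Longrightarrow> a \<bullet> i \<le> b \<bullet> i"
    and sub: "\<And>t. 0 \<le> t \<Longrightarrow> t \<le> 1 \<Longrightarrow> cbox (a + t *\<^sub>R c) (b + t *\<^sub>R c) \<subseteq> \<Omega>"
  shows "\<bar>(LINT y|L. indicator (box (a + c) (b + c)) y *\<^sub>R v y) - (LINT y|L. indicator (box a b) y *\<^sub>R v y)\<bar>
    \<le> M * norm c * (\<Prod>i\<in>Basis. (b - a) \<bullet> i)"
proof (rule LIMSEQ_le_const2)
  have abc: "(a + c) \<bullet> i \<le> (b + c) \<bullet> i" if "i \<in> Basis" for i using ab[OF that] by (simp add: inner_add_left)
  show "(\<lambda>n. \<bar>(LINT y|L. smooth_box (a + c) (b + c) n y *\<^sub>R v y) - (LINT y|L. smooth_box a b n y *\<^sub>R v y)\<bar>)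
      \<longlonglongrightarrow> \<bar>(LINT y|L. indicator (box (a + c) (b + c)) y *\<^sub>R v y) - (LINT y|L. indicator (box a b) y *\<^sub>R v y)\<bar>"
    by (intro tendsto_rabs tendsto_diff smooth_box_integral_tendsto ab abc integrable_Linf[OF v])
  show "\<exists>N. \<forall>n\<ge>N. \<bar>(LINT y|L. smooth_box (a + c) (b + c) n y *\<^sub>R v y) - (LINT y|L. smooth_box a b n y *\<^sub>R v y)\<bar>
      \<le> M * norm c * (\<Prod>i\<in>Basis. (b - a) \<bullet> i)"
    using translated_smooth_box_integrals[OF v V M ab sub] by blast
qed

text \<open>The exceptional set collects the points where cube averages fail to converge, so it does
  not depend on the pair of points. Compactness of the segment provides one cube size that fits
  inside \<Omega> along all of it.\<close>

lemma W1inf_lipschitz_on_segments: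
  fixes v :: "'a \<Rightarrow> real"
  assumes v: "v \<in> Linf \<Omega>" and V: "V \<in> Linf \<Omega>" "weak_gradient \<Omega> v V"
    and M: "AE x in L. norm (V x) \<le> M" "M \<ge> 0"
  obtains N where "negligible N"
    "\<And>x y. x \<in> \<Omega> - N \<Longrightarrow> y \<in> \<Omega> - N \<Longrightarrow> closed_segment x y \<subseteq> \<Omega> \<Longrightarrow> \<bar>v x - v y\<bar> \<le> M * dist x y"
proof -
  define A where "A h x = (LINT y|L. indicator (box x (x + h *\<^sub>R One)) y *\<^sub>R v y) /\<^sub>R h ^ DIM('a)" for h x
  have "\<exists>N. negligible N \<and> (\<forall>x e. x \<in> \<Omega> \<longrightarrow> x \<notin> N \<longrightarrow> e > 0 \<longrightarrow> (\<exists>d>0. \<forall>h. 0 < h \<and> h < d \<longrightarrow> norm (A h x - v x) < e))"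
    unfolding A_def by (rule Lebesgue_differentiation_cubes[OF integrable_Linf[OF v]])
  then obtain N where N: "negligible N"
    "\<And>x e. x \<in> \<Omega> \<Longrightarrow> x \<notin> N \<Longrightarrow> e > 0 \<Longrightarrow> \<exists>d>0. \<forall>h. 0 < h \<and> h < d \<longrightarrow> norm (A h x - v x) < e" by blast
  show thesis
  proof (rule that[OF N(1)])
    fix x y assume xy: "x \<in> \<Omega> - N" "y \<in> \<Omega> - N" and seg: "closed_segment x y \<subseteq> \<Omega>"
    show "\<bar>v x - v y\<bar> \<le> M * dist x y"
    proof (rule field_le_epsilon)
      fix e :: real assume e: "e > 0"
      obtain d1 where d1: "d1 > 0" "\<And>h. 0 < h \<Longrightarrow> h < d1 \<Longrightarrow> norm (A h x - v x) < e / 2"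
        using N(2)[of x "e / 2"] xy(1) e by auto
      obtain d2 where d2: "d2 > 0" "\<And>h. 0 < h \<Longrightarrow> h < d2 \<Longrightarrow> norm (A h y - v y) < e / 2"
        using N(2)[of y "e / 2"] xy(2) e by auto
      obtain d3 where d3: "d3 > 0" "\<And>z h. z \<in> closed_segment x y \<Longrightarrow> 0 < h \<Longrightarrow> h < d3 \<Longrightarrow> cbox z (z + h *\<^sub>R One) \<subseteq> \<Omega>"
        using small_cubes_in_Omega[OF compact_segment seg] by blast
      define h where "h = min d1 (min d2 d3) / 2"
      have h: "0 < h" "h < d1" "h < d2" "h < d3" using d1(1) d2(1) d3(1) by (auto simp: h_def min_def)
      have "\<bar>(LINT z|L. indicator (box (x + (y - x)) (x + h *\<^sub>R One + (y - x))) z *\<^sub>R v z) -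
          (LINT z|L. indicator (box x (x + h *\<^sub>R One)) z *\<^sub>R v z)\<bar>
          \<le> M * norm (y - x) * (\<Prod>i\<in>Basis. (x + h *\<^sub>R One - x) \<bullet> i)"
      proof (rule translated_box_integrals[OF v V M])
        fix t :: real assume t: "0 \<le> t" "t \<le> 1"
        have "x + t *\<^sub>R (y - x) \<in> closed_segment x y"
          using t by (auto simp: in_segment algebra_simps intro!: exI[of _ t])
        from d3(2)[OF this h(1,4)] show "cbox (x + t *\<^sub>R (y - x)) (x + h *\<^sub>R One + t *\<^sub>R (y - x)) \<subseteq> \<Omega>"
          by (simp add: add_ac)
      qed (use h in \<open>auto simp: inner_add_left\<close>)
      also have "(\<Prod>i\<in>Basis. (x + h *\<^sub>R One - x) \<bullet> i) = h ^ DIM('a)" by simp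
      also have "x + (y - x) = y" by simp
      also have "x + h *\<^sub>R One + (y - x) = y + h *\<^sub>R One" by simp
      finally have le: "\<bar>(LINT z|L. indicator (box y (y + h *\<^sub>R One)) z *\<^sub>R v z) -
          (LINT z|L. indicator (box x (x + h *\<^sub>R One)) z *\<^sub>R v z)\<bar> \<le> M * norm (y - x) * h ^ DIM('a)" .
      have "\<bar>A h y - A h x\<bar> = \<bar>(LINT z|L. indicator (box y (y + h *\<^sub>R One)) z *\<^sub>R v z) -
          (LINT z|L. indicator (box x (x + h *\<^sub>R One)) z *\<^sub>R v z)\<bar> / h ^ DIM('a)"
      proof -
        have "\<bar>P /\<^sub>R k - Q /\<^sub>R k\<bar> = \<bar>P - Q\<bar> / k" if "k > 0" for P Q k :: real
          using that by (simp add: divide_inverse_commute abs_mult flip: right_diff_distrib)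
        then show ?thesis unfolding A_def using h(1) by simp
      qed
      also have "\<dots> \<le> M * norm (y - x)" using le h(1) by (simp add: pos_divide_le_eq)
      finally have "\<bar>A h y - A h x\<bar> \<le> M * dist x y" by (simp add: dist_norm norm_minus_commute)
      then show "\<bar>v x - v y\<bar> \<le> M * dist x y + e"
        using d1(2)[OF h(1,2)] d2(2)[OF h(1,3)] unfolding real_norm_def by arith
    qed
  qed
qed

lemma segment_perturbation:
  assumes "closed_segment a b \<subseteq> \<Omega>"
  obtains e where "e > 0" "\<And>a' b'. dist a a' < e \<Longrightarrow> dist b b' < e \<Longrightarrow> closed_segment a' b' \<subseteq> \<Omega>"
proof -
  obtain e where e: "e > 0" "(\<Union>x\<in>closed_segment a b. ball x e) \<subseteq> \<Omega>"
    using compact_subset_open_imp_ball_epsilon_subset[OF compact_segment open_Omega assms] by blast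
  show thesis
  proof (rule that[OF e(1)])
    fix a' b' assume d: "dist a a' < e" "dist b b' < e"
    show "closed_segment a' b' \<subseteq> \<Omega>"
    proof
      fix z assume "z \<in> closed_segment a' b'"
      then obtain u where u: "0 \<le> u" "u \<le> 1" "z = (1 - u) *\<^sub>R a' + u *\<^sub>R b'" by (auto simp: in_segment)
      define p where "p = (1 - u) *\<^sub>R a + u *\<^sub>R b"
      have p: "p \<in> closed_segment a b" using u by (auto simp: p_def in_segment)
      have "p - z = (1 - u) *\<^sub>R (a - a') + u *\<^sub>R (b - b')" by (simp add: p_def u(3) algebra_simps)
      then have "norm (p - z) \<le> (1 - u) * norm (a - a') + u * norm (b - b')"
        using u norm_triangle_ineq[of "(1 - u) *\<^sub>R (a - a')" "u *\<^sub>R (b - b')"] by simp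
      also have "\<dots> < e"
        using convex_bound_lt[of "norm (a - a')" e "norm (b - b')" "1 - u" u] d u by (simp add: dist_norm)
      finally have "z \<in> ball p e" by (simp add: dist_norm)
      then show "z \<in> \<Omega>" using e(2) p by blast
    qed
  qed
qed

lemma points_off_negligible:
  assumes "negligible N" "p \<in> closure \<Omega>" "e > 0"
  obtains x where "x \<in> \<Omega> - N" "dist p x < e"
proof -
  have "\<Omega> \<inter> ball p e \<noteq> {}" using assms(2,3) by (metis Int_commute closure_approachable disjoint_iff dist_commute mem_ball)
  then have "\<not> negligible (\<Omega> \<inter> ball p e)" using open_Omega by (intro open_not_negligible) auto
  then have "\<not> \<Omega> \<inter> ball p e \<subseteq> N" using assms(1) negligible_subset by blast
  then obtain x where "x \<in> \<Omega> \<inter> ball p e" "x \<notin> N" by blast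
  then show thesis by (intro that[of x]) auto
qed

text \<open>The corners p and q may fall into the exceptional set, where the estimate on segments is
  silent. They are replaced by nearby points outside it; the three segments survive a small
  perturbation inside the open set.\<close>

lemma polyline_bound:
  fixes v :: "'a \<Rightarrow> real"
  assumes N: "negligible N"
    and lip: "\<And>x y. x \<in> \<Omega> - N \<Longrightarrow> y \<in> \<Omega> - N \<Longrightarrow> closed_segment x y \<subseteq> \<Omega> \<Longrightarrow> \<bar>v x - v y\<bar> \<le> M * dist x y"
    and M: "M \<ge> 0" and xy: "x \<in> \<Omega> - N" "y \<in> \<Omega> - N"
    and seg: "closed_segment x p \<subseteq> \<Omega>" "closed_segment p q \<subseteq> \<Omega>" "closed_segment q y \<subseteq> \<Omega>"
  shows "\<bar>v x - v y\<bar> \<le> M * (dist x p + dist p q + dist q y)"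
proof (rule field_le_epsilon)
  fix e :: real assume e: "e > 0"
  obtain e1 where e1: "e1 > 0" "\<And>a' b'. dist x a' < e1 \<Longrightarrow> dist p b' < e1 \<Longrightarrow> closed_segment a' b' \<subseteq> \<Omega>"
    using segment_perturbation[OF seg(1)] by blast
  obtain e2 where e2: "e2 > 0" "\<And>a' b'. dist p a' < e2 \<Longrightarrow> dist q b' < e2 \<Longrightarrow> closed_segment a' b' \<subseteq> \<Omega>"
    using segment_perturbation[OF seg(2)] by blast
  obtain e3 where e3: "e3 > 0" "\<And>a' b'. dist q a' < e3 \<Longrightarrow> dist y b' < e3 \<Longrightarrow> closed_segment a' b' \<subseteq> \<Omega>"
    using segment_perturbation[OF seg(3)] by blast
  \<comment> \<open>Besides the three perturbation radii, d must respect that each moved corner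
    belongs to two segments, which lengthens the path by at most 4 d.\<close>
  define d where "d = min (min e1 (min e2 e3)) (e / (4 * (M + 1)))"
  have d: "d > 0" "d \<le> e1" "d \<le> e2" "d \<le> e3" using e1(1) e2(1) e3(1) e M by (auto simp: d_def)
  have "d \<le> e / (4 * (M + 1))" by (simp add: d_def)
  then have "4 * d * (M + 1) \<le> e" using M by (simp add: field_simps)
  then have dM: "M * (4 * d) \<le> e" using d(1) by (simp add: algebra_simps)
  have "p \<in> closure \<Omega>" "q \<in> closure \<Omega>" using seg(2) closure_subset by auto
  then obtain p' q' where p': "p' \<in> \<Omega> - N" "dist p p' < d" and q': "q' \<in> \<Omega> - N" "dist q q' < d"
    using points_off_negligible[OF N _ d(1)] by metis
  have "\<bar>v x - v p'\<bar> \<le> M * dist x p'" using p' e1 d by (intro lip xy e1(2)) auto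
  moreover have "\<bar>v p' - v q'\<bar> \<le> M * dist p' q'" using p' q' d by (intro lip e2(2)) auto
  moreover have "\<bar>v q' - v y\<bar> \<le> M * dist q' y" using q' e3 d by (intro lip xy e3(2)) auto
  ultimately have "\<bar>v x - v y\<bar> \<le> M * dist x p' + M * dist p' q' + M * dist q' y" by linarith
  also have "\<dots> = M * (dist x p' + dist p' q' + dist q' y)" by (simp add: algebra_simps)
  also have "\<dots> \<le> M * (dist x p + dist p q + dist q y + 4 * d)"
  proof (intro mult_left_mono M)
    have "dist x p' \<le> dist x p + dist p p'" by (rule dist_triangle)
    moreover have "dist p' q' \<le> dist p p' + dist p q + dist q q'"
      using dist_triangle[of p' q' p] dist_triangle[of p q' q] by (simp add: dist_commute)
    moreover have "dist q' y \<le> dist q q' + dist q y" by (metis dist_commute dist_triangle)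
    ultimately show "dist x p' + dist p' q' + dist q' y \<le> dist x p + dist p q + dist q y + 4 * d"
      using p'(2) q'(2) by linarith
  qed
  finally show "\<bar>v x - v y\<bar> \<le> M * (dist x p + dist p q + dist q y) + e"
    using dM by (simp add: distrib_left)
qed

end

section \<open>Traces on Lipschitz domains\<close>

locale bounded_lipschitz_domain = bounded_open_set +
  assumes lipschitz_boundary_Omega: "lipschitz_boundary \<Omega>"
begin

text \<open>The radius r / (2 K + 1) leaves room for the lift: two such points are less than twice
  this radius apart, so the height K \<open>dist x y\<close> keeps the lifted segment inside the
  ball where the chart describes \<Omega>.\<close>

lemma epigraph_segments:
  fixes e :: 'a and \<psi> :: "'a \<Rightarrow> real"
  assumes e: "norm e = 1" and lip: "K-lipschitz_on {y. e \<bullet> y = 0} \<psi>" and r: "0 < r"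
    and chart: "\<Omega> \<inter> ball p r = {y \<in> ball p r. \<psi> (y - (e \<bullet> y) *\<^sub>R e) < e \<bullet> y}"
    and x: "x \<in> \<Omega>" "dist p x < r / (2 * K + 1)" and y: "y \<in> \<Omega>" "dist p y < r / (2 * K + 1)"
  shows "closed_segment x (x + (K * dist x y) *\<^sub>R e) \<subseteq> \<Omega>"
    and "closed_segment (x + (K * dist x y) *\<^sub>R e) (y + (K * dist x y) *\<^sub>R e) \<subseteq> \<Omega>"
proof -
  have K: "K \<ge> 0" using lip by (rule lipschitz_on_nonneg)
  define \<pi> where "\<pi> z = z - (e \<bullet> z) *\<^sub>R e" for z
  have ee: "e \<bullet> e = 1" using e by (simp add: dot_square_norm)
  have \<pi>_in: "\<pi> z \<in> {y. e \<bullet> y = 0}" for z by (simp add: \<pi>_def inner_diff_right ee)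
  have \<pi>_add: "\<pi> (z + s *\<^sub>R e) = \<pi> z" for z s
    by (simp add: \<pi>_def inner_add_right ee algebra_simps)
  have \<pi>_norm: "norm (\<pi> z) \<le> norm z" for z
  proof -
    have "(norm (\<pi> z))\<^sup>2 = \<pi> z \<bullet> \<pi> z" by (simp add: dot_square_norm)
    also have "\<dots> = z \<bullet> z - (e \<bullet> z)\<^sup>2"
      by (simp add: \<pi>_def inner_diff_left inner_diff_right ee inner_commute power2_eq_square)
    also have "\<dots> \<le> (norm z)\<^sup>2" by (simp add: dot_square_norm)
    finally show ?thesis by (rule power2_le_imp_le) simp
  qed
  have \<pi>_lin: "\<pi> ((1 - u) *\<^sub>R z + u *\<^sub>R w) = (1 - u) *\<^sub>R \<pi> z + u *\<^sub>R \<pi> w" for u z w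
    by (simp add: \<pi>_def inner_add_right algebra_simps)
  have \<psi>_le: "\<psi> a \<le> \<psi> b + K * norm (a - b)" if "e \<bullet> a = 0" "e \<bullet> b = 0" for a b
    using lipschitz_onD[OF lip, of a b] that by (simp add: dist_real_def dist_norm abs_le_iff)
  have mem: "z \<in> \<Omega>" if "dist p z < r" "\<psi> (\<pi> z) < e \<bullet> z" for z
  proof -
    have "z \<in> \<Omega> \<inter> ball p r" unfolding chart using that by (simp add: \<pi>_def)
    then show ?thesis by simp
  qed
  have le_r: "r / (2 * K + 1) \<le> r" using r K by (simp add: field_simps)
  have memD: "\<psi> (\<pi> z) < e \<bullet> z" if "z \<in> \<Omega>" "dist p z < r / (2 * K + 1)" for z
  proof -
    have "z \<in> \<Omega> \<inter> ball p r" using that le_r by simp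
    then show ?thesis unfolding chart by (simp add: \<pi>_def)
  qed
  define t where "t = K * dist x y"
  have t0: "t \<ge> 0" using K by (simp add: t_def)
  have rad: "dist p z + t < r" if "dist p z < r / (2 * K + 1)" for z
  proof -
    have "dist x y < 2 * (r / (2 * K + 1))" using dist_triangle2[of x y p] x(2) y(2) by (simp add: dist_commute)
    then have "t \<le> K * (2 * (r / (2 * K + 1)))" unfolding t_def using K by (intro mult_left_mono) auto
    moreover have "r / (2 * K + 1) + K * (2 * (r / (2 * K + 1))) = r / (2 * K + 1) * (2 * K + 1)"
      by (simp only: distrib_left mult_1_right) (simp add: mult.commute mult.left_commute)
    moreover have "r / (2 * K + 1) * (2 * K + 1) = r" using K by simp
    ultimately show ?thesis using that by linarith
  qed
  have near: "dist p (z + s *\<^sub>R e) < r" if "dist p z < r / (2 * K + 1)" "0 \<le> s" "s \<le> t" for z s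
  proof -
    have "dist p (z + s *\<^sub>R e) \<le> dist p z + dist z (z + s *\<^sub>R e)" by (rule dist_triangle)
    also have "dist z (z + s *\<^sub>R e) = s" using that e by (simp add: dist_norm)
    finally show ?thesis using rad[OF that(1)] that by linarith
  qed
  have "closed_segment x (x + t *\<^sub>R e) \<subseteq> \<Omega>"
  proof
    fix z assume "z \<in> closed_segment x (x + t *\<^sub>R e)"
    then obtain u where u: "0 \<le> u" "u \<le> 1" "z = x + (u * t) *\<^sub>R e" by (auto simp: in_segment algebra_simps)
    have "u * t \<le> 1 * t" using u t0 by (intro mult_right_mono) auto
    then have "dist p z < r" unfolding u(3) using u t0 by (intro near x) auto
    moreover have "\<psi> (\<pi> z) < e \<bullet> z"
      using memD[OF x] mult_nonneg_nonneg[OF u(1) t0] by (simp add: u(3) \<pi>_add inner_add_right ee)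
    ultimately show "z \<in> \<Omega>" by (rule mem)
  qed
  then show "closed_segment x (x + (K * dist x y) *\<^sub>R e) \<subseteq> \<Omega>" by (simp add: t_def)
  have "closed_segment (x + t *\<^sub>R e) (y + t *\<^sub>R e) \<subseteq> \<Omega>"
  proof
    fix z assume "z \<in> closed_segment (x + t *\<^sub>R e) (y + t *\<^sub>R e)"
    then obtain u where u: "0 \<le> u" "u \<le> 1" "z = (1 - u) *\<^sub>R (x + t *\<^sub>R e) + u *\<^sub>R (y + t *\<^sub>R e)" by (auto simp: in_segment)
    define w where "w = (1 - u) *\<^sub>R x + u *\<^sub>R y"
    have z: "z = w + t *\<^sub>R e" by (simp add: u(3) w_def algebra_simps)
    have "w \<in> ball p (r / (2 * K + 1))"
      using convexD[OF convex_ball[of p "r / (2 * K + 1)"], of x y "1 - u" u] x(2) y(2) u by (simp add: w_def)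
    then have "dist p z < r" unfolding z using t0 by (intro near) auto
    moreover have "\<psi> (\<pi> z) < e \<bullet> z"
    proof -
      have e0: "e \<bullet> \<pi> v = 0" for v using \<pi>_in[of v] by simp
      have \<pi>w: "\<pi> z = (1 - u) *\<^sub>R \<pi> x + u *\<^sub>R \<pi> y" unfolding z \<pi>_add w_def \<pi>_lin ..
      have xy: "norm (\<pi> x - \<pi> y) \<le> dist x y"
        using \<pi>_norm[of "x - y"] by (simp add: \<pi>_def dist_norm inner_diff_right algebra_simps)
      have "\<pi> z - \<pi> x = u *\<^sub>R (\<pi> y - \<pi> x)" "\<pi> z - \<pi> y = (1 - u) *\<^sub>R (\<pi> x - \<pi> y)"
        by (simp_all add: \<pi>w algebra_simps)
      then have n: "norm (\<pi> z - \<pi> x) \<le> u * dist x y" "norm (\<pi> z - \<pi> y) \<le> (1 - u) * dist x y"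
        using u xy by (auto simp: norm_minus_commute intro!: mult_left_mono)
      have 1: "\<psi> (\<pi> z) \<le> \<psi> (\<pi> x) + K * (u * dist x y)"
        using \<psi>_le[OF e0 e0, of z x] mult_left_mono[OF n(1) K] by linarith
      have 2: "\<psi> (\<pi> z) \<le> \<psi> (\<pi> y) + K * ((1 - u) * dist x y)"
        using \<psi>_le[OF e0 e0, of z y] mult_left_mono[OF n(2) K] by linarith
      \<comment> \<open>The Lipschitz bounds from both endpoints are averaged with the weights of
        the convex combination. The excess over the interpolated values is 2 u (1 - u) t, which the
        lift by t absorbs.\<close>
      have "\<psi> (\<pi> z) = (1 - u) * \<psi> (\<pi> z) + u * \<psi> (\<pi> z)" by (simp add: algebra_simps)
      also have "\<dots> \<le> (1 - u) * (\<psi> (\<pi> x) + K * (u * dist x y)) + u * (\<psi> (\<pi> y) + K * ((1 - u) * dist x y))"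
        using 1 2 u by (intro add_mono mult_left_mono) auto
      also have "\<dots> = (1 - u) * \<psi> (\<pi> x) + u * \<psi> (\<pi> y) + 2 * (u * (1 - u)) * t"
        by (simp add: t_def algebra_simps)
      also have "\<dots> \<le> (1 - u) * \<psi> (\<pi> x) + u * \<psi> (\<pi> y) + 1 * t"
      proof -
        have "0 \<le> (1 - 2 * u)\<^sup>2" by simp
        then have "2 * (u * (1 - u)) \<le> 1" by (simp add: power2_eq_square algebra_simps)
        then show ?thesis using t0 by (intro add_left_mono mult_right_mono) auto
      qed
      also have "\<dots> < (1 - u) * (e \<bullet> x) + u * (e \<bullet> y) + 1 * t"
      \<comment> \<open>Strictness must come from an endpoint with positive weight, so the case in
        which y has weight 0 is separate.\<close>
      proof (cases "u = 0")
        case True then show ?thesis using memD[OF x] by simp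
      next
        case False
        then have "u * \<psi> (\<pi> y) < u * (e \<bullet> y)" using u memD[OF y] by simp
        moreover have "(1 - u) * \<psi> (\<pi> x) \<le> (1 - u) * (e \<bullet> x)" using u memD[OF x] by (intro mult_left_mono) auto
        ultimately show ?thesis by linarith
      qed
      also have "\<dots> = e \<bullet> z" by (simp add: z w_def inner_add_right ee)
      finally show ?thesis .
    qed
    ultimately show "z \<in> \<Omega>" by (rule mem)
  qed
  then show "closed_segment (x + (K * dist x y) *\<^sub>R e) (y + (K * dist x y) *\<^sub>R e) \<subseteq> \<Omega>" by (simp add: t_def)
qed

text \<open>At interior points the segment estimate applies inside a ball. At boundary points the
  path up, across and down has length (2 K + 1) \<open>dist x y\<close>, so the constant M grows by
  the factor 2 K + 1.\<close>

lemma W1inf_locally_lipschitz: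
  fixes v :: "'a \<Rightarrow> real"
  assumes N: "negligible N"
    and lip: "\<And>x y. x \<in> \<Omega> - N \<Longrightarrow> y \<in> \<Omega> - N \<Longrightarrow> closed_segment x y \<subseteq> \<Omega> \<Longrightarrow> \<bar>v x - v y\<bar> \<le> M * dist x y"
    and M: "M \<ge> 0" and p: "p \<in> closure \<Omega>"
  shows "\<exists>r>0. \<exists>C\<ge>0. \<forall>x\<in>\<Omega> - N. \<forall>y\<in>\<Omega> - N. dist p x < r \<longrightarrow> dist p y < r \<longrightarrow> \<bar>v x - v y\<bar> \<le> C * dist x y"
proof (cases "p \<in> \<Omega>")
  case True
  then obtain r where r: "r > 0" "ball p r \<subseteq> \<Omega>" using open_Omega open_contains_ball by blast
  have "\<bar>v x - v y\<bar> \<le> M * dist x y" if "x \<in> \<Omega> - N" "y \<in> \<Omega> - N" "dist p x < r" "dist p y < r" for x y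
  proof (rule lip[OF that(1,2)])
    have "closed_segment x y \<subseteq> ball p r" using that by (intro closed_segment_subset) auto
    then show "closed_segment x y \<subseteq> \<Omega>" using r(2) by blast
  qed
  then show ?thesis using r(1) M by blast
next
  case False
  then have front: "p \<in> frontier \<Omega>" using p open_Omega by (simp add: frontier_def interior_open)
  obtain e r K \<psi> where c: "norm e = 1" "0 < r" "K-lipschitz_on {y. e \<bullet> y = 0} \<psi>"
    "\<Omega> \<inter> ball p r = {y \<in> ball p r. \<psi> (y - (e \<bullet> y) *\<^sub>R e) < e \<bullet> y}"
    using bspec[OF lipschitz_boundary_Omega[unfolded lipschitz_boundary_def] front] by (elim exE conjE) (rule that)
  have K: "K \<ge> 0" using c(3) by (rule lipschitz_on_nonneg)
  have "\<bar>v x - v y\<bar> \<le> (M * (2 * K + 1)) * dist x y"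
    if xy: "x \<in> \<Omega> - N" "y \<in> \<Omega> - N" "dist p x < r / (2 * K + 1)" "dist p y < r / (2 * K + 1)" for x y
  proof -
    let ?t = "K * dist x y"
    have seg: "closed_segment x (x + ?t *\<^sub>R e) \<subseteq> \<Omega>" "closed_segment (x + ?t *\<^sub>R e) (y + ?t *\<^sub>R e) \<subseteq> \<Omega>"
      using epigraph_segments[OF c(1,3,2,4), of x y] xy by auto
    have seg': "closed_segment (y + ?t *\<^sub>R e) y \<subseteq> \<Omega>"
      using epigraph_segments(1)[OF c(1,3,2,4), of y x] xy by (simp add: dist_commute closed_segment_commute)
    have "\<bar>v x - v y\<bar> \<le> M * (dist x (x + ?t *\<^sub>R e) + dist (x + ?t *\<^sub>R e) (y + ?t *\<^sub>R e) + dist (y + ?t *\<^sub>R e) y)"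
      by (rule polyline_bound[OF N lip M xy(1,2) seg seg'])
    also have "\<dots> = (M * (2 * K + 1)) * dist x y"
      using c(1) K by (simp add: dist_norm abs_mult algebra_simps)
    finally show ?thesis .
  qed
  moreover have "r / (2 * K + 1) > 0" "M * (2 * K + 1) \<ge> 0" using c(2) K M by auto
  ultimately show ?thesis by blast
qed

text \<open>One constant and one radius serve all points. Restricted to a boundary part this yields
  the local Lipschitz condition with uniform constant in \<open>W1inf_surface_bound\<close>.\<close>

definition uniformly_locally_lipschitz :: "'a set \<Rightarrow> ('a \<Rightarrow> real) \<Rightarrow> bool" where
  "uniformly_locally_lipschitz S w \<longleftrightarrow>
     (\<exists>C\<ge>0. \<exists>d>0. \<forall>x\<in>S. \<forall>y\<in>S. dist x y < d \<longrightarrow> \<bar>w x - w y\<bar> \<le> C * dist x y)"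

text \<open>Compactness of the closure turns the local estimates into a uniform one off the
  negligible set N. Hence v extends by uniform continuity from \<Omega> - N, which is still dense in
  the closure, and the Lipschitz bound passes to limits of sequences.\<close>

lemma W1inf_trace_exists:
  assumes v: "v \<in> W1inf \<Omega>"
  obtains w where "continuous_on (closure \<Omega>) w" "AE x in L. w x = v x" "uniformly_locally_lipschitz (closure \<Omega>) w"
proof -
  obtain M where M: "M \<ge> 0" "AE x in L. norm (grad \<Omega> v x) \<le> M"
    using W1inf_grad(1)[OF v] by (rule LinfE)
  obtain N where N: "negligible N" and lip: "\<And>x y. x \<in> \<Omega> - N \<Longrightarrow> y \<in> \<Omega> - N \<Longrightarrow> closed_segment x y \<subseteq> \<Omega> \<Longrightarrow> \<bar>v x - v y\<bar> \<le> M * dist x y"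
    using W1inf_lipschitz_on_segments[OF W1inf_Linf[OF v] W1inf_grad[OF v] M(2,1)] by blast
  have "\<forall>p\<in>closure \<Omega>. \<exists>r>0. \<exists>C\<ge>0. \<forall>x\<in>\<Omega> - N. \<forall>y\<in>\<Omega> - N. dist p x < r \<longrightarrow> dist p y < r \<longrightarrow> \<bar>v x - v y\<bar> \<le> C * dist x y"
    using W1inf_locally_lipschitz[OF N lip M(1)] by blast
  then obtain r C where rC: "\<And>p. p \<in> closure \<Omega> \<Longrightarrow> r p > 0" "\<And>p. p \<in> closure \<Omega> \<Longrightarrow> C p \<ge> 0"
    "\<And>p x y. p \<in> closure \<Omega> \<Longrightarrow> x \<in> \<Omega> - N \<Longrightarrow> y \<in> \<Omega> - N \<Longrightarrow> dist p x < r p \<Longrightarrow> dist p y < r p \<Longrightarrow> \<bar>v x - v y\<bar> \<le> C p * dist x y"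
    by metis
  have comp: "compact (closure \<Omega>)" using bounded_Omega by (simp add: compact_closure)
  obtain P where P: "P \<subseteq> closure \<Omega>" "finite P" "closure \<Omega> \<subseteq> (\<Union>p\<in>P. ball p (r p))"
    by (rule compactE_image[OF comp, of "closure \<Omega>" "\<lambda>p. ball p (r p)"]) (use rC(1) in auto)
  \<comment> \<open>d is a Lebesgue number of the cover: points closer than d share a ball of the
    finite cover. The sum of the finitely many local constants then dominates whichever one
    applies.\<close>
  obtain d where d: "d > 0" "\<And>x. x \<in> closure \<Omega> \<Longrightarrow> \<exists>G\<in>(\<lambda>p. ball p (r p)) ` P. ball x d \<subseteq> G"
    by (rule Heine_Borel_lemma[OF comp P(3)]) auto
  define C0 where "C0 = (\<Sum>p\<in>P. C p)"
  have C0: "C0 \<ge> 0" using P(1) rC(2) by (auto simp: C0_def intro!: sum_nonneg)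
  have unif: "\<bar>v x - v y\<bar> \<le> C0 * dist x y" if xy: "x \<in> \<Omega> - N" "y \<in> \<Omega> - N" "dist x y < d" for x y
  proof -
    have "x \<in> closure \<Omega>" using xy closure_subset by auto
    then obtain p where p: "p \<in> P" "ball x d \<subseteq> ball p (r p)" using d(2) by blast
    have "x \<in> ball x d" "y \<in> ball x d" using xy d(1) by auto
    then have "x \<in> ball p (r p)" "y \<in> ball p (r p)" using subsetD[OF p(2)] by blast+
    then have "dist p x < r p" "dist p y < r p" by auto
    then have "\<bar>v x - v y\<bar> \<le> C p * dist x y" using p(1) P(1) xy by (intro rC(3)) auto
    also have "\<dots> \<le> C0 * dist x y"
      unfolding C0_def using P rC(2) p(1) by (intro mult_right_mono member_le_sum) auto
    finally show ?thesis .
  qed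
  have uc: "uniformly_continuous_on (\<Omega> - N) v"
    unfolding uniformly_continuous_on_def
  proof (intro allI impI)
    fix e :: real assume e: "e > 0"
    define d' where "d' = min d (e / (C0 + 1))"
    have "d' > 0" using d(1) e C0 by (simp add: d'_def)
    moreover have "dist (v y) (v x) < e" if "x \<in> \<Omega> - N" "y \<in> \<Omega> - N" "dist y x < d'" for x y
    proof -
      have "dist y x < e / (C0 + 1)" using that(3) by (simp add: d'_def)
      then have "(C0 + 1) * dist y x < e" using C0 by (simp add: field_simps)
      moreover have "C0 * dist y x \<le> (C0 + 1) * dist y x" by (intro mult_right_mono) auto
      ultimately have "C0 * dist y x < e" by linarith
      moreover have "\<bar>v y - v x\<bar> \<le> C0 * dist y x" using that by (intro unif) (auto simp: d'_def)
      ultimately show ?thesis by (simp add: dist_real_def)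
    qed
    ultimately show "\<exists>d>0. \<forall>x\<in>\<Omega> - N. \<forall>x'\<in>\<Omega> - N. dist x' x < d \<longrightarrow> dist (v x') (v x) < e" by blast
  qed
  have cl: "closure (\<Omega> - N) = closure \<Omega>"
  proof
    show "closure (\<Omega> - N) \<subseteq> closure \<Omega>" by (rule closure_mono) auto
    show "closure \<Omega> \<subseteq> closure (\<Omega> - N)"
    proof
      fix p assume p: "p \<in> closure \<Omega>"
      show "p \<in> closure (\<Omega> - N)"
        unfolding closure_approachable
      proof (intro allI impI)
        fix e :: real assume "e > 0"
        then obtain x where "x \<in> \<Omega> - N" "dist p x < e" using points_off_negligible[OF N p] by blast
        then show "\<exists>y\<in>\<Omega> - N. dist y p < e" by (metis dist_commute)
      qed
    qed
  qed
  obtain w where w: "uniformly_continuous_on (closure (\<Omega> - N)) w" "\<And>x. x \<in> \<Omega> - N \<Longrightarrow> v x = w x"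
    by (rule uniformly_continuous_on_extension_on_closure[OF uc]) (rule that)
  have cont: "continuous_on (closure \<Omega>) w" using uniformly_continuous_imp_continuous[OF w(1)] unfolding cl .
  show thesis
  proof (rule that[OF cont])
    have "AE x in L. x \<notin> N \<longrightarrow> w x = v x" by (rule AE_I2) (use w(2) in auto)
    with AE_L_negligible[OF N] show "AE x in L. w x = v x" by (rule AE_mp)
    have "\<bar>w x - w y\<bar> \<le> C0 * dist x y" if xy: "x \<in> closure \<Omega>" "y \<in> closure \<Omega>" "dist x y < d" for x y
    proof -
      obtain X where X: "\<And>n. X n \<in> \<Omega> - N" "X \<longlonglongrightarrow> x" using xy(1) unfolding cl[symmetric] closure_sequential by blast
      obtain Y where Y: "\<And>n. Y n \<in> \<Omega> - N" "Y \<longlonglongrightarrow> y" using xy(2) unfolding cl[symmetric] closure_sequential by blast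
      have XY: "X n \<in> closure \<Omega>" "Y n \<in> closure \<Omega>" for n using X(1) Y(1) closure_subset by auto
      have wX: "(\<lambda>n. w (X n)) \<longlonglongrightarrow> w x" "(\<lambda>n. w (Y n)) \<longlonglongrightarrow> w y"
        by (rule continuous_on_tendsto_compose[OF cont X(2) xy(1)]; use XY in auto)
          (rule continuous_on_tendsto_compose[OF cont Y(2) xy(2)]; use XY in auto)
      have dl: "(\<lambda>n. dist (X n) (Y n)) \<longlonglongrightarrow> dist x y" by (intro tendsto_dist X Y)
      have "eventually (\<lambda>n. \<bar>w (X n) - w (Y n)\<bar> \<le> C0 * dist (X n) (Y n)) sequentially"
        using order_tendstoD(2)[OF dl xy(3)]
      proof eventually_elim
        case (elim n)
        then show ?case using unif[OF X(1) Y(1)] w(2)[OF X(1)] w(2)[OF Y(1)] by simp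
      qed
      moreover have "(\<lambda>n. \<bar>w (X n) - w (Y n)\<bar>) \<longlonglongrightarrow> \<bar>w x - w y\<bar>" by (intro tendsto_intros wX)
      moreover have "(\<lambda>n. C0 * dist (X n) (Y n)) \<longlonglongrightarrow> C0 * dist x y" by (intro tendsto_intros dl)
      ultimately show ?thesis by (intro tendsto_le[OF sequentially_bot]) auto
    qed
    then show "uniformly_locally_lipschitz (closure \<Omega>) w"
      using C0 d(1) unfolding uniformly_locally_lipschitz_def by blast
  qed
qed

text \<open>The points of \<Omega> where the two differ form an open null set, hence none exist;
  continuity carries equality to the closure. The choice inside \<open>bd_trace\<close> is thereby
  immaterial on the closure, though not outside it.\<close>

lemma continuous_representative_unique:
  fixes w w' :: "'a \<Rightarrow> real"
  assumes w: "continuous_on (closure \<Omega>) w" and w': "continuous_on (closure \<Omega>) w'"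
    and ae: "AE x in L. w x = w' x" and x: "x \<in> closure \<Omega>"
  shows "w x = w' x"
proof -
  have cont: "continuous_on (closure \<Omega>) (\<lambda>x. w x - w' x)" by (intro continuous_intros w w')
  have "w x - w' x = 0"
  proof (rule continuous_constant_on_closure[OF cont _ x])
    fix z assume z: "z \<in> \<Omega>"
    define U where "U = {x\<in>\<Omega>. w x - w' x \<in> - {0}}"
    have "U = \<Omega> \<inter> (\<lambda>x. w x - w' x) -` (- {0})" by (auto simp: U_def)
    moreover have "open \<dots>"
      by (rule continuous_open_preimage[OF continuous_on_subset[OF cont closure_subset] open_Omega]) auto
    ultimately have "open U" by simp
    have "AE x in L. x \<notin> U" using ae by eventually_elim (simp add: U_def)
    then have "U \<in> null_sets L"
      using \<open>open U\<close> by (subst AE_iff_null_sets) (auto simp: sets_L_iff U_def)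
    then have "U \<in> null_sets lebesgue" by (simp add: null_sets_restrict_space)
    then have "negligible U" by (simp add: negligible_iff_null_sets)
    then have "U = {}" using \<open>open U\<close> open_not_negligible by blast
    then show "w z - w' z = 0" using z by (auto simp: U_def)
  qed
  then show ?thesis by simp
qed

lemma
  assumes v: "v \<in> W1inf \<Omega>"
  shows continuous_on_bd_trace: "continuous_on (closure \<Omega>) (bd_trace \<Omega> v)"
    and bd_trace_AE: "AE x in L. bd_trace \<Omega> v x = v x"
proof -
  have "\<exists>w. continuous_on (closure \<Omega>) w \<and> (AE x in L. w x = v x)" using W1inf_trace_exists[OF v] by blast
  from someI_ex[OF this] show "continuous_on (closure \<Omega>) (bd_trace \<Omega> v)" "AE x in L. bd_trace \<Omega> v x = v x"
    by (simp_all add: bd_trace_def)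
qed

lemma bd_trace_lipschitz:
  assumes v: "v \<in> W1inf \<Omega>"
  shows "uniformly_locally_lipschitz (closure \<Omega>) (bd_trace \<Omega> v)"
proof -
  obtain w where w: "continuous_on (closure \<Omega>) w" "AE x in L. w x = v x" "uniformly_locally_lipschitz (closure \<Omega>) w"
    using W1inf_trace_exists[OF v] by blast
  have "AE x in L. bd_trace \<Omega> v x = w x" using bd_trace_AE[OF v] w(2) by eventually_elim simp
  then have eq: "bd_trace \<Omega> v x = w x" if "x \<in> closure \<Omega>" for x
    by (rule continuous_representative_unique[OF continuous_on_bd_trace[OF v] w(1) _ that])
  then show ?thesis using w(3) unfolding uniformly_locally_lipschitz_def by simp
qed

lemma bd_trace_linear:
  assumes v: "v \<in> W1inf \<Omega>" and w: "w \<in> W1inf \<Omega>" and x: "x \<in> closure \<Omega>"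
  shows "bd_trace \<Omega> (\<lambda>x. v x + c * w x) x = bd_trace \<Omega> v x + c * bd_trace \<Omega> w x"
proof (rule continuous_representative_unique[OF _ _ _ x])
  have vw: "(\<lambda>x. v x + c * w x) \<in> W1inf \<Omega>" by (rule W1inf_linear[OF v w])
  show "continuous_on (closure \<Omega>) (bd_trace \<Omega> (\<lambda>x. v x + c * w x))" by (rule continuous_on_bd_trace[OF vw])
  show "continuous_on (closure \<Omega>) (\<lambda>x. bd_trace \<Omega> v x + c * bd_trace \<Omega> w x)"
    by (intro continuous_intros continuous_on_bd_trace v w)
  show "AE x in L. bd_trace \<Omega> (\<lambda>x. v x + c * w x) x = bd_trace \<Omega> v x + c * bd_trace \<Omega> w x"
    using bd_trace_AE[OF vw] bd_trace_AE[OF v] bd_trace_AE[OF w] by eventually_elim simp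
qed

end

section \<open>Null sets of the surface measure\<close>

lemma hausdorff_pre_mono: "A \<subseteq> B \<Longrightarrow> hausdorff_pre s \<delta> A \<le> hausdorff_pre s \<delta> B"
  unfolding hausdorff_pre_def by (rule INF_superset_mono) auto

text \<open>Covers of cost below e/2 of each set are interleaved by parity into a single cover of
  the union of cost at most e.\<close>

lemma hausdorff_pre_null_Un:
  assumes A: "hausdorff_pre s \<delta> A = 0" and B: "hausdorff_pre s \<delta> B = 0"
  shows "hausdorff_pre s \<delta> (A \<union> B) = 0"
proof -
  define c where "c U = (if U = {} then 0 else ennreal (unit_ball_vol (real s) / 2 ^ s * diameter U ^ s))" for U :: "'a set"
  define S where "S A = {U :: nat \<Rightarrow> 'a set. A \<subseteq> (\<Union>i. U i) \<and> (\<forall>i. bounded (U i) \<and> diameter (U i) \<le> \<delta>)}" for A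
  have pre: "hausdorff_pre s \<delta> A = (INF U\<in>S A. \<Sum>i. c (U i))" for A
    by (simp add: hausdorff_pre_def S_def c_def)
  have "hausdorff_pre s \<delta> (A \<union> B) \<le> 0 + ennreal e" if e: "e > 0" for e
  proof -
    have "hausdorff_pre s \<delta> A < ennreal (e / 2)" "hausdorff_pre s \<delta> B < ennreal (e / 2)" using e A B by simp_all
    then obtain U W where UW: "U \<in> S A" "(\<Sum>i. c (U i)) < ennreal (e / 2)" "W \<in> S B" "(\<Sum>i. c (W i)) < ennreal (e / 2)"
      unfolding pre INF_less_iff by blast
    have U: "A \<subseteq> (\<Union>i. U i)" "\<And>i. bounded (U i) \<and> diameter (U i) \<le> \<delta>" "(\<Sum>i. c (U i)) < ennreal (e / 2)"
      using UW(1,2) by (simp_all add: S_def)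
    have W: "B \<subseteq> (\<Union>i. W i)" "\<And>i. bounded (W i) \<and> diameter (W i) \<le> \<delta>" "(\<Sum>i. c (W i)) < ennreal (e / 2)"
      using UW(3,4) by (simp_all add: S_def)
    define Z where "Z n = (if even n then U (n div 2) else W (n div 2))" for n :: nat
    have "A \<union> B \<subseteq> (\<Union>n. Z n)" unfolding Z_def UN_interleave using U(1) W(1) by (rule Un_mono)
    moreover have "bounded (Z n) \<and> diameter (Z n) \<le> \<delta>" for n unfolding Z_def using U(2) W(2) by simp
    ultimately have "hausdorff_pre s \<delta> (A \<union> B) \<le> (\<Sum>n. c (Z n))"
      unfolding pre by (intro INF_lower) (simp add: S_def)
    also have "\<dots> = (\<Sum>n. if even n then c (U (n div 2)) else c (W (n div 2)))"
      by (intro suminf_cong) (simp add: Z_def)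
    also have "\<dots> = (\<Sum>n. c (U n)) + (\<Sum>n. c (W n))" by (rule suminf_interleave)
    also have "\<dots> \<le> ennreal (e / 2) + ennreal (e / 2)" using U(3) W(3) by (intro add_mono) auto
    also have "\<dots> = 0 + ennreal e" using e by (simp flip: ennreal_plus)
    finally show ?thesis .
  qed
  then have "hausdorff_pre s \<delta> (A \<union> B) \<le> 0" by (rule ennreal_le_epsilon)
  then show ?thesis by simp
qed

lemma hausdorff_measure_eq_0_iff: "hausdorff_measure s A = 0 \<longleftrightarrow> (\<forall>\<delta>>0. hausdorff_pre s \<delta> A = 0)"
proof
  assume 0: "hausdorff_measure s A = 0"
  have "hausdorff_pre s \<delta> A \<le> hausdorff_measure s A" if "\<delta> > 0" for \<delta>
    unfolding hausdorff_measure_def by (rule SUP_upper) (use that in simp)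
  then show "\<forall>\<delta>>0. hausdorff_pre s \<delta> A = 0" unfolding 0 by simp
next
  assume "\<forall>\<delta>>0. hausdorff_pre s \<delta> A = 0"
  then have "hausdorff_measure s A \<le> 0" unfolding hausdorff_measure_def by (intro SUP_least) simp
  then show "hausdorff_measure s A = 0" by simp
qed

lemma surface_measure_null_Un:
  "surface_measure A = 0 \<Longrightarrow> surface_measure B = 0 \<Longrightarrow> surface_measure (A \<union> B) = 0"
  unfolding surface_measure_def hausdorff_measure_eq_0_iff by (blast intro: hausdorff_pre_null_Un)

lemma surface_measure_null_subset:
  "A \<subseteq> B \<Longrightarrow> surface_measure B = 0 \<Longrightarrow> surface_measure A = 0"
  unfolding surface_measure_def hausdorff_measure_eq_0_iff using hausdorff_pre_mono[of A B] by (metis le_zero_eq)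

lemma surface_measure_empty: "surface_measure ({} :: 'a::euclidean_space set) = 0"
proof -
  have "hausdorff_pre s \<delta> ({} :: 'a set) \<le> 0" if "\<delta> > 0" for s \<delta>
    \<comment> \<open>The cover by empty sets costs 0 even for s = 0, thanks to the separate
      treatment of the empty set in the sum.\<close>
    unfolding hausdorff_pre_def by (rule INF_lower2[of "\<lambda>i. {}"]) (use that in auto)
  then show ?thesis unfolding surface_measure_def hausdorff_measure_eq_0_iff by simp
qed

lemma surface_ae_mp2:
  assumes "surface_ae \<Gamma> P" "surface_ae \<Gamma> Q" "\<And>x. x \<in> \<Gamma> \<Longrightarrow> P x \<Longrightarrow> Q x \<Longrightarrow> R x"
  shows "surface_ae \<Gamma> R"
  unfolding surface_ae_def
proof (rule surface_measure_null_subset)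
  show "{x\<in>\<Gamma>. \<not> R x} \<subseteq> {x\<in>\<Gamma>. \<not> P x} \<union> {x\<in>\<Gamma>. \<not> Q x}" using assms(3) by auto
  show "surface_measure ({x\<in>\<Gamma>. \<not> P x} \<union> {x\<in>\<Gamma>. \<not> Q x}) = 0"
    using assms(1,2) unfolding surface_ae_def by (rule surface_measure_null_Un)
qed

lemma surface_aeI: "(\<And>x. x \<in> \<Gamma> \<Longrightarrow> P x) \<Longrightarrow> surface_ae \<Gamma> P"
proof -
  assume "\<And>x. x \<in> \<Gamma> \<Longrightarrow> P x"
  then have empty: "{x\<in>\<Gamma>. \<not> P x} = {}" by blast
  show ?thesis unfolding surface_ae_def empty by (rule surface_measure_empty)
qed

text \<open>The zero function is a representative with bounds C = L = 0, so the norm is 0 and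
  continuity of g finishes. Thus g sees only values on \<Gamma>, although its argument is defined
  everywhere.\<close>

lemma W1inf_surface_dual_null:
  assumes g: "g \<in> W1inf_surface_dual \<Gamma>" and w: "w \<in> W1inf_surface \<Gamma>" and 0: "\<And>x. x \<in> \<Gamma> \<Longrightarrow> w x = 0"
  shows "g w = 0"
proof -
  obtain M where M: "\<bar>g w\<bar> \<le> M * W1inf_surface_norm \<Gamma> w" using g w unfolding W1inf_surface_dual_def by blast
  have "W1inf_surface_bound \<Gamma> w 0 0"
    unfolding W1inf_surface_bound_def
  proof (intro conjI exI[of _ "\<lambda>x. 0"])
    show "surface_ae \<Gamma> (\<lambda>x. 0 = w x)" by (rule surface_aeI) (use 0 in auto)
    show "\<forall>x\<in>\<Gamma>. \<exists>r>0. 0-lipschitz_on (\<Gamma> \<inter> ball x r) (\<lambda>x. 0::real)"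
      by (auto simp: lipschitz_on_def intro!: exI[of _ 1])
  qed auto
  then have "0 \<in> {C + L | C L. W1inf_surface_bound \<Gamma> w C L}" by force
  moreover have "0 \<le> s" if "s \<in> {C + L | C L. W1inf_surface_bound \<Gamma> w C L}" for s
    using that by (auto simp: W1inf_surface_bound_def)
  ultimately have "W1inf_surface_norm \<Gamma> w = 0"
    unfolding W1inf_surface_norm_def by (intro cInf_eq_minimum)
  then show ?thesis using M by simp
qed

section \<open>Boundary functionals acting on traces\<close>

context bounded_lipschitz_domain begin

lemma W1inf_zero: "(\<lambda>x. 0) \<in> W1inf \<Omega>"
  by (rule W1infI[of _ "\<lambda>x. 0"]) (auto simp: weak_gradient_def)

lemma bd_trace_in_W1inf_surface:
  assumes v: "v \<in> W1inf \<Omega>" and \<Gamma>: "\<Gamma> \<subseteq> closure \<Omega>" and h: "\<And>x. x \<in> \<Gamma> \<Longrightarrow> h x = bd_trace \<Omega> v x"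
  shows "h \<in> W1inf_surface \<Gamma>"
proof -
  have comp: "compact (closure \<Omega>)" using bounded_Omega by (simp add: compact_closure)
  have "bounded (bd_trace \<Omega> v ` closure \<Omega>)"
    by (rule compact_imp_bounded[OF compact_continuous_image[OF continuous_on_bd_trace[OF v] comp]])
  then have "\<exists>B. \<forall>x\<in>closure \<Omega>. \<bar>bd_trace \<Omega> v x\<bar> \<le> B" by (simp add: bounded_iff)
  then obtain B where B: "\<And>x. x \<in> closure \<Omega> \<Longrightarrow> \<bar>bd_trace \<Omega> v x\<bar> \<le> B" by blast
  obtain C d where C: "C \<ge> 0" "d > 0"
    "\<And>x y. x \<in> closure \<Omega> \<Longrightarrow> y \<in> closure \<Omega> \<Longrightarrow> dist x y < d \<Longrightarrow> \<bar>bd_trace \<Omega> v x - bd_trace \<Omega> v y\<bar> \<le> C * dist x y"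
    using bd_trace_lipschitz[OF v] unfolding uniformly_locally_lipschitz_def by blast
  have "W1inf_surface_bound \<Gamma> h (max B 0) C"
    unfolding W1inf_surface_bound_def
  proof (intro conjI exI[of _ h] ballI C(1))
    show "surface_ae \<Gamma> (\<lambda>x. h x = h x)" by (rule surface_aeI) simp
    fix x assume x: "x \<in> \<Gamma>"
    have "\<bar>bd_trace \<Omega> v x\<bar> \<le> B" using B x \<Gamma> by blast
    then show "\<bar>h x\<bar> \<le> max B 0" using h[OF x] by simp
    show "\<exists>r>0. C-lipschitz_on (\<Gamma> \<inter> ball x r) h"
    proof (intro exI[of _ "d / 2"] conjI lipschitz_onI C(1))
      fix y z assume yz: "y \<in> \<Gamma> \<inter> ball x (d / 2)" "z \<in> \<Gamma> \<inter> ball x (d / 2)"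
      have "dist y z < d" using dist_triangle_half_r[of x y d z] yz by simp
      then have "\<bar>bd_trace \<Omega> v y - bd_trace \<Omega> v z\<bar> \<le> C * dist y z" using yz \<Gamma> by (intro C(3)) auto
      then show "dist (h y) (h z) \<le> C * dist y z" using h yz by (simp add: dist_real_def)
    qed (use C(2) in simp)
  qed simp
  then show ?thesis unfolding W1inf_surface_def by blast
qed

text \<open>The trace of a linear combination equals the combination of traces only on the closure
  of \<Omega>, not as a function on the whole space. Hence g is applied to the difference of both,
  which vanishes on \<Gamma>. Linearity of g is available only within \<open>W1inf_surface\<close>,
  so every intermediate function needs its membership.\<close>

lemma dual_of_trace_linear:
  assumes g: "g \<in> W1inf_surface_dual \<Gamma>" and \<Gamma>: "\<Gamma> \<subseteq> closure \<Omega>" and v: "v \<in> W1inf \<Omega>" and w: "w \<in> W1inf \<Omega>"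
  shows "g (bd_trace \<Omega> (\<lambda>x. v x + c * w x)) = g (bd_trace \<Omega> v) + c * g (bd_trace \<Omega> w)"
proof -
  let ?tv = "bd_trace \<Omega> v" and ?tw = "bd_trace \<Omega> w" and ?ts = "bd_trace \<Omega> (\<lambda>x. v x + c * w x)"
  have gadd: "g (\<lambda>x. h x + k x) = g h + g k" if "h \<in> W1inf_surface \<Gamma>" "k \<in> W1inf_surface \<Gamma>" for h k
    using g that unfolding W1inf_surface_dual_def by blast
  have gscale: "g (\<lambda>x. b * h x) = b * g h" if "h \<in> W1inf_surface \<Gamma>" for h b
    using g that unfolding W1inf_surface_dual_def by blast
  have vw: "(\<lambda>x. v x + c * w x) \<in> W1inf \<Omega>" by (rule W1inf_linear[OF v w])
  have ts: "?ts x = ?tv x + c * ?tw x" if "x \<in> \<Gamma>" for x using bd_trace_linear[OF v w] that \<Gamma> by blast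
  have t0: "bd_trace \<Omega> (\<lambda>x. 0) x = 0" if "x \<in> \<Gamma>" for x
    using bd_trace_linear[OF W1inf_zero W1inf_zero, of x "-1"] that \<Gamma> by auto
  have tcw: "bd_trace \<Omega> (\<lambda>x. 0 + b * w x) x = b * ?tw x" if "x \<in> \<Gamma>" for x b
    using bd_trace_linear[OF W1inf_zero w, of x b] t0[OF that] that \<Gamma> by auto
  have m1: "?tv \<in> W1inf_surface \<Gamma>" "?tw \<in> W1inf_surface \<Gamma>" "?ts \<in> W1inf_surface \<Gamma>"
    by (rule bd_trace_in_W1inf_surface[OF _ \<Gamma> refl]; use v w vw in simp)+
  have m2: "(\<lambda>x. c * ?tw x) \<in> W1inf_surface \<Gamma>"
    by (rule bd_trace_in_W1inf_surface[OF W1inf_linear[OF W1inf_zero w, of c] \<Gamma>]) (rule tcw[symmetric])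
  have vmw: "(\<lambda>x. 0 + (-1) * (v x + c * w x)) \<in> W1inf \<Omega>" by (rule W1inf_linear[OF W1inf_zero vw])
  have m3: "(\<lambda>x. (-1) * ?ts x) \<in> W1inf_surface \<Gamma>"
  proof (rule bd_trace_in_W1inf_surface[OF vmw \<Gamma>])
    fix x assume x: "x \<in> \<Gamma>"
    then have "x \<in> closure \<Omega>" using \<Gamma> by blast
    then show "(-1) * ?ts x = bd_trace \<Omega> (\<lambda>x. 0 + (-1) * (v x + c * w x)) x"
      unfolding bd_trace_linear[OF W1inf_zero vw \<open>x \<in> closure \<Omega>\<close>] t0[OF x] by simp
  qed
  have m4: "(\<lambda>x. ?tv x + c * ?tw x) \<in> W1inf_surface \<Gamma>"
    by (rule bd_trace_in_W1inf_surface[OF vw \<Gamma>]) (simp add: ts)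
  have m5: "(\<lambda>x. (?tv x + c * ?tw x) + (-1) * ?ts x) \<in> W1inf_surface \<Gamma>"
    by (rule bd_trace_in_W1inf_surface[OF W1inf_zero \<Gamma>]) (simp add: ts t0)
  have "g (\<lambda>x. (?tv x + c * ?tw x) + (-1) * ?ts x) = 0"
    by (rule W1inf_surface_dual_null[OF g m5]) (simp add: ts)
  moreover have "g (\<lambda>x. (?tv x + c * ?tw x) + (-1) * ?ts x) = g ?tv + c * g ?tw + (-1) * g ?ts"
    using gadd[OF m4 m3] gadd[OF m1(1) m2] gscale[OF m1(2)] gscale[OF m1(3)] by metis
  ultimately show ?thesis by simp
qed

lemma load_linear:
  assumes f: "integrable L f" and g: "g \<in> W1inf_surface_dual \<Gamma>" and \<Gamma>: "\<Gamma> \<subseteq> closure \<Omega>"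
    and v: "v \<in> W1inf \<Omega>" and w: "w \<in> W1inf \<Omega>"
  shows "load \<Omega> f g (\<lambda>x. v x + c * w x) = load \<Omega> f g v + c * load \<Omega> f g w"
proof -
  have int: "integrable L (\<lambda>x. f x * h x)" if h: "h \<in> W1inf \<Omega>" for h
  proof -
    obtain C where "AE x in L. norm (h x) \<le> C" using W1inf_Linf[OF h] by (rule LinfE)
    then have "integrable L (\<lambda>x. h x *\<^sub>R f x)"
      using integrable_bounded_mult[OF Linf_measurable[OF W1inf_Linf[OF h]] _ f] by simp
    then show ?thesis by (simp add: mult.commute)
  qed
  have "(LINT x|L. f x * (v x + c * w x)) = (LINT x|L. f x * v x + c * (f x * w x))"
    by (simp add: algebra_simps)
  also have "\<dots> = (LINT x|L. f x * v x) + c * (LINT x|L. f x * w x)"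
    using int[OF v] int[OF w] by simp
  finally show ?thesis
    unfolding load_def dual_of_trace_linear[OF g \<Gamma> v w] by (simp add: algebra_simps)
qed

lemma trace_condition_linear:
  assumes \<Gamma>: "\<Gamma> \<subseteq> closure \<Omega>" and v: "v \<in> W1inf \<Omega>" and w: "w \<in> W1inf \<Omega>"
    and tr: "surface_ae \<Gamma> (\<lambda>x. bd_trace \<Omega> v x = p x)" "surface_ae \<Gamma> (\<lambda>x. bd_trace \<Omega> w x = q x)"
  shows "surface_ae \<Gamma> (\<lambda>x. bd_trace \<Omega> (\<lambda>x. v x + c * w x) x = p x + c * q x)"
  by (rule surface_ae_mp2[OF tr]) (use bd_trace_linear[OF v w] \<Gamma> in auto)

lemma W1inf_D_linear:
  assumes "\<Gamma> \<subseteq> closure \<Omega>" "v \<in> W1inf_D \<Omega> \<Gamma>" "w \<in> W1inf_D \<Omega> \<Gamma>"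
  shows "(\<lambda>x. v x + c * w x) \<in> W1inf_D \<Omega> \<Gamma>"
  using trace_condition_linear[OF assms(1), of v w "\<lambda>x. 0" "\<lambda>x. 0" c] W1inf_linear[of v w c] assms(2,3)
  unfolding W1inf_D_def by simp

end

section \<open>Fenchel conjugates\<close>

text \<open>The nearest point of the closed ball of radius r about 0. It is both the maximizer in
  the conjugate and the gradient of \<open>phi_star\<close>, and its two branches have the form
  required in the optimality relation.\<close>

definition ball_projection :: "real \<Rightarrow> 'a::euclidean_space \<Rightarrow> 'a" where
  "ball_projection r s = (if norm s \<le> r then s else r *\<^sub>R (s /\<^sub>R norm s))"

lemma ball_projection_outside:
  assumes "0 \<le> r" "r < norm s"
  shows "norm (ball_projection r s) = r" "s \<bullet> ball_projection r s = r * norm s"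
    "s - ball_projection r s = (1 - r / norm s) *\<^sub>R s"
proof -
  have n: "norm s > 0" using assms by linarith
  have p: "ball_projection r s = (r / norm s) *\<^sub>R s"
    using assms(2) by (simp add: ball_projection_def divide_inverse)
  have "0 \<le> r / norm s" using assms(1) n by (intro divide_nonneg_pos)
  then show "norm (ball_projection r s) = r" unfolding p norm_scaleR using n by (simp only: abs_of_nonneg) simp
  show "s \<bullet> ball_projection r s = r * norm s"
    unfolding p inner_scaleR_right dot_square_norm using n by (simp add: power2_eq_square)
  show "s - ball_projection r s = (1 - r / norm s) *\<^sub>R s" unfolding p by (simp add: algebra_simps)
qed

lemma norm_ball_projection: "0 \<le> r \<Longrightarrow> norm (ball_projection r s) \<le> r"
proof (cases "norm s \<le> r")
  case True
  then show ?thesis by (simp add: ball_projection_def)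
next
  case False
  assume "0 \<le> r"
  then show ?thesis using ball_projection_outside(1)[of r s] False by linarith
qed

lemma phi_star_attained:
  assumes "0 \<le> \<zeta> x"
  shows "phi_star \<zeta> x s = s \<bullet> ball_projection (\<zeta> x) s - (norm (ball_projection (\<zeta> x) s))\<^sup>2 / 2"
proof (cases "norm s \<le> \<zeta> x")
  case True
  then show ?thesis by (simp add: phi_star_def ball_projection_def dot_square_norm)
next
  case False
  then show ?thesis using ball_projection_outside[OF assms, of s] by (simp add: phi_star_def)
qed

text \<open>With p the projection of s, the surplus is the inner product of s - p and p - t,
  nonnegative because p is the nearest point of the ball. The quadratic term is what makes the
  maximizer t unique, and so turns equality of integrals into a formula for the gradient.\<close>

lemma phi_star_upper_strong:
  assumes t: "norm t \<le> \<zeta> x"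
  shows "s \<bullet> t - (norm t)\<^sup>2 / 2 + (norm (t - ball_projection (\<zeta> x) s))\<^sup>2 / 2 \<le> phi_star \<zeta> x s"
proof -
  define p where "p = ball_projection (\<zeta> x) s"
  have \<zeta>: "0 \<le> \<zeta> x" using t norm_ge_zero order_trans by blast
  have "0 \<le> (s - p) \<bullet> (p - t)"
  proof (cases "norm s \<le> \<zeta> x")
    case True
    then show ?thesis by (simp add: p_def ball_projection_def)
  next
    case False
    then have s: "norm s > 0" using \<zeta> by linarith
    have out: "s \<bullet> p = \<zeta> x * norm s" "s - p = (1 - \<zeta> x / norm s) *\<^sub>R s"
      using ball_projection_outside[OF \<zeta>, of s] False by (simp_all add: p_def)
    have "s \<bullet> t \<le> norm s * norm t" by (rule norm_cauchy_schwarz)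
    also have "\<dots> \<le> norm s * \<zeta> x" using t by (intro mult_left_mono) auto
    finally have "0 \<le> s \<bullet> (p - t)" by (simp add: inner_diff_right out(1) mult.commute)
    moreover note out(2)
    moreover have "0 \<le> 1 - \<zeta> x / norm s" using False s by simp
    ultimately show ?thesis by simp
  qed
  moreover have "(s - p) \<bullet> (p - t) = (s \<bullet> p - (norm p)\<^sup>2 / 2) - (s \<bullet> t - (norm t)\<^sup>2 / 2) - (norm (t - p))\<^sup>2 / 2"
    by (simp add: power2_norm_eq_inner inner_diff_left inner_diff_right inner_commute field_simps)
  ultimately show ?thesis unfolding phi_star_attained[where \<zeta> = \<zeta> and x = x, OF \<zeta>] p_def[symmetric] by linarith
qed

lemma phi_star_upper:
  assumes "norm t \<le> \<zeta> x"
  shows "s \<bullet> t - (norm t)\<^sup>2 / 2 \<le> phi_star \<zeta> x s"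
  using phi_star_upper_strong[of t \<zeta> x s] assms zero_le_power2[of "norm (t - ball_projection (\<zeta> x) s)"] by linarith

lemma phi_star_equality:
  assumes "norm t \<le> \<zeta> x" "s \<bullet> t - (norm t)\<^sup>2 / 2 = phi_star \<zeta> x s"
  shows "t = ball_projection (\<zeta> x) s"
proof -
  have "(norm (t - ball_projection (\<zeta> x) s))\<^sup>2 \<le> 0" using phi_star_upper_strong[of t \<zeta> x s] assms by linarith
  then show ?thesis by simp
qed

lemma phi_star_bounds:
  assumes "0 \<le> \<zeta> x"
  shows "0 \<le> phi_star \<zeta> x s" "phi_star \<zeta> x s \<le> \<zeta> x * norm s"
proof -
  show "0 \<le> phi_star \<zeta> x s" using phi_star_upper[of 0 \<zeta> x s] assms by simp
  have "s \<bullet> ball_projection (\<zeta> x) s \<le> norm s * norm (ball_projection (\<zeta> x) s)" by (rule norm_cauchy_schwarz)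
  also have "\<dots> \<le> norm s * \<zeta> x" using norm_ball_projection[OF assms] by (intro mult_left_mono) auto
  finally have "s \<bullet> ball_projection (\<zeta> x) s \<le> \<zeta> x * norm s" by (simp add: mult.commute)
  then show "phi_star \<zeta> x s \<le> \<zeta> x * norm s"
    unfolding phi_star_attained[where \<zeta> = \<zeta> and x = x, OF assms]
    using zero_le_power2[of "norm (ball_projection (\<zeta> x) s)"] by linarith
qed

text \<open>\<open>\<phi>*\<close> is the Moreau envelope of \<open>\<zeta> |\<cdot>|\<close>, which bounds its growth quadratically from above.\<close>

lemma phi_star_quadratic_growth:
  assumes "0 \<le> \<zeta> x"
  shows "phi_star \<zeta> x (s + h) \<le> phi_star \<zeta> x s + ball_projection (\<zeta> x) s \<bullet> h + (norm h)\<^sup>2 / 2"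
proof -
  define p where "p = ball_projection (\<zeta> x) s"
  define q where "q = ball_projection (\<zeta> x) (s + h)"
  have q: "norm q \<le> \<zeta> x" unfolding q_def by (rule norm_ball_projection[OF assms])
  have "(s - p) \<bullet> q \<le> (s - p) \<bullet> p"
  proof (cases "norm s \<le> \<zeta> x")
    case True
    then show ?thesis by (simp add: p_def ball_projection_def)
  next
    case False
    then have s: "norm s > 0" using assms by linarith
    have out: "s \<bullet> p = \<zeta> x * norm s" "s - p = (1 - \<zeta> x / norm s) *\<^sub>R s"
      using ball_projection_outside[OF assms, of s] False by (simp_all add: p_def)
    have "s \<bullet> q \<le> norm s * norm q" by (rule norm_cauchy_schwarz)
    also have "\<dots> \<le> norm s * \<zeta> x" using q by (intro mult_left_mono) auto
    finally have "s \<bullet> q \<le> s \<bullet> p" by (simp add: out(1) mult.commute)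
    moreover note out(2)
    moreover have "0 \<le> 1 - \<zeta> x / norm s" using False s by simp
    ultimately show ?thesis by (simp add: mult_left_mono)
  qed
  \<comment> \<open>Young's inequality for q and p + h; together with the variational inequality
    above it compares the maximizers for s and s + h.\<close>
  moreover have "0 \<le> (norm (p + h - q))\<^sup>2" by simp
  then have "(p + h) \<bullet> q - (norm q)\<^sup>2 / 2 \<le> (norm p)\<^sup>2 / 2 + p \<bullet> h + (norm h)\<^sup>2 / 2"
    by (simp add: power2_norm_eq_inner inner_diff_left inner_diff_right inner_add_left inner_add_right inner_commute field_simps)
  moreover have "(s + h) \<bullet> q = (s - p) \<bullet> q + (p + h) \<bullet> q" by (simp add: inner_diff_left inner_add_left)
  moreover have "s \<bullet> p = (s - p) \<bullet> p + (norm p)\<^sup>2" by (simp add: inner_diff_left power2_norm_eq_inner)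
  ultimately show ?thesis
    unfolding phi_star_attained[where \<zeta> = \<zeta> and x = x, OF assms] p_def[symmetric] q_def[symmetric] by linarith
qed

text \<open>The projection p is feasible for s + h, so it is a subgradient; quadratic growth bounds
  the remainder by half the squared norm of h. Points on the sphere where the two branches of
  \<open>phi_star\<close> meet are covered along with the rest.\<close>

lemma GDERIV_phi_star:
  fixes s :: "'a::euclidean_space"
  assumes "0 \<le> \<zeta> x"
  shows "GDERIV (phi_star \<zeta> x) s :> ball_projection (\<zeta> x) s"
proof -
  define p where "p = ball_projection (\<zeta> x) s"
  have lower: "phi_star \<zeta> x s + p \<bullet> h \<le> phi_star \<zeta> x (s + h)" for h
    using phi_star_upper[of p \<zeta> x "s + h"] norm_ball_projection[OF assms, of s]
    unfolding phi_star_attained[where \<zeta> = \<zeta> and x = x and s = s, OF assms] p_def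
    by (simp add: inner_add_left inner_commute)
  have bound: "\<bar>phi_star \<zeta> x (s + h) - phi_star \<zeta> x s - h \<bullet> p\<bar> \<le> (norm h)\<^sup>2 / 2" for h
    using lower[of h] phi_star_quadratic_growth[where \<zeta> = \<zeta> and x = x, OF assms, of s h]
    by (simp add: p_def inner_commute abs_le_iff)
  show ?thesis
    unfolding gderiv_def has_derivative_at
  proof (intro conjI)
    show "bounded_linear (\<lambda>h. h \<bullet> ball_projection (\<zeta> x) s)" by (rule bounded_linear_inner_left)
    show "(\<lambda>h. norm (phi_star \<zeta> x (s + h) - phi_star \<zeta> x s - h \<bullet> ball_projection (\<zeta> x) s) / norm h) \<midarrow>0\<rightarrow> 0"
    proof (rule tendsto_sandwich[where f = "\<lambda>h. 0" and h = "\<lambda>h. norm h / 2"])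
      show "\<forall>\<^sub>F h in at 0. norm (phi_star \<zeta> x (s + h) - phi_star \<zeta> x s - h \<bullet> ball_projection (\<zeta> x) s) / norm h \<le> norm h / 2"
      proof (rule always_eventually, rule allI)
        fix h
        show "norm (phi_star \<zeta> x (s + h) - phi_star \<zeta> x s - h \<bullet> ball_projection (\<zeta> x) s) / norm h \<le> norm h / 2"
        proof (cases "h = 0")
          case False
          then have h: "norm h > 0" by simp
          have "norm (phi_star \<zeta> x (s + h) - phi_star \<zeta> x s - h \<bullet> ball_projection (\<zeta> x) s) \<le> norm h / 2 * norm h"
            using bound[of h] unfolding p_def real_norm_def by (simp only: power2_eq_square times_divide_eq_left)
          then show ?thesis unfolding pos_divide_le_eq[OF h] .
        qed simp
      qed
      have "(\<lambda>h::'a. norm h / 2) \<midarrow>0\<rightarrow> norm (0::'a) / 2" by (intro tendsto_intros) simp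
      then show "(\<lambda>h::'a. norm h / 2) \<midarrow>0\<rightarrow> 0" by simp
    qed simp_all
  qed
qed

section \<open>Norming fields, densities and multiplication by a bounded function\<close>

context bounded_open_set begin

text \<open>A partition that nearly attains the variation is cut off after finitely many pieces; the
  direction of \<nu> on each remaining piece defines the norming field.\<close>

lemma tv_approximation:
  assumes \<nu>: "\<nu> \<in> ba \<Omega>" and e: "e > 0"
  obtains w where "w \<in> Linf \<Omega>" "\<And>x. norm (w x) \<le> 1" "tv \<nu> \<Omega> - e < ba_integral \<Omega> \<nu> w"
proof (cases "tv \<nu> \<Omega> = 0")
  case True
  have "ba_integral \<Omega> \<nu> (\<lambda>x. 0) = 0" by (rule Linf_functional_zero[OF Linf_functional_ba_integral[OF \<nu>]])
  then show thesis using that[of "\<lambda>x. 0"] True e by simp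
next
  case False
  then have pos: "tv \<nu> \<Omega> > 0" using tv_nonneg[of \<nu> \<Omega>] by simp
  \<comment> \<open>The maximum with 0 keeps the level meaningful in \<open>ennreal\<close>; it is
    still below the variation because the case of zero variation was split off.\<close>
  define c where "c = max 0 (tv \<nu> \<Omega> - e)"
  have "ennreal c < ennreal (tv \<nu> \<Omega>)" using pos e by (simp add: c_def ennreal_less_iff)
  then have "ennreal c < total_variation \<Omega> \<nu> \<Omega>" by (simp add: ennreal_tv[OF \<nu>])
  then obtain P :: "nat \<Rightarrow> 'a set" where P: "range P \<subseteq> sets L" "disjoint_family P"
    "ennreal c < (\<Sum>i. ennreal (norm (\<nu> (P i))))"
    unfolding total_variation_def less_SUP_iff by auto
  have "ennreal c < (SUP n. \<Sum>i<n. ennreal (norm (\<nu> (P i))))" using P(3) by (simp add: suminf_eq_SUP)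
  then obtain n where "ennreal c < (\<Sum>i<n. ennreal (norm (\<nu> (P i))))" unfolding less_SUP_iff by auto
  then have n: "c < (\<Sum>i<n. norm (\<nu> (P i)))"
    by (subst (asm) sum_ennreal) (auto simp: ennreal_less_iff c_def)
  define w where "w x = (\<Sum>i<n. indicator (P i) x *\<^sub>R sgn (\<nu> (P i)))" for x
  note l = Linf_functional_ba_integral[OF \<nu>]
  have PL: "P i \<in> sets L" for i using P(1) by auto
  have ind: "(\<lambda>x. indicator (P i) x *\<^sub>R sgn (\<nu> (P i))) \<in> Linf \<Omega>" for i
    by (rule Linf_indicator[OF PL]) simp
  note sum = Linf_functional_sum[OF l, of "{..<n}" "\<lambda>i x. indicator (P i) x *\<^sub>R sgn (\<nu> (P i))", OF finite_lessThan ind]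
  have "ba_integral \<Omega> \<nu> w = (\<Sum>i<n. sgn (\<nu> (P i)) \<bullet> \<nu> (P i))"
    using sum unfolding w_def by (simp add: ba_integral_indicator[OF \<nu> PL])
  also have "\<dots> = (\<Sum>i<n. norm (\<nu> (P i)))"
  proof (rule sum.cong[OF refl])
    show "sgn (\<nu> (P i)) \<bullet> \<nu> (P i) = norm (\<nu> (P i))" for i
      by (cases "\<nu> (P i) = 0") (simp_all add: sgn_div_norm dot_square_norm power2_eq_square)
  qed
  finally have "tv \<nu> \<Omega> - e < ba_integral \<Omega> \<nu> w" using n by (simp add: c_def)
  moreover have "w \<in> Linf \<Omega>" using sum unfolding w_def by blast
  moreover have "norm (w x) \<le> 1" for x unfolding w_def by (rule norm_sum_indicator_sgn[OF P(2)])
  ultimately show thesis using that by blast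
qed

lemma Linf_functional_mult:
  fixes m :: "'a \<Rightarrow> real"
  assumes l: "Linf_functional l" and m: "m \<in> Linf \<Omega>"
  shows "Linf_functional (\<lambda>y. l (\<lambda>x. m x *\<^sub>R y x))"
  unfolding Linf_functional_def linear_on_functions_def
proof (intro conjI ballI allI)
  fix y z :: "'a \<Rightarrow> 'a" assume y: "y \<in> Linf \<Omega>" and z: "z \<in> Linf \<Omega>"
  show "l (\<lambda>x. m x *\<^sub>R (y x + z x)) = l (\<lambda>x. m x *\<^sub>R y x) + l (\<lambda>x. m x *\<^sub>R z x)"
    using Linf_functional_add[OF l Linf_mult[OF m y] Linf_mult[OF m z]] by (simp add: scaleR_add_right)
next
  fix c and y :: "'a \<Rightarrow> 'a" assume y: "y \<in> Linf \<Omega>"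
  show "l (\<lambda>x. m x *\<^sub>R c *\<^sub>R y x) = c * l (\<lambda>x. m x *\<^sub>R y x)"
    using Linf_functional_scaleR[OF l Linf_mult[OF m y], of c] by (simp add: mult.commute)
next
  obtain K where K: "K \<ge> 0" "\<And>y C. y \<in> Linf \<Omega> \<Longrightarrow> C \<ge> 0 \<Longrightarrow> (AE x in L. norm (y x) \<le> C) \<Longrightarrow> \<bar>l y\<bar> \<le> K * C"
    using Linf_functional_bound[OF l] by blast
  obtain D where D: "D \<ge> 0" "AE x in L. norm (m x) \<le> D" using m by (rule LinfE)
  show "\<exists>K\<ge>0. \<forall>y\<in>Linf \<Omega>. \<forall>C\<ge>0. (AE x in L. norm (y x) \<le> C) \<longrightarrow> \<bar>l (\<lambda>x. m x *\<^sub>R y x)\<bar> \<le> K * C"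
  proof (intro exI[of _ "K * D"] conjI ballI allI impI)
    fix y :: "'a \<Rightarrow> 'a" and C :: real assume y: "y \<in> Linf \<Omega>" and C: "C \<ge> 0" "AE x in L. norm (y x) \<le> C"
    have "AE x in L. norm (m x *\<^sub>R y x) \<le> D * C"
      using D(2) C(2) by eventually_elim (use D(1) in \<open>auto intro!: mult_mono\<close>)
    then have "\<bar>l (\<lambda>x. m x *\<^sub>R y x)\<bar> \<le> K * (D * C)" using C D by (intro K Linf_mult m y) auto
    then show "\<bar>l (\<lambda>x. m x *\<^sub>R y x)\<bar> \<le> K * D * C" by (simp add: mult.assoc)
  qed (use K D in auto)
qed

lemma Linf_functional_plus:
  assumes l: "Linf_functional l" and m: "Linf_functional m"
  shows "Linf_functional (\<lambda>y. l y + m y)"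
  unfolding Linf_functional_def linear_on_functions_def
proof (intro conjI ballI allI)
  fix y z :: "'a \<Rightarrow> 'a" assume y: "y \<in> Linf \<Omega>" and z: "z \<in> Linf \<Omega>"
  show "l (\<lambda>x. y x + z x) + m (\<lambda>x. y x + z x) = l y + m y + (l z + m z)"
    using Linf_functional_add[OF l y z] Linf_functional_add[OF m y z] by simp
next
  fix c and y :: "'a \<Rightarrow> 'a" assume y: "y \<in> Linf \<Omega>"
  show "l (\<lambda>x. c *\<^sub>R y x) + m (\<lambda>x. c *\<^sub>R y x) = c * (l y + m y)"
    using Linf_functional_scaleR[OF l y, of c] Linf_functional_scaleR[OF m y, of c] by (simp add: distrib_left)
next
  obtain K where K: "K \<ge> 0" "\<And>y C. y \<in> Linf \<Omega> \<Longrightarrow> C \<ge> 0 \<Longrightarrow> (AE x in L. norm (y x) \<le> C) \<Longrightarrow> \<bar>l y\<bar> \<le> K * C"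
    using Linf_functional_bound[OF l] by blast
  obtain K' where K': "K' \<ge> 0" "\<And>y C. y \<in> Linf \<Omega> \<Longrightarrow> C \<ge> 0 \<Longrightarrow> (AE x in L. norm (y x) \<le> C) \<Longrightarrow> \<bar>m y\<bar> \<le> K' * C"
    using Linf_functional_bound[OF m] by blast
  show "\<exists>K\<ge>0. \<forall>y\<in>Linf \<Omega>. \<forall>C\<ge>0. (AE x in L. norm (y x) \<le> C) \<longrightarrow> \<bar>l y + m y\<bar> \<le> K * C"
  proof (intro exI[of _ "K + K'"] conjI ballI allI impI)
    fix y :: "'a \<Rightarrow> 'a" and C :: real assume "y \<in> Linf \<Omega>" "C \<ge> 0" "AE x in L. norm (y x) \<le> C"
    from K(2)[OF this] K'(2)[OF this] show "\<bar>l y + m y\<bar> \<le> (K + K') * C" by (simp add: distrib_right)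
  qed (use K K' in auto)
qed

lemma integrable_inner_Linf:
  assumes y: "integrable L y" and t: "t \<in> Linf \<Omega>"
  shows "integrable L (\<lambda>x. y x \<bullet> t x)"
proof -
  obtain C where C: "AE x in L. norm (t x) \<le> C" using t by (rule LinfE)
  show ?thesis
  proof (rule Bochner_Integration.integrable_bound)
    show "integrable L (\<lambda>x. C * norm (y x))" using y by auto
    show "AE x in L. norm (y x \<bullet> t x) \<le> norm (C * norm (y x))"
      using C
    proof eventually_elim
      case (elim x)
      have "\<bar>y x \<bullet> t x\<bar> \<le> norm (y x) * norm (t x)" by (rule Cauchy_Schwarz_ineq2)
      also have "\<dots> \<le> norm (y x) * C" using elim by (intro mult_left_mono) auto
      finally show ?case by (simp add: mult.commute)
    qed
    show "(\<lambda>x. y x \<bullet> t x) \<in> borel_measurable L" using y t by measurable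
  qed
qed

lemma Linf_functional_density:
  assumes y: "integrable L y"
  shows "Linf_functional (\<lambda>t. LINT x|L. y x \<bullet> t x)"
  unfolding Linf_functional_def linear_on_functions_def
proof (intro conjI ballI allI)
  fix s t :: "'a \<Rightarrow> 'a" assume s: "s \<in> Linf \<Omega>" and t: "t \<in> Linf \<Omega>"
  show "(LINT x|L. y x \<bullet> (s x + t x)) = (LINT x|L. y x \<bullet> s x) + (LINT x|L. y x \<bullet> t x)"
    unfolding inner_add_right by (rule Bochner_Integration.integral_add[OF integrable_inner_Linf[OF y s] integrable_inner_Linf[OF y t]])
next
  fix c and t :: "'a \<Rightarrow> 'a" assume t: "t \<in> Linf \<Omega>"
  show "(LINT x|L. y x \<bullet> c *\<^sub>R t x) = c * (LINT x|L. y x \<bullet> t x)" by simp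
next
  show "\<exists>K\<ge>0. \<forall>t\<in>Linf \<Omega>. \<forall>C\<ge>0. (AE x in L. norm (t x) \<le> C) \<longrightarrow> \<bar>LINT x|L. y x \<bullet> t x\<bar> \<le> K * C"
  proof (intro exI[of _ "LINT x|L. norm (y x)"] conjI ballI allI impI)
    fix t :: "'a \<Rightarrow> 'a" and C :: real assume t: "t \<in> Linf \<Omega>" and C: "C \<ge> 0" "AE x in L. norm (t x) \<le> C"
    have "norm (LINT x|L. y x \<bullet> t x) \<le> (LINT x|L. norm (y x \<bullet> t x))" by (rule integral_norm_bound)
    also have "\<dots> \<le> (LINT x|L. norm (y x) * C)"
    proof (rule integral_mono_AE)
      show "integrable L (\<lambda>x. norm (y x \<bullet> t x))" by (rule integrable_norm[OF integrable_inner_Linf[OF y t]])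
      show "integrable L (\<lambda>x. norm (y x) * C)" using y by auto
      show "AE x in L. norm (y x \<bullet> t x) \<le> norm (y x) * C"
        using C(2)
      proof eventually_elim
        case (elim x)
        have "\<bar>y x \<bullet> t x\<bar> \<le> norm (y x) * norm (t x)" by (rule Cauchy_Schwarz_ineq2)
        also have "\<dots> \<le> norm (y x) * C" using elim by (intro mult_left_mono) auto
        finally show ?case by simp
      qed
    qed
    finally show "\<bar>LINT x|L. y x \<bullet> t x\<bar> \<le> (LINT x|L. norm (y x)) * C" by simp
  qed simp
qed

lemma ba_integral_decomposition:
  assumes d: "ba_decomposition \<Omega> \<nu> y \<nu>s" and t: "t \<in> Linf \<Omega>"
  shows "ba_integral \<Omega> \<nu> t = (LINT x|L. y x \<bullet> t x) + ba_integral \<Omega> \<nu>s t"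
proof -
  have y: "integrable L y" and \<nu>s: "\<nu>s \<in> ba \<Omega>"
    and eq: "\<And>A. A \<in> sets L \<Longrightarrow> \<nu> A = (LINT x:A|L. y x) + \<nu>s A"
    using d unfolding ba_decomposition_def by auto
  have l: "Linf_functional (\<lambda>t. (LINT x|L. y x \<bullet> t x) + ba_integral \<Omega> \<nu>s t)"
    by (rule Linf_functional_plus[OF Linf_functional_density[OF y] Linf_functional_ba_integral[OF \<nu>s]])
  show ?thesis
  proof (rule ba_integral_eqI[OF l _ t])
    fix A c assume A: "A \<in> sets L"
    have "(LINT x|L. y x \<bullet> indicator A x *\<^sub>R c) = (LINT x|L. c \<bullet> (indicator A x *\<^sub>R y x))"
      by (simp add: inner_commute)
    also have "\<dots> = c \<bullet> (LINT x:A|L. y x)"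
      unfolding set_lebesgue_integral_def by (rule integral_inner_right) (use integrable_mult_indicator[OF A y] in simp)
    finally show "(LINT x|L. y x \<bullet> indicator A x *\<^sub>R c) + ba_integral \<Omega> \<nu>s (\<lambda>x. indicator A x *\<^sub>R c) = c \<bullet> \<nu> A"
      unfolding ba_integral_indicator[OF \<nu>s A] eq[OF A] by (simp add: inner_add_right)
  qed
qed

text \<open>The restricted integral is a bounded functional that vanishes on all indicator fields,
  so it is the functional of the zero measure.\<close>

lemma ba_integral_tv_null_set:
  assumes \<nu>: "\<nu> \<in> ba \<Omega>" and B: "B \<in> sets L" "tv \<nu> B = 0" and z: "z \<in> Linf \<Omega>"
  shows "ba_integral \<Omega> \<nu> (\<lambda>x. indicator B x *\<^sub>R z x) = 0"
proof -
  have ind: "(indicator B :: 'a \<Rightarrow> real) \<in> Linf \<Omega>"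
    by (rule LinfI[of _ 1]) (use B(1) in \<open>auto simp: indicator_def\<close>)
  note l = Linf_functional_mult[OF Linf_functional_ba_integral[OF \<nu>] ind]
  have zero: "Linf_functional (\<lambda>y. 0)" by (auto simp: Linf_functional_def linear_on_functions_def)
  have "ba_integral \<Omega> (\<lambda>A. 0) z = ba_integral \<Omega> \<nu> (\<lambda>x. indicator B x *\<^sub>R z x)"
  proof (rule ba_integral_eqI[OF l _ z])
    fix A and c :: 'a assume A: "A \<in> sets L"
    have "norm (\<nu> (A \<inter> B)) \<le> tv \<nu> (A \<inter> B)" using A B(1) by (intro norm_le_tv[OF \<nu>]) auto
    also have "\<dots> \<le> tv \<nu> B" using A B(1) by (intro tv_mono[OF \<nu>]) auto
    finally have "\<nu> (A \<inter> B) = 0" using B(2) by simp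
    moreover have "(\<lambda>x. indicator B x *\<^sub>R indicator A x *\<^sub>R c) = (\<lambda>x. indicator (A \<inter> B) x *\<^sub>R c)"
      by (auto simp: indicator_def fun_eq_iff)
    ultimately show "ba_integral \<Omega> \<nu> (\<lambda>x. indicator B x *\<^sub>R indicator A x *\<^sub>R c) = c \<bullet> 0"
      using ba_integral_indicator[OF \<nu> sets.Int[OF A B(1)]] by simp
  qed
  moreover have "ba_integral \<Omega> (\<lambda>A. 0) z = 0" by (rule ba_integral_eqI[OF zero _ z]) simp
  ultimately show ?thesis by simp
qed

lemma ba_cong:
  assumes \<nu>: "\<nu> \<in> ba \<Omega>" and eq: "\<And>A. A \<in> sets L \<Longrightarrow> \<nu>' A = \<nu> A"
  shows "\<nu>' \<in> ba \<Omega>"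
proof (rule baI_bounded)
  fix A B assume "A \<in> sets L" "B \<in> sets L" "A \<inter> B = {}"
  then show "\<nu>' (A \<union> B) = \<nu>' A + \<nu>' B" using eq ba_add[OF \<nu>, of A B] by (simp add: sets.Un)
next
  fix A assume "A \<in> null_sets L"
  then show "\<nu>' A = 0" using eq[of A] ba_null[OF \<nu>] by (simp add: null_setsD2)
next
  fix A :: "nat \<Rightarrow> 'a set" and n assume A: "\<And>i. A i \<in> sets L" "disjoint_family A"
  have "(\<Sum>i<n. norm (\<nu> (A i))) \<le> tv \<nu> \<Omega>"
    using A by (intro sum_norm_le_tv[OF \<nu>]) (auto intro: disjoint_family_on_mono simp: sets_L_iff)
  then show "(\<Sum>i<n. norm (\<nu>' (A i))) \<le> tv \<nu> \<Omega>" using eq[OF A(1)] by simp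
qed

text \<open>Multiplying the test field by \<zeta> gives a bounded functional. Its representing
  measure agrees with \<open>ba_scale\<close> on measurable sets, so bounded variation comes with
  the representation.\<close>

lemma
  assumes \<nu>: "\<nu> \<in> ba \<Omega>" and \<zeta>: "\<zeta> \<in> Linf \<Omega>"
  shows ba_scale_in_ba: "ba_scale \<Omega> \<zeta> \<nu> \<in> ba \<Omega>"
    and ba_integral_ba_scale: "\<And>w. w \<in> Linf \<Omega> \<Longrightarrow> ba_integral \<Omega> (ba_scale \<Omega> \<zeta> \<nu>) w = ba_integral \<Omega> \<nu> (\<lambda>x. \<zeta> x *\<^sub>R w x)"
proof -
  define l where "l w = ba_integral \<Omega> \<nu> (\<lambda>x. \<zeta> x *\<^sub>R w x)" for w
  have l: "Linf_functional l"
    unfolding l_def by (rule Linf_functional_mult[OF Linf_functional_ba_integral[OF \<nu>] \<zeta>])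
  obtain \<rho> where \<rho>: "\<rho> \<in> ba \<Omega>" "\<And>A c. A \<in> sets L \<Longrightarrow> l (\<lambda>x. indicator A x *\<^sub>R c) = c \<bullet> \<rho> A"
    by (rule Linf_functional_representation[OF l]) (rule that)
  have eq: "ba_scale \<Omega> \<zeta> \<nu> A = \<rho> A" if A: "A \<in> sets L" for A
  proof -
    have "ba_scale \<Omega> \<zeta> \<nu> A = (\<Sum>b\<in>Basis. l (\<lambda>x. indicator A x *\<^sub>R b) *\<^sub>R b)"
      unfolding ba_scale_def l_def scaleR_scaleR by (subst mult.commute) (rule refl)
    also have "\<dots> = \<rho> A" unfolding \<rho>(2)[OF A]       using euclidean_representation[of "\<rho> A"] by (simp add: inner_commute)
    finally show ?thesis .
  qed
  show "ba_scale \<Omega> \<zeta> \<nu> \<in> ba \<Omega>" by (rule ba_cong[OF \<rho>(1) eq])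
  show "ba_integral \<Omega> (ba_scale \<Omega> \<zeta> \<nu>) w = ba_integral \<Omega> \<nu> (\<lambda>x. \<zeta> x *\<^sub>R w x)" if "w \<in> Linf \<Omega>" for w
    using ba_integral_eqI[OF l _ that, of "ba_scale \<Omega> \<zeta> \<nu>"] \<rho>(2) eq by (simp add: l_def)
qed

end

section \<open>The conjugate of the constrained energy\<close>

locale bounded_lipschitz_problem = bounded_lipschitz_domain +
  fixes \<zeta> :: "'a \<Rightarrow> real" and c :: real
  assumes \<zeta>: "\<zeta> \<in> Linf \<Omega>" and c_pos: "c > 0" and c_le: "AE x in L. c \<le> \<zeta> x"
begin

definition feasible :: "('a \<Rightarrow> 'a) \<Rightarrow> bool" where
  "feasible t \<longleftrightarrow> (AE x in L. norm (t x) \<le> \<zeta> x)"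

definition energy :: "('a \<Rightarrow> 'a) \<Rightarrow> real" where
  "energy t = (LINT x|L. (norm (t x))\<^sup>2) / 2"

lemma \<zeta>_pos: "AE x in L. 0 < \<zeta> x"
  using c_le by eventually_elim (use c_pos in linarith)

lemma measurable_\<zeta> [measurable]: "\<zeta> \<in> borel_measurable L"
  using \<zeta> by (rule Linf_measurable)

lemma integrable_norm_square:
  assumes t: "t \<in> Linf \<Omega>"
  shows "integrable L (\<lambda>x. (norm (t x :: 'a))\<^sup>2)"
  using integrable_inner_Linf[OF integrable_Linf[OF t] t] by (simp add: power2_norm_eq_inner)

lemma functional_G_feasible:
  assumes t: "t \<in> Linf \<Omega>" and f: "feasible t"
  shows "functional_G \<Omega> \<zeta> t = ereal (energy t)"
proof -
  have "(\<integral>\<^sup>+x. e2ennreal (phi \<zeta> x (t x)) \<partial>L) = (\<integral>\<^sup>+x. ennreal ((norm (t x))\<^sup>2 / 2) \<partial>L)"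
    using f unfolding feasible_def
    by (intro nn_integral_cong_AE) (auto elim!: eventually_mono simp: phi_def e2ennreal_ereal)
  also have "\<dots> = ennreal (LINT x|L. (norm (t x))\<^sup>2 / 2)"
    by (rule nn_integral_eq_integral) (use integrable_norm_square[OF t] in auto)
  also have "(LINT x|L. (norm (t x))\<^sup>2 / 2) = energy t" by (simp add: energy_def)
  finally have "(\<integral>\<^sup>+x. e2ennreal (phi \<zeta> x (t x)) \<partial>L) = ennreal (energy t)" .
  moreover have "0 \<le> energy t" by (simp add: energy_def)
  ultimately show ?thesis by (simp add: functional_G_def enn2ereal_ennreal)
qed

lemma functional_G_infeasible:
  assumes t: "t \<in> Linf \<Omega>" and f: "\<not> feasible t"
  shows "functional_G \<Omega> \<zeta> t = \<infinity>"
proof -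
  define B where "B = {x\<in>\<Omega>. \<not> norm (t x) \<le> \<zeta> x}"
  have [measurable]: "t \<in> borel_measurable L" using t by (rule Linf_measurable)
  have "{x\<in>space L. \<not> norm (t x) \<le> \<zeta> x} \<in> sets L" by measurable
  then have B: "B \<in> sets L" by (simp add: B_def)
  have "emeasure L B \<noteq> 0"
  proof
    assume "emeasure L B = 0"
    then have "AE x in L. norm (t x) \<le> \<zeta> x" by (intro AE_I[of _ _ B]) (use B in \<open>auto simp: B_def\<close>)
    then show False using f by (simp add: feasible_def)
  qed
  then have "\<infinity> = (\<integral>\<^sup>+x. \<infinity> * indicator B x \<partial>L)"
    unfolding nn_integral_cmult_indicator[OF B] by (simp add: ennreal_top_mult)
  also have "\<dots> \<le> (\<integral>\<^sup>+x. e2ennreal (phi \<zeta> x (t x)) \<partial>L)"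
    by (intro nn_integral_mono) (auto simp: indicator_def B_def phi_def e2ennreal_infty)
  finally have "(\<integral>\<^sup>+x. e2ennreal (phi \<zeta> x (t x)) \<partial>L) = \<infinity>" by (simp add: top_unique)
  then show ?thesis by (simp add: functional_G_def)
qed

lemma integrable_phi_star:
  assumes y: "integrable L y"
  shows "integrable L (\<lambda>x. phi_star \<zeta> x (y x))"
proof (rule Bochner_Integration.integrable_bound)
  have [measurable]: "y \<in> borel_measurable L" using y by auto
  obtain C where C: "C \<ge> 0" "AE x in L. norm (\<zeta> x) \<le> C" using \<zeta> by (rule LinfE)
  have "integrable L (\<lambda>x. \<zeta> x *\<^sub>R norm (y x))"
    by (rule integrable_bounded_mult[of _ C]) (use C y in auto)
  then show "integrable L (\<lambda>x. \<zeta> x * norm (y x))" by simp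
  show "(\<lambda>x. phi_star \<zeta> x (y x)) \<in> borel_measurable L" unfolding phi_star_def by measurable
  show "AE x in L. norm (phi_star \<zeta> x (y x)) \<le> norm (\<zeta> x * norm (y x))"
    using \<zeta>_pos
  proof eventually_elim
    case (elim x)
    then show ?case using phi_star_bounds[of \<zeta> x "y x"] by simp
  qed
qed

text \<open>Dividing a feasible field by \<zeta> gives a field of norm at most 1, and \<zeta> moves
  over to the measure.\<close>

lemma ba_integral_le_tv_scale:
  assumes \<nu>: "\<nu> \<in> ba \<Omega>" and t: "t \<in> Linf \<Omega>" "feasible t"
  shows "ba_integral \<Omega> \<nu> t \<le> tv (ba_scale \<Omega> \<zeta> \<nu>) \<Omega>"
proof -
  define w where "w x = (1 / \<zeta> x) *\<^sub>R t x" for x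
  have [measurable]: "t \<in> borel_measurable L" using t(1) by (rule Linf_measurable)
  have w1: "AE x in L. norm (w x) \<le> 1"
    using t(2) \<zeta>_pos unfolding feasible_def by eventually_elim (simp add: w_def divide_le_eq_1)
  have w: "w \<in> Linf \<Omega>" by (rule LinfI[OF _ w1]) (unfold w_def, measurable)
  have "ba_integral \<Omega> \<nu> t = ba_integral \<Omega> \<nu> (\<lambda>x. \<zeta> x *\<^sub>R w x)"
  proof (rule Linf_functional_cong[OF Linf_functional_ba_integral[OF \<nu>] t(1) Linf_mult[OF \<zeta> w]])
    show "AE x in L. t x = \<zeta> x *\<^sub>R w x" using \<zeta>_pos by eventually_elim (simp add: w_def)
  qed
  also have "\<dots> = ba_integral \<Omega> (ba_scale \<Omega> \<zeta> \<nu>) w" by (rule ba_integral_ba_scale[OF \<nu> \<zeta> w, symmetric])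
  also have "\<dots> \<le> tv (ba_scale \<Omega> \<zeta> \<nu>) \<Omega> * 1"
    using ba_integral_bound[OF ba_scale_in_ba[OF \<nu> \<zeta>] w _ w1] by simp
  finally show ?thesis by simp
qed

text \<open>The intersection of the decreasing sets is null, so the indicators tend to 0 almost
  everywhere; dominated convergence applies with bound |r|.\<close>

lemma integral_over_vanishing_sets:
  fixes r :: "'a \<Rightarrow> real"
  assumes r: "integrable L r" and E: "decseq E" "\<And>n. E n \<in> sets L" "(\<lambda>n. emeasure L (E n)) \<longlonglongrightarrow> 0"
  shows "(\<lambda>n. LINT x|L. indicator (E n) x * r x) \<longlonglongrightarrow> 0"
proof -
  have "(\<Inter>n. E n) \<in> null_sets L"
  proof (rule null_setsI)
    have "emeasure L (\<Inter>n. E n) \<le> emeasure L (E n)" for n by (rule emeasure_mono) (use E(2) in auto)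
    then have "emeasure L (\<Inter>n. E n) \<le> 0" by (intro LIMSEQ_le_const[OF E(3)]) auto
    then show "emeasure L (\<Inter>n. E n) = 0" by simp
    show "(\<Inter>n. E n) \<in> sets L" using E(2) by auto
  qed
  then have ae: "AE x in L. x \<notin> (\<Inter>n. E n)" by (rule AE_not_in)
  have "(\<lambda>n. LINT x|L. indicator (E n) x * r x) \<longlonglongrightarrow> (LINT x|L. 0)"
  proof (rule integral_dominated_convergence[where w = "\<lambda>x. norm (r x)"])
    show "AE x in L. (\<lambda>n. indicator (E n) x * r x) \<longlonglongrightarrow> 0"
      using ae
    proof eventually_elim
      case (elim x)
      then obtain N where N: "x \<notin> E N" by blast
      have "x \<notin> E n" if "n \<ge> N" for n using N decseqD[OF E(1) that] by blast
      then have "eventually (\<lambda>n. indicator (E n) x * r x = 0) sequentially"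
        unfolding eventually_sequentially by (intro exI[of _ N]) (simp add: indicator_def)
      then show ?case by (rule tendsto_eventually)
    qed
    have [measurable]: "r \<in> borel_measurable L" using r by auto
    note [measurable] = E(2)
    show "(\<lambda>x. indicator (E n) x * r x) \<in> borel_measurable L" for n by measurable
    show "AE x in L. norm (indicator (E n) x * r x) \<le> norm (r x)" for n
      by (rule AE_I2) (simp add: indicator_def)
  qed (use r in auto)
  then show ?thesis by simp
qed

lemma feasible_Linf:
  assumes "t \<in> borel_measurable L" "feasible t"
  shows "t \<in> Linf \<Omega>"
proof -
  obtain C where C: "AE x in L. norm (\<zeta> x) \<le> C" using \<zeta> by (rule LinfE)
  have "AE x in L. norm (t x) \<le> C"
    using C assms(2) unfolding feasible_def by eventually_elim (simp add: abs_le_iff)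
  then show ?thesis using assms(1) by (rule LinfI[rotated])
qed

text \<open>Using the maximizer of \<open>y t - |t|\<^sup>2/2\<close> off a small set \<open>E n\<close> carrying \<open>\<nu>\<^sup>s\<close>, and a nearly
  norming field of \<open>\<zeta>\<nu>\<^sup>s\<close> on \<open>E n\<close>, decouples the two parts in the limit.\<close>

lemma conjugate_G_approximation:
  assumes d: "ba_decomposition \<Omega> \<nu> y \<nu>s" and e: "e > 0"
  obtains t where "t \<in> Linf \<Omega>" "feasible t"
    "(LINT x|L. phi_star \<zeta> x (y x)) + tv (ba_scale \<Omega> \<zeta> \<nu>s) \<Omega> - e < ba_integral \<Omega> \<nu> t - energy t"
proof -
  have y: "integrable L y" and \<nu>s: "\<nu>s \<in> ba \<Omega>" and "ba_singular \<Omega> \<nu>s"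
    using d unfolding ba_decomposition_def by auto
  then obtain E :: "nat \<Rightarrow> 'a set" where E: "decseq E" "\<And>n. E n \<in> sets L" "(\<lambda>n. emeasure L (E n)) \<longlonglongrightarrow> 0"
    "\<And>n. total_variation \<Omega> \<nu>s (\<Omega> - E n) = 0"
    unfolding ba_singular_def by (auto simp: image_subset_iff)
  obtain w where w: "w \<in> Linf \<Omega>" "\<And>x. norm (w x) \<le> 1"
    "tv (ba_scale \<Omega> \<zeta> \<nu>s) \<Omega> - e / 2 < ba_integral \<Omega> (ba_scale \<Omega> \<zeta> \<nu>s) w"
    using tv_approximation[OF ba_scale_in_ba[OF \<nu>s \<zeta>], of "e / 2"] e by auto
  have [measurable]: "y \<in> borel_measurable L" using y by auto
  define T where "T x = ball_projection (\<zeta> x) (y x)" for x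
  define W where "W x = \<zeta> x *\<^sub>R w x" for x
  have T_feas: "feasible T"
    unfolding feasible_def using \<zeta>_pos by eventually_elim (simp add: T_def norm_ball_projection)
  have W_feas: "feasible W"
    unfolding feasible_def using \<zeta>_pos by eventually_elim (simp add: W_def w(2) mult_left_le)
  have T: "T \<in> Linf \<Omega>" by (rule feasible_Linf[OF _ T_feas]) (unfold T_def ball_projection_def, measurable)
  have W: "W \<in> Linf \<Omega>" unfolding W_def by (rule Linf_mult[OF \<zeta> w(1)])
  \<comment> \<open>This is T off \<open>E n\<close> and W on \<open>E n\<close>. Written this way,
    the correction to W lives where \<open>\<nu>s\<close> has no variation, so the singular pairing
    sees only W, for every n.\<close>
  define t where "t n x = W x + indicator (\<Omega> - E n) x *\<^sub>R (T x - W x)" for n x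
  have compl: "\<Omega> - E n \<in> sets L" for n using E(2) by auto
  have t: "t n \<in> Linf \<Omega>" for n
    unfolding t_def by (rule Linf_add[OF W Linf_indicator[OF compl Linf_diff[OF T W]]])
  have t_feas: "feasible (t n)" for n
    using T_feas W_feas unfolding feasible_def by eventually_elim (auto simp: t_def indicator_def)
  have sing: "ba_integral \<Omega> \<nu>s (t n) = ba_integral \<Omega> (ba_scale \<Omega> \<zeta> \<nu>s) w" for n
  proof -
    note l = Linf_functional_ba_integral[OF \<nu>s]
    have "ba_integral \<Omega> \<nu>s (t n) = ba_integral \<Omega> \<nu>s W + ba_integral \<Omega> \<nu>s (\<lambda>x. indicator (\<Omega> - E n) x *\<^sub>R (T x - W x))"
      unfolding t_def by (rule Linf_functional_add[OF l W Linf_indicator[OF compl Linf_diff[OF T W]]])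
    also have "ba_integral \<Omega> \<nu>s (\<lambda>x. indicator (\<Omega> - E n) x *\<^sub>R (T x - W x)) = 0"
      by (rule ba_integral_tv_null_set[OF \<nu>s compl _ Linf_diff[OF T W]]) (simp add: tv_def E(4))
    also have "ba_integral \<Omega> \<nu>s W = ba_integral \<Omega> (ba_scale \<Omega> \<zeta> \<nu>s) w"
      unfolding W_def by (rule ba_integral_ba_scale[OF \<nu>s \<zeta> w(1), symmetric])
    finally show ?thesis by simp
  qed
  \<comment> \<open>The change in the absolutely continuous part caused by using W in place of the
    pointwise maximizer. It is integrable, so its contribution over \<open>E n\<close> tends to
    0.\<close>
  define r where "r x = (y x \<bullet> W x - (norm (W x))\<^sup>2 / 2) - phi_star \<zeta> x (y x)" for x
  have int_r: "integrable L r"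
    unfolding r_def
    by (intro Bochner_Integration.integrable_diff integrable_inner_Linf[OF y W] integrable_phi_star[OF y])
      (use integrable_norm_square[OF W] in auto)
  have ac: "(LINT x|L. y x \<bullet> t n x) - energy (t n) = (LINT x|L. phi_star \<zeta> x (y x)) + (LINT x|L. indicator (E n) x * r x)" for n
  proof -
    have ir: "integrable L (\<lambda>x. indicator (E n) x * r x)" using integrable_mult_indicator[OF E(2) int_r, of n] by simp
    have "(LINT x|L. y x \<bullet> t n x) - energy (t n) = (LINT x|L. y x \<bullet> t n x - (norm (t n x))\<^sup>2 / 2)"
      unfolding energy_def using integrable_inner_Linf[OF y t] integrable_norm_square[OF t]
      by (subst Bochner_Integration.integral_diff) auto
    also have "\<dots> = (LINT x|L. phi_star \<zeta> x (y x) + indicator (E n) x * r x)"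
    proof (rule integral_cong_AE)
      have [measurable]: "t n \<in> borel_measurable L" by (rule Linf_measurable[OF t])
      show "(\<lambda>x. y x \<bullet> t n x - (norm (t n x))\<^sup>2 / 2) \<in> borel_measurable L" by measurable
      show "(\<lambda>x. phi_star \<zeta> x (y x) + indicator (E n) x * r x) \<in> borel_measurable L"
        using integrable_phi_star[OF y] ir by auto
      show "AE x in L. y x \<bullet> t n x - (norm (t n x))\<^sup>2 / 2 = phi_star \<zeta> x (y x) + indicator (E n) x * r x"
        using \<zeta>_pos AE_space
      proof eventually_elim
        case (elim x)
        then show ?case
          using phi_star_attained[of \<zeta> x "y x"] by (cases "x \<in> E n") (auto simp: t_def T_def r_def)
      qed
    qed
    also have "\<dots> = (LINT x|L. phi_star \<zeta> x (y x)) + (LINT x|L. indicator (E n) x * r x)"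
      by (rule Bochner_Integration.integral_add[OF integrable_phi_star[OF y] ir])
    finally show ?thesis .
  qed
  have "eventually (\<lambda>n. (LINT x|L. indicator (E n) x * r x) > - (e / 2)) sequentially"
    using integral_over_vanishing_sets[OF int_r E(1-3)] e by (intro order_tendstoD(1)[of _ 0]) auto
  then obtain n where n: "(LINT x|L. indicator (E n) x * r x) > - (e / 2)"
    using eventually_happens' sequentially_bot by blast
  have "ba_integral \<Omega> \<nu> (t n) - energy (t n) =
      (LINT x|L. phi_star \<zeta> x (y x)) + (LINT x|L. indicator (E n) x * r x) + ba_integral \<Omega> (ba_scale \<Omega> \<zeta> \<nu>s) w"
    unfolding ba_integral_decomposition[OF d t] sing using ac[of n] by linarith
  then show thesis using that[OF t t_feas, of n] n w(3) by linarith
qed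

lemma conjugate_G_bound:
  assumes d: "ba_decomposition \<Omega> \<nu> y \<nu>s" and t: "t \<in> Linf \<Omega>" "feasible t"
  shows "ba_integral \<Omega> \<nu> t - energy t \<le> (LINT x|L. phi_star \<zeta> x (y x)) + tv (ba_scale \<Omega> \<zeta> \<nu>s) \<Omega>"
proof -
  have y: "integrable L y" and \<nu>s: "\<nu>s \<in> ba \<Omega>" using d unfolding ba_decomposition_def by auto
  have int: "integrable L (\<lambda>x. y x \<bullet> t x)" "integrable L (\<lambda>x. (norm (t x))\<^sup>2 / 2)"
    using integrable_inner_Linf[OF y t(1)] integrable_norm_square[OF t(1)] by auto
  have "(LINT x|L. y x \<bullet> t x) - energy t = (LINT x|L. y x \<bullet> t x - (norm (t x))\<^sup>2 / 2)"
    using Bochner_Integration.integral_diff[OF int] by (simp add: energy_def)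
  also have "\<dots> \<le> (LINT x|L. phi_star \<zeta> x (y x))"
  proof (rule integral_mono_AE)
    show "AE x in L. y x \<bullet> t x - (norm (t x))\<^sup>2 / 2 \<le> phi_star \<zeta> x (y x)"
      using t(2) unfolding feasible_def by eventually_elim (rule phi_star_upper)
  qed (use int integrable_phi_star[OF y] in auto)
  finally show ?thesis
    using ba_integral_decomposition[OF d t(1)] ba_integral_le_tv_scale[OF \<nu>s t] by linarith
qed

theorem conjugate_G:
  assumes d: "ba_decomposition \<Omega> \<nu> y \<nu>s"
  shows "fenchel_conjugate (Linf \<Omega>) (functional_G \<Omega> \<zeta>) (ba_integral \<Omega> \<nu>)
    = ereal ((LINT x|L. phi_star \<zeta> x (y x)) + tv (ba_scale \<Omega> \<zeta> \<nu>s) \<Omega>)" (is "?S = ereal ?A")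
proof (rule antisym)
  show "?S \<le> ereal ?A"
    unfolding fenchel_conjugate_def
  proof (rule SUP_least)
    fix t :: "'a \<Rightarrow> 'a" assume t: "t \<in> Linf \<Omega>"
    show "ereal (ba_integral \<Omega> \<nu> t) - functional_G \<Omega> \<zeta> t \<le> ereal ?A"
    proof (cases "feasible t")
      case True
      then show ?thesis using conjugate_G_bound[OF d t True] by (simp add: functional_G_feasible[OF t True])
    qed (simp add: functional_G_infeasible[OF t])
  qed
  show "ereal ?A \<le> ?S"
  proof (rule ereal_le_epsilon2)
    fix e :: real assume e: "0 < e"
    obtain t where t: "t \<in> Linf \<Omega>" "feasible t" "?A - e < ba_integral \<Omega> \<nu> t - energy t"
      using conjugate_G_approximation[OF d e] by blast
    have "ereal ?A \<le> ereal (ba_integral \<Omega> \<nu> t - energy t) + ereal e" using t(3) by simp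
    also have "ereal (ba_integral \<Omega> \<nu> t - energy t) = ereal (ba_integral \<Omega> \<nu> t) - functional_G \<Omega> \<zeta> t"
      by (simp add: functional_G_feasible[OF t(1,2)])
    also have "\<dots> \<le> ?S" unfolding fenchel_conjugate_def by (rule SUP_upper[OF t(1)])
    finally show "ereal ?A \<le> ?S + ereal e" by (simp add: add_right_mono)
  qed
qed

end

section \<open>Strong duality\<close>

context bounded_open_set begin

definition convex_on_functions :: "('a \<Rightarrow> 'a) set \<Rightarrow> (('a \<Rightarrow> 'a) \<Rightarrow> real) \<Rightarrow> bool" where
  "convex_on_functions C G \<longleftrightarrow> (\<forall>y\<in>C. \<forall>z\<in>C. \<forall>a\<in>{0..1}.
     (\<lambda>x. (1 - a) *\<^sub>R y x + a *\<^sub>R z x) \<in> C \<and>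
     G (\<lambda>x. (1 - a) *\<^sub>R y x + a *\<^sub>R z x) \<le> (1 - a) * G y + a * G z)"

text \<open>\<open>S\<close> is the graph of a linear functional on a subspace. The Hahn-Banach theorem is applied to the
  directional derivative at \<open>0\<close> of \<open>y \<mapsto> inf\<^bsub>(z, r) \<in> S\<^esub> (G (y0 + y + z) - r)\<close>, which is finite because \<open>y0 + z0\<close>
  is interior to \<open>C\<close>.\<close>

lemma subgradient_extending:
  fixes S :: "(('a \<Rightarrow> 'a) \<times> real) set"
  assumes convex: "convex_on_functions C G" and C: "C \<subseteq> Linf \<Omega>" and y0: "y0 \<in> C"
    and S: "\<And>z r. (z, r) \<in> S \<Longrightarrow> z \<in> Linf \<Omega>" "(\<lambda>x. 0, 0) \<in> S"
      "\<And>z r z' r'. (z, r) \<in> S \<Longrightarrow> (z', r') \<in> S \<Longrightarrow> (\<lambda>x. z x + z' x, r + r') \<in> S"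
      "\<And>z r a. (z, r) \<in> S \<Longrightarrow> (\<lambda>x. a *\<^sub>R z x, a * r) \<in> S"
    and minimal: "\<And>z r. (z, r) \<in> S \<Longrightarrow> (\<lambda>x. y0 x + z x) \<in> C \<Longrightarrow> G y0 \<le> G (\<lambda>x. y0 x + z x) - r"
    and slater: "(z0, r0) \<in> S" "\<rho> > 0"
      "\<And>y. y \<in> Linf \<Omega> \<Longrightarrow> (AE x in L. norm (y x) \<le> \<rho>) \<Longrightarrow> (\<lambda>x. y0 x + z0 x + y x) \<in> C"
      "\<And>y. y \<in> Linf \<Omega> \<Longrightarrow> (AE x in L. norm (y x) \<le> \<rho>) \<Longrightarrow> G (\<lambda>x. y0 x + z0 x + y x) \<le> B"
  obtains l where "Linf_functional l" "\<And>z r. (z, r) \<in> S \<Longrightarrow> l z = r"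
    "\<And>y. y \<in> C \<Longrightarrow> l (\<lambda>x. y x - y0 x) \<le> G y - G y0"
proof -
  define pert where "pert y t z = (\<lambda>x. y0 x + t *\<^sub>R (y x + z x))" for y z :: "'a \<Rightarrow> 'a" and t :: real
  \<comment> \<open>Difference quotients of the infimum with step t. The element taken from S is
    scaled to (t z, t r), so its value -t r contributes -r after division by t.\<close>
  define Q where "Q y = {(G (pert y t z) - G y0) / t - r | t z r. t > 0 \<and> (z, r) \<in> S \<and> pert y t z \<in> C}" for y
  have QI: "(G (pert y t z) - G y0) / t - r \<in> Q y" if "t > 0" "(z, r) \<in> S" "pert y t z \<in> C" for y t z r
    using that unfolding Q_def by blast
  have QE: "\<exists>t z r. q = (G (pert y t z) - G y0) / t - r \<and> t > 0 \<and> (z, r) \<in> S \<and> pert y t z \<in> C" if "q \<in> Q y" for q y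
    using that unfolding Q_def by blast
  have ne: "\<exists>q. q \<in> Q y" if y: "y \<in> Linf \<Omega>" for y
  proof -
    obtain M where M: "M \<ge> 0" "AE x in L. norm (y x) \<le> M" using y by (rule LinfE)
    \<comment> \<open>With z0 / t taken from S the perturbed point is y0 + z0 + t y, and this step
      keeps t y within the radius \<rho> of the interior point.\<close>
    define t where "t = \<rho> / (M + 1)"
    have t: "t > 0" using M(1) slater(2) by (simp add: t_def)
    have "t * M \<le> \<rho>" using M(1) slater(2) by (simp add: t_def field_simps)
    then have "AE x in L. norm (t *\<^sub>R y x) \<le> \<rho>"
      using M(2)
    proof (elim eventually_mono)
      fix x assume "norm (y x) \<le> M" "t * M \<le> \<rho>"
      then have "t * norm (y x) \<le> \<rho>" using t mult_left_mono[of "norm (y x)" M t] by linarith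
      then show "norm (t *\<^sub>R y x) \<le> \<rho>" using t by simp
    qed
    then have "(\<lambda>x. y0 x + z0 x + t *\<^sub>R y x) \<in> C" by (intro slater(3) Linf_scaleR y)
    moreover have "pert y t (\<lambda>x. (1 / t) *\<^sub>R z0 x) = (\<lambda>x. y0 x + z0 x + t *\<^sub>R y x)"
      using t by (simp add: pert_def algebra_simps)
    ultimately have "pert y t (\<lambda>x. (1 / t) *\<^sub>R z0 x) \<in> C" by simp
    from QI[OF t S(4)[OF slater(1), of "1 / t"] this] show ?thesis by blast
  qed
  have combine: "\<exists>q\<in>Q (\<lambda>x. y1 x + y2 x). q \<le> q1 + q2" if q: "q1 \<in> Q y1" "q2 \<in> Q y2" for y1 y2 q1 q2
  proof -
    obtain t1 z1 r1 where 1: "q1 = (G (pert y1 t1 z1) - G y0) / t1 - r1" "t1 > 0" "(z1, r1) \<in> S" "pert y1 t1 z1 \<in> C"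
      using QE[OF q(1)] by blast
    obtain t2 z2 r2 where 2: "q2 = (G (pert y2 t2 z2) - G y0) / t2 - r2" "t2 > 0" "(z2, r2) \<in> S" "pert y2 t2 z2 \<in> C"
      using QE[OF q(2)] by blast
    \<comment> \<open>The convex weights balance the steps, (1 - a) t1 = a t2 = t, so the convex
      combination of the two perturbed points is the perturbed point for y1 + y2 with step
      t.\<close>
    define a where "a = t1 / (t1 + t2)"
    define t where "t = t1 * t2 / (t1 + t2)"
    have t: "t > 0" using 1(2) 2(2) by (simp add: t_def)
    have a: "0 \<le> a" "a \<le> 1" using 1(2) 2(2) by (auto simp: a_def)
    have at: "(1 - a) * t1 = t" "a * t2 = t" using 1(2) 2(2) by (simp_all add: a_def t_def field_simps)
    have "(\<lambda>x. (1 - a) *\<^sub>R pert y1 t1 z1 x + a *\<^sub>R pert y2 t2 z2 x) = pert (\<lambda>x. y1 x + y2 x) t (\<lambda>x. z1 x + z2 x)"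
    proof
      fix x
      have "(1 - a) *\<^sub>R pert y1 t1 z1 x + a *\<^sub>R pert y2 t2 z2 x
          = y0 x + ((1 - a) * t1) *\<^sub>R (y1 x + z1 x) + (a * t2) *\<^sub>R (y2 x + z2 x)"
        by (simp add: pert_def algebra_simps)
      then show "(1 - a) *\<^sub>R pert y1 t1 z1 x + a *\<^sub>R pert y2 t2 z2 x = pert (\<lambda>x. y1 x + y2 x) t (\<lambda>x. z1 x + z2 x) x"
        unfolding at by (simp add: pert_def algebra_simps)
    qed
    then have mem: "pert (\<lambda>x. y1 x + y2 x) t (\<lambda>x. z1 x + z2 x) \<in> C"
      and le: "G (pert (\<lambda>x. y1 x + y2 x) t (\<lambda>x. z1 x + z2 x)) \<le> (1 - a) * G (pert y1 t1 z1) + a * G (pert y2 t2 z2)"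
      using convex 1(4) 2(4) a unfolding convex_on_functions_def by (metis atLeastAtMost_iff)+
    have "(G (pert (\<lambda>x. y1 x + y2 x) t (\<lambda>x. z1 x + z2 x)) - G y0) / t
        \<le> ((1 - a) * (G (pert y1 t1 z1) - G y0) + a * (G (pert y2 t2 z2) - G y0)) / t"
      using le t by (intro divide_right_mono) (auto simp: algebra_simps)
    also have "\<dots> = (G (pert y1 t1 z1) - G y0) * ((1 - a) / t) + (G (pert y2 t2 z2) - G y0) * (a / t)"
      by (simp add: add_divide_distrib mult.commute)
    also have "(1 - a) / t = 1 / t1" using at(1) t 1(2) by (simp add: field_simps)
    also have "a / t = 1 / t2" using at(2) t 2(2) by (simp add: field_simps)
    finally have "(G (pert (\<lambda>x. y1 x + y2 x) t (\<lambda>x. z1 x + z2 x)) - G y0) / t - (r1 + r2) \<le> q1 + q2"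
      by (simp add: 1(1) 2(1))
    then show ?thesis using QI[OF t S(3)[OF 1(3) 2(3)] mem] by blast
  qed
  have zero_nonneg: "0 \<le> q" if q0: "q \<in> Q (\<lambda>x. 0)" for q
  proof -
    obtain t z r where q: "q = (G (pert (\<lambda>x. 0) t z) - G y0) / t - r" "t > 0" "(z, r) \<in> S" "pert (\<lambda>x. 0) t z \<in> C"
      using QE[OF q0] by blast
    \<comment> \<open>In direction 0 only elements of S perturb y0, and there y0 is minimal by
      hypothesis.\<close>
    have "G y0 \<le> G (pert (\<lambda>x. 0) t z) - t * r"
      using minimal[OF S(4)[OF q(3), of t]] q(4) by (simp add: pert_def)
    then have "r \<le> (G (pert (\<lambda>x. 0) t z) - G y0) / t" using q(2) by (simp add: pos_le_divide_eq mult.commute)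
    then show ?thesis by (simp add: q(1))
  qed
  have scale: "a * q \<in> Q (\<lambda>x. a *\<^sub>R y x)" if a: "a > 0" and q: "q \<in> Q y" for a q y
  proof -
    obtain t z r where 1: "q = (G (pert y t z) - G y0) / t - r" "t > 0" "(z, r) \<in> S" "pert y t z \<in> C"
      using QE[OF q] by blast
    have eq: "pert (\<lambda>x. a *\<^sub>R y x) (t / a) (\<lambda>x. a *\<^sub>R z x) = pert y t z"
      using a by (simp add: pert_def flip: scaleR_add_right)
    have "(G (pert y t z) - G y0) / (t / a) - a * r \<in> Q (\<lambda>x. a *\<^sub>R y x)"
      using QI[of "t / a" "\<lambda>x. a *\<^sub>R z x" "a * r" "\<lambda>x. a *\<^sub>R y x"] S(4)[OF 1(3)] 1 a unfolding eq by simp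
    moreover have "(G (pert y t z) - G y0) / (t / a) - a * r = a * q" using a by (simp add: 1(1) field_simps)
    ultimately show ?thesis by simp
  qed
  have bdd: "bdd_below (Q y)" if y: "y \<in> Linf \<Omega>" for y
  proof -
    \<comment> \<open>A quotient in direction -y bounds all quotients in direction y: their sum
      dominates a quotient in direction 0, which is nonnegative.\<close>
    obtain q' where q': "q' \<in> Q (\<lambda>x. - y x)" using ne[OF Linf_minus[OF y]] by blast
    have "- q' \<le> q" if q: "q \<in> Q y" for q
    proof -
      obtain q0 where "q0 \<in> Q (\<lambda>x. y x + - y x)" "q0 \<le> q + q'" using combine[OF q q'] by blast
      then show ?thesis using zero_nonneg[of q0] by simp
    qed
    then show ?thesis by (rule bdd_belowI)
  qed
  define p where "p y = Inf (Q y)" for y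
  have p_le: "p y \<le> q" if "y \<in> Linf \<Omega>" "q \<in> Q y" for y q
    unfolding p_def by (rule cInf_lower[OF that(2) bdd[OF that(1)]])
  have p_ge: "m \<le> p y" if "y \<in> Linf \<Omega>" "\<And>q. q \<in> Q y \<Longrightarrow> m \<le> q" for y m
    unfolding p_def using ne[OF that(1)] that(2) by (intro cInf_greatest) auto
  have p_scale: "a * p y \<le> p (\<lambda>x. a *\<^sub>R y x)" if a: "a > 0" and y: "y \<in> Linf \<Omega>" for a y
  proof (rule p_ge[OF Linf_scaleR[OF y]])
    fix q assume "q \<in> Q (\<lambda>x. a *\<^sub>R y x)"
    then have "(1 / a) * q \<in> Q (\<lambda>x. (1 / a) *\<^sub>R a *\<^sub>R y x)" using a by (intro scale) auto
    then have "p y \<le> (1 / a) * q" using a by (intro p_le[OF y]) simp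
    then show "a * p y \<le> q" using a by (simp add: field_simps)
  qed
  have sub: "sublinear_on (Linf \<Omega>) p"
    unfolding sublinear_on_def
  proof (intro conjI ballI allI impI)
    fix y z :: "'a \<Rightarrow> 'a" assume y: "y \<in> Linf \<Omega>" and z: "z \<in> Linf \<Omega>"
    have "p (\<lambda>x. y x + z x) - q1 \<le> q2" if "q1 \<in> Q y" "q2 \<in> Q z" for q1 q2
    proof -
      obtain q where "q \<in> Q (\<lambda>x. y x + z x)" "q \<le> q1 + q2" using combine[OF \<open>q1 \<in> Q y\<close> \<open>q2 \<in> Q z\<close>] by blast
      then show ?thesis using p_le[OF Linf_add[OF y z], of q] by linarith
    qed
    then have "p (\<lambda>x. y x + z x) - q1 \<le> p z" if "q1 \<in> Q y" for q1 by (rule p_ge[OF z]) (use that in blast)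
    then have "p (\<lambda>x. y x + z x) - p z \<le> q1" if "q1 \<in> Q y" for q1 using that by (simp add: algebra_simps)
    then have "p (\<lambda>x. y x + z x) - p z \<le> p y" by (rule p_ge[OF y])
    then show "p (\<lambda>x. y x + z x) \<le> p y + p z" by simp
  next
    fix a :: real and y :: "'a \<Rightarrow> 'a" assume a: "a > 0" and y: "y \<in> Linf \<Omega>"
    have "(1 / a) * p (\<lambda>x. a *\<^sub>R y x) \<le> p (\<lambda>x. (1 / a) *\<^sub>R a *\<^sub>R y x)" using a by (intro p_scale Linf_scaleR y) simp
    then have "p (\<lambda>x. a *\<^sub>R y x) \<le> a * p y" using a by (simp add: field_simps)
    then show "p (\<lambda>x. a *\<^sub>R y x) = a * p y" using p_scale[OF a y] by simp
  next
    have "pert (\<lambda>x. 0) 1 (\<lambda>x. 0) = y0" by (simp add: pert_def)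
    then have "0 \<in> Q (\<lambda>x. 0)" using QI[OF zero_less_one S(2), of "\<lambda>x. 0"] y0 by simp
    then have "p (\<lambda>x. 0) \<le> 0" by (intro p_le) auto
    moreover have "0 \<le> p (\<lambda>x. 0)" by (intro p_ge zero_nonneg) auto
    ultimately show "p (\<lambda>x. 0) = 0" by simp
  qed
  obtain l where l: "linear_on_functions (Linf \<Omega>) l" "\<And>y. y \<in> Linf \<Omega> \<Longrightarrow> l y \<le> p y"
    using sublinear_on_dominates_linear[OF function_subspace_Linf sub] by blast
  have l_scale: "l (\<lambda>x. a *\<^sub>R y x) = a * l y" if "y \<in> Linf \<Omega>" for y a
    using l(1) that unfolding linear_on_functions_def by blast
  have l_le: "l y \<le> q" if "y \<in> Linf \<Omega>" "q \<in> Q y" for y q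
    using l(2)[OF that(1)] p_le[OF that] by simp
  have l_graph_le: "l z \<le> r" if zr: "(z, r) \<in> S" for z r
  proof -
    have m: "(\<lambda>x. (-1) *\<^sub>R z x, (-1) * r) \<in> S" by (rule S(4)[OF zr])
    \<comment> \<open>In direction z, the element (-z, -r) of S cancels the perturbation, leaving
      the quotient r. Doing the same for -z gives equality on the graph.\<close>
    have eq: "pert z 1 (\<lambda>x. (-1) *\<^sub>R z x) = y0" by (simp add: pert_def)
    show ?thesis using l_le[OF S(1)[OF zr] QI[OF zero_less_one m, of z]] y0 unfolding eq by simp
  qed
  have graph: "l z = r" if zr: "(z, r) \<in> S" for z r
    using l_graph_le[OF zr] l_graph_le[OF S(4)[OF zr, of "-1"]] l_scale[OF S(1)[OF zr], of "-1"] by simp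
  have subgrad: "l (\<lambda>x. y x - y0 x) \<le> G y - G y0" if y: "y \<in> C" for y
  proof -
    have eq: "pert (\<lambda>x. y x - y0 x) 1 (\<lambda>x. 0) = y" by (simp add: pert_def)
    have "(\<lambda>x. y x - y0 x) \<in> Linf \<Omega>" using C y y0 by (intro Linf_diff) auto
    from l_le[OF this QI[OF zero_less_one S(2), of "\<lambda>x. y x - y0 x"]] show ?thesis using y unfolding eq by simp
  qed
  \<comment> \<open>The element (z0, r0) with step 1 bounds l from above on the ball of radius
    \<rho>, and symmetry of the ball gives the two-sided bound.\<close>
  define B' where "B' = B - G y0 - r0"
  have l_ball: "l y \<le> B'" if y: "y \<in> Linf \<Omega>" "AE x in L. norm (y x) \<le> \<rho>" for y
  proof -
    have eq: "pert y 1 z0 = (\<lambda>x. y0 x + z0 x + y x)" by (simp add: pert_def algebra_simps)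
    have "l y \<le> (G (pert y 1 z0) - G y0) / 1 - r0"
      by (rule l_le[OF y(1) QI[OF zero_less_one slater(1)]]) (unfold eq, rule slater(3)[OF y])
    also have "\<dots> \<le> B'" unfolding eq B'_def using slater(4)[OF y] by simp
    finally show ?thesis .
  qed
  have l_abs: "\<bar>l y\<bar> \<le> B'" if y: "y \<in> Linf \<Omega>" "AE x in L. norm (y x) \<le> \<rho>" for y
    using l_ball[OF y] l_ball[OF Linf_scaleR[OF y(1), of "-1"]] l_scale[OF y(1), of "-1"] y(2) by simp
  have B': "B' \<ge> 0" using l_abs[of "\<lambda>x. 0"] slater(2) by simp
  have "Linf_functional l"
    unfolding Linf_functional_def
  proof (intro conjI l(1) exI[of _ "B' / \<rho>"] ballI allI impI)
    fix y :: "'a \<Rightarrow> 'a" and D :: real assume y: "y \<in> Linf \<Omega>" and D: "0 \<le> D" "AE x in L. norm (y x) \<le> D"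
    \<comment> \<open>The field is normalised by D + e because its essential bound D may be
      0.\<close>
    have step: "\<bar>l y\<bar> \<le> B' / \<rho> * (D + e)" if e: "e > 0" for e
    proof -
      define a where "a = \<rho> / (D + e)"
      have a: "a > 0" using e D(1) slater(2) by (simp add: a_def)
      have "AE x in L. norm (a *\<^sub>R y x) \<le> \<rho>"
        using D(2)
      proof eventually_elim
        case (elim x)
        have "a * norm (y x) \<le> a * (D + e)" using elim e a by (intro mult_left_mono) auto
        also have "\<dots> = \<rho>" using e D(1) by (simp add: a_def)
        finally show ?case using a by simp
      qed
      then have "\<bar>a * l y\<bar> \<le> B'" using l_abs[OF Linf_scaleR[OF y, of a]] l_scale[OF y, of a] by simp
      then have "\<bar>l y\<bar> \<le> B' / a" using a by (simp add: abs_mult pos_le_divide_eq mult.commute)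
      also have "B' / a = B' / \<rho> * (D + e)" using e D(1) slater(2) by (simp add: a_def)
      finally show ?thesis .
    qed
    show "\<bar>l y\<bar> \<le> B' / \<rho> * D"
    proof (rule field_le_epsilon)
      fix e :: real assume e: "e > 0"
      define e' where "e' = e / (B' / \<rho> + 1)"
      have K: "B' / \<rho> \<ge> 0" using B' slater(2) by simp
      have e': "e' > 0" using e K by (simp add: e'_def)
      have "(B' / \<rho> + 1) * e' = e" using K by (simp add: e'_def)
      then have "B' / \<rho> * e' \<le> e" using e' by (simp add: distrib_right)
      then show "\<bar>l y\<bar> \<le> B' / \<rho> * D + e" using step[OF e'] by (simp add: distrib_left)
    qed
  qed (use B' slater(2) in simp)
  then show thesis using that graph subgrad by blast
qed

end

context bounded_lipschitz_problem begin

lemma convex_energy: "convex_on_functions {t \<in> Linf \<Omega>. feasible t} energy"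
  unfolding convex_on_functions_def
proof (intro ballI conjI)
  fix y z a assume "y \<in> {t \<in> Linf \<Omega>. feasible t}" "z \<in> {t \<in> Linf \<Omega>. feasible t}" and a: "a \<in> {0..1::real}"
  then have y: "y \<in> Linf \<Omega>" "feasible y" and z: "z \<in> Linf \<Omega>" "feasible z" by auto
  let ?w = "\<lambda>x. (1 - a) *\<^sub>R y x + a *\<^sub>R z x"
  have w: "?w \<in> Linf \<Omega>" by (intro Linf_add Linf_scaleR y z)
  have "feasible ?w"
    using y(2) z(2) unfolding feasible_def
  proof eventually_elim
    case (elim x)
    have "norm (?w x) \<le> (1 - a) * norm (y x) + a * norm (z x)"
      using a norm_triangle_ineq[of "(1 - a) *\<^sub>R y x" "a *\<^sub>R z x"] by simp
    also have "\<dots> \<le> \<zeta> x" using convex_bound_le[OF elim, of "1 - a" a] a by simp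
    finally show ?case .
  qed
  then show "?w \<in> {t \<in> Linf \<Omega>. feasible t}" using w by simp
  have sq: "(norm (?w x))\<^sup>2 \<le> (1 - a) * (norm (y x))\<^sup>2 + a * (norm (z x))\<^sup>2" for x
  proof -
    have "(1 - a) * (norm (y x))\<^sup>2 + a * (norm (z x))\<^sup>2 - (norm (?w x))\<^sup>2 = (a * (1 - a)) * (norm (y x - z x))\<^sup>2"
      by (simp add: power2_norm_eq_inner inner_add_left inner_add_right inner_diff_left inner_diff_right
          inner_commute algebra_simps)
    moreover have "0 \<le> (a * (1 - a)) * (norm (y x - z x))\<^sup>2" using a by simp
    ultimately show ?thesis by linarith
  qed
  have "(LINT x|L. (norm (?w x))\<^sup>2) \<le> (LINT x|L. (1 - a) * (norm (y x))\<^sup>2 + a * (norm (z x))\<^sup>2)"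
    by (intro integral_mono sq) (use integrable_norm_square y z w in auto)
  also have "\<dots> = (1 - a) * (LINT x|L. (norm (y x))\<^sup>2) + a * (LINT x|L. (norm (z x))\<^sup>2)"
    using integrable_norm_square[OF y(1)] integrable_norm_square[OF z(1)] by simp
  finally show "energy ?w \<le> (1 - a) * energy y + a * energy z" by (simp add: energy_def)
qed

lemma feasible_cong: "AE x in L. s x = t x \<Longrightarrow> feasible s \<longleftrightarrow> feasible t"
  unfolding feasible_def by (intro iffI; elim eventually_rev_mp; simp; auto elim: eventually_mono)

lemma energy_cong:
  assumes "s \<in> Linf \<Omega>" "t \<in> Linf \<Omega>" "AE x in L. s x = t x"
  shows "energy s = energy t"
proof -
  have "(LINT x|L. (norm (s x))\<^sup>2) = (LINT x|L. (norm (t x))\<^sup>2)"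
    by (rule integral_cong_AE) (use assms integrable_norm_square in \<open>auto elim: eventually_mono\<close>)
  then show ?thesis by (simp add: energy_def)
qed

end

section \<open>The primal and dual problems\<close>

locale gradient_constrained_problem = bounded_lipschitz_problem +
  fixes \<Gamma>D \<Gamma>N :: "'a set" and f uD uD_hat :: "'a \<Rightarrow> real" and g :: "('a \<Rightarrow> real) \<Rightarrow> real" and q :: real
  assumes \<Gamma>D: "\<Gamma>D \<subseteq> closure \<Omega>" and \<Gamma>N: "\<Gamma>N \<subseteq> closure \<Omega>"
    and f: "integrable L f" and g: "g \<in> W1inf_surface_dual \<Gamma>N"
    and uD_hat: "uD_hat \<in> W1inf \<Omega>" "surface_ae \<Gamma>D (\<lambda>x. bd_trace \<Omega> uD_hat x = uD x)"
    and q: "q < 1" "AE x in L. norm (grad \<Omega> uD_hat x) \<le> q * \<zeta> x"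
begin

abbreviation load' :: "('a \<Rightarrow> real) \<Rightarrow> real" where "load' \<equiv> load \<Omega> f g"

definition has_trace :: "('a \<Rightarrow> real) \<Rightarrow> bool" where
  "has_trace v \<longleftrightarrow> surface_ae \<Gamma>D (\<lambda>x. bd_trace \<Omega> v x = uD x)"

lemma load'_linear: "v \<in> W1inf \<Omega> \<Longrightarrow> w \<in> W1inf \<Omega> \<Longrightarrow> load' (\<lambda>x. v x + a * w x) = load' v + a * load' w"
  by (rule load_linear[OF f g \<Gamma>N])

lemma ba_integral_grad_linear:
  assumes \<nu>: "\<nu> \<in> ba \<Omega>" and v: "v \<in> W1inf \<Omega>" and w: "w \<in> W1inf \<Omega>"
  shows "ba_integral \<Omega> \<nu> (grad \<Omega> (\<lambda>x. v x + a * w x)) = ba_integral \<Omega> \<nu> (grad \<Omega> v) + a * ba_integral \<Omega> \<nu> (grad \<Omega> w)"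
proof -
  note l = Linf_functional_ba_integral[OF \<nu>]
  have gv: "grad \<Omega> v \<in> Linf \<Omega>" and gw: "grad \<Omega> w \<in> Linf \<Omega>" using W1inf_grad v w by auto
  have "ba_integral \<Omega> \<nu> (grad \<Omega> (\<lambda>x. v x + a * w x)) = ba_integral \<Omega> \<nu> (\<lambda>x. grad \<Omega> v x + a *\<^sub>R grad \<Omega> w x)"
    by (rule Linf_functional_cong[OF l W1inf_grad(1)[OF W1inf_linear[OF v w]] Linf_add[OF gv Linf_scaleR[OF gw]] grad_linear[OF v w]])
  also have "\<dots> = ba_integral \<Omega> \<nu> (grad \<Omega> v) + ba_integral \<Omega> \<nu> (\<lambda>x. a *\<^sub>R grad \<Omega> w x)"
    by (rule Linf_functional_add[OF l gv Linf_scaleR[OF gw]])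
  also have "ba_integral \<Omega> \<nu> (\<lambda>x. a *\<^sub>R grad \<Omega> w x) = a * ba_integral \<Omega> \<nu> (grad \<Omega> w)"
    by (rule Linf_functional_scaleR[OF l gw])
  finally show ?thesis .
qed

lemma has_trace_diff:
  assumes "v \<in> W1inf \<Omega>" "has_trace v" "w \<in> W1inf \<Omega>" "has_trace w"
  shows "(\<lambda>x. v x + (-1) * w x) \<in> W1inf_D \<Omega> \<Gamma>D"
  using trace_condition_linear[OF \<Gamma>D assms(1,3) assms(2,4)[unfolded has_trace_def], of "-1"] W1inf_linear[OF assms(1,3), of "-1"]
  unfolding W1inf_D_def by simp

lemma has_trace_add:
  assumes "v \<in> W1inf \<Omega>" "has_trace v" "w \<in> W1inf_D \<Omega> \<Gamma>D"
  shows "has_trace (\<lambda>x. v x + a * w x)"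
  using trace_condition_linear[OF \<Gamma>D assms(1) _ assms(2)[unfolded has_trace_def], of w "\<lambda>x. 0" a] assms(3)
  unfolding W1inf_D_def has_trace_def by simp

lemma has_trace_uD_hat: "has_trace uD_hat"
  using uD_hat(2) by (simp add: has_trace_def)

text \<open>The defect in the equilibrium equation. For \<nu> in \<open>K_star\<close> it depends on
  v only through the Dirichlet data, and its value on functions with trace \<open>uD\<close> is the
  conjugate of F at the negative adjoint.\<close>

definition residual :: "('a set \<Rightarrow> 'a) \<Rightarrow> ('a \<Rightarrow> real) \<Rightarrow> real" where
  "residual \<nu> v = load' v - ba_integral \<Omega> \<nu> (grad \<Omega> v)"

lemma residual_linear:
  assumes "\<nu> \<in> ba \<Omega>" "v \<in> W1inf \<Omega>" "w \<in> W1inf \<Omega>"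
  shows "residual \<nu> (\<lambda>x. v x + a * w x) = residual \<nu> v + a * residual \<nu> w"
  unfolding residual_def load'_linear[OF assms(2,3)] ba_integral_grad_linear[OF assms] by (simp add: algebra_simps)

lemma K_star_iff: "\<nu> \<in> K_star \<Omega> \<Gamma>D f g \<longleftrightarrow> \<nu> \<in> ba \<Omega> \<and> (\<forall>w\<in>W1inf_D \<Omega> \<Gamma>D. residual \<nu> w = 0)"
  by (auto simp: K_star_def residual_def)

lemma residual_eq_of_trace:
  assumes \<nu>: "\<nu> \<in> K_star \<Omega> \<Gamma>D f g" and v: "v \<in> W1inf \<Omega>" "has_trace v"
  shows "residual \<nu> v = residual \<nu> uD_hat"
proof -
  have "residual \<nu> (\<lambda>x. v x + (-1) * uD_hat x) = residual \<nu> v + (-1) * residual \<nu> uD_hat"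
    using \<nu> v uD_hat by (intro residual_linear) (auto simp: K_star_iff)
  moreover have "residual \<nu> (\<lambda>x. v x + (-1) * uD_hat x) = 0"
    using \<nu> has_trace_diff[OF v uD_hat(1) has_trace_uD_hat] unfolding K_star_iff by blast
  ultimately show ?thesis by simp
qed

lemma conjugate_F_term:
  "ereal (- grad_adjoint \<Omega> \<nu> v) - functional_F \<Omega> \<Gamma>D f g uD v = (if has_trace v then ereal (residual \<nu> v) else - \<infinity>)"
  by (simp add: functional_F_def has_trace_def grad_adjoint_def residual_def)

text \<open>Outside \<open>K_star\<close> some w with zero Dirichlet trace has nonzero residual.
  Adding multiples of it to \<open>uD_hat\<close> preserves the trace and reaches every real value,
  so the supremum is infinite.\<close>

lemma conjugate_F:
  assumes \<nu>: "\<nu> \<in> ba \<Omega>"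
  shows "fenchel_conjugate (W1inf \<Omega>) (functional_F \<Omega> \<Gamma>D f g uD) (\<lambda>v. - grad_adjoint \<Omega> \<nu> v)
    = (if \<nu> \<in> K_star \<Omega> \<Gamma>D f g then ereal (residual \<nu> uD_hat) else \<infinity>)"
proof (cases "\<nu> \<in> K_star \<Omega> \<Gamma>D f g")
  case True
  have "(SUP v\<in>W1inf \<Omega>. if has_trace v then ereal (residual \<nu> v) else - \<infinity>) = ereal (residual \<nu> uD_hat)"
  proof (rule antisym)
    show "(SUP v\<in>W1inf \<Omega>. if has_trace v then ereal (residual \<nu> v) else - \<infinity>) \<le> ereal (residual \<nu> uD_hat)"
      by (rule SUP_least) (use residual_eq_of_trace[OF True] in simp)
    show "ereal (residual \<nu> uD_hat) \<le> (SUP v\<in>W1inf \<Omega>. if has_trace v then ereal (residual \<nu> v) else - \<infinity>)"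
      by (rule SUP_upper2[OF uD_hat(1)]) (simp add: has_trace_uD_hat)
  qed
  then show ?thesis using True by (simp add: fenchel_conjugate_def conjugate_F_term)
next
  case False
  then obtain w where w: "w \<in> W1inf_D \<Omega> \<Gamma>D" "residual \<nu> w \<noteq> 0" using \<nu> by (auto simp: K_star_iff)
  have wW: "w \<in> W1inf \<Omega>" using w(1) by (simp add: W1inf_D_def)
  have "(SUP v\<in>W1inf \<Omega>. if has_trace v then ereal (residual \<nu> v) else - \<infinity>) = \<infinity>"
  proof (rule ereal_top)
    fix B :: real
    define a where "a = (B - residual \<nu> uD_hat) / residual \<nu> w"
    have "residual \<nu> (\<lambda>x. uD_hat x + a * w x) = B"
      unfolding residual_linear[OF \<nu> uD_hat(1) wW] using w(2) by (simp add: a_def)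
    then show "ereal B \<le> (SUP v\<in>W1inf \<Omega>. if has_trace v then ereal (residual \<nu> v) else - \<infinity>)"
      by (intro SUP_upper2[OF W1inf_linear[OF uD_hat(1) wW, of a]])
        (simp add: has_trace_add[OF uD_hat(1) has_trace_uD_hat w(1)])
  qed
  then show ?thesis using False by (simp add: fenchel_conjugate_def conjugate_F_term)
qed

abbreviation D :: "('a set \<Rightarrow> 'a) \<Rightarrow> ereal" where "D \<equiv> dual_D \<Omega> \<Gamma>D f g \<zeta> uD_hat"

lemma dual_D_conjugates:
  assumes \<nu>: "\<nu> \<in> ba \<Omega>"
  shows "- fenchel_conjugate (Linf \<Omega>) (functional_G \<Omega> \<zeta>) (ba_integral \<Omega> \<nu>)
    - fenchel_conjugate (W1inf \<Omega>) (functional_F \<Omega> \<Gamma>D f g uD) (\<lambda>v. - grad_adjoint \<Omega> \<nu> v) = D \<nu>"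
proof -
  obtain y0 \<nu>0 where "ba_decomposition \<Omega> \<nu> y0 \<nu>0" using Yosida_Hewitt_decomposition[OF \<nu>] by blast
  then have "\<exists>p. case p of (y, \<nu>s) \<Rightarrow> ba_decomposition \<Omega> \<nu> y \<nu>s" by auto
  note ex = someI_ex[OF this]
  \<comment> \<open>The conjugate of G is evaluated for the very decomposition that
    \<open>dual_D\<close> chooses.\<close>
  obtain y \<nu>s where some: "(SOME (y, \<nu>s). ba_decomposition \<Omega> \<nu> y \<nu>s) = (y, \<nu>s)" by fastforce
  have d: "ba_decomposition \<Omega> \<nu> y \<nu>s" using ex unfolding some by simp
  have "\<nu>s \<in> ba \<Omega>" using d by (simp add: ba_decomposition_def)
  then have tv: "enn2ereal (total_variation \<Omega> (ba_scale \<Omega> \<zeta> \<nu>s) \<Omega>) = ereal (tv (ba_scale \<Omega> \<zeta> \<nu>s) \<Omega>)"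
    by (simp add: ennreal_tv[OF ba_scale_in_ba[OF _ \<zeta>], symmetric] enn2ereal_ennreal tv_nonneg)
  show ?thesis
    unfolding conjugate_G[OF d] conjugate_F[OF \<nu>] dual_D_def some by (simp add: tv residual_def)
qed

text \<open>The conjugate of G can be computed from any decomposition and is defined without
  reference to one. This transfers the value of D from the decomposition it chooses to an arbitrary
  one.\<close>

lemma dual_D_value:
  assumes \<nu>: "\<nu> \<in> K_star \<Omega> \<Gamma>D f g" and d: "ba_decomposition \<Omega> \<nu> y \<nu>s"
  shows "D \<nu> = ereal (- ((LINT x|L. phi_star \<zeta> x (y x)) + tv (ba_scale \<Omega> \<zeta> \<nu>s) \<Omega>) - residual \<nu> uD_hat)"
proof -
  have "\<nu> \<in> ba \<Omega>" using \<nu> by (simp add: K_star_iff)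
  then show ?thesis using \<nu> unfolding dual_D_conjugates[OF \<open>\<nu> \<in> ba \<Omega>\<close>, symmetric] conjugate_G[OF d] conjugate_F[OF \<open>\<nu> \<in> ba \<Omega>\<close>]
    by simp
qed

lemma dual_D_outside: "\<nu> \<notin> K_star \<Omega> \<Gamma>D f g \<Longrightarrow> D \<nu> = - \<infinity>"
  by (simp add: dual_D_def)

lemma admissible_iff: "v \<in> admissible \<Omega> \<Gamma>D \<zeta> uD \<longleftrightarrow> v \<in> W1inf \<Omega> \<and> feasible (grad \<Omega> v) \<and> has_trace v"
  by (simp add: admissible_def feasible_def has_trace_def)

abbreviation I :: "('a \<Rightarrow> real) \<Rightarrow> ereal" where "I \<equiv> primal_I \<Omega> \<Gamma>D f g \<zeta> uD"

lemma primal_I_value: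
  "v \<in> admissible \<Omega> \<Gamma>D \<zeta> uD \<Longrightarrow> I v = ereal (energy (grad \<Omega> v) - load' v)"
  by (simp add: primal_I_def energy_def)

text \<open>The residuals of v and of \<open>uD_hat\<close> agree, so the load terms match and
  Fenchel's inequality for G is what remains.\<close>

lemma weak_duality:
  assumes \<nu>: "\<nu> \<in> ba \<Omega>" and v: "v \<in> admissible \<Omega> \<Gamma>D \<zeta> uD"
  shows "D \<nu> \<le> I v"
proof (cases "\<nu> \<in> K_star \<Omega> \<Gamma>D f g")
  case True
  obtain y \<nu>s where d: "ba_decomposition \<Omega> \<nu> y \<nu>s" using Yosida_Hewitt_decomposition[OF \<nu>] by blast
  have v': "v \<in> W1inf \<Omega>" "feasible (grad \<Omega> v)" "has_trace v" using v by (auto simp: admissible_iff)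
  show ?thesis
    using conjugate_G_bound[OF d W1inf_grad(1)[OF v'(1)] v'(2)] residual_eq_of_trace[OF True v'(1,3)]
    unfolding dual_D_value[OF True d] primal_I_value[OF v] residual_def by simp
qed (simp add: dual_D_outside)

text \<open>Provides the uniform bound near the interior point that
  \<open>subgradient_extending\<close> asks for: feasible fields are bounded by \<zeta>.\<close>

lemma energy_bounded:
  obtains B where "\<And>t. t \<in> Linf \<Omega> \<Longrightarrow> feasible t \<Longrightarrow> energy t \<le> B"
proof
  fix t :: "'a \<Rightarrow> 'a" assume t: "t \<in> Linf \<Omega>" "feasible t"
  have "(LINT x|L. (norm (t x))\<^sup>2) \<le> (LINT x|L. \<zeta> x *\<^sub>R \<zeta> x)"
  proof (rule integral_mono_AE)
    show "integrable L (\<lambda>x. \<zeta> x *\<^sub>R \<zeta> x)" by (rule integrable_Linf[OF Linf_mult[OF \<zeta> \<zeta>]])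
    show "AE x in L. (norm (t x))\<^sup>2 \<le> \<zeta> x *\<^sub>R \<zeta> x"
      using t(2) unfolding feasible_def by eventually_elim (simp add: power2_eq_square mult_mono')
  qed (rule integrable_norm_square[OF t(1)])
  then show "energy t \<le> (LINT x|L. \<zeta> x *\<^sub>R \<zeta> x) / 2" by (simp add: energy_def)
qed

theorem strong_duality:
  assumes u: "u \<in> admissible \<Omega> \<Gamma>D \<zeta> uD" and minimal: "\<And>v. v \<in> W1inf \<Omega> \<Longrightarrow> I u \<le> I v"
  obtains \<mu> where "\<mu> \<in> K_star \<Omega> \<Gamma>D f g" "I u = D \<mu>"
proof -
  have u': "u \<in> W1inf \<Omega>" "feasible (grad \<Omega> u)" "has_trace u" using u by (auto simp: admissible_iff)
  define C where "C = {t \<in> Linf \<Omega>. feasible t}"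
  define S where "S = {(z, r). \<exists>w\<in>W1inf_D \<Omega> \<Gamma>D. z \<in> Linf \<Omega> \<and> (AE x in L. z x = grad \<Omega> w x) \<and> r = load' w}"
  have D_W1inf: "w \<in> W1inf \<Omega>" if "w \<in> W1inf_D \<Omega> \<Gamma>D" for w using that by (simp add: W1inf_D_def)
  have SI: "(z, load' w) \<in> S" if "w \<in> W1inf_D \<Omega> \<Gamma>D" "z \<in> Linf \<Omega>" "AE x in L. z x = grad \<Omega> w x" for z w
    using that by (auto simp: S_def)
  have SE: "\<exists>w\<in>W1inf_D \<Omega> \<Gamma>D. z \<in> Linf \<Omega> \<and> (AE x in L. z x = grad \<Omega> w x) \<and> r = load' w" if "(z, r) \<in> S" for z r
    using that by (simp add: S_def)
  have zero_D: "(\<lambda>x. 0) \<in> W1inf_D \<Omega> \<Gamma>D"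
    using has_trace_diff[OF u'(1,3) u'(1,3)] by simp
  have S_lin: "(\<lambda>x. z x + a *\<^sub>R z' x, r + a * r') \<in> S" if zr: "(z, r) \<in> S" "(z', r') \<in> S" for z r z' r' a
  proof -
    obtain w where w: "w \<in> W1inf_D \<Omega> \<Gamma>D" "z \<in> Linf \<Omega>" "AE x in L. z x = grad \<Omega> w x" "r = load' w" using SE[OF zr(1)] by blast
    obtain w' where w': "w' \<in> W1inf_D \<Omega> \<Gamma>D" "z' \<in> Linf \<Omega>" "AE x in L. z' x = grad \<Omega> w' x" "r' = load' w'" using SE[OF zr(2)] by blast
    have "(\<lambda>x. z x + a *\<^sub>R z' x, load' (\<lambda>x. w x + a * w' x)) \<in> S"
    proof (rule SI[OF W1inf_D_linear[OF \<Gamma>D w(1) w'(1)] Linf_add[OF w(2) Linf_scaleR[OF w'(2)]]])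
      show "AE x in L. z x + a *\<^sub>R z' x = grad \<Omega> (\<lambda>x. w x + a * w' x) x"
        using w(3) w'(3) grad_linear[OF D_W1inf[OF w(1)] D_W1inf[OF w'(1)], of a] by eventually_elim simp
    qed
    then show ?thesis unfolding load'_linear[OF D_W1inf[OF w(1)] D_W1inf[OF w'(1)]] w(4) w'(4) .
  qed
  have S0: "(\<lambda>x. 0, 0) \<in> S"
  proof -
    have "grad \<Omega> (\<lambda>x. 0) \<in> Linf \<Omega>" by (rule W1inf_grad(1)[OF W1inf_zero])
    then have "(grad \<Omega> (\<lambda>x. 0), load' (\<lambda>x. 0)) \<in> S" by (intro SI zero_D) auto
    from S_lin[OF this this, of "-1"] show ?thesis by simp
  qed
  \<comment> \<open>The step from u to \<open>uD_hat\<close> keeps the Dirichlet trace, so it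
    belongs to S, and it leads from the gradient of u to the gradient of
    \<open>uD_hat\<close>.\<close>
  define z0 where "z0 x = grad \<Omega> uD_hat x - grad \<Omega> u x" for x
  define r0 where "r0 = load' uD_hat - load' u"
  have hat_diff: "(\<lambda>x. uD_hat x + (-1) * u x) \<in> W1inf_D \<Omega> \<Gamma>D"
    by (rule has_trace_diff[OF uD_hat(1) has_trace_uD_hat u'(1,3)])
  have z0: "z0 \<in> Linf \<Omega>" unfolding z0_def by (rule Linf_diff[OF W1inf_grad(1)[OF uD_hat(1)] W1inf_grad(1)[OF u'(1)]])
  have "AE x in L. z0 x = grad \<Omega> (\<lambda>x. uD_hat x + (-1) * u x) x"
    using grad_linear[OF uD_hat(1) u'(1), of "-1"] by eventually_elim (simp add: z0_def)
  from SI[OF hat_diff z0 this] have zr0: "(z0, r0) \<in> S"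
    unfolding load'_linear[OF uD_hat(1) u'(1)] by (simp add: r0_def)
  obtain B where B: "\<And>t. t \<in> Linf \<Omega> \<Longrightarrow> feasible t \<Longrightarrow> energy t \<le> B" using energy_bounded by blast
  have slater: "(\<lambda>x. grad \<Omega> u x + z0 x + y x) \<in> C"
    if y: "y \<in> Linf \<Omega>" "AE x in L. norm (y x) \<le> (1 - q) * c" for y
  proof -
    have "(\<lambda>x. grad \<Omega> u x + z0 x + y x) \<in> Linf \<Omega>" by (intro Linf_add W1inf_grad(1) u'(1) z0 y(1))
    moreover have "feasible (\<lambda>x. grad \<Omega> u x + z0 x + y x)"
      unfolding feasible_def using y(2) q(2) c_le
    proof eventually_elim
      case (elim x)
      have "norm (grad \<Omega> u x + z0 x + y x) \<le> norm (grad \<Omega> uD_hat x) + norm (y x)"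
        using norm_triangle_ineq[of "grad \<Omega> uD_hat x" "y x"] by (simp add: z0_def)
      \<comment> \<open>The radius (1 - q) c is at most (1 - q) \<zeta>, exactly the slack left by q
        \<zeta>.\<close>
      also have "\<dots> \<le> q * \<zeta> x + (1 - q) * \<zeta> x"
        using elim q(1) mult_left_mono[OF elim(3), of "1 - q"] by linarith
      finally show ?case by (simp add: algebra_simps)
    qed
    ultimately show ?thesis by (simp add: C_def)
  qed
  obtain l where l: "Linf_functional l" "\<And>z r. (z, r) \<in> S \<Longrightarrow> l z = r"
    "\<And>y. y \<in> C \<Longrightarrow> l (\<lambda>x. y x - grad \<Omega> u x) \<le> energy y - energy (grad \<Omega> u)"
  proof (rule subgradient_extending[of C energy "grad \<Omega> u" S z0 r0 "(1 - q) * c" B])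
    show "convex_on_functions C energy" unfolding C_def by (rule convex_energy)
    show "C \<subseteq> Linf \<Omega>" by (auto simp: C_def)
    show "grad \<Omega> u \<in> C" using u' W1inf_grad(1) by (simp add: C_def)
    show "z \<in> Linf \<Omega>" if "(z, r) \<in> S" for z r using SE[OF that] by blast
    show "(\<lambda>x. z x + z' x, r + r') \<in> S" if "(z, r) \<in> S" "(z', r') \<in> S" for z r z' r'
      using S_lin[OF that, of 1] by simp
    show "(\<lambda>x. a *\<^sub>R z x, a * r) \<in> S" if "(z, r) \<in> S" for z r a using S_lin[OF S0 that, of a] by simp
    show "0 < (1 - q) * c" using q(1) c_pos by simp
    fix z r assume zr: "(z, r) \<in> S" and mem: "(\<lambda>x. grad \<Omega> u x + z x) \<in> C"
    obtain w where w: "w \<in> W1inf_D \<Omega> \<Gamma>D" "z \<in> Linf \<Omega>" "AE x in L. z x = grad \<Omega> w x" "r = load' w" using SE[OF zr] by blast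
    define v where "v x = u x + 1 * w x" for x
    have v: "v \<in> W1inf \<Omega>" unfolding v_def by (rule W1inf_linear[OF u'(1) D_W1inf[OF w(1)]])
    have gv: "AE x in L. grad \<Omega> v x = grad \<Omega> u x + z x"
      using grad_linear[OF u'(1) D_W1inf[OF w(1)], of 1] w(3) unfolding v_def[abs_def] by eventually_elim simp
    have "has_trace v" unfolding v_def[abs_def] by (rule has_trace_add[OF u'(1,3) w(1)])
    moreover have "feasible (grad \<Omega> v)" using mem unfolding C_def feasible_cong[OF gv] by simp
    ultimately have "v \<in> admissible \<Omega> \<Gamma>D \<zeta> uD" using v by (simp add: admissible_iff)
    then have "energy (grad \<Omega> u) - load' u \<le> energy (grad \<Omega> v) - load' v"
      using minimal[OF v] by (simp add: primal_I_value u)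
    moreover have "load' v = load' u + r"
      unfolding v_def[abs_def] load'_linear[OF u'(1) D_W1inf[OF w(1)]] w(4) by simp
    moreover have "energy (grad \<Omega> v) = energy (\<lambda>x. grad \<Omega> u x + z x)"
      using mem by (intro energy_cong[OF W1inf_grad(1)[OF v] _ gv]) (simp add: C_def)
    ultimately show "energy (grad \<Omega> u) \<le> energy (\<lambda>x. grad \<Omega> u x + z x) - r" by simp
  next
    fix y :: "'a \<Rightarrow> 'a" assume "y \<in> Linf \<Omega>" "AE x in L. norm (y x) \<le> (1 - q) * c"
    from slater[OF this] show "energy (\<lambda>x. grad \<Omega> u x + z0 x + y x) \<le> B" by (intro B) (auto simp: C_def)
  qed (use zr0 S0 slater in auto)
  obtain \<mu> where \<mu>: "\<mu> \<in> ba \<Omega>" "\<And>y. y \<in> Linf \<Omega> \<Longrightarrow> ba_integral \<Omega> \<mu> y = l y"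
    by (rule Linf_functional_representation[OF l(1)]) (rule that)
  have \<mu>_grad: "ba_integral \<Omega> \<mu> (grad \<Omega> w) = load' w" if w: "w \<in> W1inf_D \<Omega> \<Gamma>D" for w
    using l(2)[OF SI[OF w W1inf_grad(1)[OF D_W1inf[OF w]]]] \<mu>(2)[OF W1inf_grad(1)[OF D_W1inf[OF w]]] by simp
  then have K: "\<mu> \<in> K_star \<Omega> \<Gamma>D f g" using \<mu>(1) by (simp add: K_star_iff residual_def)
  obtain y \<mu>s where d: "ba_decomposition \<Omega> \<mu> y \<mu>s" using Yosida_Hewitt_decomposition[OF \<mu>(1)] by blast
  have gu: "grad \<Omega> u \<in> Linf \<Omega>" by (rule W1inf_grad(1)[OF u'(1)])
  define A where "A = (LINT x|L. phi_star \<zeta> x (y x)) + tv (ba_scale \<Omega> \<zeta> \<mu>s) \<Omega>"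
  \<comment> \<open>The subgradient inequality says that the gradient of u maximizes the pairing
    minus the energy among feasible fields, so the supremum A does not exceed the value
    there.\<close>
  have "A \<le> ba_integral \<Omega> \<mu> (grad \<Omega> u) - energy (grad \<Omega> u)"
  proof (rule field_le_epsilon)
    fix e :: real assume e: "e > 0"
    obtain t where t: "t \<in> Linf \<Omega>" "feasible t" "A - e < ba_integral \<Omega> \<mu> t - energy t"
      using conjugate_G_approximation[OF d e] unfolding A_def by blast
    have "l (\<lambda>x. t x - grad \<Omega> u x) \<le> energy t - energy (grad \<Omega> u)" using t(1,2) by (intro l(3)) (simp add: C_def)
    then have "l t - l (grad \<Omega> u) \<le> energy t - energy (grad \<Omega> u)"
      unfolding Linf_functional_diff[OF l(1) t(1) gu] .
    then show "A \<le> ba_integral \<Omega> \<mu> (grad \<Omega> u) - energy (grad \<Omega> u) + e"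
      using t(3) unfolding \<mu>(2)[OF t(1)] \<mu>(2)[OF gu] by linarith
  qed
  then have "I u \<le> D \<mu>"
    unfolding dual_D_value[OF K d] primal_I_value[OF u] A_def[symmetric]
    using residual_eq_of_trace[OF K u'(1,3)] by (simp add: residual_def)
  then have "I u = D \<mu>" using weak_duality[OF \<mu>(1) u] by (rule antisym)
  then show thesis using that K by blast
qed

text \<open>The difference of \<open>I u\<close> and \<open>D \<mu>\<close> is the integral of the
  pointwise Fenchel gap plus the variation of the scaled singular part minus its pairing. Both
  contributions are nonnegative, so both vanish.\<close>

theorem optimality_relations:
  assumes u: "u \<in> admissible \<Omega> \<Gamma>D \<zeta> uD" and \<mu>: "\<mu> \<in> ba \<Omega>" and d: "ba_decomposition \<Omega> \<mu> z \<mu>s" and eq: "I u = D \<mu>"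
  shows "AE x in L. grad \<Omega> u x = ball_projection (\<zeta> x) (z x)"
    and "tv (ba_scale \<Omega> \<zeta> \<mu>s) \<Omega> = ba_integral \<Omega> \<mu>s (grad \<Omega> u)"
proof -
  have u': "u \<in> W1inf \<Omega>" "feasible (grad \<Omega> u)" "has_trace u" using u by (auto simp: admissible_iff)
  have gu: "grad \<Omega> u \<in> Linf \<Omega>" by (rule W1inf_grad(1)[OF u'(1)])
  have z: "integrable L z" and \<mu>s: "\<mu>s \<in> ba \<Omega>" using d by (auto simp: ba_decomposition_def)
  \<comment> \<open>Outside \<open>K_star\<close> the dual value is minus infinity, while
    \<open>I u\<close> is finite.\<close>
  have K: "\<mu> \<in> K_star \<Omega> \<Gamma>D f g"
  proof (rule ccontr)
    assume "\<mu> \<notin> K_star \<Omega> \<Gamma>D f g"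
    then show False using eq by (simp add: dual_D_outside primal_I_value[OF u])
  qed
  define gap where "gap x = phi_star \<zeta> x (z x) + (norm (grad \<Omega> u x))\<^sup>2 / 2 - z x \<bullet> grad \<Omega> u x" for x
  have gap_nonneg: "AE x in L. 0 \<le> gap x"
    using u'(2) unfolding feasible_def
  proof eventually_elim
    case (elim x)
    then show ?case using phi_star_upper[of "grad \<Omega> u x" \<zeta> x "z x"] by (simp add: gap_def)
  qed
  have int: "integrable L (\<lambda>x. phi_star \<zeta> x (z x))" "integrable L (\<lambda>x. (norm (grad \<Omega> u x))\<^sup>2 / 2)"
    "integrable L (\<lambda>x. z x \<bullet> grad \<Omega> u x)"
    using integrable_phi_star[OF z] integrable_norm_square[OF gu] integrable_inner_Linf[OF z gu] by auto
  have int_gap: "integrable L gap" unfolding gap_def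
    by (intro Bochner_Integration.integrable_diff Bochner_Integration.integrable_add int)
  have "(LINT x|L. gap x) = (LINT x|L. phi_star \<zeta> x (z x)) + energy (grad \<Omega> u) - (LINT x|L. z x \<bullet> grad \<Omega> u x)"
    using int by (simp add: gap_def energy_def)
  moreover have "- ((LINT x|L. phi_star \<zeta> x (z x)) + tv (ba_scale \<Omega> \<zeta> \<mu>s) \<Omega>) - residual \<mu> u = energy (grad \<Omega> u) - load' u"
    using eq residual_eq_of_trace[OF K u'(1,3)] by (simp add: dual_D_value[OF K d] primal_I_value[OF u])
  moreover have "0 \<le> (LINT x|L. gap x)" using gap_nonneg by (rule integral_nonneg_AE)
  moreover have "ba_integral \<Omega> \<mu>s (grad \<Omega> u) \<le> tv (ba_scale \<Omega> \<zeta> \<mu>s) \<Omega>"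
    by (rule ba_integral_le_tv_scale[OF \<mu>s gu u'(2)])
  ultimately have "(LINT x|L. gap x) = 0" and *: "tv (ba_scale \<Omega> \<zeta> \<mu>s) \<Omega> = ba_integral \<Omega> \<mu>s (grad \<Omega> u)"
    unfolding residual_def ba_integral_decomposition[OF d gu] by linarith+
  then have "AE x in L. gap x = 0" using integral_nonneg_eq_0_iff_AE[OF int_gap gap_nonneg] by simp
  then show "AE x in L. grad \<Omega> u x = ball_projection (\<zeta> x) (z x)"
    using u'(2) unfolding feasible_def
  proof eventually_elim
    case (elim x)
    then show ?case by (intro phi_star_equality) (simp_all add: gap_def)
  qed
  show "tv (ba_scale \<Omega> \<zeta> \<mu>s) \<Omega> = ba_integral \<Omega> \<mu>s (grad \<Omega> u)" by (rule *)
qed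

end

theorem theorem3p1:
  fixes \<Omega> \<Gamma>D \<Gamma>N :: "'a::euclidean_space set"
    and f \<zeta> uD uD_hat u :: "'a \<Rightarrow> real"
    and g :: "('a \<Rightarrow> real) \<Rightarrow> real"
  assumes domain: "simplicial_lipschitz_domain \<Omega>"
    and Gamma_D: "openin (top_of_set (frontier \<Omega>)) \<Gamma>D" "surface_measure \<Gamma>D > 0"
    and Gamma_N: "openin (top_of_set (frontier \<Omega>)) \<Gamma>N"
    and boundary: "\<Gamma>D \<inter> \<Gamma>N = {}" "frontier \<Omega> = closure \<Gamma>D \<union> closure \<Gamma>N"
    and f: "integrable (lebesgue_on \<Omega>) f"
    and g: "g \<in> W1inf_surface_dual \<Gamma>N"
    and zeta: "\<zeta> \<in> Linf \<Omega>" "\<exists>c>0. AE x in lebesgue_on \<Omega>. c \<le> \<zeta> x"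
    and uD: "uD \<in> W1inf_surface \<Gamma>D"
    and uD_hat: "uD_hat \<in> W1inf \<Omega>"
      "surface_ae \<Gamma>D (\<lambda>x. bd_trace \<Omega> uD_hat x = uD x)"
      "Linf_norm \<Omega> (\<lambda>x. grad \<Omega> uD_hat x /\<^sub>R \<zeta> x) < 1"
    and primal_solution: "u \<in> admissible \<Omega> \<Gamma>D \<zeta> uD"
      "\<forall>v\<in>W1inf \<Omega>. primal_I \<Omega> \<Gamma>D f g \<zeta> uD u \<le> primal_I \<Omega> \<Gamma>D f g \<zeta> uD v"
  shows
    "(\<forall>\<nu>\<in>ba \<Omega>.
        - fenchel_conjugate (Linf \<Omega>) (functional_G \<Omega> \<zeta>) (ba_integral \<Omega> \<nu>)
        - fenchel_conjugate (W1inf \<Omega>) (functional_F \<Omega> \<Gamma>D f g uD) (\<lambda>v. - grad_adjoint \<Omega> \<nu> v)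
        = dual_D \<Omega> \<Gamma>D f g \<zeta> uD_hat \<nu>)
     \<and> (\<exists>\<mu>\<in>ba \<Omega>. \<exists>z \<mu>s.
          ba_decomposition \<Omega> \<mu> z \<mu>s
          \<and> (\<forall>\<nu>\<in>ba \<Omega>. dual_D \<Omega> \<Gamma>D f g \<zeta> uD_hat \<nu> \<le> dual_D \<Omega> \<Gamma>D f g \<zeta> uD_hat \<mu>)
          \<and> (\<forall>v\<in>W1inf_D \<Omega> \<Gamma>D. ba_integral \<Omega> \<mu> (grad \<Omega> v) = load \<Omega> f g v)
          \<and> primal_I \<Omega> \<Gamma>D f g \<zeta> uD u = dual_D \<Omega> \<Gamma>D f g \<zeta> uD_hat \<mu>)
     \<and> (\<forall>\<mu>\<in>ba \<Omega>. \<forall>z \<mu>s.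
          ba_decomposition \<Omega> \<mu> z \<mu>s
          \<and> (\<forall>\<nu>\<in>ba \<Omega>. dual_D \<Omega> \<Gamma>D f g \<zeta> uD_hat \<nu> \<le> dual_D \<Omega> \<Gamma>D f g \<zeta> uD_hat \<mu>)
          \<longrightarrow> (AE x in lebesgue_on \<Omega>.
                 GDERIV (phi_star \<zeta> x) (z x) :> grad \<Omega> u x
                 \<and> grad \<Omega> u x =
                     (if norm (z x) \<le> \<zeta> x then z x else \<zeta> x *\<^sub>R (z x /\<^sub>R norm (z x))))
            \<and> enn2ereal (total_variation \<Omega> (ba_scale \<Omega> \<zeta> \<mu>s) \<Omega>)
                = ereal (ba_integral \<Omega> \<mu>s (grad \<Omega> u)))"
proof -
  have basics: "open \<Omega>" "bounded \<Omega>" "\<Omega> \<noteq> {}" "lipschitz_boundary \<Omega>"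
    using domain by (simp_all add: simplicial_lipschitz_domain_def)
  interpret bounded_lipschitz_domain \<Omega> by standard (rule basics)+
  obtain c where c: "c > 0" "AE x in lebesgue_on \<Omega>. c \<le> \<zeta> x" using zeta(2) by blast
  interpret bounded_lipschitz_problem \<Omega> \<zeta> c by standard (rule zeta(1) c)+
  \<comment> \<open>The strict inequality for the essential supremum leaves a uniform relative gap,
    the source of the interior point.\<close>
  have "\<exists>q<1. AE x in lebesgue_on \<Omega>. norm (grad \<Omega> uD_hat x) \<le> q * \<zeta> x"
  proof -
    let ?y = "\<lambda>x. grad \<Omega> uD_hat x /\<^sub>R \<zeta> x"
    have [measurable]: "grad \<Omega> uD_hat \<in> borel_measurable (lebesgue_on \<Omega>)"
      by (rule Linf_measurable[OF W1inf_grad(1)[OF uD_hat(1)]])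
    have m: "?y \<in> borel_measurable (lebesgue_on \<Omega>)" by measurable
    obtain q where q: "Linf_norm \<Omega> ?y = ereal q"
      using uD_hat(3) Linf_norm_nonneg[of ?y] by (cases "Linf_norm \<Omega> ?y") auto
    have "AE x in lebesgue_on \<Omega>. norm (?y x) \<le> q" using q Linf_norm_le_iff[OF m, of q] by simp
    then have "AE x in lebesgue_on \<Omega>. norm (grad \<Omega> uD_hat x) \<le> q * \<zeta> x"
      using \<zeta>_pos by eventually_elim (simp add: field_simps)
    moreover have "q < 1" using uD_hat(3) q by simp
    ultimately show ?thesis by blast
  qed
  then obtain q where q: "q < 1" "AE x in lebesgue_on \<Omega>. norm (grad \<Omega> uD_hat x) \<le> q * \<zeta> x" by blast
  have sub: "\<Gamma>D \<subseteq> closure \<Omega>" "\<Gamma>N \<subseteq> closure \<Omega>"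
    using openin_imp_subset[OF Gamma_D(1)] openin_imp_subset[OF Gamma_N] by (auto simp: frontier_def)
  interpret gradient_constrained_problem \<Omega> \<zeta> c \<Gamma>D \<Gamma>N f uD uD_hat g q
    by standard (rule sub f g uD_hat(1,2) q)+
  have minimal: "I u \<le> I v" if "v \<in> W1inf \<Omega>" for v using primal_solution(2) that by blast
  obtain \<mu> where \<mu>: "\<mu> \<in> K_star \<Omega> \<Gamma>D f g" "I u = D \<mu>"
    using strong_duality[OF primal_solution(1) minimal] by blast
  have \<mu>_ba: "\<mu> \<in> ba \<Omega>" using \<mu>(1) by (simp add: K_star_def)
  have maximal: "D \<nu> \<le> D \<mu>" if "\<nu> \<in> ba \<Omega>" for \<nu>
    using weak_duality[OF that primal_solution(1)] \<mu>(2) by simp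
  obtain z \<mu>s where d: "ba_decomposition \<Omega> \<mu> z \<mu>s" using Yosida_Hewitt_decomposition[OF \<mu>_ba] by blast
  \<comment> \<open>All maximizers share the optimal value, so the relations hold for each of them
    and not only for the constructed one.\<close>
  have attained: "I u = D \<mu>'" if "\<mu>' \<in> ba \<Omega>" "\<forall>\<nu>\<in>ba \<Omega>. D \<nu> \<le> D \<mu>'" for \<mu>'
    using that \<mu>_ba maximal[OF that(1)] \<mu>(2) by (simp add: antisym)
  have relations: "(AE x in lebesgue_on \<Omega>. GDERIV (phi_star \<zeta> x) (z x) :> grad \<Omega> u x
        \<and> grad \<Omega> u x = (if norm (z x) \<le> \<zeta> x then z x else \<zeta> x *\<^sub>R (z x /\<^sub>R norm (z x))))
      \<and> enn2ereal (total_variation \<Omega> (ba_scale \<Omega> \<zeta> \<mu>s) \<Omega>) = ereal (ba_integral \<Omega> \<mu>s (grad \<Omega> u))"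
    if \<mu>': "\<mu>' \<in> ba \<Omega>" and d: "ba_decomposition \<Omega> \<mu>' z \<mu>s" and max: "\<forall>\<nu>\<in>ba \<Omega>. D \<nu> \<le> D \<mu>'" for \<mu>' z \<mu>s
  proof
    note opt = optimality_relations[OF primal_solution(1) \<mu>' d attained[OF \<mu>' max]]
    show "AE x in lebesgue_on \<Omega>. GDERIV (phi_star \<zeta> x) (z x) :> grad \<Omega> u x
        \<and> grad \<Omega> u x = (if norm (z x) \<le> \<zeta> x then z x else \<zeta> x *\<^sub>R (z x /\<^sub>R norm (z x)))"
      using opt(1) \<zeta>_pos
    proof eventually_elim
      case (elim x)
      have "GDERIV (phi_star \<zeta> x) (z x) :> grad \<Omega> u x"
        unfolding elim(1) using elim(2) by (intro GDERIV_phi_star) simp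
      then show ?case using elim(1) by (simp only: ball_projection_def simp_thms)
    qed
    have "\<mu>s \<in> ba \<Omega>" using d by (simp add: ba_decomposition_def)
    then have "enn2ereal (total_variation \<Omega> (ba_scale \<Omega> \<zeta> \<mu>s) \<Omega>) = ereal (tv (ba_scale \<Omega> \<zeta> \<mu>s) \<Omega>)"
      by (simp add: ennreal_tv[OF ba_scale_in_ba[OF _ \<zeta>], symmetric] enn2ereal_ennreal tv_nonneg)
    then show "enn2ereal (total_variation \<Omega> (ba_scale \<Omega> \<zeta> \<mu>s) \<Omega>) = ereal (ba_integral \<Omega> \<mu>s (grad \<Omega> u))"
      by (simp only: opt(2))
  qed
  have stationary: "\<forall>v\<in>W1inf_D \<Omega> \<Gamma>D. ba_integral \<Omega> \<mu> (grad \<Omega> v) = load \<Omega> f g v"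
    using \<mu>(1) by (simp add: K_star_def)
  show ?thesis
  proof (intro conjI ballI)
    show "- fenchel_conjugate (Linf \<Omega>) (functional_G \<Omega> \<zeta>) (ba_integral \<Omega> \<nu>)
        - fenchel_conjugate (W1inf \<Omega>) (functional_F \<Omega> \<Gamma>D f g uD) (\<lambda>v. - grad_adjoint \<Omega> \<nu> v)
        = dual_D \<Omega> \<Gamma>D f g \<zeta> uD_hat \<nu>" if "\<nu> \<in> ba \<Omega>" for \<nu>
      by (rule dual_D_conjugates[OF that])
    show "\<exists>\<mu>\<in>ba \<Omega>. \<exists>z \<mu>s. ba_decomposition \<Omega> \<mu> z \<mu>s
        \<and> (\<forall>\<nu>\<in>ba \<Omega>. D \<nu> \<le> D \<mu>)
        \<and> (\<forall>v\<in>W1inf_D \<Omega> \<Gamma>D. ba_integral \<Omega> \<mu> (grad \<Omega> v) = load \<Omega> f g v) \<and> I u = D \<mu>"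
      by (intro bexI[OF _ \<mu>_ba] exI[of _ z] exI[of _ \<mu>s] conjI ballI d maximal stationary[rule_format] \<mu>(2))
    fix \<mu>' assume \<mu>': "\<mu>' \<in> ba \<Omega>"
    show "\<forall>z \<mu>s. ba_decomposition \<Omega> \<mu>' z \<mu>s \<and> (\<forall>\<nu>\<in>ba \<Omega>. D \<nu> \<le> D \<mu>')
          \<longrightarrow> (AE x in lebesgue_on \<Omega>. GDERIV (phi_star \<zeta> x) (z x) :> grad \<Omega> u x
                 \<and> grad \<Omega> u x = (if norm (z x) \<le> \<zeta> x then z x else \<zeta> x *\<^sub>R (z x /\<^sub>R norm (z x))))
            \<and> enn2ereal (total_variation \<Omega> (ba_scale \<Omega> \<zeta> \<mu>s) \<Omega>) = ereal (ba_integral \<Omega> \<mu>s (grad \<Omega> u))"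
      by (intro allI impI, elim conjE) (rule relations[OF \<mu>'])
  qed
qed

end
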